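(* Let $d\ge 1$ and let $g\in L^2(\mathbb{R}^d)$ be such that the Gabor system $G(g)=\{e^{2\pi i n\cdot x}g(x-m)\}_{(m,n)\in\mathbb{Z}^{2d}}$ (with $m,n\in\mathbb{Z}^d$) is a Riesz basis of $L^2(\mathbb{R}^d)$. Let $R_i,L_i\ge 1$ be real numbers for each $1\le i\le d$, and let $\mathcal{R}:=(-R_1,R_1)\times\cdots\times(-R_d,R_d)$ and $\mathcal{L}:=(-L_1,L_1)\times\cdots\times(-L_d,L_d)$. Then, for a constant $C>0$ depending only on the Riesz basis bounds of $g$ (that is, of $G(g)$), one has $$\int_{\mathbb{R}^d\setminus\mathcal{R}}|g(x)|^2\,dx+\int_{\mathbb{R}^d\setminus\mathcal{L}}|\widehat{g}(\xi)|^2\,d\xi\ \ge\ \frac{C}{R_iL_i}$$ for every $1\le i\le d$. Moreover, the result is sharp in the following sense: the term $C/(R_iL_i)$ cannot be replaced by $C\log(R_iL_i)/(R_iL_i)$. That is, in any dimension $d$, the statement obtained from the one above by replacing the right-hand side with $C\log(R_iL_i)/(R_iL_i)$, with $C>0$ depending only on the Riesz basis bounds of $g$, is false.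
   Context: A system $\{v_n\}$ in a separable Hilbert space $H$ is a Riesz basis if it is complete in $H$ and there are constants $A,B>0$ such that $A\sum|a_n|^2\le\|\sum a_nv_n\|^2\le B\sum|a_n|^2$ for every sequence $\{a_n\}\in\ell^2$. The largest such $A$ and the smallest such $B$ are called the Riesz basis bounds. The Fourier transform is $\widehat{g}(\xi)=\int_{\mathbb{R}^d}g(x)e^{-2\pi i x\cdot\xi}\,dx$, extended to $L^2(\mathbb{R}^d)$ as a unitary operator. *)

theory Defs
  imports "HOL-Analysis.Analysis"
begin

(* The dimension d has to be an ordinary variable, because the constant in the lower bound
   must not depend on it.  A point of R^d is therefore an extensional function on {..<d},
   and coordinates are numbered 0, ..., d - 1.  The measure is Lebesgue measure on the Borel
   sets, which suffices since every L^2 class has a Borel representative. *)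

definition Rd :: "nat \<Rightarrow> (nat \<Rightarrow> real) measure" where
  "Rd d = (\<Pi>\<^sub>M i\<in>{..<d}. lborel)"

definition Zd :: "nat \<Rightarrow> (nat \<Rightarrow> int) set" where
  "Zd d = (\<Pi>\<^sub>E i\<in>{..<d}. UNIV)"

definition open_box :: "nat \<Rightarrow> (nat \<Rightarrow> real) \<Rightarrow> (nat \<Rightarrow> real) set" where
  "open_box d R = (\<Pi>\<^sub>E i\<in>{..<d}. {- R i <..< R i})"

(* Elements of L^2(M) are represented by functions; all notions below are invariant under
   changes on null sets. *)

definition L2 :: "'a measure \<Rightarrow> ('a \<Rightarrow> complex) set" where
  "L2 M = {f \<in> borel_measurable M. integrable M (\<lambda>x. (cmod (f x))\<^sup>2)}"

definition norm_L2 :: "'a measure \<Rightarrow> ('a \<Rightarrow> complex) \<Rightarrow> real" where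
  "norm_L2 M f = sqrt (LINT x|M. (cmod (f x))\<^sup>2)"

definition has_L2_sum ::
  "'a measure \<Rightarrow> 'i set \<Rightarrow> ('i \<Rightarrow> 'a \<Rightarrow> complex) \<Rightarrow> ('i \<Rightarrow> complex) \<Rightarrow> ('a \<Rightarrow> complex) \<Rightarrow> bool" where
  "has_L2_sum M I v a f \<longleftrightarrow> f \<in> L2 M \<and>
     ((\<lambda>F. norm_L2 M (\<lambda>x. (\<Sum>i\<in>F. a i * v i x) - f x)) \<longlongrightarrow> 0) (finite_subsets_at_top I)"

definition complete_system :: "'a measure \<Rightarrow> 'i set \<Rightarrow> ('i \<Rightarrow> 'a \<Rightarrow> complex) \<Rightarrow> bool" where
  "complete_system M I v \<longleftrightarrow>
     (\<forall>f\<in>L2 M. \<forall>\<epsilon>>0. \<exists>F c. finite F \<and> F \<subseteq> I \<and>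
        norm_L2 M (\<lambda>x. (\<Sum>i\<in>F. c i * v i x) - f x) < \<epsilon>)"

definition riesz_constants ::
  "'a measure \<Rightarrow> 'i set \<Rightarrow> ('i \<Rightarrow> 'a \<Rightarrow> complex) \<Rightarrow> real \<Rightarrow> real \<Rightarrow> bool" where
  "riesz_constants M I v A B \<longleftrightarrow> 0 < A \<and> 0 < B \<and>
     (\<forall>a. (\<lambda>i. (cmod (a i))\<^sup>2) summable_on I \<longrightarrow>
        (\<exists>f. has_L2_sum M I v a f \<and>
             A * (\<Sum>\<^sub>\<infinity>i\<in>I. (cmod (a i))\<^sup>2) \<le> (norm_L2 M f)\<^sup>2 \<and>
             (norm_L2 M f)\<^sup>2 \<le> B * (\<Sum>\<^sub>\<infinity>i\<in>I. (cmod (a i))\<^sup>2)))"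

definition riesz_basis :: "'a measure \<Rightarrow> 'i set \<Rightarrow> ('i \<Rightarrow> 'a \<Rightarrow> complex) \<Rightarrow> bool" where
  "riesz_basis M I v \<longleftrightarrow> (\<forall>i\<in>I. v i \<in> L2 M) \<and> complete_system M I v \<and>
     (\<exists>A B. riesz_constants M I v A B)"

definition lower_riesz_bound :: "'a measure \<Rightarrow> 'i set \<Rightarrow> ('i \<Rightarrow> 'a \<Rightarrow> complex) \<Rightarrow> real" where
  "lower_riesz_bound M I v = (GREATEST A. \<exists>B. riesz_constants M I v A B)"

definition upper_riesz_bound :: "'a measure \<Rightarrow> 'i set \<Rightarrow> ('i \<Rightarrow> 'a \<Rightarrow> complex) \<Rightarrow> real" where
  "upper_riesz_bound M I v = (LEAST B. \<exists>A. riesz_constants M I v A B)"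

(* The restriction keeps the translate x - m inside the space of extensional functions. *)

definition gabor ::
  "nat \<Rightarrow> ((nat \<Rightarrow> real) \<Rightarrow> complex) \<Rightarrow> (nat \<Rightarrow> int) \<times> (nat \<Rightarrow> int) \<Rightarrow> (nat \<Rightarrow> real) \<Rightarrow> complex" where
  "gabor d g = (\<lambda>(m, n) x.
     cis (2 * pi * (\<Sum>i<d. of_int (n i) * x i)) * g (\<lambda>i\<in>{..<d}. x i - of_int (m i)))"

abbreviation gabor_riesz_basis :: "nat \<Rightarrow> ((nat \<Rightarrow> real) \<Rightarrow> complex) \<Rightarrow> bool" where
  "gabor_riesz_basis d g \<equiv> riesz_basis (Rd d) (Zd d \<times> Zd d) (gabor d g)"

abbreviation gabor_lower_bound :: "nat \<Rightarrow> ((nat \<Rightarrow> real) \<Rightarrow> complex) \<Rightarrow> real" where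
  "gabor_lower_bound d g \<equiv> lower_riesz_bound (Rd d) (Zd d \<times> Zd d) (gabor d g)"

abbreviation gabor_upper_bound :: "nat \<Rightarrow> ((nat \<Rightarrow> real) \<Rightarrow> complex) \<Rightarrow> real" where
  "gabor_upper_bound d g \<equiv> upper_riesz_bound (Rd d) (Zd d \<times> Zd d) (gabor d g)"

definition fourier_integral ::
  "nat \<Rightarrow> ((nat \<Rightarrow> real) \<Rightarrow> complex) \<Rightarrow> (nat \<Rightarrow> real) \<Rightarrow> complex" where
  "fourier_integral d f \<xi> = (LINT x|Rd d. f x * cis (- 2 * pi * (\<Sum>i<d. x i * \<xi> i)))"

(* Extension by continuity from the dense subspace L^1 \<inter> L^2.  By Plancherel's theorem such an
   h exists for every g in L^2 and is unique up to null sets, so the choice of representative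
   is immaterial. *)

definition fourier_L2 ::
  "nat \<Rightarrow> ((nat \<Rightarrow> real) \<Rightarrow> complex) \<Rightarrow> (nat \<Rightarrow> real) \<Rightarrow> complex" where
  "fourier_L2 d g = (SOME h. h \<in> L2 (Rd d) \<and>
     (\<exists>f :: nat \<Rightarrow> (nat \<Rightarrow> real) \<Rightarrow> complex.
        (\<forall>k. integrable (Rd d) (f k) \<and> f k \<in> L2 (Rd d) \<and> fourier_integral d (f k) \<in> L2 (Rd d)) \<and>
        (\<lambda>k. norm_L2 (Rd d) (\<lambda>x. f k x - g x)) \<longlonglongrightarrow> 0 \<and>
        (\<lambda>k. norm_L2 (Rd d) (\<lambda>\<xi>. fourier_integral d (f k) \<xi> - h \<xi>)) \<longlonglongrightarrow> 0))"

definition energy_outside :: "nat \<Rightarrow> (nat \<Rightarrow> real) \<Rightarrow> ((nat \<Rightarrow> real) \<Rightarrow> complex) \<Rightarrow> real" where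
  "energy_outside d R f = (LINT x:(space (Rd d) - open_box d R)|Rd d. (cmod (f x))\<^sup>2)"

end

theory Submission
  imports Defs
begin

text \<open>The Zak transform turns \<open>g\<close> into a function \<open>\<zeta>\<close> of two variables \<open>x\<close> and \<open>y\<close> in \<open>\<real>\<^sup>d\<close> that is
periodic in \<open>y\<close> and quasiperiodic in \<open>x\<close>: a lattice translation in \<open>x\<close> multiplies it by a character of
\<open>y\<close>.  It is isometric and turns the Gabor system into the products of \<open>\<zeta>\<close> with the characters of the
torus.  Therefore \<open>A\<close> and \<open>B\<close> can be Riesz constants only if \<open>A \<le> \<bar>\<zeta>\<bar>\<^sup>2 \<le> B\<close> almost everywhere
(\<open>gabor_riesz_zak\<close>).  A continuous quasiperiodic function has a zero: its argument along one period of
\<open>y\<close> would change by \<open>2 \<pi>\<close> more at \<open>x + 1\<close> than at \<open>x\<close>.  The lower bound is a quantitative form of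
this obstruction.

Fix a coordinate \<open>i\<close> and smooth \<open>\<zeta>\<close> in the \<open>i\<close>-th component of \<open>x\<close> by a de la Vallee Poussin kernel,
whose Fourier transform has values in \<open>[0, 1]\<close> and is \<open>1\<close> on \<open>[- L i, L i]\<close>.  For \<open>g\<close> this is a
convolution, hence multiplies the Fourier transform of \<open>g\<close> by a function that is \<open>1\<close> on the box; the
squared norm of the part removed from \<open>\<zeta>\<close> is at most the energy of the Fourier transform outside the
box.  Smoothing in the dual variable \<open>y\<close> multiplies \<open>g\<close> itself, and the energy of \<open>g\<close> outside its
box appears in the same way (\<open>smoothing_energy\<close>).  These norms depend only on the Gram matrix of
the translates that are superposed (\<open>superposition_remainder_gram\<close>), so that they may be computed
on \<open>\<real>\<^sup>d\<close> instead of the torus.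

The smoothed functions change little over steps of length about \<open>1 / L i\<close> in \<open>x\<close> and \<open>1 / R i\<close> in
\<open>y\<close>.  Such steps form a grid of \<open>K K'\<close> points on a period, with \<open>K K'\<close> of order \<open>R i L i\<close>.  If both
removed parts were small at all points of the grid, then \<open>\<zeta>\<close>, whose modulus is at least \<open>sqrt A\<close>,
would change along every edge by less than its modulus, and the discrete winding number would be
well defined, which contradicts quasiperiodicity (\<open>grid_winding\<close>).  Hence every translate of the grid
contains a point where a removed part is at least \<open>sqrt A / 4\<close>.  Averaging over the translates bounds
the sum of the two energies from below by \<open>A / (16 K K')\<close> (\<open>balian_low_quantitative\<close>).

For the sharpness let \<open>g\<close> be the indicator of the unit cube, whose Gabor system is an orthonormal
basis.  It has no energy outside the box with \<open>R = 1\<close>, and its Fourier transform has energy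
\<open>O(1 / l)\<close> outside the box with \<open>L = l\<close>, which is eventually smaller than any multiple of
\<open>ln l / l\<close>.

Three general facts support this: the supremum and the infimum of the admissible Riesz constants are
admissible (\<open>riesz_basis_optimal_constants\<close>), trigonometric polynomials are dense on the torus
(\<open>approx_torus_all\<close>), and Plancherel's theorem, which here follows from Parseval's identity for the
Zak transform in \<open>x\<close> with \<open>y\<close> fixed (\<open>plancherel\<close>).\<close>

section \<open>Square integrable functions\<close>

lemma borel_measurable_cnj[measurable (raw)]:
  "f \<in> borel_measurable M \<Longrightarrow> (\<lambda>x. cnj (f x)) \<in> borel_measurable M"
  by (rule borel_measurable_continuous_on[OF continuous_on_cnj[OF continuous_on_id]])

definition inner_L2 :: "'a measure \<Rightarrow> ('a \<Rightarrow> complex) \<Rightarrow> ('a \<Rightarrow> complex) \<Rightarrow> complex" where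
  "inner_L2 M f g = (LINT x|M. f x * cnj (g x))"

lemma L2_measurable[measurable_dest]: "f \<in> L2 M \<Longrightarrow> f \<in> borel_measurable M"
  by (simp add: L2_def)

lemma L2_integrable_square: "f \<in> L2 M \<Longrightarrow> integrable M (\<lambda>x. (cmod (f x))\<^sup>2)"
  by (simp add: L2_def)

lemma norm_L2_nonneg[simp]: "0 \<le> norm_L2 M f"
  by (simp add: norm_L2_def)

lemma norm_L2_power2: "(norm_L2 M f)\<^sup>2 = (LINT x|M. (cmod (f x))\<^sup>2)"
  by (simp add: norm_L2_def)

lemma L2_dominated:
  assumes "f \<in> borel_measurable M" "g \<in> L2 M" "\<And>x. x \<in> space M \<Longrightarrow> cmod (f x) \<le> c * cmod (g x)"
  shows "f \<in> L2 M"
proof -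
  have "integrable M (\<lambda>x. (cmod (f x))\<^sup>2)"
  proof (rule Bochner_Integration.integrable_bound[where f="\<lambda>x. c\<^sup>2 * (cmod (g x))\<^sup>2"])
    show "integrable M (\<lambda>x. c\<^sup>2 * (cmod (g x))\<^sup>2)"
      using L2_integrable_square[OF assms(2)] by simp
    show "(\<lambda>x. (cmod (f x))\<^sup>2) \<in> borel_measurable M" using assms(1) by measurable
    have "(cmod (f x))\<^sup>2 \<le> c\<^sup>2 * (cmod (g x))\<^sup>2" if "x \<in> space M" for x
      using power_mono[OF assms(3)[OF that], of 2] by (simp add: power_mult_distrib)
    then show "AE x in M. norm ((cmod (f x))\<^sup>2) \<le> norm (c\<^sup>2 * (cmod (g x))\<^sup>2)"
      by (intro AE_I2) auto
  qed
  then show ?thesis using assms(1) by (simp add: L2_def)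
qed

lemma L2_add:
  assumes "f \<in> L2 M" "g \<in> L2 M" shows "(\<lambda>x. f x + g x) \<in> L2 M"
proof -
  have "integrable M (\<lambda>x. (cmod (f x + g x))\<^sup>2)"
  proof (rule Bochner_Integration.integrable_bound[where f="\<lambda>x. 2 * (cmod (f x))\<^sup>2 + 2 * (cmod (g x))\<^sup>2"])
    show "integrable M (\<lambda>x. 2 * (cmod (f x))\<^sup>2 + 2 * (cmod (g x))\<^sup>2)"
      using assms[THEN L2_integrable_square] by simp
    show "(\<lambda>x. (cmod (f x + g x))\<^sup>2) \<in> borel_measurable M"
      using assms[THEN L2_measurable] by measurable
    have "(cmod (f x + g x))\<^sup>2 \<le> 2 * (cmod (f x))\<^sup>2 + 2 * (cmod (g x))\<^sup>2" for x
    proof -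
      have "(cmod (f x + g x))\<^sup>2 \<le> (cmod (f x) + cmod (g x))\<^sup>2"
        by (intro power_mono norm_triangle_ineq) auto
      also have "\<dots> \<le> 2 * (cmod (f x))\<^sup>2 + 2 * (cmod (g x))\<^sup>2"
        using sum_squares_bound[of "cmod (f x)" "cmod (g x)"] by (simp add: power2_sum)
      finally show ?thesis .
    qed
    then show "AE x in M. norm ((cmod (f x + g x))\<^sup>2) \<le> norm (2 * (cmod (f x))\<^sup>2 + 2 * (cmod (g x))\<^sup>2)"
      by (intro AE_I2) auto
  qed
  then show ?thesis using assms by (auto simp: L2_def)
qed

lemma L2_cmult: "f \<in> L2 M \<Longrightarrow> (\<lambda>x. c * f x) \<in> L2 M"
  by (rule L2_dominated[where g=f and c="cmod c"]) (auto simp: norm_mult L2_measurable)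

lemma L2_zero[simp]: "(\<lambda>x. 0) \<in> L2 M"
  by (simp add: L2_def)

lemma L2_diff: "f \<in> L2 M \<Longrightarrow> g \<in> L2 M \<Longrightarrow> (\<lambda>x. f x - g x) \<in> L2 M"
  using L2_add[of f M "\<lambda>x. (-1) * g x"] L2_cmult[of g M "-1"] by simp

lemma L2_sum: "(\<And>i. i \<in> F \<Longrightarrow> f i \<in> L2 M) \<Longrightarrow> (\<lambda>x. \<Sum>i\<in>F. f i x) \<in> L2 M"
  by (induction F rule: infinite_finite_induct) (auto intro: L2_add)

lemma L2_mult_integrable:
  assumes "f \<in> L2 M" "g \<in> L2 M" shows "integrable M (\<lambda>x. cmod (f x) * cmod (g x))"
proof (rule Bochner_Integration.integrable_bound[where f="\<lambda>x. (cmod (f x))\<^sup>2 + (cmod (g x))\<^sup>2"])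
  show "integrable M (\<lambda>x. (cmod (f x))\<^sup>2 + (cmod (g x))\<^sup>2)"
    using assms[THEN L2_integrable_square] by simp
  show "(\<lambda>x. cmod (f x) * cmod (g x)) \<in> borel_measurable M"
    using assms[THEN L2_measurable] by measurable
  have "cmod (f x) * cmod (g x) \<le> (cmod (f x))\<^sup>2 + (cmod (g x))\<^sup>2" for x
    using sum_squares_bound[of "cmod (f x)" "cmod (g x)"] mult_nonneg_nonneg[OF norm_ge_zero norm_ge_zero, of "f x" "g x"]
    by linarith
  then show "AE x in M. norm (cmod (f x) * cmod (g x)) \<le> norm ((cmod (f x))\<^sup>2 + (cmod (g x))\<^sup>2)"
    by (intro AE_I2) auto
qed

lemma inner_L2_integrable:
  assumes "f \<in> L2 M" "g \<in> L2 M" shows "integrable M (\<lambda>x. f x * cnj (g x))"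
  by (rule Bochner_Integration.integrable_bound[OF L2_mult_integrable[OF assms]])
     (use assms in \<open>auto simp: norm_mult L2_def\<close>)

lemma L2_cauchy_schwarz_abs:
  assumes "f \<in> L2 M" "g \<in> L2 M"
  shows "(LINT x|M. cmod (f x) * cmod (g x)) \<le> norm_L2 M f * norm_L2 M g"
proof -
  have m[measurable]: "f \<in> borel_measurable M" "g \<in> borel_measurable M"
    using assms by (auto simp: L2_def)
  have "ennreal ((LINT x|M. cmod (f x) * cmod (g x))\<^sup>2) = (\<integral>\<^sup>+x. ennreal (cmod (f x)) * ennreal (cmod (g x)) \<partial>M)\<^sup>2"
    using nn_integral_eq_integral[OF L2_mult_integrable[OF assms]]
    by (simp add: ennreal_mult ennreal_power)
  also have "\<dots> \<le> (\<integral>\<^sup>+x. ennreal (cmod (f x)) ^ 2 \<partial>M) * (\<integral>\<^sup>+x. ennreal (cmod (g x)) ^ 2 \<partial>M)"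
    by (rule Cauchy_Schwarz_nn_integral) auto
  also have "\<dots> = ennreal ((norm_L2 M f)\<^sup>2) * ennreal ((norm_L2 M g)\<^sup>2)"
    using assms[THEN L2_integrable_square, THEN nn_integral_eq_integral]
    by (simp add: norm_L2_power2 ennreal_power)
  also have "\<dots> = ennreal ((norm_L2 M f * norm_L2 M g)\<^sup>2)"
    by (simp add: ennreal_mult power_mult_distrib)
  finally have "(LINT x|M. cmod (f x) * cmod (g x))\<^sup>2 \<le> (norm_L2 M f * norm_L2 M g)\<^sup>2"
    by simp
  then show ?thesis by (rule power2_le_imp_le) simp
qed

lemma norm_L2_triangle:
  assumes "f \<in> L2 M" "g \<in> L2 M"
  shows "norm_L2 M (\<lambda>x. f x + g x) \<le> norm_L2 M f + norm_L2 M g"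
proof (rule power2_le_imp_le)
  have "(norm_L2 M (\<lambda>x. f x + g x))\<^sup>2
      \<le> (LINT x|M. (cmod (f x))\<^sup>2 + 2 * (cmod (f x) * cmod (g x)) + (cmod (g x))\<^sup>2)"
    unfolding norm_L2_power2
  proof (rule integral_mono)
    show "integrable M (\<lambda>x. (cmod (f x + g x))\<^sup>2)" using L2_add[OF assms] by (rule L2_integrable_square)
    show "integrable M (\<lambda>x. (cmod (f x))\<^sup>2 + 2 * (cmod (f x) * cmod (g x)) + (cmod (g x))\<^sup>2)"
      using assms[THEN L2_integrable_square] L2_mult_integrable[OF assms] by simp
    show "(cmod (f x + g x))\<^sup>2 \<le> (cmod (f x))\<^sup>2 + 2 * (cmod (f x) * cmod (g x)) + (cmod (g x))\<^sup>2" for x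
      using power_mono[OF norm_triangle_ineq[of "f x" "g x"], of 2] by (simp add: power2_sum algebra_simps)
  qed
  also have "\<dots> = (norm_L2 M f)\<^sup>2 + 2 * (LINT x|M. cmod (f x) * cmod (g x)) + (norm_L2 M g)\<^sup>2"
    using assms[THEN L2_integrable_square] L2_mult_integrable[OF assms] by (simp add: norm_L2_power2)
  also have "\<dots> \<le> (norm_L2 M f + norm_L2 M g)\<^sup>2"
    using L2_cauchy_schwarz_abs[OF assms] by (simp add: power2_sum)
  finally show "(norm_L2 M (\<lambda>x. f x + g x))\<^sup>2 \<le> (norm_L2 M f + norm_L2 M g)\<^sup>2" .
qed simp

lemma norm_L2_cmult: "norm_L2 M (\<lambda>x. c * f x) = cmod c * norm_L2 M f"
  by (simp add: norm_L2_def norm_mult power_mult_distrib real_sqrt_mult)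

lemma norm_L2_minus_commute: "norm_L2 M (\<lambda>x. f x - g x) = norm_L2 M (\<lambda>x. g x - f x)"
  by (simp add: norm_L2_def norm_minus_commute)

lemma norm_L2_diff_triangle:
  assumes "f \<in> L2 M" "g \<in> L2 M" "h \<in> L2 M"
  shows "norm_L2 M (\<lambda>x. f x - h x) \<le> norm_L2 M (\<lambda>x. f x - g x) + norm_L2 M (\<lambda>x. g x - h x)"
  using norm_L2_triangle[OF L2_diff[OF assms(1,2)] L2_diff[OF assms(2,3)]] by simp

lemma norm_L2_triangle_diff:
  assumes "f \<in> L2 M" "g \<in> L2 M"
  shows "\<bar>norm_L2 M f - norm_L2 M g\<bar> \<le> norm_L2 M (\<lambda>x. f x - g x)"
  using norm_L2_triangle[OF L2_diff[OF assms] assms(2)]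
    norm_L2_triangle[OF L2_diff[OF assms(2,1)] assms(1)] norm_L2_minus_commute[of M f g]
  by simp

lemma norm_L2_zero[simp]: "norm_L2 M (\<lambda>x. 0) = 0"
  by (simp add: norm_L2_def)

lemma norm_L2_sum_le:
  assumes "\<And>i. i \<in> F \<Longrightarrow> f i \<in> L2 M"
  shows "norm_L2 M (\<lambda>x. \<Sum>i\<in>F. f i x) \<le> (\<Sum>i\<in>F. norm_L2 M (f i))"
  using assms
proof (induction F rule: infinite_finite_induct)
  case (insert i F)
  then show ?case
    using norm_L2_triangle[of "f i" M "\<lambda>x. \<Sum>i\<in>F. f i x"] L2_sum[of F f M] by fastforce
qed simp_all

lemma norm_L2_cong_AE:
  assumes "f \<in> borel_measurable M" "g \<in> borel_measurable M" "AE x in M. f x = g x"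
  shows "norm_L2 M f = norm_L2 M g"
proof -
  have "(LINT x|M. (cmod (f x))\<^sup>2) = (LINT x|M. (cmod (g x))\<^sup>2)"
    by (rule integral_cong_AE) (use assms in auto)
  then show ?thesis by (simp add: norm_L2_def)
qed

lemma norm_L2_eq_0_iff:
  assumes "f \<in> L2 M" shows "norm_L2 M f = 0 \<longleftrightarrow> (AE x in M. f x = 0)"
proof -
  have "norm_L2 M f = 0 \<longleftrightarrow> (LINT x|M. (cmod (f x))\<^sup>2) = 0" by (simp add: norm_L2_def)
  also have "\<dots> \<longleftrightarrow> (AE x in M. (cmod (f x))\<^sup>2 = 0)"
    by (rule integral_nonneg_eq_0_iff_AE) (use L2_integrable_square[OF assms] in auto)
  finally show ?thesis by simp
qed

lemma L2_iff_nn: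
  assumes "f \<in> borel_measurable M"
  shows "f \<in> L2 M \<longleftrightarrow> (\<integral>\<^sup>+x. ennreal ((cmod (f x))\<^sup>2) \<partial>M) < \<infinity>"
  using assms by (auto simp: L2_def integrable_iff_bounded)

lemma norm_L2_nn:
  assumes "f \<in> L2 M"
  shows "(\<integral>\<^sup>+x. ennreal ((cmod (f x))\<^sup>2) \<partial>M) = ennreal ((norm_L2 M f)\<^sup>2)"
  using nn_integral_eq_integral[OF L2_integrable_square[OF assms]] by (simp add: norm_L2_power2)

lemma norm_L2_nn_le:
  assumes "f \<in> borel_measurable M" "(\<integral>\<^sup>+x. ennreal ((cmod (f x))\<^sup>2) \<partial>M) \<le> ennreal (c\<^sup>2)" "0 \<le> c"
  shows "f \<in> L2 M" "norm_L2 M f \<le> c"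
proof -
  show f: "f \<in> L2 M" using assms(2) by (subst L2_iff_nn[OF assms(1)]) (auto intro: order.strict_trans1)
  have "(norm_L2 M f)\<^sup>2 \<le> c\<^sup>2" using norm_L2_nn[OF f] assms(2) by simp
  then show "norm_L2 M f \<le> c" using assms(3) by (rule power2_le_imp_le)
qed

lemma norm_L2_nn_eq:
  assumes "f \<in> borel_measurable M" "(\<integral>\<^sup>+x. ennreal ((cmod (f x))\<^sup>2) \<partial>M) = ennreal (c\<^sup>2)" "0 \<le> c"
  shows "f \<in> L2 M \<and> norm_L2 M f = c"
proof -
  have f: "f \<in> L2 M" using norm_L2_nn_le(1)[OF assms(1) _ assms(3)] assms(2) by simp
  then have "(norm_L2 M f)\<^sup>2 = c\<^sup>2" using norm_L2_nn[OF f] assms(2) by simp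
  then show ?thesis using f assms(3) by (simp add: power2_eq_iff_nonneg)
qed

lemma L2_fatou:
  assumes "\<And>n. f n \<in> L2 M" "\<And>n. norm_L2 M (f n) \<le> c" "g \<in> borel_measurable M"
    and "AE x in M. (\<lambda>n. f n x) \<longlonglongrightarrow> g x" and "0 \<le> c"
  shows "g \<in> L2 M" "norm_L2 M g \<le> c"
proof -
  have [measurable]: "f n \<in> borel_measurable M" for n using assms(1) by (simp add: L2_def)
  have "(\<integral>\<^sup>+x. ennreal ((cmod (g x))\<^sup>2) \<partial>M) = (\<integral>\<^sup>+x. liminf (\<lambda>n. ennreal ((cmod (f n x))\<^sup>2)) \<partial>M)"
    using assms(4)
    by (intro nn_integral_cong_AE, eventually_elim)
       (auto intro!: lim_imp_Liminf[symmetric] tendsto_intros)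
  also have "\<dots> \<le> liminf (\<lambda>n. \<integral>\<^sup>+x. ennreal ((cmod (f n x))\<^sup>2) \<partial>M)"
    by (rule nn_integral_liminf) auto
  also have "\<dots> \<le> ennreal (c\<^sup>2)"
    using assms(1,2,5) by (intro Liminf_le) (auto simp: norm_L2_nn intro!: always_eventually power_mono)
  finally show "g \<in> L2 M" "norm_L2 M g \<le> c"
    using norm_L2_nn_le[OF assms(3) _ assms(5)] by auto
qed

text \<open>The moduli of the increments have norms with a convergent geometric sum, so that their
partial sums are bounded in norm; by monotone convergence the series of increments converges
absolutely almost everywhere.\<close>

lemma L2_fast_cauchy_AE:
  assumes f: "\<And>n. f n \<in> L2 M" and fast: "\<And>n. norm_L2 M (\<lambda>x. f (Suc n) x - f n x) \<le> (1/2)^n"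
  shows "AE x in M. convergent (\<lambda>n. f n x)"
proof -
  have m[measurable]: "f n \<in> borel_measurable M" for n using f by (simp add: L2_def)
  define S where "S n x = (\<Sum>k<n. cmod (f (Suc k) x - f k x))" for n x
  have Sm[measurable]: "S n \<in> borel_measurable M" for n unfolding S_def by measurable
  have SL: "(\<lambda>x. complex_of_real (S n x)) \<in> L2 M \<and> norm_L2 M (\<lambda>x. complex_of_real (S n x)) \<le> 2" for n
  proof -
    have a: "(\<lambda>x. complex_of_real (cmod (f (Suc k) x - f k x))) \<in> L2 M" for k
      by (rule L2_dominated[OF _ L2_diff[OF f[of "Suc k"] f[of k]], where c=1]) auto
    have "norm_L2 M (\<lambda>x. complex_of_real (S n x))
        \<le> (\<Sum>k<n. norm_L2 M (\<lambda>x. complex_of_real (cmod (f (Suc k) x - f k x))))"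
      unfolding S_def of_real_sum by (rule norm_L2_sum_le) (use a in auto)
    also have "\<dots> \<le> (\<Sum>k<n. (1/2)^k)"
      using fast by (intro sum_mono) (auto simp: norm_L2_def)
    also have "\<dots> \<le> 2" by (simp add: geometric_sum)
    finally show ?thesis unfolding S_def of_real_sum using a by (auto intro: L2_sum)
  qed
  have "(\<integral>\<^sup>+x. (SUP n. ennreal ((S n x)\<^sup>2)) \<partial>M) = (SUP n. \<integral>\<^sup>+x. ennreal ((S n x)\<^sup>2) \<partial>M)"
    by (intro nn_integral_monotone_convergence_SUP)
       (auto simp: incseq_def le_fun_def S_def intro!: power_mono sum_mono2 ennreal_leI sum_nonneg)
  also have "\<dots> \<le> ennreal (2\<^sup>2)"
  proof (rule SUP_least)
    fix n
    have "(\<integral>\<^sup>+x. ennreal ((S n x)\<^sup>2) \<partial>M) = ennreal ((norm_L2 M (\<lambda>x. complex_of_real (S n x)))\<^sup>2)"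
      using norm_L2_nn[of "\<lambda>x. complex_of_real (S n x)" M] SL[of n] by simp
    also have "\<dots> \<le> ennreal (2\<^sup>2)" using SL[of n] by (intro ennreal_leI power_mono) auto
    finally show "(\<integral>\<^sup>+x. ennreal ((S n x)\<^sup>2) \<partial>M) \<le> ennreal (2\<^sup>2)" .
  qed
  finally have "(\<integral>\<^sup>+x. (SUP n. ennreal ((S n x)\<^sup>2)) \<partial>M) \<noteq> \<infinity>"
    by (auto simp: top_unique)
  then have "AE x in M. (SUP n. ennreal ((S n x)\<^sup>2)) \<noteq> \<infinity>"
    by (intro nn_integral_PInf_AE) measurable
  then show ?thesis
  proof eventually_elim
    case (elim x)
    then obtain c where c: "0 \<le> c" "(SUP n. ennreal ((S n x)\<^sup>2)) = ennreal c"
      by (metis ennreal_cases infinity_ennreal_def)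
    have "(S n x)\<^sup>2 \<le> c" for n
    proof -
      have "ennreal ((S n x)\<^sup>2) \<le> ennreal c" unfolding c(2)[symmetric] by (rule SUP_upper) auto
      then show ?thesis using c by simp
    qed
    then have "S n x \<le> sqrt c" for n by (simp add: real_le_rsqrt)
    then have "summable (\<lambda>k. cmod (f (Suc k) x - f k x))"
      by (intro summableI_nonneg_bounded[where x="sqrt c"]) (auto simp: S_def)
    then have "summable (\<lambda>k. f (Suc k) x - f k x)" by (rule summable_norm_cancel)
    then have "convergent (\<lambda>n. (\<Sum>k<n. f (Suc k) x - f k x))" by (simp add: summable_iff_convergent)
    then have "convergent (\<lambda>n. f n x - f 0 x)" by (simp add: sum_lessThan_telescope[of "\<lambda>k. f k x"])
    then show "convergent (\<lambda>n. f n x)"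
      using convergent_add_const_right_iff[of "\<lambda>n. f n x" "- f 0 x"] by simp
  qed
qed

text \<open>Fatou's lemma, applied to \<open>f m - f n\<close> as a sequence in \<open>n\<close>,
shows that a pointwise limit of a Cauchy sequence is also its limit in norm.\<close>

lemma L2_cauchy_limit_AE:
  assumes f: "\<And>n. f n \<in> L2 M"
    and cauchy: "\<And>e. 0 < e \<Longrightarrow> \<exists>N. \<forall>m\<ge>N. \<forall>n\<ge>N. norm_L2 M (\<lambda>x. f m x - f n x) \<le> e"
    and g: "g \<in> borel_measurable M" "AE x in M. (\<lambda>n. f n x) \<longlonglongrightarrow> g x"
  shows "g \<in> L2 M" "(\<lambda>n. norm_L2 M (\<lambda>x. f n x - g x)) \<longlonglongrightarrow> 0"
proof -
  have [measurable]: "f n \<in> borel_measurable M" "g \<in> borel_measurable M" for n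
    using f g by (auto simp: L2_def)
  have key: "\<exists>N. \<forall>m\<ge>N. (\<lambda>x. f m x - g x) \<in> L2 M \<and> norm_L2 M (\<lambda>x. f m x - g x) \<le> e" if e: "0 < e" for e
  proof -
    obtain N where N: "\<And>m n. m \<ge> N \<Longrightarrow> n \<ge> N \<Longrightarrow> norm_L2 M (\<lambda>x. f m x - f n x) \<le> e"
      using cauchy[OF e] by blast
    have "(\<lambda>x. f m x - g x) \<in> L2 M \<and> norm_L2 M (\<lambda>x. f m x - g x) \<le> e" if m: "m \<ge> N" for m
    proof -
      have "AE x in M. (\<lambda>n. f m x - f (n + N) x) \<longlonglongrightarrow> f m x - g x"
        using g(2) by eventually_elim (intro tendsto_intros LIMSEQ_ignore_initial_segment)
      then show ?thesis
        using L2_fatou[of "\<lambda>n x. f m x - f (n + N) x" M e "\<lambda>x. f m x - g x"] N m e f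
        by (auto intro: L2_diff)
    qed
    then show ?thesis by blast
  qed
  obtain N where "(\<lambda>x. f N x - g x) \<in> L2 M" using key[of 1] by auto
  from L2_diff[OF f[of N] this] show "g \<in> L2 M" by simp
  show "(\<lambda>n. norm_L2 M (\<lambda>x. f n x - g x)) \<longlonglongrightarrow> 0"
  proof (rule LIMSEQ_I)
    fix r :: real assume "0 < r"
    then obtain N where "\<forall>m\<ge>N. norm_L2 M (\<lambda>x. f m x - g x) \<le> r/2" using key[of "r/2"] by auto
    then show "\<exists>N. \<forall>m\<ge>N. norm (norm_L2 M (\<lambda>x. f m x - g x) - 0) < r"
      using \<open>0 < r\<close> by (intro exI[of _ N]) (auto intro: order.strict_trans1[of _ "r/2"])
  qed
qed

lemma fast_cauchy_imp_cauchy: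
  assumes f: "\<And>n. f n \<in> L2 M" and fast: "\<And>n. norm_L2 M (\<lambda>x. f (Suc n) x - f n x) \<le> (1/2)^n"
    and e: "0 < e"
  shows "\<exists>N. \<forall>m\<ge>N. \<forall>n\<ge>N. norm_L2 M (\<lambda>x. f m x - f n x) \<le> e"
proof -
  have step: "norm_L2 M (\<lambda>x. f (N + k) x - f N x) \<le> 2 * (1/2)^N - 2 * (1/2)^(N+k)" for N k
  proof (induction k)
    case (Suc k)
    have "norm_L2 M (\<lambda>x. f (N + Suc k) x - f N x)
       \<le> norm_L2 M (\<lambda>x. f (N + Suc k) x - f (N+k) x) + norm_L2 M (\<lambda>x. f (N + k) x - f N x)"
      by (intro norm_L2_diff_triangle f)
    also have "\<dots> \<le> (1/2)^(N+k) + (2 * (1/2)^N - 2 * (1/2)^(N+k))"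
      using fast[of "N+k"] Suc by (intro add_mono) auto
    finally show ?case by simp
  qed simp
  have lim: "(\<lambda>n. 4 * (1/2)^n :: real) \<longlonglongrightarrow> 4 * 0" by (intro tendsto_intros LIMSEQ_power_zero) auto
  have "\<forall>\<^sub>F n in sequentially. 4 * (1/2)^n < e" by (rule order_tendstoD(2)[OF lim]) (use e in simp)
  then obtain N where N: "4 * (1/2)^N < e" by (auto simp: eventually_sequentially)
  have a: "norm_L2 M (\<lambda>x. f m x - f N x) \<le> 2 * (1/2)^N" if "m \<ge> N" for m
  proof -
    have "norm_L2 M (\<lambda>x. f m x - f N x) \<le> 2 * (1/2)^N - 2 * (1/2)^m"
      using step[of N "m - N"] that by simp
    also have "\<dots> \<le> 2 * (1/2)^N" by simp
    finally show ?thesis .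
  qed
  have "norm_L2 M (\<lambda>x. f m x - f n x) \<le> e" if "m \<ge> N" "n \<ge> N" for m n
    using norm_L2_diff_triangle[OF f[of m] f[of N] f[of n]] a[OF that(1)] a[OF that(2)]
      norm_L2_minus_commute[of M "f N" "f n"] N by linarith
  then show ?thesis by blast
qed

text \<open>The theorem of Riesz and Fischer: a subsequence with increments of norm at most
\<open>(1/2)^k\<close> converges almost everywhere, and a Cauchy sequence converges to the limit of
any of its subsequences.\<close>

lemma L2_complete:
  assumes f: "\<And>n. f n \<in> L2 M"
    and cauchy: "\<And>e. 0 < e \<Longrightarrow> \<exists>N. \<forall>m\<ge>N. \<forall>n\<ge>N. norm_L2 M (\<lambda>x. f m x - f n x) \<le> e"
  shows "\<exists>g\<in>L2 M. (\<lambda>n. norm_L2 M (\<lambda>x. f n x - g x)) \<longlonglongrightarrow> 0"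
proof -
  have "\<forall>k. \<exists>N. \<forall>m\<ge>N. \<forall>n\<ge>N. norm_L2 M (\<lambda>x. f m x - f n x) \<le> (1/2)^k"
    using cauchy by auto
  then obtain N where N: "\<And>k m n. m \<ge> N k \<Longrightarrow> n \<ge> N k \<Longrightarrow> norm_L2 M (\<lambda>x. f m x - f n x) \<le> (1/2)^k"
    by metis
  \<comment> \<open>an increasing choice of indices that dominates every \<open>N k\<close>\<close>
  define r where "r k = k + (\<Sum>j\<le>k. N j)" for k
  have r1: "N k \<le> r k" for k
    using member_le_sum[of k "{..k}" N] by (simp add: r_def)
  have r2: "r k \<le> r (Suc k)" for k by (simp add: r_def)
  define h where "h k = f (r k)" for k
  have hL: "h k \<in> L2 M" for k by (simp add: h_def f)
  have fast: "norm_L2 M (\<lambda>x. h (Suc k) x - h k x) \<le> (1/2)^k" for k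
    unfolding h_def by (rule N) (use r1[of k] r2[of k] in auto)
  have [measurable]: "h k \<in> borel_measurable M" for k using hL by (simp add: L2_def)
  define g where "g x = lim (\<lambda>k. h k x)" for x
  have gm: "g \<in> borel_measurable M"
    unfolding g_def by measurable
  have conv: "AE x in M. (\<lambda>k. h k x) \<longlonglongrightarrow> g x"
    using L2_fast_cauchy_AE[OF hL fast] by eventually_elim (simp add: g_def convergent_LIMSEQ_iff)
  have g: "g \<in> L2 M" "(\<lambda>n. norm_L2 M (\<lambda>x. h n x - g x)) \<longlonglongrightarrow> 0"
    using L2_cauchy_limit_AE[OF hL fast_cauchy_imp_cauchy[OF hL fast] gm conv] by auto
  have "(\<lambda>n. norm_L2 M (\<lambda>x. f n x - g x)) \<longlonglongrightarrow> 0"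
  proof (rule LIMSEQ_I)
    fix e :: real assume e: "0 < e"
    obtain K where K: "\<And>m n. m \<ge> K \<Longrightarrow> n \<ge> K \<Longrightarrow> norm_L2 M (\<lambda>x. f m x - f n x) \<le> e/2"
      using cauchy[of "e/2"] e by auto
    obtain J where J: "\<And>n. n \<ge> J \<Longrightarrow> norm_L2 M (\<lambda>x. h n x - g x) < e/2"
      using LIMSEQ_D[OF g(2), of "e/2"] e by auto
    define j where "j = max J K"
    have rj: "r j \<ge> K" by (auto simp: r_def j_def)
    have "norm_L2 M (\<lambda>x. f n x - g x) < e" if "n \<ge> K" for n
      using norm_L2_diff_triangle[OF f[of n] hL[of j] g(1)] K[OF that rj] J[of j]
      by (simp add: h_def j_def)
    then show "\<exists>N. \<forall>n\<ge>N. norm (norm_L2 M (\<lambda>x. f n x - g x) - 0) < e" by auto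
  qed
  then show ?thesis using g(1) by blast
qed

section \<open>Inner products, closed spans and orthonormal systems\<close>

lemma inner_L2_self: "inner_L2 M f f = complex_of_real ((norm_L2 M f)\<^sup>2)"
  unfolding inner_L2_def norm_L2_power2
  by (simp add: complex_norm_square[symmetric] del: of_real_power)

lemma inner_L2_commute: "inner_L2 M g f = cnj (inner_L2 M f g)"
  unfolding inner_L2_def by (rule trans[OF _ Bochner_Integration.integral_cnj]) (simp add: mult.commute)

lemma inner_L2_add_left:
  "\<lbrakk>f \<in> L2 M; g \<in> L2 M; h \<in> L2 M\<rbrakk> \<Longrightarrow> inner_L2 M (\<lambda>x. f x + g x) h = inner_L2 M f h + inner_L2 M g h"
  using inner_L2_integrable[of f M h] inner_L2_integrable[of g M h]
  by (simp add: inner_L2_def distrib_right)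

lemma inner_L2_cmult_left: "inner_L2 M (\<lambda>x. c * f x) h = c * inner_L2 M f h"
  by (simp add: inner_L2_def mult.assoc)

lemma inner_L2_cmult_right: "inner_L2 M f (\<lambda>x. c * h x) = cnj c * inner_L2 M f h"
  by (subst (1 2) inner_L2_commute) (simp add: inner_L2_cmult_left)

lemma inner_L2_sum_left:
  assumes "\<And>i. i \<in> F \<Longrightarrow> f i \<in> L2 M" "h \<in> L2 M"
  shows "inner_L2 M (\<lambda>x. \<Sum>i\<in>F. f i x) h = (\<Sum>i\<in>F. inner_L2 M (f i) h)"
  using assms
proof (induction F rule: infinite_finite_induct)
  case (insert i F)
  then show ?case
    using inner_L2_add_left[of "f i" M "\<lambda>x. \<Sum>i\<in>F. f i x" h] L2_sum[of F f M] by simp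
qed (simp_all add: inner_L2_def)

lemma norm_L2_add_power2:
  assumes "f \<in> L2 M" "g \<in> L2 M"
  shows "(norm_L2 M (\<lambda>x. f x + g x))\<^sup>2 = (norm_L2 M f)\<^sup>2 + 2 * Re (inner_L2 M f g) + (norm_L2 M g)\<^sup>2"
proof -
  have "(norm_L2 M (\<lambda>x. f x + g x))\<^sup>2
      = (LINT x|M. (cmod (f x))\<^sup>2 + 2 * Re (f x * cnj (g x)) + (cmod (g x))\<^sup>2)"
    unfolding norm_L2_power2
  proof (rule Bochner_Integration.integral_cong)
    fix x
    show "(cmod (f x + g x))\<^sup>2 = (cmod (f x))\<^sup>2 + 2 * Re (f x * cnj (g x)) + (cmod (g x))\<^sup>2"
      unfolding cmod_power2 by (simp add: power2_eq_square algebra_simps)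
  qed simp
  also have "\<dots> = (norm_L2 M f)\<^sup>2 + 2 * Re (inner_L2 M f g) + (norm_L2 M g)\<^sup>2"
    using assms[THEN L2_integrable_square] inner_L2_integrable[OF assms]
    by (simp add: norm_L2_power2 inner_L2_def integrable_Re del: Re_complex_of_real complex_cnj times_complex.sel)
  finally show ?thesis .
qed

text \<open>Polarization: the four norms with \<open>c = 1, -1, \<i>, -\<i>\<close> determine the
inner product.  In this form it transports inner products along isometries that are only known
through the norms of linear combinations.\<close>

lemma inner_L2_eq_polarization:
  assumes "u \<in> L2 M" "w \<in> L2 M" "u' \<in> L2 N" "w' \<in> L2 N"
    and eq: "\<And>c. norm_L2 M (\<lambda>x. u x + c * w x) = norm_L2 N (\<lambda>x. u' x + c * w' x)"
  shows "inner_L2 M u w = inner_L2 N u' w'"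
proof -
  have e: "(norm_L2 M u)\<^sup>2 + 2 * Re (cnj c * inner_L2 M u w) + (cmod c)\<^sup>2 * (norm_L2 M w)\<^sup>2
     = (norm_L2 N u')\<^sup>2 + 2 * Re (cnj c * inner_L2 N u' w') + (cmod c)\<^sup>2 * (norm_L2 N w')\<^sup>2" for c
    using eq[of c] norm_L2_add_power2[OF assms(1) L2_cmult[OF assms(2)], of c]
      norm_L2_add_power2[OF assms(3) L2_cmult[OF assms(4)], of c]
    by (simp add: inner_L2_cmult_right norm_L2_cmult power_mult_distrib)
  show ?thesis
    using e[of 1] e[of "-1"] e[of "\<i>"] e[of "-\<i>"] by (simp add: complex_eq_iff)
qed

text \<open>Membership in the closed linear span of the system, phrased as in
\<open>complete_system\<close>.\<close>

definition L2_approx :: "'a measure \<Rightarrow> 'i set \<Rightarrow> ('i \<Rightarrow> 'a \<Rightarrow> complex) \<Rightarrow> ('a \<Rightarrow> complex) \<Rightarrow> bool" where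
  "L2_approx M I v f \<longleftrightarrow> f \<in> L2 M \<and> (\<forall>\<epsilon>>0. \<exists>F c. finite F \<and> F \<subseteq> I \<and>
        norm_L2 M (\<lambda>x. (\<Sum>i\<in>F. c i * v i x) - f x) < \<epsilon>)"

lemma L2_approxE:
  assumes "L2_approx M I v f" "0 < \<epsilon>"
  obtains F c where "finite F" "F \<subseteq> I" "norm_L2 M (\<lambda>x. (\<Sum>i\<in>F. c i * v i x) - f x) < \<epsilon>"
  using assms unfolding L2_approx_def by blast

lemma complete_system_iff: "complete_system M I v \<longleftrightarrow> (\<forall>f\<in>L2 M. L2_approx M I v f)"
  by (auto simp: complete_system_def L2_approx_def)

context
  fixes M :: "'a measure" and I :: "'i set" and v
  assumes v: "\<And>i. i \<in> I \<Longrightarrow> v i \<in> L2 M"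
begin

lemma L2_finite_sum: "F \<subseteq> I \<Longrightarrow> (\<lambda>x. \<Sum>i\<in>F. c i * v i x) \<in> L2 M"
  by (intro L2_sum L2_cmult v) auto

lemma L2_approx_limit:
  assumes f: "f \<in> L2 M" and lim: "\<And>e. 0 < e \<Longrightarrow> \<exists>g. L2_approx M I v g \<and> norm_L2 M (\<lambda>x. g x - f x) < e"
  shows "L2_approx M I v f"
  unfolding L2_approx_def
proof (intro conjI allI impI f)
  fix e :: real assume "0 < e"
  then obtain g where g: "L2_approx M I v g" "norm_L2 M (\<lambda>x. g x - f x) < e/2"
    using lim[of "e/2"] by auto
  obtain F c where F: "finite F" "F \<subseteq> I" "norm_L2 M (\<lambda>x. (\<Sum>i\<in>F. c i * v i x) - g x) < e/2"
    by (rule L2_approxE[OF g(1), of "e/2"]) (use \<open>0 < e\<close> in auto)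
  have "norm_L2 M (\<lambda>x. (\<Sum>i\<in>F. c i * v i x) - f x) < e"
    using norm_L2_diff_triangle[OF L2_finite_sum[OF F(2), of c] _ f, of g] g F(3)
    by (simp add: L2_approx_def)
  then show "\<exists>F c. finite F \<and> F \<subseteq> I \<and> norm_L2 M (\<lambda>x. (\<Sum>i\<in>F. c i * v i x) - f x) < e"
    using F by blast
qed

lemma L2_approx_finite_sum:
  assumes "finite F" "F \<subseteq> I" shows "L2_approx M I v (\<lambda>x. \<Sum>i\<in>F. c i * v i x)"
  unfolding L2_approx_def using assms L2_finite_sum[OF assms(2)] by (auto intro!: exI[of _ F] exI[of _ c])

lemma L2_approx_zero: "L2_approx M I v (\<lambda>x. 0)"
  using L2_approx_finite_sum[of "{}"] by simp

lemma L2_approx_add: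
  assumes "L2_approx M I v f" "L2_approx M I v g"
  shows "L2_approx M I v (\<lambda>x. f x + g x)"
  unfolding L2_approx_def
proof (intro conjI allI impI)
  have fg: "f \<in> L2 M" "g \<in> L2 M" using assms by (auto simp: L2_approx_def)
  then show "(\<lambda>x. f x + g x) \<in> L2 M" by (rule L2_add)
  fix e :: real assume "0 < e"
  then have e2: "0 < e/2" by simp
  obtain F c where F: "finite F" "F \<subseteq> I" "norm_L2 M (\<lambda>x. (\<Sum>i\<in>F. c i * v i x) - f x) < e/2"
    by (rule L2_approxE[OF assms(1) e2])
  obtain G d where G: "finite G" "G \<subseteq> I" "norm_L2 M (\<lambda>x. (\<Sum>i\<in>G. d i * v i x) - g x) < e/2"
    by (rule L2_approxE[OF assms(2) e2])
  define b where "b i = (if i \<in> F then c i else 0) + (if i \<in> G then d i else 0)" for i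
  have eq: "(\<Sum>i\<in>F \<union> G. b i * v i x) = (\<Sum>i\<in>F. c i * v i x) + (\<Sum>i\<in>G. d i * v i x)" for x
  proof -
    have "(\<Sum>i\<in>F. c i * v i x) = (\<Sum>i\<in>F \<union> G. (if i \<in> F then c i else 0) * v i x)"
      by (rule sum.mono_neutral_cong_left) (use F G in auto)
    moreover have "(\<Sum>i\<in>G. d i * v i x) = (\<Sum>i\<in>F \<union> G. (if i \<in> G then d i else 0) * v i x)"
      by (rule sum.mono_neutral_cong_left) (use F G in auto)
    ultimately show ?thesis by (simp add: b_def distrib_right sum.distrib)
  qed
  have "norm_L2 M (\<lambda>x. (\<Sum>i\<in>F \<union> G. b i * v i x) - (f x + g x)) < e"
    using norm_L2_triangle[OF L2_diff[OF L2_finite_sum[OF F(2), of c] fg(1)] L2_diff[OF L2_finite_sum[OF G(2), of d] fg(2)]]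
      F(3) G(3) unfolding eq by (simp add: algebra_simps)
  then show "\<exists>F c. finite F \<and> F \<subseteq> I \<and> norm_L2 M (\<lambda>x. (\<Sum>i\<in>F. c i * v i x) - (f x + g x)) < e"
    using F G by (intro exI[of _ "F \<union> G"] exI[of _ b]) auto
qed

lemma L2_approx_cmult:
  assumes "L2_approx M I v f" shows "L2_approx M I v (\<lambda>x. a * f x)"
  unfolding L2_approx_def
proof (intro conjI allI impI)
  show "(\<lambda>x. a * f x) \<in> L2 M" using assms by (auto simp: L2_approx_def intro: L2_cmult)
  fix e :: real assume "0 < e"
  then have "0 < e / (cmod a + 1)" by (intro divide_pos_pos) (auto simp: add_nonneg_pos)
  from L2_approxE[OF assms this] obtain F c where F: "finite F" "F \<subseteq> I"
    "norm_L2 M (\<lambda>x. (\<Sum>i\<in>F. c i * v i x) - f x) < e / (cmod a + 1)" .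
  have "norm_L2 M (\<lambda>x. (\<Sum>i\<in>F. (a * c i) * v i x) - a * f x)
      = cmod a * norm_L2 M (\<lambda>x. (\<Sum>i\<in>F. c i * v i x) - f x)"
    by (subst norm_L2_cmult[symmetric]) (simp add: sum_distrib_left right_diff_distrib mult.assoc)
  also have "\<dots> \<le> (cmod a + 1) * norm_L2 M (\<lambda>x. (\<Sum>i\<in>F. c i * v i x) - f x)"
    by (intro mult_right_mono) auto
  also have "\<dots> < e" using F(3) by (simp add: pos_less_divide_eq add_nonneg_pos mult.commute)
  finally show "\<exists>F c. finite F \<and> F \<subseteq> I \<and> norm_L2 M (\<lambda>x. (\<Sum>i\<in>F. c i * v i x) - a * f x) < e"
    using F by (intro exI[of _ F] exI[of _ "\<lambda>i. a * c i"]) simp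
qed

lemma L2_approx_basis: "i \<in> I \<Longrightarrow> L2_approx M I v (v i)"
  using L2_approx_finite_sum[of "{i}" "\<lambda>_. 1"] by simp

lemma L2_approx_sum: "(\<And>j. j \<in> J \<Longrightarrow> L2_approx M I v (f j)) \<Longrightarrow> L2_approx M I v (\<lambda>x. \<Sum>j\<in>J. f j x)"
  by (induction J rule: infinite_finite_induct) (auto intro: L2_approx_zero L2_approx_add)

lemma L2_approx_diff:
  "L2_approx M I v f \<Longrightarrow> L2_approx M I v g \<Longrightarrow> L2_approx M I v (\<lambda>x. f x - g x)"
  using L2_approx_add[of f "\<lambda>x. (-1) * g x"] L2_approx_cmult[of g "-1"] by simp

lemma L2_approx_limit_seq:
  assumes f: "f \<in> L2 M" and g: "\<And>n. L2_approx M I v (g n)"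
    and lim: "(\<lambda>n. norm_L2 M (\<lambda>x. g n x - f x)) \<longlonglongrightarrow> 0"
  shows "L2_approx M I v f"
proof (rule L2_approx_limit[OF f])
  fix e :: real assume "0 < e"
  then obtain n where "norm_L2 M (\<lambda>x. g n x - f x) < e" using LIMSEQ_D[OF lim, of e] by auto
  then show "\<exists>g. L2_approx M I v g \<and> norm_L2 M (\<lambda>x. g x - f x) < e" using g by blast
qed

lemma L2_approx_cong_AE:
  assumes "L2_approx M I v f" "g \<in> borel_measurable M" "AE x in M. f x = g x"
  shows "L2_approx M I v g"
proof -
  have f: "f \<in> L2 M" using assms by (simp add: L2_approx_def)
  have [measurable]: "f \<in> borel_measurable M" "g \<in> borel_measurable M" using f assms by (auto simp: L2_def)
  have "(\<integral>\<^sup>+x. ennreal ((cmod (g x))\<^sup>2) \<partial>M) = (\<integral>\<^sup>+x. ennreal ((cmod (f x))\<^sup>2) \<partial>M)"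
    using assms(3) by (intro nn_integral_cong_AE) auto
  then have g: "g \<in> L2 M" using f by (simp add: L2_iff_nn)
  have "norm_L2 M (\<lambda>x. f x - g x) = norm_L2 M (\<lambda>x. 0)"
    by (rule norm_L2_cong_AE) (use assms(3) in auto)
  then show ?thesis by (intro L2_approx_limit[OF g] exI[of _ f]) (use assms(1) in auto)
qed

end

lemma L2_dominated_convergence:
  assumes f: "\<And>n. f n \<in> borel_measurable M" and g: "g \<in> borel_measurable M"
    and b: "integrable M b" "\<And>n. AE x in M. (cmod (f n x - g x))\<^sup>2 \<le> b x"
    and lim: "AE x in M. (\<lambda>n. f n x) \<longlonglongrightarrow> g x"
  shows "(\<lambda>n. norm_L2 M (\<lambda>x. f n x - g x)) \<longlonglongrightarrow> 0"
proof -
  have "(\<lambda>n. LINT x|M. (cmod (f n x - g x))\<^sup>2) \<longlonglongrightarrow> (LINT x|M. 0)"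
  proof (rule integral_dominated_convergence[where w=b])
    show "AE x in M. (\<lambda>n. (cmod (f n x - g x))\<^sup>2) \<longlonglongrightarrow> 0"
      using lim
    proof eventually_elim
      case (elim x)
      then have "(\<lambda>n. (cmod (f n x - g x))\<^sup>2) \<longlonglongrightarrow> (cmod (g x - g x))\<^sup>2" by (intro tendsto_intros)
      then show ?case by simp
    qed
  qed (use f g b in auto)
  then have "(\<lambda>n. sqrt (LINT x|M. (cmod (f n x - g x))\<^sup>2)) \<longlonglongrightarrow> sqrt 0"
    by (intro tendsto_real_sqrt) simp
  then show ?thesis by (simp add: norm_L2_def)
qed

lemma (in finite_measure) indicator_L2: "A \<in> sets M \<Longrightarrow> (indicator A :: 'a \<Rightarrow> complex) \<in> L2 M"
proof -
  assume A[measurable]: "A \<in> sets M"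
  have "integrable M (\<lambda>x. (cmod (indicator A x))\<^sup>2)"
    by (rule integrable_const_bound[where B=1]) (auto simp: indicator_def)
  then show ?thesis by (simp add: L2_def)
qed

text \<open>A complex function is the limit of simple functions with at most twice its modulus, so
that dominated convergence reduces the claim to indicators.\<close>

lemma (in finite_measure) L2_approx_all:
  assumes v: "\<And>i. i \<in> I \<Longrightarrow> v i \<in> L2 M"
    and ind: "\<And>A. A \<in> sets M \<Longrightarrow> L2_approx M I v (indicator A)" and f: "f \<in> L2 M"
  shows "L2_approx M I v f"
proof -
  have fm[measurable]: "f \<in> borel_measurable M" using f by (simp add: L2_def)
  obtain s where s': "\<forall>i. simple_function M (s i)" "\<forall>x\<in>space M. (\<lambda>i. s i x) \<longlonglongrightarrow> f x"
     "\<forall>i. \<forall>x\<in>space M. dist (s i x) 0 \<le> 2 * dist (f x) 0"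
    using borel_measurable_implies_sequence_metric[OF fm, of 0] by blast
  have s: "\<And>i. simple_function M (s i)" "\<And>x. x \<in> space M \<Longrightarrow> (\<lambda>i. s i x) \<longlonglongrightarrow> f x"
     "\<And>i x. x \<in> space M \<Longrightarrow> cmod (s i x) \<le> 2 * cmod (f x)"
    using s' by auto
  have [measurable]: "s i \<in> borel_measurable M" for i using s(1) by (rule borel_measurable_simple_function)
  have approx: "L2_approx M I v (s i)" for i
  proof -
    have fin: "finite (s i ` space M)" using s(1) by (rule simple_functionD)
    have A: "L2_approx M I v (\<lambda>x. \<Sum>y\<in>s i ` space M. y * indicator (s i -` {y} \<inter> space M) x)"
      by (intro L2_approx_sum[OF v] L2_approx_cmult[OF v] ind) (use s(1) in \<open>auto dest: simple_functionD\<close>)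
    have B: "(\<Sum>y\<in>s i ` space M. y * indicator (s i -` {y} \<inter> space M) x) = s i x" if x: "x \<in> space M" for x
    proof -
      have "(\<Sum>y\<in>s i ` space M. y * indicator (s i -` {y} \<inter> space M) x)
          = (\<Sum>y\<in>s i ` space M. if y = s i x then y else 0)"
        by (rule sum.cong) (use x in \<open>auto simp: indicator_def\<close>)
      then show ?thesis using x fin by simp
    qed
    show ?thesis
      by (rule L2_approx_cong_AE[where I=I and v=v, OF v A]) (use B in auto)
  qed
  show ?thesis
  proof (rule L2_approx_limit_seq[OF v f approx])
    show "(\<lambda>n. norm_L2 M (\<lambda>x. s n x - f x)) \<longlonglongrightarrow> 0"
    proof (rule L2_dominated_convergence)
      \<comment> \<open>\<open>9 = (2 + 1)\<^sup>2\<close>, from \<open>cmod (s n x) \<le> 2 * cmod (f x)\<close>\<close>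
      show "integrable M (\<lambda>x. 9 * (cmod (f x))\<^sup>2)" using L2_integrable_square[OF f] by simp
      show "AE x in M. (cmod (s n x - f x))\<^sup>2 \<le> 9 * (cmod (f x))\<^sup>2" for n
      proof (rule AE_I2)
        fix x assume x: "x \<in> space M"
        have "cmod (s n x - f x) \<le> 3 * cmod (f x)"
          using norm_triangle_ineq4[of "s n x" "f x"] s(3)[OF x, of n] by simp
        from power_mono[OF this, of 2] show "(cmod (s n x - f x))\<^sup>2 \<le> 9 * (cmod (f x))\<^sup>2"
          by (simp add: power_mult_distrib)
      qed
    qed (use s(2) in auto)
  qed
qed

text \<open>The sets whose indicators lie in the closed span are closed under complements and
disjoint countable unions, so that a generating family stable under intersections suffices.\<close>

lemma (in finite_measure) L2_approx_pi_system:
  assumes v: "\<And>i. i \<in> I \<Longrightarrow> v i \<in> L2 M"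
    and G: "sets M = sigma_sets (space M) G" "Int_stable G" "G \<subseteq> Pow (space M)"
    and sp: "L2_approx M I v (indicator (space M))"
    and ind: "\<And>A. A \<in> G \<Longrightarrow> L2_approx M I v (indicator A)" and f: "f \<in> L2 M"
  shows "L2_approx M I v f"
proof (rule L2_approx_all[OF v _ f])
  fix A assume "A \<in> sets M"
  then have "A \<in> sigma_sets (space M) G" using G(1) by simp
  with G(2,3) show "L2_approx M I v (indicator A)"
  proof (induction rule: sigma_sets_induct_disjoint)
    case (basic A) then show ?case by (rule ind)
  next
    case empty then show ?case using L2_approx_zero[OF v] by (simp add: indicator_def[abs_def])
  next
    case (compl A)
    from L2_approx_diff[OF v sp compl(2)]
    have D: "L2_approx M I v (\<lambda>x. indicator (space M) x - indicator A x)" by simp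
    have "A \<in> sets M" using compl(1) G(1) by simp
    then show ?case
      by (intro L2_approx_cong_AE[where I=I and v=v, OF v D])
         (auto simp: indicator_def dest: sets.sets_into_space)
  next
    case (union A)
    have m[measurable]: "A i \<in> sets M" for i using union(2) G(1) by auto
    show ?case
    proof (rule L2_approx_limit_seq[OF v])
      show "(indicator (\<Union>i. A i) :: 'a \<Rightarrow> complex) \<in> L2 M" by (rule indicator_L2) auto
      show "L2_approx M I v (\<lambda>x. \<Sum>i<n. indicator (A i) x)" for n
        by (rule L2_approx_sum[OF v]) (use union(3) in auto)
      have eq: "(\<Sum>i<n. indicator (A i) x :: complex) = indicator (\<Union>i<n. A i) x" for n x
        by (subst indicator_UN_disjoint)
           (use union(1) in \<open>auto simp: disjoint_family_on_def\<close>)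
      show "(\<lambda>n. norm_L2 M (\<lambda>x. (\<Sum>i<n. indicator (A i) x) - indicator (\<Union>i. A i) x)) \<longlonglongrightarrow> 0"
        unfolding eq
      proof (rule L2_dominated_convergence[where b="\<lambda>_. 1"])
        show "AE x in M. (\<lambda>n. indicator (\<Union>i<n. A i) x :: complex) \<longlonglongrightarrow> indicator (\<Union>i. A i) x"
          by (intro AE_I2 LIMSEQ_indicator_UN)
        show "AE x in M. (cmod (indicator (\<Union>i<n. A i) x - indicator (\<Union>i. A i) x))\<^sup>2 \<le> 1" for n
          by (intro AE_I2) (auto simp: indicator_def)
      qed auto
    qed
  qed
qed

definition orthonormal_L2 :: "'a measure \<Rightarrow> 'i set \<Rightarrow> ('i \<Rightarrow> 'a \<Rightarrow> complex) \<Rightarrow> bool" where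
  "orthonormal_L2 M I v \<longleftrightarrow> (\<forall>i\<in>I. v i \<in> L2 M) \<and> (\<forall>i\<in>I. \<forall>j\<in>I. inner_L2 M (v i) (v j) = (if i = j then 1 else 0))"

lemma norm_orthonormal_sum:
  assumes "orthonormal_L2 M I v" "finite F" "F \<subseteq> I"
  shows "(norm_L2 M (\<lambda>x. \<Sum>i\<in>F. a i * v i x))\<^sup>2 = (\<Sum>i\<in>F. (cmod (a i))\<^sup>2)"
proof -
  have v: "v i \<in> L2 M" if "i \<in> F" for i using assms that by (auto simp: orthonormal_L2_def)
  have "complex_of_real ((norm_L2 M (\<lambda>x. \<Sum>i\<in>F. a i * v i x))\<^sup>2)
     = (\<Sum>i\<in>F. a i * cnj (\<Sum>j\<in>F. a j * inner_L2 M (v j) (v i)))"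
  proof -
    have S: "(\<lambda>x. \<Sum>i\<in>F. a i * v i x) \<in> L2 M" by (intro L2_sum L2_cmult v)
    have "inner_L2 M (\<lambda>x. \<Sum>j\<in>F. a j * v j x) (v i) = (\<Sum>j\<in>F. a j * inner_L2 M (v j) (v i))" if "i \<in> F" for i
      by (subst inner_L2_sum_left) (auto intro!: L2_cmult v that simp: inner_L2_cmult_left)
    then have "inner_L2 M (v i) (\<lambda>x. \<Sum>j\<in>F. a j * v j x) = cnj (\<Sum>j\<in>F. a j * inner_L2 M (v j) (v i))" if "i \<in> F" for i
      using inner_L2_commute[of M "v i" "\<lambda>x. \<Sum>j\<in>F. a j * v j x"] that by simp
    then show ?thesis
      unfolding inner_L2_self[symmetric]
      by (subst inner_L2_sum_left) (auto intro!: L2_cmult v S sum.cong simp: inner_L2_cmult_left)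
  qed
  also have "\<dots> = (\<Sum>i\<in>F. a i * cnj (a i))"
  proof (rule sum.cong[OF refl])
    fix i assume i: "i \<in> F"
    have "(\<Sum>j\<in>F. a j * inner_L2 M (v j) (v i)) = (\<Sum>j\<in>F. if j = i then a j else 0)"
      by (rule sum.cong[OF refl]) (use assms(1,3) i in \<open>auto simp: orthonormal_L2_def subset_iff\<close>)
    then show "a i * cnj (\<Sum>j\<in>F. a j * inner_L2 M (v j) (v i)) = a i * cnj (a i)"
      using i assms(2) by simp
  qed
  also have "\<dots> = complex_of_real (\<Sum>i\<in>F. (cmod (a i))\<^sup>2)" by (simp add: complex_norm_square[symmetric] del: of_real_power)
  finally show ?thesis using of_real_eq_iff by blast
qed

text \<open>Completing the square in the coefficients.  The choice \<open>a i = inner_L2 M u (v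
i)\<close> gives Bessel's inequality, and any other choice increases the distance to
\<open>u\<close>.\<close>

lemma norm_orthonormal_diff:
  assumes "orthonormal_L2 M I v" "finite F" "F \<subseteq> I" "u \<in> L2 M"
  shows "(norm_L2 M (\<lambda>x. (\<Sum>i\<in>F. a i * v i x) - u x))\<^sup>2
    = (norm_L2 M u)\<^sup>2 - (\<Sum>i\<in>F. (cmod (inner_L2 M u (v i)))\<^sup>2) + (\<Sum>i\<in>F. (cmod (a i - inner_L2 M u (v i)))\<^sup>2)"
proof -
  have v: "v i \<in> L2 M" if "i \<in> F" for i using assms that by (auto simp: orthonormal_L2_def)
  have S: "(\<lambda>x. \<Sum>i\<in>F. a i * v i x) \<in> L2 M" by (intro L2_sum L2_cmult v)
  have "(norm_L2 M (\<lambda>x. (\<Sum>i\<in>F. a i * v i x) + (-1) * u x))\<^sup>2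
     = (\<Sum>i\<in>F. (cmod (a i))\<^sup>2) + 2 * Re (inner_L2 M (\<lambda>x. \<Sum>i\<in>F. a i * v i x) (\<lambda>x. (-1) * u x)) + (norm_L2 M u)\<^sup>2"
    unfolding norm_L2_add_power2[OF S L2_cmult[OF assms(4)]] norm_orthonormal_sum[OF assms(1-3)] norm_L2_cmult by simp
  also have "inner_L2 M (\<lambda>x. \<Sum>i\<in>F. a i * v i x) (\<lambda>x. (-1) * u x) = - (\<Sum>i\<in>F. a i * cnj (inner_L2 M u (v i)))"
    unfolding inner_L2_cmult_right
    by (subst inner_L2_sum_left)
       (auto intro!: L2_cmult v assms sum.cong simp: inner_L2_cmult_left inner_L2_commute[of M u])
  also have "(\<Sum>i\<in>F. (cmod (a i))\<^sup>2) + 2 * Re (- (\<Sum>i\<in>F. a i * cnj (inner_L2 M u (v i)))) + (norm_L2 M u)\<^sup>2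
     = (norm_L2 M u)\<^sup>2 + (\<Sum>i\<in>F. (cmod (a i))\<^sup>2 - 2 * Re (a i * cnj (inner_L2 M u (v i))))"
    by (simp add: sum_subtractf sum_distrib_left Re_sum del: times_complex.sel)
  also have "(\<Sum>i\<in>F. (cmod (a i))\<^sup>2 - 2 * Re (a i * cnj (inner_L2 M u (v i))))
     = (\<Sum>i\<in>F. (cmod (a i - inner_L2 M u (v i)))\<^sup>2 - (cmod (inner_L2 M u (v i)))\<^sup>2)"
    by (rule sum.cong[OF refl], simp only: cmod_power2) (simp add: power2_eq_square algebra_simps)
  finally show ?thesis by (simp add: sum_subtractf)
qed

text \<open>Bessel's inequality bounds the finite partial sums.  Conversely the orthogonal
projection onto finitely many vectors is at least as close to \<open>u\<close> as the combination of
them that approximates \<open>u\<close>.\<close>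

lemma parseval_orthonormal:
  assumes o: "orthonormal_L2 M I v" and c: "L2_approx M I v u" and I: "countable I"
  shows "(\<integral>\<^sup>+i. ennreal ((cmod (inner_L2 M u (v i)))\<^sup>2) \<partial>count_space I) = ennreal ((norm_L2 M u)\<^sup>2)"
proof -
  have u: "u \<in> L2 M" using c by (simp add: L2_approx_def)
  let ?c = "\<lambda>i. (cmod (inner_L2 M u (v i)))\<^sup>2"
  have bessel: "(\<Sum>i\<in>F. ?c i) \<le> (norm_L2 M u)\<^sup>2" if "finite F" "F \<subseteq> I" for F
    using norm_orthonormal_diff[OF o that u, of "\<lambda>i. inner_L2 M u (v i)"]
      zero_le_power2[of "norm_L2 M (\<lambda>x. (\<Sum>i\<in>F. inner_L2 M u (v i) * v i x) - u x)"] by simp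
  have le: "(\<integral>\<^sup>+i. ennreal (?c i) \<partial>count_space I) \<le> ennreal ((norm_L2 M u)\<^sup>2)"
  proof (cases "I = {}")
    case False
    define F where "F n = from_nat_into I ` {..<n}" for n :: nat
    have F: "finite (F n)" "F n \<subseteq> I" for n
      unfolding F_def by (simp, intro image_subsetI from_nat_into[OF False])
    have U: "\<exists>n. i \<in> F n" if "i \<in> I" for i
    proof -
      have "i \<in> range (from_nat_into I)" unfolding range_from_nat_into[OF False I] by (rule that)
      then obtain n where "i = from_nat_into I n" by (rule rangeE)
      then have "i \<in> F (Suc n)" by (simp add: F_def)
      then show ?thesis ..
    qed
    have mono: "incseq F" unfolding F_def incseq_def by (intro allI impI image_mono) auto
    have "(\<integral>\<^sup>+i. ennreal (?c i) \<partial>count_space I) = (\<integral>\<^sup>+i. (SUP n. ennreal (?c i) * indicator (F n) i) \<partial>count_space I)"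
    proof (rule nn_integral_cong)
      fix i assume "i \<in> space (count_space I)"
      then obtain n where n: "i \<in> F n" using U by force
      show "ennreal (?c i) = (SUP n. ennreal (?c i) * indicator (F n) i)"
        by (rule antisym, rule SUP_upper2[of n]) (use n in \<open>auto intro!: SUP_least simp: indicator_def\<close>)
    qed
    also have "\<dots> = (SUP n. \<integral>\<^sup>+i. ennreal (?c i) * indicator (F n) i \<partial>count_space I)"
      by (rule nn_integral_monotone_convergence_SUP)
         (use mono in \<open>auto simp: incseq_def le_fun_def indicator_def\<close>)
    also have "\<dots> = (SUP n. ennreal (\<Sum>i\<in>F n. ?c i))"
    proof (rule SUP_cong[OF refl])
      fix n
      have "(\<integral>\<^sup>+i. ennreal (?c i) * indicator (F n) i \<partial>count_space I) = (\<Sum>i\<in>F n. ennreal (?c i) * indicator (F n) i)"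
        by (rule nn_integral_count_space') (use F in auto)
      also have "\<dots> = ennreal (\<Sum>i\<in>F n. ?c i)" by (simp add: sum_ennreal)
      finally show "(\<integral>\<^sup>+i. ennreal (?c i) * indicator (F n) i \<partial>count_space I) = ennreal (\<Sum>i\<in>F n. ?c i)" .
    qed
    also have "\<dots> \<le> ennreal ((norm_L2 M u)\<^sup>2)"
      by (intro SUP_least ennreal_leI bessel F)
    finally show ?thesis .
  qed (simp add: nn_integral_count_space_finite)
  have ge: "ennreal ((norm_L2 M u)\<^sup>2) \<le> (\<integral>\<^sup>+i. ennreal (?c i) \<partial>count_space I) + ennreal e" if e: "0 < e" for e :: real
  proof -
    obtain F a where F: "finite F" "F \<subseteq> I" "norm_L2 M (\<lambda>x. (\<Sum>i\<in>F. a i * v i x) - u x) < sqrt e"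
      by (rule L2_approxE[OF c, of "sqrt e"]) (use e in auto)
    have "(norm_L2 M (\<lambda>x. (\<Sum>i\<in>F. a i * v i x) - u x))\<^sup>2 \<le> (sqrt e)\<^sup>2"
      using F(3) by (intro power_mono) auto
    then have "(norm_L2 M u)\<^sup>2 - (\<Sum>i\<in>F. ?c i) \<le> e"
      using norm_orthonormal_diff[OF o F(1,2) u, of a] e
        sum_nonneg[of F "\<lambda>i. (cmod (a i - inner_L2 M u (v i)))\<^sup>2"] by simp
    then have "ennreal ((norm_L2 M u)\<^sup>2) \<le> ennreal ((\<Sum>i\<in>F. ?c i) + e)" by (intro ennreal_leI) simp
    also have "\<dots> = ennreal (\<Sum>i\<in>F. ?c i) + ennreal e" using e by (simp add: sum_nonneg)
    also have "ennreal (\<Sum>i\<in>F. ?c i) = (\<integral>\<^sup>+i. ennreal (?c i) * indicator F i \<partial>count_space I)"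
      by (subst nn_integral_count_space'[where A=F]) (use F in \<open>auto simp: sum_ennreal\<close>)
    also have "\<dots> \<le> (\<integral>\<^sup>+i. ennreal (?c i) \<partial>count_space I)"
      by (rule nn_integral_mono) (auto simp: indicator_def)
    finally show ?thesis by (simp add: add_right_mono)
  qed
  show ?thesis
    by (rule antisym[OF le], rule ennreal_le_epsilon, rule ge)
qed

section \<open>Orthogonal series and optimal Riesz constants\<close>

text \<open>Over an arbitrary index set the finite partial sums form a net.  Finite sets \<open>H
k\<close> that exhaust the mass of the coefficients up to \<open>(1/2)^k\<close> reduce its
convergence to that of a Cauchy sequence.\<close>

lemma orthonormal_has_L2_sum:
  assumes o: "orthonormal_L2 M I v" and a: "(\<lambda>i. (cmod (a i))\<^sup>2) summable_on I"
  shows "\<exists>f. has_L2_sum M I v a f \<and> (norm_L2 M f)\<^sup>2 = (\<Sum>\<^sub>\<infinity>i\<in>I. (cmod (a i))\<^sup>2)"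
proof -
  define S where "S F = (\<lambda>x. \<Sum>i\<in>F. a i * v i x)" for F
  define q where "q = (\<Sum>\<^sub>\<infinity>i\<in>I. (cmod (a i))\<^sup>2)"
  have SL: "S F \<in> L2 M" if "F \<subseteq> I" for F
    unfolding S_def by (rule L2_sum, rule L2_cmult) (use o that in \<open>auto simp: orthonormal_L2_def\<close>)
  have nS: "(norm_L2 M (S F))\<^sup>2 = (\<Sum>i\<in>F. (cmod (a i))\<^sup>2)" if "finite F" "F \<subseteq> I" for F
    unfolding S_def by (rule norm_orthonormal_sum[OF o that])
  have conv: "(sum (\<lambda>i. (cmod (a i))\<^sup>2) \<longlongrightarrow> q) (finite_subsets_at_top I)"
    using has_sum_infsum[OF a] unfolding has_sum_def q_def .
  have key: "\<exists>F0. finite F0 \<and> F0 \<subseteq> I \<and> (\<forall>F. finite F \<and> F0 \<subseteq> F \<and> F \<subseteq> I \<longrightarrow> norm_L2 M (\<lambda>x. S F x - S F0 x) \<le> e)"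
    if e: "0 < e" for e
  proof -
    have "0 < e\<^sup>2 / 2" using e by simp
    from tendstoD[OF conv this] obtain F0 where F0': "finite F0 \<and> F0 \<subseteq> I \<and>
      (\<forall>F. finite F \<and> F0 \<subseteq> F \<and> F \<subseteq> I \<longrightarrow> dist (\<Sum>i\<in>F. (cmod (a i))\<^sup>2) q < e\<^sup>2 / 2)"
      unfolding eventually_finite_subsets_at_top ..
    then have F0: "finite F0" "F0 \<subseteq> I"
      "\<And>F. finite F \<Longrightarrow> F0 \<subseteq> F \<Longrightarrow> F \<subseteq> I \<Longrightarrow> dist (\<Sum>i\<in>F. (cmod (a i))\<^sup>2) q < e\<^sup>2 / 2"
      by simp_all
    have "norm_L2 M (\<lambda>x. S F x - S F0 x) \<le> e" if F: "finite F" "F0 \<subseteq> F" "F \<subseteq> I" for F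
    proof (rule power2_le_imp_le)
      have "(\<lambda>x. S F x - S F0 x) = S (F - F0)"
        using F by (auto simp: S_def fun_eq_iff sum_diff)
      then have "(norm_L2 M (\<lambda>x. S F x - S F0 x))\<^sup>2 = (\<Sum>i\<in>F - F0. (cmod (a i))\<^sup>2)"
        using nS[of "F - F0"] F by auto
      also have "\<dots> = (\<Sum>i\<in>F. (cmod (a i))\<^sup>2) - (\<Sum>i\<in>F0. (cmod (a i))\<^sup>2)"
        using F by (simp add: sum_diff)
      also have "\<dots> \<le> e\<^sup>2" using F0(3)[OF F] F0(3)[OF F0(1) order_refl F0(2)] unfolding dist_real_def by linarith
      finally show "(norm_L2 M (\<lambda>x. S F x - S F0 x))\<^sup>2 \<le> e\<^sup>2" .
    qed (use e in simp)
    then show ?thesis using F0 by blast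
  qed
  have "\<forall>k::nat. \<exists>F0. finite F0 \<and> F0 \<subseteq> I \<and> (\<forall>F. finite F \<and> F0 \<subseteq> F \<and> F \<subseteq> I \<longrightarrow> norm_L2 M (\<lambda>x. S F x - S F0 x) \<le> (1/2)^k)"
    by (intro allI key) simp
  then obtain G where G': "\<forall>k. finite (G k) \<and> G k \<subseteq> I \<and>
      (\<forall>F. finite F \<and> G k \<subseteq> F \<and> F \<subseteq> I \<longrightarrow> norm_L2 M (\<lambda>x. S F x - S (G k) x) \<le> (1/2)^k)"
    unfolding choice_iff ..
  then have G: "finite (G k)" "G k \<subseteq> I"
      "\<And>F. finite F \<Longrightarrow> G k \<subseteq> F \<Longrightarrow> F \<subseteq> I \<Longrightarrow> norm_L2 M (\<lambda>x. S F x - S (G k) x) \<le> (1/2)^k" for k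
    by auto
  define H where "H k = (\<Union>j\<le>k. G j)" for k
  have H: "finite (H k)" "H k \<subseteq> I" "\<And>j. j \<le> k \<Longrightarrow> G j \<subseteq> H k" for k
    using G(1,2) by (auto simp: H_def)
  have near: "norm_L2 M (\<lambda>x. S F x - S (H k) x) \<le> 2 * (1/2)^j"
    if F: "finite F" "H j \<subseteq> F" "F \<subseteq> I" "j \<le> k" for F k j
  proof -
    have "G j \<subseteq> F" "G j \<subseteq> H k" using H(3)[of j j] H(3)[of j k] F by auto
    then have "norm_L2 M (\<lambda>x. S F x - S (G j) x) \<le> (1/2)^j" "norm_L2 M (\<lambda>x. S (H k) x - S (G j) x) \<le> (1/2)^j"
      using G(3)[of F j] G(3)[of "H k" j] F H by auto
    then show ?thesis
      using norm_L2_diff_triangle[OF SL[OF F(3)] SL[OF G(2)[of j]] SL[OF H(2)[of k]]]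
        norm_L2_minus_commute[of M "S (G j)" "S (H k)"] by linarith
  qed
  have small: "\<exists>j. 2 * (1/2)^j \<le> e" if "0 < e" for e :: real
  proof -
    obtain j where "(1/2)^j < e/2" using real_arch_pow_inv[of "e/2" "1/2"] \<open>0 < e\<close> by auto
    then show ?thesis by (intro exI[of _ j]) simp
  qed
  have "\<exists>f\<in>L2 M. (\<lambda>n. norm_L2 M (\<lambda>x. S (H n) x - f x)) \<longlonglongrightarrow> 0"
  proof (rule L2_complete[OF SL[OF H(2)]])
    fix e :: real assume "0 < e"
    then obtain j where j: "2 * (1/2)^j \<le> e" using small by blast
    have "H j \<subseteq> H m" if "j \<le> m" for m using that by (force simp: H_def)
    then have "norm_L2 M (\<lambda>x. S (H m) x - S (H n) x) \<le> e" if "m \<ge> j" "n \<ge> j" for m n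
      using near[of "H m" j n] H that j by force
    then show "\<exists>N. \<forall>m\<ge>N. \<forall>n\<ge>N. norm_L2 M (\<lambda>x. S (H m) x - S (H n) x) \<le> e" by blast
  qed
  then obtain f where f: "f \<in> L2 M" "(\<lambda>n. norm_L2 M (\<lambda>x. S (H n) x - f x)) \<longlonglongrightarrow> 0" by blast
  have lim: "((\<lambda>F. norm_L2 M (\<lambda>x. S F x - f x)) \<longlongrightarrow> 0) (finite_subsets_at_top I)"
  proof (rule tendstoI)
    fix e :: real assume e: "0 < e"
    obtain j where j: "2 * (1/2)^j \<le> e/2" using small[of "e/2"] e by auto
    obtain N where N: "\<And>n. n \<ge> N \<Longrightarrow> norm_L2 M (\<lambda>x. S (H n) x - f x) < e/2"
      using LIMSEQ_D[OF f(2), of "e/2"] e by auto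
    have "norm_L2 M (\<lambda>x. S F x - f x) < e" if F: "finite F" "H j \<subseteq> F" "F \<subseteq> I" for F
      using norm_L2_diff_triangle[OF SL[OF F(3)] SL[OF H(2)[of "max j N"]] f(1)]
        near[OF F, of "max j N"] N[of "max j N"] j by simp
    then show "\<forall>\<^sub>F F in finite_subsets_at_top I. dist (norm_L2 M (\<lambda>x. S F x - f x)) 0 < e"
      unfolding eventually_finite_subsets_at_top using H[of j] by (intro exI[of _ "H j"]) auto
  qed
  have "((\<lambda>F. norm_L2 M (S F)) \<longlongrightarrow> norm_L2 M f) (finite_subsets_at_top I)"
  proof (rule Lim_transform2[OF tendsto_const], rule tendsto_0_le[OF lim, where K=1])
    show "\<forall>\<^sub>F F in finite_subsets_at_top I. norm (norm_L2 M f - norm_L2 M (S F)) \<le> norm (norm_L2 M (\<lambda>x. S F x - f x)) * 1"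
      by (rule eventually_finite_subsets_at_top_weakI)
         (use norm_L2_triangle_diff[OF SL f(1)] in \<open>auto simp: abs_minus_commute\<close>)
  qed
  then have "((\<lambda>F. (norm_L2 M (S F))\<^sup>2) \<longlongrightarrow> (norm_L2 M f)\<^sup>2) (finite_subsets_at_top I)"
    by (intro tendsto_intros)
  moreover have "\<forall>\<^sub>F F in finite_subsets_at_top I. (norm_L2 M (S F))\<^sup>2 = (\<Sum>i\<in>F. (cmod (a i))\<^sup>2)"
    by (rule eventually_finite_subsets_at_top_weakI) (rule nS)
  ultimately have "(sum (\<lambda>i. (cmod (a i))\<^sup>2) \<longlongrightarrow> (norm_L2 M f)\<^sup>2) (finite_subsets_at_top I)"
    by (rule Lim_transform_eventually)
  from tendsto_unique[OF finite_subsets_at_top_neq_bot this conv] have "(norm_L2 M f)\<^sup>2 = q" .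
  moreover have "has_L2_sum M I v a f" using f(1) lim by (simp add: has_L2_sum_def S_def)
  ultimately show ?thesis unfolding q_def by blast
qed

lemma has_L2_sum_norm_unique:
  assumes v: "\<And>i. i \<in> I \<Longrightarrow> v i \<in> L2 M" and f: "has_L2_sum M I v a f" "has_L2_sum M I v a g"
  shows "norm_L2 M f = norm_L2 M g"
proof -
  have fg: "f \<in> L2 M" "g \<in> L2 M" using f by (auto simp: has_L2_sum_def)
  let ?s = "\<lambda>F x. \<Sum>i\<in>F. a i * v i x"
  have "((\<lambda>F. norm_L2 M (\<lambda>x. ?s F x - f x) + norm_L2 M (\<lambda>x. ?s F x - g x)) \<longlongrightarrow> 0 + 0) (finite_subsets_at_top I)"
    using f unfolding has_L2_sum_def by (intro tendsto_add) auto
  moreover have "\<forall>\<^sub>F F in finite_subsets_at_top I. norm_L2 M (\<lambda>x. f x - g x) \<le> norm_L2 M (\<lambda>x. ?s F x - f x) + norm_L2 M (\<lambda>x. ?s F x - g x)"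
  proof (rule eventually_finite_subsets_at_top_weakI)
    fix F assume "finite F" "F \<subseteq> I"
    then have "?s F \<in> L2 M" by (intro L2_sum L2_cmult v) auto
    from norm_L2_diff_triangle[OF fg(1) this fg(2)]
    show "norm_L2 M (\<lambda>x. f x - g x) \<le> norm_L2 M (\<lambda>x. ?s F x - f x) + norm_L2 M (\<lambda>x. ?s F x - g x)"
      by (simp add: norm_L2_minus_commute)
  qed
  ultimately have "norm_L2 M (\<lambda>x. f x - g x) \<le> 0 + 0"
    by (intro tendsto_lowerbound[OF _ _ finite_subsets_at_top_neq_bot])
  then show ?thesis using norm_L2_triangle_diff[OF fg] by simp
qed

lemma has_L2_sum_finite_norm:
  assumes v: "\<And>i. i \<in> I \<Longrightarrow> v i \<in> L2 M" and F: "finite F" "F \<subseteq> I" and f: "has_L2_sum M I v a f"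
    and a: "\<And>i. i \<in> I - F \<Longrightarrow> a i = 0"
  shows "norm_L2 M f = norm_L2 M (\<lambda>x. \<Sum>i\<in>F. a i * v i x)"
proof (rule has_L2_sum_norm_unique[OF v f])
  let ?s = "\<lambda>F x. \<Sum>i\<in>F. a i * v i x"
  have "?s F \<in> L2 M" using F by (intro L2_sum L2_cmult v) auto
  moreover have "((\<lambda>G. norm_L2 M (\<lambda>x. ?s G x - ?s F x)) \<longlongrightarrow> 0) (finite_subsets_at_top I)"
  proof (rule tendsto_eventually)
    have "norm_L2 M (\<lambda>x. ?s G x - ?s F x) = 0" if G: "finite G" "F \<subseteq> G" "G \<subseteq> I" for G
    proof -
      have "?s G x = ?s F x" for x by (rule sum.mono_neutral_right) (use G a in auto)
      then show ?thesis by simp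
    qed
    then show "\<forall>\<^sub>F G in finite_subsets_at_top I. norm_L2 M (\<lambda>x. ?s G x - ?s F x) = 0"
      unfolding eventually_finite_subsets_at_top using F by blast
  qed
  ultimately show "has_L2_sum M I v a (?s F)" by (simp add: has_L2_sum_def)
qed simp

text \<open>The norm of the sum is determined by the coefficients, so the defining inequalities are
closed conditions on \<open>A\<close> and \<open>B\<close> that pass to the supremum of the lower
and to the infimum of the upper constants.  A coefficient sequence with a single nonzero entry at
\<open>i0\<close> shows that this supremum is finite and this infimum positive; over an empty index
set all positive constants would be admissible.\<close>

lemma riesz_basis_optimal_constants:
  assumes rb: "riesz_basis M I v" and i0: "i0 \<in> I"
  shows "riesz_constants M I v (lower_riesz_bound M I v) (upper_riesz_bound M I v)"
proof -
  have v: "\<And>i. i \<in> I \<Longrightarrow> v i \<in> L2 M" using rb by (auto simp: riesz_basis_def)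
  obtain A0 B0 where R0: "riesz_constants M I v A0 B0" using rb by (auto simp: riesz_basis_def)
  define q where "q a = (\<Sum>\<^sub>\<infinity>i\<in>I. (cmod (a i))\<^sup>2)" for a :: "_ \<Rightarrow> complex"
  define s where "s a \<longleftrightarrow> (\<lambda>i. (cmod (a i))\<^sup>2) summable_on I" for a :: "_ \<Rightarrow> complex"
  define f where "f a = (SOME f. has_L2_sum M I v a f)" for a
  define n where "n a = (norm_L2 M (f a))\<^sup>2" for a
  have f: "has_L2_sum M I v a (f a)" if "s a" for a
    using R0 that unfolding f_def riesz_constants_def s_def by (metis someI_ex)
  have iff: "riesz_constants M I v A B \<longleftrightarrow> 0 < A \<and> 0 < B \<and> (\<forall>a. s a \<longrightarrow> A * q a \<le> n a \<and> n a \<le> B * q a)" for A B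
  proof
    assume R: "riesz_constants M I v A B"
    have "A * q a \<le> n a \<and> n a \<le> B * q a" if a: "s a" for a
    proof -
      obtain g where g: "has_L2_sum M I v a g" "A * q a \<le> (norm_L2 M g)\<^sup>2" "(norm_L2 M g)\<^sup>2 \<le> B * q a"
        using R a unfolding riesz_constants_def s_def q_def by blast
      then show ?thesis using has_L2_sum_norm_unique[OF v g(1) f[OF a]] by (simp add: n_def)
    qed
    then show "0 < A \<and> 0 < B \<and> (\<forall>a. s a \<longrightarrow> A * q a \<le> n a \<and> n a \<le> B * q a)"
      using R by (auto simp: riesz_constants_def)
  next
    assume "0 < A \<and> 0 < B \<and> (\<forall>a. s a \<longrightarrow> A * q a \<le> n a \<and> n a \<le> B * q a)"
    then show "riesz_constants M I v A B"
      unfolding riesz_constants_def using f unfolding s_def q_def n_def by blast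
  qed
  define a0 :: "_ \<Rightarrow> complex" where "a0 i = (if i = i0 then 1 else 0)" for i
  have "((\<lambda>i. (cmod (a0 i))\<^sup>2) has_sum 1) {i0}"
    using has_sum_finite[of "{i0}" "\<lambda>i. (cmod (a0 i))\<^sup>2"] by (simp add: a0_def)
  then have hs: "((\<lambda>i. (cmod (a0 i))\<^sup>2) has_sum 1) I"
    by (subst has_sum_cong_neutral[where T="{i0}" and g="\<lambda>i. (cmod (a0 i))\<^sup>2"]) (use i0 in \<open>auto simp: a0_def\<close>)
  have sa0: "s a0" and qa0: "q a0 = 1"
    using hs unfolding s_def q_def by (auto simp: summable_on_def infsumI)
  have q0: "0 \<le> q a" and n0: "0 \<le> n a" for a unfolding q_def n_def by (auto intro: infsum_nonneg)
  define SA where "SA = {A. \<exists>B. riesz_constants M I v A B}"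
  define SB where "SB = {B. \<exists>A. riesz_constants M I v A B}"
  have bA: "A \<le> n a0" if "A \<in> SA" for A using that sa0 qa0 unfolding SA_def iff by force
  have bB: "n a0 \<le> B" if "B \<in> SB" for B using that sa0 qa0 unfolding SB_def iff by force
  have A0: "A0 \<in> SA" and B0: "B0 \<in> SB" using R0 by (auto simp: SA_def SB_def)
  have A0p: "0 < A0" using R0 by (simp add: riesz_constants_def)
  have bdd: "bdd_above SA" "bdd_below SB" 
    unfolding bdd_above_def bdd_below_def using bA bB by blast+
  have SupA: "0 < Sup SA" using cSup_upper[OF A0 bdd(1)] A0p by linarith
  have InfB: "0 < Inf SB"
    using cInf_greatest[of SB "n a0"] bB B0 bA[OF A0] A0p by fastforce
  have opt: "riesz_constants M I v (Sup SA) (Inf SB)"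
    unfolding iff
  proof (intro conjI allI impI SupA InfB)
    fix a assume a: "s a"
    show "Sup SA * q a \<le> n a"
    proof (cases "q a = 0")
      case False
      then have qp: "0 < q a" using q0[of a] by linarith
      have "Sup SA \<le> n a / q a"
        by (rule cSup_least) (use A0 a qp in \<open>auto simp: SA_def iff pos_le_divide_eq\<close>)
      then show ?thesis using qp by (simp add: pos_le_divide_eq)
    qed (use n0 in simp)
    show "n a \<le> Inf SB * q a"
    proof (cases "q a = 0")
      case True
      have "n a \<le> B0 * q a" using R0 a by (simp add: iff)
      then show ?thesis using True by simp
    next
      case False
      then have qp: "0 < q a" using q0[of a] by linarith
      have "n a / q a \<le> Inf SB"
        by (rule cInf_greatest) (use B0 a qp in \<open>auto simp: SB_def iff pos_divide_le_eq\<close>)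
      then show ?thesis using qp by (simp add: pos_divide_le_eq)
    qed
  qed
  have "lower_riesz_bound M I v = Sup SA"
    unfolding lower_riesz_bound_def
    by (rule Greatest_equality) (use opt bdd in \<open>auto simp: SA_def intro: cSup_upper\<close>)
  moreover have "upper_riesz_bound M I v = Inf SB"
    unfolding upper_riesz_bound_def
    by (rule Least_equality) (use opt bdd in \<open>auto simp: SB_def intro: cInf_lower\<close>)
  ultimately show ?thesis using opt by simp
qed

section \<open>Superpositions with an integrable kernel\<close>

lemma superposition_Fubini:
  fixes k :: "real \<Rightarrow> real"
  assumes M: "sigma_finite_measure M" and k: "integrable lborel k"
    and w[measurable]: "(\<lambda>(s, z). w s z) \<in> borel_measurable (lborel \<Otimes>\<^sub>M M)"
    and h[measurable]: "h \<in> borel_measurable M"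
    and b[measurable]: "b \<in> borel_measurable M" "integrable M (\<lambda>z. (b z)\<^sup>2)"
    and bd: "\<And>s z. z \<in> space M \<Longrightarrow> cmod (w s z) \<le> b z" "\<And>z. z \<in> space M \<Longrightarrow> cmod (h z) \<le> C * b z"
  shows "(LINT z|M. (LINT s|lborel. of_real (k s) * w s z) * cnj (h z))
       = (LINT s|lborel. of_real (k s) * (LINT z|M. w s z * cnj (h z)))"
proof -
  interpret M: sigma_finite_measure M by (rule M)
  interpret P: pair_sigma_finite lborel M ..
  have [measurable]: "k \<in> borel_measurable lborel" using k by auto
  have wl[measurable]: "(\<lambda>z. w s z) \<in> borel_measurable M" for s
    using measurable_Pair2[OF w, of s] by simp
  have int1: "integrable M (\<lambda>z. w s z * cnj (h z))" for s
  proof (rule Bochner_Integration.integrable_bound[where f="\<lambda>z. C * (b z)\<^sup>2"])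
    show "AE z in M. norm (w s z * cnj (h z)) \<le> norm (C * (b z)\<^sup>2)"
    proof (rule AE_I2)
      fix z assume z: "z \<in> space M"
      have "cmod (w s z) * cmod (h z) \<le> b z * (C * b z)"
        by (intro mult_mono bd z) (use bd(1)[OF z, of s] norm_ge_zero[of "w s z"] in linarith, simp)
      then show "norm (w s z * cnj (h z)) \<le> norm (C * (b z)\<^sup>2)"
        by (simp add: norm_mult power2_eq_square ac_simps)
    qed
  qed (use b in auto)
  have nb: "(LINT z|M. cmod (w s z * cnj (h z))) \<le> C * (LINT z|M. (b z)\<^sup>2)" for s
  proof -
    have "(LINT z|M. cmod (w s z * cnj (h z))) \<le> (LINT z|M. C * (b z)\<^sup>2)"
    proof (rule integral_mono)
      fix z assume z: "z \<in> space M"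
      have "cmod (w s z) * cmod (h z) \<le> b z * (C * b z)"
        by (intro mult_mono bd z) (use bd(1)[OF z, of s] norm_ge_zero[of "w s z"] in linarith, simp)
      then show "cmod (w s z * cnj (h z)) \<le> C * (b z)\<^sup>2"
        by (simp add: norm_mult power2_eq_square ac_simps)
    qed (use b int1 in auto)
    then show ?thesis by simp
  qed
  have int: "integrable (lborel \<Otimes>\<^sub>M M) (\<lambda>(s, z). of_real (k s) * (w s z * cnj (h z)))"
  proof (rule P.Fubini_integrable)
    show "integrable lborel (\<lambda>s. LINT z|M. norm (case (s, z) of (s, z) \<Rightarrow> of_real (k s) * (w s z * cnj (h z))))"
    proof (rule Bochner_Integration.integrable_bound[where f="\<lambda>s. k s * (C * (LINT z|M. (b z)\<^sup>2))"])
      show "AE s in lborel. norm (LINT z|M. norm (case (s, z) of (s, z) \<Rightarrow> of_real (k s) * (w s z * cnj (h z))))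
          \<le> norm (k s * (C * (LINT z|M. (b z)\<^sup>2)))"
      proof (rule AE_I2)
        fix s
        have "(LINT z|M. cmod (of_real (k s) * (w s z * cnj (h z)))) = \<bar>k s\<bar> * (LINT z|M. cmod (w s z * cnj (h z)))"
          by (simp only: norm_mult[of "of_real (k s)"] norm_of_real integral_mult_right_zero)
        also have "\<dots> \<le> \<bar>k s\<bar> * (C * (LINT z|M. (b z)\<^sup>2))" by (intro mult_left_mono nb) simp
        also have "\<dots> \<le> norm (k s * (C * (LINT z|M. (b z)\<^sup>2)))"
          by (simp only: real_norm_def abs_mult[of "k s"]) (intro mult_left_mono abs_ge_self abs_ge_zero)
        finally show "norm (LINT z|M. norm (case (s, z) of (s, z) \<Rightarrow> of_real (k s) * (w s z * cnj (h z))))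
          \<le> norm (k s * (C * (LINT z|M. (b z)\<^sup>2)))"
          by simp
      qed
    qed (use k in auto)
    show "AE s in lborel. integrable M (\<lambda>z. case (s, z) of (s, z) \<Rightarrow> of_real (k s) * (w s z * cnj (h z)))"
      using int1 by auto
  qed measurable
  have "(LINT z|M. (LINT s|lborel. of_real (k s) * w s z) * cnj (h z))
     = (LINT z|M. LINT s|lborel. of_real (k s) * (w s z * cnj (h z)))"
    by (simp add: mult.assoc[symmetric])
  also have "\<dots> = (LINT s|lborel. LINT z|M. of_real (k s) * (w s z * cnj (h z)))"
    using P.Fubini_integral[OF int] by simp
  finally show ?thesis by simp
qed

definition superposition :: "(real \<Rightarrow> real) \<Rightarrow> (real \<Rightarrow> 'a \<Rightarrow> complex) \<Rightarrow> 'a \<Rightarrow> complex" where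
  "superposition k w z = (LINT s|lborel. of_real (k s) * w s z)"

text \<open>Expanding the square expresses the norm through the inner products of the functions
\<open>w s\<close> alone.  Hence two families with the same Gram matrix, possibly on different
spaces, leave remainders of the same norm.\<close>

lemma superposition_remainder_gram:
  fixes k :: "real \<Rightarrow> real"
  assumes M: "sigma_finite_measure M" and k: "integrable lborel k"
    and w[measurable]: "(\<lambda>(s, z). w s z) \<in> borel_measurable (lborel \<Otimes>\<^sub>M M)"
    and b[measurable]: "b \<in> borel_measurable M" "integrable M (\<lambda>z. (b z)\<^sup>2)"
    and bd: "\<And>s z. z \<in> space M \<Longrightarrow> cmod (w s z) \<le> b z"
  shows "(\<lambda>z. w 0 z - superposition k w z) \<in> L2 M"
    and "complex_of_real ((norm_L2 M (\<lambda>z. w 0 z - superposition k w z))\<^sup>2)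
      = inner_L2 M (w 0) (w 0) - (LINT s|lborel. of_real (k s) * inner_L2 M (w s) (w 0))
        - cnj (LINT s|lborel. of_real (k s) * inner_L2 M (w s) (w 0))
        + (LINT s|lborel. of_real (k s) * cnj (LINT t|lborel. of_real (k t) * inner_L2 M (w t) (w s)))"
proof -
  interpret M: sigma_finite_measure M by (rule M)
  interpret P: pair_sigma_finite lborel M ..
  have [measurable]: "k \<in> borel_measurable lborel" using k by auto
  have wl[measurable]: "(\<lambda>z. w s z) \<in> borel_measurable M" for s
    using measurable_Pair2[OF w, of s] by simp
  have wl': "w s \<in> borel_measurable M" for s using wl[of s] by simp
  let ?P = "superposition k w"
  have Pm[measurable]: "?P \<in> borel_measurable M"
  proof -
    have "(\<lambda>z. LINT s|lborel. of_real (k s) * w s z) \<in> borel_measurable M" by measurable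
    then show ?thesis by (simp add: superposition_def[abs_def])
  qed
  have b0: "0 \<le> b z" if "z \<in> space M" for z using bd[OF that, of 0] norm_ge_zero[of "w 0 z"] by linarith
  have Pb: "cmod (?P z) \<le> (LINT s|lborel. \<bar>k s\<bar>) * b z" if z: "z \<in> space M" for z
  proof -
    have wz: "(\<lambda>s. w s z) \<in> borel_measurable lborel" using measurable_Pair1[OF w z] by simp
    have "cmod (?P z) \<le> (LINT s|lborel. cmod (of_real (k s) * w s z))"
      unfolding superposition_def by (rule integral_norm_bound)
    also have "\<dots> \<le> (LINT s|lborel. \<bar>k s\<bar> * b z)"
    proof (rule integral_mono)
      show "integrable lborel (\<lambda>s. \<bar>k s\<bar> * b z)" using k by auto
      then show "integrable lborel (\<lambda>s. cmod (of_real (k s) * w s z))"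
        by (rule Bochner_Integration.integrable_bound)
           (use wz bd[OF z] b0[OF z] in \<open>auto simp: norm_mult abs_mult intro!: mult_left_mono\<close>)
      show "cmod (of_real (k s) * w s z) \<le> \<bar>k s\<bar> * b z" for s
        using bd[OF z, of s] by (simp add: norm_mult mult_left_mono)
    qed
    finally show ?thesis by simp
  qed
  have bL: "(\<lambda>z. complex_of_real (b z)) \<in> L2 M" using b by (simp add: L2_def)
  have wL: "w s \<in> L2 M" for s
    by (rule L2_dominated[OF wl' bL, where c=1]) (use bd b0 in auto)
  have PL: "?P \<in> L2 M"
    by (rule L2_dominated[OF Pm bL]) (use Pb b0 in auto)
  show DL: "(\<lambda>z. w 0 z - superposition k w z) \<in> L2 M" by (rule L2_diff[OF wL PL])
  have ip: "inner_L2 M ?P (w s) = (LINT t|lborel. of_real (k t) * inner_L2 M (w t) (w s))" for s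
    unfolding inner_L2_def superposition_def
    by (rule superposition_Fubini[OF M k w wl' b, where C=1]) (use bd in auto)
  have ip': "inner_L2 M (w s) ?P = cnj (LINT t|lborel. of_real (k t) * inner_L2 M (w t) (w s))" for s
    unfolding ip[symmetric] by (rule inner_L2_commute)
  have PP: "inner_L2 M ?P ?P = (LINT s|lborel. of_real (k s) * inner_L2 M (w s) ?P)"
    using superposition_Fubini[OF M k w Pm b bd Pb] unfolding inner_L2_def superposition_def by simp
  have "complex_of_real ((norm_L2 M (\<lambda>z. w 0 z - ?P z))\<^sup>2) = inner_L2 M (\<lambda>z. w 0 z - ?P z) (\<lambda>z. w 0 z - ?P z)"
    by (rule inner_L2_self[symmetric])
  also have "\<dots> = (LINT z|M. w 0 z * cnj (w 0 z) - ?P z * cnj (w 0 z) - w 0 z * cnj (?P z) + ?P z * cnj (?P z))"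
    unfolding inner_L2_def by (rule Bochner_Integration.integral_cong) (simp_all add: algebra_simps)
  also have "\<dots> = inner_L2 M (w 0) (w 0) - inner_L2 M ?P (w 0) - inner_L2 M (w 0) ?P + inner_L2 M ?P ?P"
    unfolding inner_L2_def
    using inner_L2_integrable[OF wL wL, of 0 0] inner_L2_integrable[OF PL wL, of 0]
      inner_L2_integrable[OF wL PL, of 0] inner_L2_integrable[OF PL PL] by simp
  also have "inner_L2 M (w 0) ?P = cnj (inner_L2 M ?P (w 0))" by (rule inner_L2_commute)
  finally show "complex_of_real ((norm_L2 M (\<lambda>z. w 0 z - superposition k w z))\<^sup>2)
      = inner_L2 M (w 0) (w 0) - (LINT s|lborel. of_real (k s) * inner_L2 M (w s) (w 0))
        - cnj (LINT s|lborel. of_real (k s) * inner_L2 M (w s) (w 0))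
        + (LINT s|lborel. of_real (k s) * cnj (LINT t|lborel. of_real (k t) * inner_L2 M (w t) (w s)))"
    unfolding PP ip' ip .
qed

section \<open>Lattice translations, the unit cube and the torus\<close>

text \<open>The standard character of the real line, with period \<open>1\<close>.\<close>

definition ex :: "real \<Rightarrow> complex" where "ex t = cis (2 * pi * t)"

lemma ex_add: "ex (a + b) = ex a * ex b" by (simp add: ex_def cis_mult ring_distribs)
lemma ex_0[simp]: "ex 0 = 1" by (simp add: ex_def)
lemma ex_minus: "ex (- a) = cnj (ex a)" by (simp add: ex_def cis_cnj)
lemma ex_diff: "ex (a - b) = ex a * cnj (ex b)" using ex_add[of a "-b"] by (simp add: ex_minus)
lemma norm_ex[simp]: "cmod (ex a) = 1" by (simp add: ex_def)
lemma ex_of_int[simp]: "ex (of_int k) = 1"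
  by (simp add: ex_def complex_eq_iff)
lemma ex_mult_cnj[simp]: "ex a * cnj (ex a) = 1" "cnj (ex a) * ex a = 1"
  using ex_add[of a "-a"] by (simp_all add: ex_minus mult.commute)
lemma ex_nonzero[simp]: "ex a \<noteq> 0" by (simp add: ex_def)
lemma borel_measurable_ex[measurable]: "ex \<in> borel_measurable borel"
proof -
  have "continuous_on UNIV ex" unfolding ex_def[abs_def] by (intro continuous_intros)
  then show ?thesis by (rule borel_measurable_continuous_onI)
qed
lemma ex_sum: "ex (\<Sum>i\<in>I. f i) = (\<Prod>i\<in>I. ex (f i))"
  by (induction I rule: infinite_finite_induct) (auto simp: ex_add)

definition rvec :: "(nat \<Rightarrow> int) \<Rightarrow> nat \<Rightarrow> real" where "rvec m = (\<lambda>i. of_int (m i))"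

definition dot :: "nat \<Rightarrow> (nat \<Rightarrow> real) \<Rightarrow> (nat \<Rightarrow> real) \<Rightarrow> real" where
  "dot d a x = (\<Sum>i<d. a i * x i)"

text \<open>The restriction keeps the values in the space of extensional functions.\<close>

definition shift :: "nat \<Rightarrow> (nat \<Rightarrow> real) \<Rightarrow> (nat \<Rightarrow> real) \<Rightarrow> nat \<Rightarrow> real" where
  "shift d v x = (\<lambda>i\<in>{..<d}. x i - v i)"

text \<open>Half open, so that its lattice translates partition the space.\<close>

definition cube :: "nat \<Rightarrow> (nat \<Rightarrow> real) set" where
  "cube d = (\<Pi>\<^sub>E i\<in>{..<d}. {0..<1})"

definition cube_measure :: "nat \<Rightarrow> (nat \<Rightarrow> real) measure" where
  "cube_measure d = density (Rd d) (indicator (cube d))"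

lemma space_Rd: "space (Rd d) = (\<Pi>\<^sub>E i\<in>{..<d}. UNIV)"
  by (simp add: Rd_def space_PiM)

interpretation lborel_product: product_sigma_finite "\<lambda>_::nat. lborel :: real measure" ..

lemma sigma_finite_Rd: "sigma_finite_measure (Rd d)"
proof -
  interpret finite_product_sigma_finite "\<lambda>_::nat. lborel :: real measure" "{..<d}" by standard simp
  show ?thesis unfolding Rd_def by (rule sigma_finite_measure_axioms)
qed

lemma measurable_Rd_component:
  assumes "f \<in> N \<rightarrow>\<^sub>M Rd d" "i < d" shows "(\<lambda>x. f x i) \<in> borel_measurable N"
  using measurable_compose[OF assms(1)[unfolded Rd_def], OF measurable_component_singleton, of i] assms(2)
  by simp

lemma measurable_Rd_restrict:
  assumes "\<And>i. i < d \<Longrightarrow> (\<lambda>x. f x i) \<in> borel_measurable N"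
  shows "(\<lambda>x. \<lambda>i\<in>{..<d}. f x i) \<in> N \<rightarrow>\<^sub>M Rd d"
  unfolding Rd_def by (rule measurable_restrict) (use assms in simp)

lemma shift_measurable[measurable]: "shift d v \<in> Rd d \<rightarrow>\<^sub>M Rd d"
  unfolding shift_def[abs_def]
  by (intro measurable_Rd_restrict borel_measurable_diff measurable_Rd_component[OF measurable_ident_sets[OF refl]]) auto

lemma shift_in_space[simp]: "shift d v x \<in> space (Rd d)"
  by (simp add: space_Rd shift_def)

lemma dot_measurable[measurable (raw)]:
  assumes "f \<in> N \<rightarrow>\<^sub>M Rd d" shows "(\<lambda>z. dot d a (f z)) \<in> borel_measurable N"
  unfolding dot_def by (intro borel_measurable_sum borel_measurable_times measurable_Rd_component[OF assms]) auto

lemma dot_measurable2[measurable (raw)]: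
  assumes "f \<in> N \<rightarrow>\<^sub>M Rd d" shows "(\<lambda>z. dot d (f z) a) \<in> borel_measurable N"
  unfolding dot_def by (intro borel_measurable_sum borel_measurable_times measurable_Rd_component[OF assms]) auto

lemma cube_sets[measurable]: "cube d \<in> sets (Rd d)"
  unfolding cube_def Rd_def by (rule sets_PiM_I_finite) auto

lemma shift_shift: "shift d u (shift d v x) = shift d (\<lambda>i. u i + v i) x"
  by (auto simp: shift_def fun_eq_iff)

lemma shift_0: "x \<in> space (Rd d) \<Longrightarrow> shift d (\<lambda>_. 0) x = x"
  by (auto simp: shift_def space_Rd PiE_def extensional_def fun_eq_iff)

lemma shift_inverse: "x \<in> space (Rd d) \<Longrightarrow> shift d v (shift d (\<lambda>i. - v i) x) = x"
  "x \<in> space (Rd d) \<Longrightarrow> shift d (\<lambda>i. - v i) (shift d v x) = x"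
  by (auto simp: shift_shift shift_0)

lemma dot_shift: "dot d a (shift d v x) = dot d a x - dot d a v"
  by (simp add: dot_def shift_def right_diff_distrib sum_subtractf)

lemma dot_shift_left: "dot d (shift d v x) a = dot d x a - dot d v a"
  by (simp add: dot_def shift_def left_diff_distrib sum_subtractf)

lemma dot_commute: "dot d a b = dot d b a" by (simp add: dot_def mult.commute)

lemma ex_dot_int[simp]: "ex (dot d (rvec m) (rvec n)) = 1"
proof -
  have "dot d (rvec m) (rvec n) = of_int (\<Sum>i<d. m i * n i)" by (simp add: dot_def rvec_def)
  then show ?thesis by (simp only: ex_of_int)
qed

text \<open>It suffices to compare the two measures on boxes, where each coordinate is a translate
of Lebesgue measure on the line.\<close>

lemma Rd_shift_invariant: "distr (Rd d) (Rd d) (shift d v) = Rd d"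
proof -
  have "distr (Rd d) (Rd d) (shift d v) = PiM {..<d} (\<lambda>_. lborel)"
  proof (rule lborel_product.PiM_eqI)
    fix A :: "nat \<Rightarrow> real set" assume A: "\<And>i. i \<in> {..<d} \<Longrightarrow> A i \<in> sets lborel"
    have A': "Pi\<^sub>E {..<d} A \<in> sets (Rd d)" unfolding Rd_def by (rule sets_PiM_I_finite) (use A in auto)
    have eq: "shift d v -` Pi\<^sub>E {..<d} A \<inter> space (Rd d) = Pi\<^sub>E {..<d} (\<lambda>i. (\<lambda>t. - v i + t) -` A i)"
      by (auto simp: space_Rd shift_def PiE_def Pi_def extensional_def)
    have m: "(\<lambda>t. - v i + t) -` A i \<in> sets lborel" if "i < d" for i
    proof -
      have "(\<lambda>t. - v i + t) \<in> borel_measurable borel" by simp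
      from measurable_sets[OF this, of "A i"] A[of i] that show ?thesis by simp
    qed
    have "emeasure (distr (Rd d) (Rd d) (shift d v)) (Pi\<^sub>E {..<d} A) = emeasure (Rd d) (Pi\<^sub>E {..<d} (\<lambda>i. (\<lambda>t. - v i + t) -` A i))"
      by (subst emeasure_distr[OF shift_measurable A']) (simp only: eq)
    also have "\<dots> = (\<Prod>i<d. emeasure lborel ((\<lambda>t. - v i + t) -` A i))"
      unfolding Rd_def by (rule lborel_product.emeasure_PiM) (use m in auto)
    also have "\<dots> = (\<Prod>i<d. emeasure lborel (A i))"
    proof (rule prod.cong[OF refl])
      fix i assume i: "i \<in> {..<d}"
      have "emeasure lborel (A i) = emeasure (distr lborel borel (\<lambda>t. - v i + t)) (A i)"
        by (subst lborel_distr_plus) simp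
      also have "\<dots> = emeasure lborel ((\<lambda>t. - v i + t) -` A i)"
        by (subst emeasure_distr) (use A i in auto)
      finally show "emeasure lborel ((\<lambda>t. - v i + t) -` A i) = emeasure lborel (A i)" by simp
    qed
    finally show "emeasure (distr (Rd d) (Rd d) (shift d v)) (Pi\<^sub>E {..<d} A) = (\<Prod>i\<in>{..<d}. emeasure lborel (A i))" .
  qed (simp_all add: Rd_def)
  then show ?thesis by (simp add: Rd_def)
qed

lemma nn_integral_Rd_shift:
  assumes "f \<in> borel_measurable (Rd d)"
  shows "(\<integral>\<^sup>+x. f (shift d v x) \<partial>Rd d) = (\<integral>\<^sup>+x. f x \<partial>Rd d)"
  using nn_integral_distr[OF shift_measurable, of f d v] assms by (simp add: Rd_shift_invariant)

lemma integral_Rd_shift: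
  fixes f :: "_ \<Rightarrow> complex"
  assumes "f \<in> borel_measurable (Rd d)"
  shows "(LINT x|Rd d. f (shift d v x)) = (LINT x|Rd d. f x)"
  using integral_distr[OF shift_measurable assms, of v] by (simp add: Rd_shift_invariant)

lemma sets_cube_measure[measurable_cong, simp]: "sets (cube_measure d) = sets (Rd d)"
  by (simp add: cube_measure_def)

lemma space_cube_measure[simp]: "space (cube_measure d) = space (Rd d)"
  by (simp add: cube_measure_def)

lemma borel_measurable_cube_measure[simp]: "borel_measurable (cube_measure d) = borel_measurable (Rd d)"
  by (rule measurable_cong_sets) auto

lemma nn_integral_cube_measure:
  "f \<in> borel_measurable (Rd d) \<Longrightarrow> (\<integral>\<^sup>+x. f x \<partial>cube_measure d) = (\<integral>\<^sup>+x. indicator (cube d) x * f x \<partial>Rd d)"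
  unfolding cube_measure_def by (rule nn_integral_density) auto

lemma emeasure_cube: "emeasure (Rd d) (cube d) = 1"
  unfolding cube_def Rd_def by (subst lborel_product.emeasure_PiM) auto

lemma prob_cube_measure: "emeasure (cube_measure d) (space (Rd d)) = 1"
  unfolding cube_measure_def
  by (subst emeasure_density) (auto simp: emeasure_cube cube_sets nn_integral_indicator
      cong: nn_integral_cong simp: mult.commute)

lemma finite_cube_measure: "finite_measure (cube_measure d)"
  by (rule finite_measureI) (simp add: prob_cube_measure)

lemma AE_cube_measure: "AE x in cube_measure d. x \<in> cube d"
  unfolding cube_measure_def by (subst AE_density) (auto simp: indicator_def)

lemma countable_Zd: "countable (Zd d)"
  unfolding Zd_def by (rule countable_PiE) auto

definition floor_vec :: "nat \<Rightarrow> (nat \<Rightarrow> real) \<Rightarrow> nat \<Rightarrow> int" where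
  "floor_vec d x = (\<lambda>i\<in>{..<d}. \<lfloor>x i\<rfloor>)"

lemma floor_vec_Zd[simp]: "floor_vec d x \<in> Zd d"
  by (simp add: floor_vec_def Zd_def)

lemma shift_cube_iff:
  assumes "m \<in> Zd d" "x \<in> space (Rd d)"
  shows "shift d (rvec m) x \<in> cube d \<longleftrightarrow> m = floor_vec d x"
proof -
  have "shift d (rvec m) x \<in> cube d \<longleftrightarrow> (\<forall>i<d. 0 \<le> x i - of_int (m i) \<and> x i - of_int (m i) < 1)"
    by (auto simp: shift_def cube_def rvec_def PiE_def Pi_def extensional_def)
  also have "\<dots> \<longleftrightarrow> (\<forall>i<d. \<lfloor>x i\<rfloor> = m i)" by (simp add: floor_eq_iff algebra_simps)
  also have "\<dots> \<longleftrightarrow> m = floor_vec d x"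
    using assms(1) by (auto simp: floor_vec_def Zd_def PiE_def extensional_def fun_eq_iff)
  finally show ?thesis .
qed

lemma cube_tiles:
  assumes "x \<in> space (Rd d)"
  shows "(\<integral>\<^sup>+m. indicator (cube d) (shift d (rvec m) x) \<partial>count_space (Zd d)) = (1::ennreal)"
proof -
  have "(\<integral>\<^sup>+m. indicator (cube d) (shift d (rvec m) x) \<partial>count_space (Zd d))
      = (\<Sum>m\<in>{floor_vec d x}. indicator (cube d) (shift d (rvec m) x))"
    by (rule nn_integral_count_space') (use assms in \<open>auto simp: shift_cube_iff\<close>)
  then show ?thesis using assms by (simp add: shift_cube_iff)
qed

text \<open>The integral splits over the lattice translates of the cube, and each piece is moved
back to the cube.\<close>

lemma nn_integral_Rd_tiling:
  assumes f[measurable]: "f \<in> borel_measurable (Rd d)"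
  shows "(\<integral>\<^sup>+x. f x \<partial>Rd d) = (\<integral>\<^sup>+x. (\<integral>\<^sup>+m. f (shift d (rvec (\<lambda>i. - m i)) x) \<partial>count_space (Zd d)) \<partial>cube_measure d)"
proof -
  have "(\<integral>\<^sup>+x. f x \<partial>Rd d) = (\<integral>\<^sup>+x. (\<integral>\<^sup>+m. indicator (cube d) (shift d (rvec m) x) * f x \<partial>count_space (Zd d)) \<partial>Rd d)"
    by (rule nn_integral_cong) (simp add: nn_integral_multc cube_tiles)
  also have "\<dots> = (\<integral>\<^sup>+m. (\<integral>\<^sup>+x. indicator (cube d) (shift d (rvec m) x) * f x \<partial>Rd d) \<partial>count_space (Zd d))"
    by (rule nn_integral_count_space_nn_integral[OF countable_Zd]) measurable
  also have "\<dots> = (\<integral>\<^sup>+m. (\<integral>\<^sup>+x. indicator (cube d) x * f (shift d (rvec (\<lambda>i. - m i)) x) \<partial>Rd d) \<partial>count_space (Zd d))"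
  proof (rule nn_integral_cong)
    fix m
    have "(\<integral>\<^sup>+x. indicator (cube d) (shift d (rvec m) x) * f x \<partial>Rd d)
        = (\<integral>\<^sup>+x. indicator (cube d) (shift d (rvec m) (shift d (rvec (\<lambda>i. - m i)) x)) * f (shift d (rvec (\<lambda>i. - m i)) x) \<partial>Rd d)"
      by (rule nn_integral_Rd_shift[symmetric]) measurable
    also have "\<dots> = (\<integral>\<^sup>+x. indicator (cube d) x * f (shift d (rvec (\<lambda>i. - m i)) x) \<partial>Rd d)"
      by (rule nn_integral_cong) (simp add: shift_shift rvec_def shift_0)
    finally show "(\<integral>\<^sup>+x. indicator (cube d) (shift d (rvec m) x) * f x \<partial>Rd d) = (\<integral>\<^sup>+x. indicator (cube d) x * f (shift d (rvec (\<lambda>i. - m i)) x) \<partial>Rd d)" .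
  qed
  also have "\<dots> = (\<integral>\<^sup>+x. (\<integral>\<^sup>+m. indicator (cube d) x * f (shift d (rvec (\<lambda>i. - m i)) x) \<partial>count_space (Zd d)) \<partial>Rd d)"
    by (rule nn_integral_count_space_nn_integral[OF countable_Zd, symmetric]) measurable
  also have "\<dots> = (\<integral>\<^sup>+x. indicator (cube d) x * (\<integral>\<^sup>+m. f (shift d (rvec (\<lambda>i. - m i)) x) \<partial>count_space (Zd d)) \<partial>Rd d)"
    by (rule nn_integral_cong) (rule nn_integral_cmult, simp)
  also have "\<dots> = (\<integral>\<^sup>+x. (\<integral>\<^sup>+m. f (shift d (rvec (\<lambda>i. - m i)) x) \<partial>count_space (Zd d)) \<partial>cube_measure d)"
  proof (rule nn_integral_cube_measure[symmetric])
    interpret sigma_finite_measure "count_space (Zd d)" by (rule sigma_finite_measure_count_space_countable[OF countable_Zd])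
    show "(\<lambda>x. \<integral>\<^sup>+m. f (shift d (rvec (\<lambda>i. - m i)) x) \<partial>count_space (Zd d)) \<in> borel_measurable (Rd d)"
    proof (rule borel_measurable_nn_integral)
      have "(\<lambda>p. f (shift d (rvec (\<lambda>i. - snd p i)) (fst p))) \<in> borel_measurable (Rd d \<Otimes>\<^sub>M count_space (Zd d))"
        by (rule measurable_compose_countable'[where f="\<lambda>m p. f (shift d (rvec (\<lambda>i. - m i)) (fst p))" and g=snd and I="Zd d"])
           (auto simp: countable_Zd)
      then show "(\<lambda>(x, m). f (shift d (rvec (\<lambda>i. - m i)) x)) \<in> borel_measurable (Rd d \<Otimes>\<^sub>M count_space (Zd d))"
        by (simp add: case_prod_beta')
    qed
  qed
  finally show ?thesis .
qed

lemma uminus_Zd: "m \<in> Zd d \<Longrightarrow> (\<lambda>i\<in>{..<d}. - m i) \<in> Zd d" by (simp add: Zd_def)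

lemma shift_cong: "(\<And>i. i < d \<Longrightarrow> u i = v i) \<Longrightarrow> shift d u x = shift d v x"
  by (auto simp: shift_def fun_eq_iff)

text \<open>Any translate of the unit cube is a fundamental domain of the lattice: the integral over
it is split along the tiling, and every point of the cube is counted once.\<close>

lemma nn_integral_cube_shift:
  assumes u[measurable]: "u \<in> borel_measurable (Rd d)"
    and per: "\<And>m x. m \<in> Zd d \<Longrightarrow> x \<in> space (Rd d) \<Longrightarrow> u (shift d (rvec m) x) = u x"
  shows "(\<integral>\<^sup>+x. u (shift d v x) \<partial>cube_measure d) = (\<integral>\<^sup>+x. u x \<partial>cube_measure d)"
proof -
  let ?w = "\<lambda>i. - v i"
  have per': "u (shift d (rvec (\<lambda>i. - m i)) x) = u x" if "m \<in> Zd d" "x \<in> space (Rd d)" for m x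
    using per[OF uminus_Zd[OF that(1)] that(2)] shift_cong[of d "rvec (\<lambda>i\<in>{..<d}. - m i)" "rvec (\<lambda>i. - m i)" x]
    by (simp add: rvec_def)
  have "(\<integral>\<^sup>+x. u (shift d v x) \<partial>cube_measure d) = (\<integral>\<^sup>+x. indicator (cube d) x * u (shift d v x) \<partial>Rd d)"
    by (rule nn_integral_cube_measure) measurable
  also have "\<dots> = (\<integral>\<^sup>+x. indicator (cube d) (shift d ?w x) * u (shift d v (shift d ?w x)) \<partial>Rd d)"
    by (rule nn_integral_Rd_shift[symmetric]) measurable
  also have "\<dots> = (\<integral>\<^sup>+x. indicator (cube d) (shift d ?w x) * u x \<partial>Rd d)"
    by (rule nn_integral_cong) (simp add: shift_inverse)
  also have "\<dots> = (\<integral>\<^sup>+x. (\<integral>\<^sup>+m. indicator (cube d) (shift d ?w (shift d (rvec (\<lambda>i. - m i)) x)) * u (shift d (rvec (\<lambda>i. - m i)) x) \<partial>count_space (Zd d)) \<partial>cube_measure d)"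
    by (rule nn_integral_Rd_tiling) measurable
  also have "\<dots> = (\<integral>\<^sup>+x. u x \<partial>cube_measure d)"
  proof (rule nn_integral_cong)
    fix x assume "x \<in> space (cube_measure d)"
    then have x: "x \<in> space (Rd d)" by simp
    have "(\<integral>\<^sup>+m. indicator (cube d) (shift d ?w (shift d (rvec (\<lambda>i. - m i)) x)) * u (shift d (rvec (\<lambda>i. - m i)) x) \<partial>count_space (Zd d))
       = (\<integral>\<^sup>+m. indicator (cube d) (shift d (rvec (\<lambda>i\<in>{..<d}. - m i)) (shift d ?w x)) * u x \<partial>count_space (Zd d))"
    proof (rule nn_integral_cong)
      fix m assume "m \<in> space (count_space (Zd d))"
      then have m: "m \<in> Zd d" by simp
      have "shift d ?w (shift d (rvec (\<lambda>i. - m i)) x) = shift d (rvec (\<lambda>i\<in>{..<d}. - m i)) (shift d ?w x)"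
        unfolding shift_shift by (rule shift_cong) (simp add: rvec_def)
      then show "indicator (cube d) (shift d ?w (shift d (rvec (\<lambda>i. - m i)) x)) * u (shift d (rvec (\<lambda>i. - m i)) x)
        = indicator (cube d) (shift d (rvec (\<lambda>i\<in>{..<d}. - m i)) (shift d ?w x)) * u x"
        by (simp add: per'[OF m x])
    qed
    also have "\<dots> = (\<integral>\<^sup>+m. indicator (cube d) (shift d (rvec (\<lambda>i\<in>{..<d}. - m i)) (shift d ?w x)) \<partial>count_space (Zd d)) * u x"
      by (rule nn_integral_multc) simp
    also have "(\<integral>\<^sup>+m. indicator (cube d) (shift d (rvec (\<lambda>i\<in>{..<d}. - m i)) (shift d ?w x)) \<partial>count_space (Zd d))
       = (\<integral>\<^sup>+m. indicator (cube d) (shift d (rvec m) (shift d ?w x)) \<partial>count_space (Zd d))"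
    proof (rule nn_integral_bij_count_space[where g="\<lambda>m. \<lambda>i\<in>{..<d}. - m i"])
      show "bij_betw (\<lambda>m. \<lambda>i\<in>{..<d}. - m i) (Zd d) (Zd d)"
      proof (rule bij_betw_byWitness[where f'="\<lambda>m. \<lambda>i\<in>{..<d}. - m i"])
        show "\<forall>m\<in>Zd d. (\<lambda>i\<in>{..<d}. - (\<lambda>i\<in>{..<d}. - m i) i) = m"
          by (auto simp: Zd_def PiE_def extensional_def fun_eq_iff)
        then show "\<forall>m\<in>Zd d. (\<lambda>i\<in>{..<d}. - (\<lambda>i\<in>{..<d}. - m i) i) = m" .
      qed (use uminus_Zd in auto)
    qed
    also have "\<dots> = 1" by (rule cube_tiles) simp
    finally show "(\<integral>\<^sup>+m. indicator (cube d) (shift d ?w (shift d (rvec (\<lambda>i. - m i)) x)) * u (shift d (rvec (\<lambda>i. - m i)) x) \<partial>count_space (Zd d)) = u x"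
      by simp
  qed
  finally show ?thesis .
qed

text \<open>A fundamental domain of the lattice in both variables.  Quasiperiodic functions are not
functions on the quotient, but their moduli are, and integrals of these do not change under
translations.\<close>

definition torus :: "nat \<Rightarrow> ((nat \<Rightarrow> real) \<times> (nat \<Rightarrow> real)) measure" where
  "torus d = cube_measure d \<Otimes>\<^sub>M cube_measure d"

lemma sets_torus[measurable_cong, simp]: "sets (torus d) = sets (Rd d \<Otimes>\<^sub>M Rd d)"
  unfolding torus_def by (rule sets_pair_measure_cong) auto

lemma space_torus: "space (torus d) = space (Rd d) \<times> space (Rd d)"
  by (simp add: torus_def space_pair_measure)

lemma borel_measurable_torus[simp]: "borel_measurable (torus d) = borel_measurable (Rd d \<Otimes>\<^sub>M Rd d)"
  by (rule measurable_cong_sets) auto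

lemma sigma_finite_cube_measure: "sigma_finite_measure (cube_measure d)"
  using finite_cube_measure[of d] by (rule finite_measure.axioms)

lemma nn_integral_torus:
  assumes f: "f \<in> borel_measurable (Rd d \<Otimes>\<^sub>M Rd d)"
  shows "(\<integral>\<^sup>+z. f z \<partial>torus d) = (\<integral>\<^sup>+x. (\<integral>\<^sup>+y. f (x, y) \<partial>cube_measure d) \<partial>cube_measure d)"
    and "(\<integral>\<^sup>+z. f z \<partial>torus d) = (\<integral>\<^sup>+y. (\<integral>\<^sup>+x. f (x, y) \<partial>cube_measure d) \<partial>cube_measure d)"
proof -
  interpret Q: sigma_finite_measure "cube_measure d" by (rule sigma_finite_cube_measure)
  interpret P: pair_sigma_finite "cube_measure d" "cube_measure d" ..
  have f': "f \<in> borel_measurable (cube_measure d \<Otimes>\<^sub>M cube_measure d)"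
    using f borel_measurable_torus[of d] unfolding torus_def by simp
  show "(\<integral>\<^sup>+z. f z \<partial>torus d) = (\<integral>\<^sup>+x. (\<integral>\<^sup>+y. f (x, y) \<partial>cube_measure d) \<partial>cube_measure d)"
    unfolding torus_def by (rule Q.nn_integral_fst[OF f', symmetric])
  show "(\<integral>\<^sup>+z. f z \<partial>torus d) = (\<integral>\<^sup>+y. (\<integral>\<^sup>+x. f (x, y) \<partial>cube_measure d) \<partial>cube_measure d)"
    unfolding torus_def using P.nn_integral_snd[OF f'] by simp
qed

lemma nn_integral_torus_shift:
  assumes U[measurable]: "U \<in> borel_measurable (Rd d \<Otimes>\<^sub>M Rd d)"
    and per: "\<And>m x y. m \<in> Zd d \<Longrightarrow> x \<in> space (Rd d) \<Longrightarrow> y \<in> space (Rd d) \<Longrightarrow> U (shift d (rvec m) x, y) = U (x, y)"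
      "\<And>m x y. m \<in> Zd d \<Longrightarrow> x \<in> space (Rd d) \<Longrightarrow> y \<in> space (Rd d) \<Longrightarrow> U (x, shift d (rvec m) y) = U (x, y)"
  shows "(\<integral>\<^sup>+z. U (shift d u (fst z), shift d v (snd z)) \<partial>torus d) = (\<integral>\<^sup>+z. U z \<partial>torus d)"
proof -
  have U1: "(\<lambda>z. U (shift d u (fst z), shift d v (snd z))) \<in> borel_measurable (Rd d \<Otimes>\<^sub>M Rd d)" by measurable
  have U2: "(\<lambda>z. U (shift d u (fst z), snd z)) \<in> borel_measurable (Rd d \<Otimes>\<^sub>M Rd d)" by measurable
  have "(\<integral>\<^sup>+z. U (shift d u (fst z), shift d v (snd z)) \<partial>torus d)
     = (\<integral>\<^sup>+x. (\<integral>\<^sup>+y. U (shift d u x, shift d v y) \<partial>cube_measure d) \<partial>cube_measure d)"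
    unfolding nn_integral_torus(1)[OF U1] by simp
  also have "\<dots> = (\<integral>\<^sup>+x. (\<integral>\<^sup>+y. U (shift d u x, y) \<partial>cube_measure d) \<partial>cube_measure d)"
    by (intro nn_integral_cong nn_integral_cube_shift) (auto simp: per)
  also have "\<dots> = (\<integral>\<^sup>+y. (\<integral>\<^sup>+x. U (shift d u x, y) \<partial>cube_measure d) \<partial>cube_measure d)"
    using nn_integral_torus[OF U2] by simp
  also have "\<dots> = (\<integral>\<^sup>+y. (\<integral>\<^sup>+x. U (x, y) \<partial>cube_measure d) \<partial>cube_measure d)"
    by (rule nn_integral_cong, rule nn_integral_cube_shift) (auto simp: per)
  also have "\<dots> = (\<integral>\<^sup>+z. U z \<partial>torus d)" using nn_integral_torus(2)[OF U] by simp
  finally show ?thesis .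
qed

lemma prob_torus: "emeasure (torus d) (space (torus d)) = 1"
proof -
  have "emeasure (torus d) (space (torus d)) = (\<integral>\<^sup>+z. 1 \<partial>torus d)" by simp
  also have "\<dots> = 1" by (subst nn_integral_torus) (auto simp: prob_cube_measure)
  finally show ?thesis .
qed

lemma finite_torus: "finite_measure (torus d)"
  by (rule finite_measureI) (simp add: prob_torus)

section \<open>Characters on the unit interval\<close>

definition unit_measure :: "real measure" where
  "unit_measure = density lborel (indicator {0..<1})"

lemma sets_unit_measure[measurable_cong, simp]: "sets unit_measure = sets borel"
  by (simp add: unit_measure_def)

lemma space_unit_measure[simp]: "space unit_measure = UNIV"
  by (simp add: unit_measure_def)

lemma borel_measurable_unit_measure[simp]: "borel_measurable unit_measure = borel_measurable borel"
  by (rule measurable_cong_sets) auto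

lemma emeasure_unit_measure: "emeasure unit_measure UNIV = 1"
  unfolding unit_measure_def by (subst emeasure_density) (auto simp: nn_integral_indicator)

lemma finite_unit_measure: "finite_measure unit_measure"
  by (rule finite_measureI) (simp add: emeasure_unit_measure)

lemma AE_unit_measure: "AE x in unit_measure. 0 < x \<and> x < 1"
proof -
  have "AE x in lborel. x \<noteq> (0::real)" by (rule AE_lborel_singleton)
  then show ?thesis
    unfolding unit_measure_def by (subst AE_density) (auto simp: indicator_def)
qed

lemma cube_indicator_prod:
  "x \<in> space (Rd d) \<Longrightarrow> (indicator (cube d) x :: 'a::comm_semiring_1) = (\<Prod>i<d. indicator {0..<1} (x i))"
proof (cases "x \<in> cube d")
  case True
  then have "\<forall>i<d. x i \<in> {0..<1}" unfolding cube_def PiE_iff by blast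
  then have "(\<Prod>i<d. indicator {0..<1} (x i)) = (1::'a)" by (intro prod.neutral) simp
  then show ?thesis using True by simp
next
  case False
  assume "x \<in> space (Rd d)"
  then obtain i where "i < d" "x i \<notin> {0..<1}" using False unfolding cube_def space_Rd PiE_iff by blast
  then have "(\<Prod>i<d. indicator {0..<1} (x i)) = (0::'a)" by (intro prod_zero bexI[of _ i]) auto
  then show ?thesis using False by simp
qed

lemma nn_integral_cube_prod:
  fixes f :: "nat \<Rightarrow> real \<Rightarrow> ennreal"
  assumes f: "\<And>i. i < d \<Longrightarrow> f i \<in> borel_measurable borel"
  shows "(\<integral>\<^sup>+x. (\<Prod>i<d. f i (x i)) \<partial>cube_measure d) = (\<Prod>i<d. \<integral>\<^sup>+t. f i t \<partial>unit_measure)"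
proof -
  have "(\<lambda>x. \<Prod>i<d. f i (x i)) \<in> borel_measurable (Rd d)"
    by (intro borel_measurable_prod_ennreal measurable_compose[OF measurable_Rd_component f]) auto
  then have "(\<integral>\<^sup>+x. (\<Prod>i<d. f i (x i)) \<partial>cube_measure d) = (\<integral>\<^sup>+x. indicator (cube d) x * (\<Prod>i<d. f i (x i)) \<partial>Rd d)"
    by (rule nn_integral_cube_measure)
  also have "\<dots> = (\<integral>\<^sup>+x. (\<Prod>i<d. indicator {0..<1} (x i) * f i (x i)) \<partial>Rd d)"
    by (rule nn_integral_cong) (simp add: cube_indicator_prod prod.distrib)
  also have "\<dots> = (\<Prod>i<d. \<integral>\<^sup>+t. indicator {0..<1} t * f i t \<partial>lborel)"
    unfolding Rd_def
    by (rule lborel_product.product_nn_integral_prod[where f="\<lambda>i t. indicator {0..<1} t * f i t"])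
       (use f in auto)
  also have "\<dots> = (\<Prod>i<d. \<integral>\<^sup>+t. f i t \<partial>unit_measure)"
    unfolding unit_measure_def
    by (rule prod.cong[OF refl], rule nn_integral_density[symmetric]) (use f in auto)
  finally show ?thesis .
qed

lemma nn_integral_cube_marginal:
  fixes h :: "real \<Rightarrow> ennreal"
  assumes "k < d" "h \<in> borel_measurable borel"
  shows "(\<integral>\<^sup>+x. h (x k) \<partial>cube_measure d) = (\<integral>\<^sup>+t. h t \<partial>unit_measure)"
proof -
  have "(\<integral>\<^sup>+x. h (x k) \<partial>cube_measure d) = (\<integral>\<^sup>+x. (\<Prod>i<d. (if i = k then h else (\<lambda>_. 1)) (x i)) \<partial>cube_measure d)"
  proof (rule nn_integral_cong)
    fix x :: "nat \<Rightarrow> real"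
    have "(\<Prod>i<d. (if i = k then h else (\<lambda>_. 1)) (x i)) = (\<Prod>i<d. if i = k then h (x k) else 1)"
      by (rule prod.cong) auto
    then show "h (x k) = (\<Prod>i<d. (if i = k then h else (\<lambda>_. 1)) (x i))" using assms(1) by simp
  qed
  also have "\<dots> = (\<Prod>i<d. \<integral>\<^sup>+t. (if i = k then h else (\<lambda>_. 1)) t \<partial>unit_measure)"
    by (rule nn_integral_cube_prod) (use assms in auto)
  also have "\<dots> = (\<Prod>i<d. if i = k then (\<integral>\<^sup>+t. h t \<partial>unit_measure) else 1)"
    by (rule prod.cong) (auto simp: emeasure_unit_measure)
  finally show ?thesis using assms(1) by simp
qed

lemma integral_cube_measure:
  fixes f :: "_ \<Rightarrow> complex"
  assumes "f \<in> borel_measurable (Rd d)"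
  shows "(LINT x|cube_measure d. f x) = (LINT x|Rd d. indicator (cube d) x * f x)"
proof -
  have "cube_measure d = density (Rd d) (\<lambda>x. ennreal (indicator (cube d) x))"
    unfolding cube_measure_def by (rule density_cong) (auto intro!: AE_I2 simp: indicator_def)
  then have "(LINT x|cube_measure d. f x) = (LINT x|Rd d. (indicator (cube d) x :: real) *\<^sub>R f x)"
    using integral_density[OF assms, of "indicator (cube d)"] by simp
  also have "\<dots> = (LINT x|Rd d. indicator (cube d) x * f x)"
    by (rule Bochner_Integration.integral_cong) (auto simp: indicator_def)
  finally show ?thesis .
qed

lemma integral_cube_prod:
  fixes f :: "nat \<Rightarrow> real \<Rightarrow> complex"
  assumes f: "\<And>i. i < d \<Longrightarrow> f i \<in> borel_measurable borel" "\<And>i t. i < d \<Longrightarrow> cmod (f i t) \<le> 1"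
  shows "(LINT x|cube_measure d. (\<Prod>i<d. f i (x i))) = (\<Prod>i<d. LINT t|lborel. indicator {0..<1} t * f i t)"
proof -
  have m: "(\<lambda>x. \<Prod>i<d. f i (x i)) \<in> borel_measurable (Rd d)"
    by (intro borel_measurable_prod measurable_compose[OF measurable_Rd_component f(1)]) auto
  have int: "integrable lborel (\<lambda>t. indicator {0..<1} t * f i t)" if "i < d" for i
  proof (rule Bochner_Integration.integrable_bound[where f="indicator {0..<1::real} :: real \<Rightarrow> real"])
    show "AE t in lborel. norm (indicator {0..<1} t * f i t) \<le> norm (indicator {0..<1} t :: real)"
      by (intro AE_I2) (use f(2)[OF that] in \<open>auto simp: indicator_def\<close>)
  qed (use f(1)[OF that] in auto)
  have "(LINT x|cube_measure d. (\<Prod>i<d. f i (x i))) = (LINT x|Rd d. (\<Prod>i<d. indicator {0..<1} (x i) * f i (x i)))"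
    unfolding integral_cube_measure[OF m]
    by (rule Bochner_Integration.integral_cong) (auto simp: cube_indicator_prod prod.distrib)
  also have "\<dots> = (\<Prod>i<d. LINT t|lborel. indicator {0..<1} t * f i t)"
    unfolding Rd_def
    by (rule lborel_product.product_integral_prod[where f="\<lambda>i t. indicator {0..<1} t * f i t"])
       (use int in auto)
  finally show ?thesis .
qed

lemma integral_unit_character:
  "(LINT t|lborel. indicator {0..<1} t * ex (of_int k * t)) = (if k = 0 then 1 else 0)"
proof (cases "k = 0")
  case True
  have "(LINT t|lborel. (indicator {0..<1::real} t :: complex)) = 1"
  proof -
    have "(LINT t|lborel. (indicator {0..<1::real} t :: complex)) = (LINT t|lborel. complex_of_real (indicator {0..<1::real} t))"
      by (rule Bochner_Integration.integral_cong) (auto simp: indicator_def)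
    then show ?thesis by (subst (asm) integral_complex_of_real) simp
  qed
  then show ?thesis using True by simp
next
  case False
  define c :: complex where "c = 2 * of_real pi * \<i> * of_int k"
  have c0: "c \<noteq> 0" using False by (simp add: c_def)
  have ex: "ex (of_int k * t) = exp (c * of_real t)" for t
    by (simp add: ex_def cis_conv_exp c_def mult_ac)
  define F where "F t = exp (c * of_real t) / c" for t :: real
  have der: "(F has_vector_derivative ex (of_int k * t)) (at t within {0..1})" for t
  proof -
    have "((\<lambda>z. exp (c * z) / c) has_field_derivative exp (c * of_real t)) (at (of_real t))"
      using c0 by (auto intro!: derivative_eq_intros)
    from has_vector_derivative_real_field[OF this] show ?thesis by (simp add: F_def[abs_def] ex)
  qed
  have cont: "continuous_on {0..1} (\<lambda>t. ex (of_int k * t))"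
    unfolding ex by (intro continuous_intros)
  have "(LINT t|lborel. indicator {0..<1} t * ex (of_int k * t)) = (LINT t|lborel. indicator {0..1} t *\<^sub>R ex (of_int k * t))"
  proof (rule integral_cong_AE)
    have "AE x in lborel. x \<noteq> (1::real)" by (rule AE_lborel_singleton)
    then show "AE t in lborel. indicator {0..<1} t * ex (of_int k * t) = indicator {0..1} t *\<^sub>R ex (of_int k * t)"
      by eventually_elim (auto simp: indicator_def)
  qed auto
  also have "\<dots> = F 1 - F 0" by (rule integral_FTC_Icc[OF _ der cont]) simp
  also have "\<dots> = 0"
    using ex[of 1] by (simp add: F_def)
  finally show ?thesis using False by simp
qed

definition chr :: "nat \<Rightarrow> (nat \<Rightarrow> int) \<Rightarrow> (nat \<Rightarrow> real) \<Rightarrow> complex" where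
  "chr d n x = ex (dot d (rvec n) x)"

lemma chr_measurable[measurable]: "chr d n \<in> borel_measurable (Rd d)"
  unfolding chr_def[abs_def] by measurable

lemma norm_chr[simp]: "cmod (chr d n x) = 1" by (simp add: chr_def)

lemma chr_prod: "chr d n x = (\<Prod>i<d. ex (of_int (n i) * x i))"
  by (simp add: chr_def dot_def rvec_def ex_sum)

lemma bounded_L2:
  assumes "finite_measure M" "f \<in> borel_measurable M" "\<And>x. x \<in> space M \<Longrightarrow> cmod (f x) \<le> c"
  shows "f \<in> L2 M"
proof -
  interpret finite_measure M by fact
  show ?thesis
  proof (rule L2_dominated[where g="\<lambda>_. 1" and c=c])
    show "(\<lambda>_. 1) \<in> L2 M" by (simp add: L2_def)
  qed (use assms in auto)
qed

lemma chr_L2: "chr d n \<in> L2 (cube_measure d)"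
  by (rule bounded_L2[OF finite_cube_measure, where c=1]) auto

lemma orthonormal_chr: "orthonormal_L2 (cube_measure d) (Zd d) (chr d)"
  unfolding orthonormal_L2_def
proof (intro conjI ballI chr_L2)
  fix n m assume nm: "n \<in> Zd d" "m \<in> Zd d"
  have "inner_L2 (cube_measure d) (chr d n) (chr d m) = (LINT x|cube_measure d. (\<Prod>i<d. ex (of_int (n i - m i) * x i)))"
    unfolding inner_L2_def chr_prod by (simp add: left_diff_distrib ex_diff prod.distrib)
  also have "\<dots> = (\<Prod>i<d. LINT t|lborel. indicator {0..<1} t * ex (of_int (n i - m i) * t))"
    by (rule integral_cube_prod[where f="\<lambda>i t. ex (of_int (n i - m i) * t)"]) auto
  also have "\<dots> = (\<Prod>i<d. if n i = m i then 1 else 0)"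
    by (simp only: integral_unit_character) (simp cong: if_cong)
  also have "\<dots> = (if n = m then 1 else 0)"
  proof (cases "n = m")
    case False
    then obtain i where "i < d" "n i \<noteq> m i"
      using nm by (auto simp: Zd_def PiE_def extensional_def fun_eq_iff) (metis lessThan_iff)
    then show ?thesis using False by (auto intro!: prod_zero)
  qed simp
  finally show "inner_L2 (cube_measure d) (chr d n) (chr d m) = (if n = m then 1 else 0)" .
qed

definition chr1 :: "int \<Rightarrow> real \<Rightarrow> complex" where "chr1 n t = ex (of_int n * t)"

lemma chr1_measurable[measurable]: "chr1 n \<in> borel_measurable borel"
  unfolding chr1_def[abs_def] by measurable

lemma chr1_L2: "chr1 n \<in> L2 unit_measure"
  by (rule bounded_L2[OF finite_unit_measure, where c=1]) (auto simp: chr1_def)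

abbreviation "approx1 \<equiv> L2_approx unit_measure UNIV chr1"

text \<open>A trigonometric polynomial of degree one with simple zeros exactly at \<open>0\<close>
and \<open>b\<close> modulo \<open>1\<close>.  For \<open>0 < b < 1\<close> it is positive on the
arc from \<open>0\<close> to \<open>b\<close> and negative on the complementary arc, which makes the
indicator of the arc a limit of functions of \<open>arc_poly b\<close>.\<close>

definition arc_poly :: "real \<Rightarrow> real \<Rightarrow> real" where "arc_poly b t = sin (pi * t) * sin (pi * (b - t))"

lemma arc_trig: "complex_of_real (arc_poly b t)
   = (cis (- (pi * b)) / 4) * chr1 1 t + (cis (pi * b) / 4) * chr1 (-1) t + of_real (- cos (pi * b) / 2) * chr1 0 t"
proof -
  have "arc_poly b t = (cos (2 * pi * t - pi * b) - cos (pi * b)) / 2"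
    unfolding arc_poly_def sin_times_sin by (simp add: algebra_simps)
  moreover have "complex_of_real (cos (2 * pi * t - pi * b))
     = (cis (- (pi * b)) * chr1 1 t + cis (pi * b) * chr1 (-1) t) / 2"
    unfolding chr1_def ex_def by (simp add: cis_mult complex_eq_iff algebra_simps cos_diff sin_diff)
  ultimately show ?thesis by (simp add: chr1_def diff_divide_distrib add_divide_distrib)
qed

lemma arc_bound: "\<bar>arc_poly b t\<bar> \<le> 1"
proof -
  have "\<bar>sin (pi * t)\<bar> * \<bar>sin (pi * (b - t))\<bar> \<le> 1 * 1" by (rule mult_mono) auto
  then show ?thesis by (simp add: arc_poly_def abs_mult)
qed

lemma arc_measurable[measurable]: "arc_poly b \<in> borel_measurable borel"
  unfolding arc_poly_def[abs_def] by measurable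

lemma chr1_mult: "chr1 n t * chr1 m t = chr1 (n + m) t"
  by (simp add: chr1_def distrib_right ex_add)

text \<open>Each factor \<open>arc_poly b\<close> shifts frequencies by at most one, so the powers
remain trigonometric polynomials.\<close>

lemma approx1_arc_power: "approx1 (\<lambda>t. complex_of_real (arc_poly b t ^ k) * chr1 n t)"
proof (induction k arbitrary: n)
  case 0
  show ?case using L2_approx_basis[of UNIV chr1 unit_measure n] chr1_L2 by simp
next
  case (Suc k)
  let ?p = "\<lambda>n t. complex_of_real (arc_poly b t ^ k) * chr1 n t"
  have "complex_of_real (arc_poly b t ^ Suc k) * chr1 n t =
     (cis (- (pi * b)) / 4) * ?p (n + 1) t + (cis (pi * b) / 4) * ?p (n - 1) t + of_real (- cos (pi * b) / 2) * ?p n t" for t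
  proof -
    have "complex_of_real (arc_poly b t ^ Suc k) * chr1 n t = complex_of_real (arc_poly b t) * ?p n t" by simp
    also have "\<dots> = ((cis (- (pi * b)) / 4) * chr1 1 t + (cis (pi * b) / 4) * chr1 (-1) t + of_real (- cos (pi * b) / 2) * chr1 0 t) * ?p n t"
      by (simp only: arc_trig)
    also have "\<dots> = (cis (- (pi * b)) / 4) * (of_real (arc_poly b t ^ k) * (chr1 n t * chr1 1 t))
       + (cis (pi * b) / 4) * (of_real (arc_poly b t ^ k) * (chr1 n t * chr1 (-1) t))
       + of_real (- cos (pi * b) / 2) * (of_real (arc_poly b t ^ k) * (chr1 n t * chr1 0 t))"
    proof -
      have "(\<alpha> * x + \<beta> * y + \<gamma> * z) * (p * m) = \<alpha> * (p * (m * x)) + \<beta> * (p * (m * y)) + \<gamma> * (p * (m * z))"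
        for \<alpha> \<beta> \<gamma> x y z p m :: complex by (simp add: algebra_simps)
      then show ?thesis .
    qed
    finally show ?thesis by (simp only: chr1_mult) simp
  qed
  then have eq: "(\<lambda>t. complex_of_real (arc_poly b t ^ Suc k) * chr1 n t) = (\<lambda>t.
     (cis (- (pi * b)) / 4) * ?p (n + 1) t + (cis (pi * b) / 4) * ?p (n - 1) t + of_real (- cos (pi * b) / 2) * ?p n t)" ..
  show ?case unfolding eq
    by (intro L2_approx_add L2_approx_cmult chr1_L2 Suc)
qed

text \<open>Weierstrass approximation of \<open>\<phi>\<close> on the interval that contains the
values of \<open>arc_poly b\<close>.\<close>

lemma approx1_arc_continuous:
  assumes phi: "continuous_on UNIV \<phi>"
  shows "approx1 (\<lambda>t. complex_of_real (\<phi> (arc_poly b t)))"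
proof -
  have phim[measurable]: "\<phi> \<in> borel_measurable borel" using phi by (rule borel_measurable_continuous_onI)
  have "bounded (\<phi> ` {-1..1})"
    by (intro compact_imp_bounded compact_continuous_image continuous_on_subset[OF phi]) auto
  then obtain B where "\<forall>t\<in>{-1..1}. \<bar>\<phi> t\<bar> \<le> B" by (auto simp: bounded_iff)
  then have B: "\<And>t. t \<in> {-1..1} \<Longrightarrow> \<bar>\<phi> t\<bar> \<le> B" by blast
  have f: "(\<lambda>t. complex_of_real (\<phi> (arc_poly b t))) \<in> L2 unit_measure"
    by (rule bounded_L2[OF finite_unit_measure, where c=B]) (use B arc_bound in \<open>auto simp: abs_le_iff\<close>)
  show ?thesis
  proof (rule L2_approx_limit[OF chr1_L2 f])
    fix e :: real assume e: "0 < e"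
    obtain q where q: "real_polynomial_function q" "\<And>x. x \<in> {-1..1} \<Longrightarrow> \<bar>\<phi> x - q x\<bar> < e/2"
      using Stone_Weierstrass_real_polynomial_function[of "{-1..1::real}" \<phi> "e/2"] e continuous_on_subset[OF phi]
      by (metis compact_Icc half_gt_zero subset_UNIV)
    obtain a n where an: "q = (\<lambda>x. \<Sum>i\<le>n. a i * x ^ i)"
      using q(1) unfolding real_polynomial_function_iff_sum by blast
    let ?g = "\<lambda>t. \<Sum>i\<le>n. of_real (a i) * (complex_of_real (arc_poly b t ^ i) * chr1 0 t)"
    have g: "approx1 ?g"
      by (intro L2_approx_sum L2_approx_cmult chr1_L2 approx1_arc_power)
    have gq: "?g t = of_real (q (arc_poly b t))" for t by (simp add: an chr1_def)
    have "norm_L2 unit_measure (\<lambda>t. ?g t - complex_of_real (\<phi> (arc_poly b t))) \<le> e/2"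
    proof (rule norm_L2_nn_le(2))
      show "(\<lambda>t. ?g t - complex_of_real (\<phi> (arc_poly b t))) \<in> borel_measurable unit_measure" by measurable
      have "(\<integral>\<^sup>+t. ennreal ((cmod (?g t - complex_of_real (\<phi> (arc_poly b t))))\<^sup>2) \<partial>unit_measure) \<le> (\<integral>\<^sup>+t. ennreal ((e/2)\<^sup>2) \<partial>unit_measure)"
      proof (intro nn_integral_mono ennreal_leI power_mono)
        fix t
        have "arc_poly b t \<in> {-1..1}" using arc_bound[of b t] by (auto simp: abs_le_iff)
        from q(2)[OF this] show "cmod (?g t - complex_of_real (\<phi> (arc_poly b t))) \<le> e/2"
          unfolding gq by (simp add: norm_of_real abs_minus_commute flip: of_real_diff)
      qed simp
      also have "\<dots> = ennreal ((e/2)\<^sup>2)" by (simp add: emeasure_unit_measure)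
      finally show "(\<integral>\<^sup>+t. ennreal ((cmod (?g t - complex_of_real (\<phi> (arc_poly b t))))\<^sup>2) \<partial>unit_measure) \<le> ennreal ((e/2)\<^sup>2)" .
    qed (use e in simp)
    then show "\<exists>g. approx1 g \<and> norm_L2 unit_measure (\<lambda>t. g t - complex_of_real (\<phi> (arc_poly b t))) < e"
      using g e by (intro exI[of _ ?g]) auto
  qed
qed

lemma arc_pos_iff:
  assumes "0 < b" "b < 1" "0 < t" "t < 1" shows "0 < arc_poly b t \<longleftrightarrow> t < b"
proof -
  have s: "0 < sin (pi * t)" using assms by (intro sin_gt_zero) auto
  have "0 < sin (pi * (b - t)) \<longleftrightarrow> t < b"
  proof
    assume "0 < sin (pi * (b - t))"
    show "t < b"
    proof (rule ccontr)
      assume "\<not> t < b"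
      then have "0 \<le> sin (pi * (t - b))" using assms by (intro sin_ge_zero) auto
      moreover have "sin (pi * (t - b)) = - sin (pi * (b - t))"
        by (simp flip: sin_minus) (simp add: algebra_simps)
      ultimately show False using \<open>0 < sin (pi * (b - t))\<close> by simp
    qed
  next
    assume "t < b"
    then show "0 < sin (pi * (b - t))" using assms by (intro sin_gt_zero) auto
  qed
  then show ?thesis using s by (simp add: arc_poly_def zero_less_mult_iff)
qed

text \<open>The continuous functions \<open>min 1 (max 0 (n s))\<close> tend to the indicator of
\<open>0 < s\<close>, and composition with \<open>arc_poly b\<close> gives the indicator of the
arc.\<close>

lemma approx1_lessThan: "approx1 (indicator {..<b})"
proof -
  consider "b \<le> 0" | "1 \<le> b" | "0 < b" "b < 1" by linarith
  then show ?thesis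
  proof cases
    case 1
    show ?thesis
      by (rule L2_approx_cong_AE[OF chr1_L2 L2_approx_zero[OF chr1_L2]])
         (simp, use AE_unit_measure in eventually_elim, use 1 in \<open>auto simp: indicator_def\<close>)
  next
    case 2
    show ?thesis
      by (rule L2_approx_cong_AE[OF chr1_L2 L2_approx_basis[where v=chr1 and i=0 and I=UNIV, OF chr1_L2 UNIV_I]])
         (simp, use AE_unit_measure in eventually_elim, use 2 in \<open>auto simp: indicator_def chr1_def\<close>)
  next
    case 3
    interpret finite_measure unit_measure by (rule finite_unit_measure)
    let ?phi = "\<lambda>n s. min 1 (max 0 (real n * s))"
    show ?thesis
    proof (rule L2_approx_limit_seq[OF chr1_L2 indicator_L2])
      show "approx1 (\<lambda>t. complex_of_real (?phi n (arc_poly b t)))" for n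
        by (rule approx1_arc_continuous) (intro continuous_intros)
      show "(\<lambda>n. norm_L2 unit_measure (\<lambda>t. complex_of_real (?phi n (arc_poly b t)) - indicator {..<b} t)) \<longlonglongrightarrow> 0"
      proof (rule L2_dominated_convergence[where b="\<lambda>_. 1"])
        show "AE t in unit_measure. (cmod (complex_of_real (?phi n (arc_poly b t)) - indicator {..<b} t))\<^sup>2 \<le> 1" for n
        proof (rule AE_I2)
          fix t
          have "complex_of_real (?phi n (arc_poly b t)) - indicator {..<b} t = complex_of_real (?phi n (arc_poly b t) - indicator {..<b} t)"
            by (simp add: indicator_def)
          moreover have "\<bar>?phi n (arc_poly b t) - indicator {..<b} t\<bar> \<le> 1" by (auto simp: indicator_def)
          ultimately show "(cmod (complex_of_real (?phi n (arc_poly b t)) - indicator {..<b} t))\<^sup>2 \<le> 1"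
            by (simp only: norm_of_real power2_abs) (simp only: abs_square_le_1)
        qed
        show "AE t in unit_measure. (\<lambda>n. complex_of_real (?phi n (arc_poly b t))) \<longlonglongrightarrow> indicator {..<b} t"
          using AE_unit_measure
        proof eventually_elim
          case (elim t)
          show ?case
          proof (cases "t < b")
            case True
            then have a: "0 < arc_poly b t" using arc_pos_iff[OF 3] elim by auto
            obtain N :: nat where N: "1 / arc_poly b t \<le> real N" using real_arch_simple by blast
            have "?phi n (arc_poly b t) = 1" if "n \<ge> N" for n
            proof -
              have "1 / arc_poly b t \<le> real n" using N that by linarith
              then have "1 \<le> real n * arc_poly b t" using a by (simp add: field_simps)
              then show ?thesis by simp
            qed
            then show ?thesis using True
              by (intro tendsto_eventually) (auto simp: eventually_sequentially intro!: exI[of _ N])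
          next
            case False
            then have "arc_poly b t \<le> 0" using arc_pos_iff[OF 3] elim by force
            then have "?phi n (arc_poly b t) = 0" for n by (simp add: mult_nonneg_nonpos)
            then show ?thesis using False by simp
          qed
        qed
      qed auto
    qed simp
  qed
qed

lemma approx1_indicator:
  assumes "A \<in> sets borel" shows "approx1 (indicator A)"
proof -
  interpret finite_measure unit_measure by (rule finite_unit_measure)
  show ?thesis
  proof (rule L2_approx_pi_system[OF chr1_L2, where G="range lessThan"])
    show "sets unit_measure = sigma_sets (space unit_measure) (range lessThan)"
      by (simp add: borel_Iio)
    show "Int_stable (range lessThan :: real set set)"
    proof (rule Int_stableI)
      fix A B :: "real set" assume "A \<in> range lessThan" "B \<in> range lessThan"
      then obtain a b where "A = {..<a}" "B = {..<b}" by auto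
      then have "A \<inter> B = {..<min a b}" by auto
      then show "A \<inter> B \<in> range lessThan" by simp
    qed
    show "approx1 (indicator (space unit_measure))"
    proof -
      have "chr1 0 = indicator (space unit_measure)" by (auto simp: chr1_def fun_eq_iff)
      then show ?thesis using L2_approx_basis[where v=chr1 and i=0 and I=UNIV, OF chr1_L2 UNIV_I] by simp
    qed
  qed (use approx1_lessThan assms in \<open>auto intro: indicator_L2\<close>)
qed

section \<open>Completeness of the characters on the cube and on the torus\<close>

abbreviation "approx_cube d \<equiv> L2_approx (cube_measure d) (Zd d) (chr d)"

text \<open>The characters in a product are replaced by indicators one coordinate at a time.  The
remaining factors have modulus at most \<open>1\<close>, so that the error at each step is the
one-dimensional one.\<close>

lemma approx_cube_partial_product:
  assumes "k \<le> d" "\<And>i. i < k \<Longrightarrow> A i \<in> sets borel"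
  shows "approx_cube d (\<lambda>x. \<Prod>i<d. if i < k then indicator (A i) (x i) else chr1 (n i) (x i))"
  using assms
proof (induction k arbitrary: n)
  case 0
  have "(\<lambda>x. \<Prod>i<d. if i < 0 then indicator (A i) (x i) else chr1 (n i) (x i)) = chr d (restrict n {..<d})"
    by (auto simp: chr_prod chr1_def fun_eq_iff intro!: prod.cong)
  moreover have "restrict n {..<d} \<in> Zd d" by (simp add: Zd_def)
  ultimately show ?case using L2_approx_basis[where I="Zd d" and v="chr d" and i="restrict n {..<d}", OF chr_L2] by simp
next
  case (Suc k)
  then have k: "k < d" by simp
  let ?r = "\<lambda>x. \<Prod>i\<in>{..<d} - {k}. if i < k then indicator (A i) (x i) else chr1 (n i) (x i)"
  have rb: "cmod (?r x) \<le> 1" for x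
  proof -
    have "cmod (?r x) = (\<Prod>i\<in>{..<d} - {k}. cmod (if i < k then indicator (A i) (x i) else chr1 (n i) (x i)))"
      by (simp add: prod_norm)
    also have "\<dots> \<le> 1" by (rule prod_le_1) (auto simp: indicator_def chr1_def)
    finally show ?thesis .
  qed
  let ?f = "\<lambda>x. \<Prod>i<d. if i < Suc k then indicator (A i) (x i) else chr1 (n i) (x i)"
  have f: "?f x = indicator (A k) (x k) * ?r x" for x
  proof -
    have "?f x = indicator (A k) (x k) * (\<Prod>i\<in>{..<d} - {k}. if i < Suc k then indicator (A i) (x i) else chr1 (n i) (x i))"
      using k by (subst prod.remove[of _ k]) auto
    also have "(\<Prod>i\<in>{..<d} - {k}. if i < Suc k then indicator (A i) (x i) else chr1 (n i) (x i)) = ?r x"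
      by (rule prod.cong) auto
    finally show ?thesis .
  qed
  have comp: "(\<lambda>x. x i) \<in> borel_measurable (Rd d)" if "i < d" for i
    by (rule measurable_Rd_component[OF measurable_ident_sets[OF refl] that])
  have Am: "A i \<in> sets borel" if "i \<le> k" for i using Suc.prems that by auto
  have fm: "?f \<in> borel_measurable (Rd d)"
  proof (rule borel_measurable_prod)
    fix i assume "i \<in> {..<d}"
    then have i: "i < d" by simp
    show "(\<lambda>x. if i < Suc k then indicator (A i) (x i) else chr1 (n i) (x i)) \<in> borel_measurable (Rd d)"
    proof (cases "i < Suc k")
      case True
      have "indicator (A i) \<in> borel_measurable borel"
        by (rule borel_measurable_indicator, rule Am) (use True in simp)
      from measurable_compose[OF comp[OF i] this] True show ?thesis by simp
    next
      case False
      from measurable_compose[OF comp[OF i] chr1_measurable] False show ?thesis by simp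
    qed
  qed
  have fL: "?f \<in> L2 (cube_measure d)"
  proof (rule bounded_L2[OF finite_cube_measure, where c=1])
    show "cmod (?f x) \<le> 1" for x
      unfolding f norm_mult using rb[of x] by (auto simp: indicator_def)
  qed (use fm in simp)
  show ?case
  proof (rule L2_approx_limit[OF chr_L2 fL])
    fix e :: real assume e: "0 < e"
    have Ak: "A k \<in> sets borel" using Suc.prems by auto
    obtain F c where F: "finite F" "norm_L2 unit_measure (\<lambda>t. (\<Sum>j\<in>F. c j * chr1 j t) - indicator (A k) t) < e"
      by (rule L2_approxE[OF approx1_indicator[OF Ak] e])
    let ?g = "\<lambda>x. \<Sum>j\<in>F. c j * (\<Prod>i<d. if i < k then indicator (A i) (x i) else chr1 ((n(k := j)) i) (x i))"
    have g: "approx_cube d ?g"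
      by (intro L2_approx_sum L2_approx_cmult chr_L2 Suc.IH) (use Suc.prems in auto)
    have geq: "?g x = (\<Sum>j\<in>F. c j * chr1 j (x k)) * ?r x" for x
      unfolding sum_distrib_right
    proof (rule sum.cong[OF refl])
      fix j
      have "(\<Prod>i<d. if i < k then indicator (A i) (x i) else chr1 ((n(k := j)) i) (x i))
        = chr1 j (x k) * (\<Prod>i\<in>{..<d} - {k}. if i < k then indicator (A i) (x i) else chr1 ((n(k := j)) i) (x i))"
        using k by (subst prod.remove[of _ k]) auto
      also have "(\<Prod>i\<in>{..<d} - {k}. if i < k then indicator (A i) (x i) else chr1 ((n(k := j)) i) (x i)) = ?r x"
        by (rule prod.cong) auto
      finally show "c j * (\<Prod>i<d. if i < k then indicator (A i) (x i) else chr1 ((n(k := j)) i) (x i)) = c j * chr1 j (x k) * ?r x"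
        by simp
    qed
    let ?h = "\<lambda>t. (\<Sum>j\<in>F. c j * chr1 j t) - indicator (A k) t"
    have hm[measurable]: "?h \<in> borel_measurable borel" using Ak by measurable
    have hL: "?h \<in> L2 unit_measure"
      using finite_measure.indicator_L2[OF finite_unit_measure, of "A k"] Ak
      by (intro L2_diff L2_sum L2_cmult chr1_L2) auto
    have gL: "?g \<in> L2 (cube_measure d)" using g by (simp add: L2_approx_def)
    have "norm_L2 (cube_measure d) (\<lambda>x. ?g x - ?f x) \<le> norm_L2 unit_measure ?h"
    proof (rule norm_L2_nn_le(2))
      show "(\<lambda>x. ?g x - ?f x) \<in> borel_measurable (cube_measure d)" using L2_diff[OF gL fL] by (rule L2_measurable)
      have "(\<integral>\<^sup>+x. ennreal ((cmod (?g x - ?f x))\<^sup>2) \<partial>cube_measure d) \<le> (\<integral>\<^sup>+x. ennreal ((cmod (?h (x k)))\<^sup>2) \<partial>cube_measure d)"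
      proof (intro nn_integral_mono ennreal_leI power_mono)
        fix x
        have "?g x - ?f x = ?h (x k) * ?r x" unfolding geq f by (simp only: left_diff_distrib)
        then show "cmod (?g x - ?f x) \<le> cmod (?h (x k))"
          using mult_left_mono[OF rb[of x] norm_ge_zero, of "?h (x k)"] by (simp only: norm_mult mult_1_right)
      qed simp
      also have "\<dots> = (\<integral>\<^sup>+t. ennreal ((cmod (?h t))\<^sup>2) \<partial>unit_measure)"
        by (rule nn_integral_cube_marginal[OF k]) measurable
      also have "\<dots> = ennreal ((norm_L2 unit_measure ?h)\<^sup>2)" by (rule norm_L2_nn[OF hL])
      finally show "(\<integral>\<^sup>+x. ennreal ((cmod (?g x - ?f x))\<^sup>2) \<partial>cube_measure d) \<le> ennreal ((norm_L2 unit_measure ?h)\<^sup>2)" .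
    qed simp
    with F(2) have "norm_L2 (cube_measure d) (\<lambda>x. ?g x - ?f x) < e" by linarith
    with g show "\<exists>g. approx_cube d g \<and> norm_L2 (cube_measure d) (\<lambda>x. g x - ?f x) < e" by blast
  qed
qed

lemma approx_cube_all:
  assumes f: "f \<in> L2 (cube_measure d)" shows "approx_cube d f"
proof -
  interpret finite_measure "cube_measure d" by (rule finite_cube_measure)
  have st: "Int_stable (prod_algebra {..<d} (\<lambda>_. lborel :: real measure))"
    by (rule Int_stable_prod_algebra)
  show ?thesis
  proof (rule L2_approx_pi_system[OF chr_L2 _ st _ _ _ f])
    show "sets (cube_measure d) = sigma_sets (space (cube_measure d)) (prod_algebra {..<d} (\<lambda>_. lborel))"
      by (simp add: Rd_def sets_PiM space_PiM)
    show "prod_algebra {..<d} (\<lambda>_. lborel) \<subseteq> Pow (space (cube_measure d))"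
      using prod_algebra_sets_into_space[of "{..<d}" "\<lambda>_. lborel :: real measure"] by (simp add: space_Rd)
    have rect: "approx_cube d (indicator (Pi\<^sub>E {..<d} A))" if A: "\<And>i. i < d \<Longrightarrow> A i \<in> sets borel" for A
    proof (rule L2_approx_cong_AE[OF chr_L2 approx_cube_partial_product[where k=d and d=d and A=A and n="\<lambda>_. 0", OF order_refl A]])
      show "(indicator (Pi\<^sub>E {..<d} A) :: _ \<Rightarrow> complex) \<in> borel_measurable (cube_measure d)"
        using A by (auto simp: Rd_def intro!: borel_measurable_indicator sets_PiM_I_finite)
      show "AE x in cube_measure d. (\<Prod>i<d. if i < d then indicator (A i) (x i) else chr1 0 (x i)) = indicator (Pi\<^sub>E {..<d} A) x"
      proof (rule AE_I2)
        fix x assume "x \<in> space (cube_measure d)"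
        then have x: "x \<in> extensional {..<d}" by (simp add: space_Rd PiE_def)
        have "(\<Prod>i<d. if i < d then indicator (A i) (x i) else chr1 0 (x i)) = (\<Prod>i<d. indicator (A i) (x i))"
          by (rule prod.cong) auto
        also have "\<dots> = (indicator (Pi\<^sub>E {..<d} A) x :: complex)"
        proof (cases "\<forall>i<d. x i \<in> A i")
          case True
          then have "x \<in> Pi\<^sub>E {..<d} A" using x by (auto simp: PiE_def)
          then show ?thesis using True by (simp add: prod.neutral)
        next
          case False
          then obtain i where i: "i < d" "x i \<notin> A i" by blast
          then have "(\<Prod>i<d. indicator (A i) (x i)) = (0::complex)" by (intro prod_zero bexI[of _ i]) auto
          moreover have "x \<notin> Pi\<^sub>E {..<d} A" using i by (auto simp: PiE_def)
          ultimately show ?thesis by simp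
        qed
        finally show "(\<Prod>i<d. if i < d then indicator (A i) (x i) else chr1 0 (x i)) = (indicator (Pi\<^sub>E {..<d} A) x :: complex)" .
      qed
    qed
    show "approx_cube d (indicator (space (cube_measure d)))"
      using rect[of "\<lambda>_. UNIV"] by (simp add: space_Rd)
    fix B assume "B \<in> prod_algebra {..<d} (\<lambda>_. lborel :: real measure)"
    from prod_algebraE_all[OF this] obtain A where "B = Pi\<^sub>E {..<d} A" "A \<in> (\<Pi> i\<in>{..<d}. sets lborel)" .
    then show "approx_cube d (indicator B)" using rect[of A] by (auto simp: Pi_def)
  qed
qed

text \<open>Characters of the torus.  The conjugate in the second variable is chosen so that the Zak
transform of the time-frequency shift with index \<open>p\<close> acquires exactly the factor
\<open>chr2 d p\<close>.\<close>

definition chr2 :: "nat \<Rightarrow> (nat \<Rightarrow> int) \<times> (nat \<Rightarrow> int) \<Rightarrow> (nat \<Rightarrow> real) \<times> (nat \<Rightarrow> real) \<Rightarrow> complex" where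
  "chr2 d p z = chr d (snd p) (fst z) * cnj (chr d (fst p) (snd z))"

lemma chr2_measurable[measurable]: "chr2 d p \<in> borel_measurable (Rd d \<Otimes>\<^sub>M Rd d)"
  unfolding chr2_def[abs_def] by measurable

lemma norm_chr2[simp]: "cmod (chr2 d p z) = 1" by (simp add: chr2_def norm_mult)

lemma chr2_L2: "chr2 d p \<in> L2 (torus d)"
  by (rule bounded_L2[OF finite_torus, where c=1]) auto

lemma norm_L2_torus_product:
  assumes u: "u \<in> L2 (cube_measure d)" and w: "w \<in> L2 (cube_measure d)"
  shows "(\<lambda>z. u (fst z) * w (snd z)) \<in> L2 (torus d)"
    and "norm_L2 (torus d) (\<lambda>z. u (fst z) * w (snd z)) = norm_L2 (cube_measure d) u * norm_L2 (cube_measure d) w"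
proof -
  have m[measurable]: "u \<in> borel_measurable (Rd d)" "w \<in> borel_measurable (Rd d)"
    using u w by (auto dest: L2_measurable)
  have "(\<integral>\<^sup>+z. ennreal ((cmod (u (fst z) * w (snd z)))\<^sup>2) \<partial>torus d)
     = (\<integral>\<^sup>+x. (\<integral>\<^sup>+y. ennreal ((cmod (u x))\<^sup>2) * ennreal ((cmod (w y))\<^sup>2) \<partial>cube_measure d) \<partial>cube_measure d)"
    by (subst nn_integral_torus(1)) (auto simp: norm_mult power_mult_distrib ennreal_mult)
  also have "\<dots> = (\<integral>\<^sup>+x. ennreal ((cmod (u x))\<^sup>2) \<partial>cube_measure d) * (\<integral>\<^sup>+y. ennreal ((cmod (w y))\<^sup>2) \<partial>cube_measure d)"
    by (subst nn_integral_cmult) (auto simp: nn_integral_multc)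
  also have "\<dots> = ennreal ((norm_L2 (cube_measure d) u * norm_L2 (cube_measure d) w)\<^sup>2)"
    by (simp add: norm_L2_nn[OF u] norm_L2_nn[OF w] power_mult_distrib ennreal_mult)
  finally have "(\<integral>\<^sup>+z. ennreal ((cmod (u (fst z) * w (snd z)))\<^sup>2) \<partial>torus d) = ennreal ((norm_L2 (cube_measure d) u * norm_L2 (cube_measure d) w)\<^sup>2)" .
  then have "(\<lambda>z. u (fst z) * w (snd z)) \<in> L2 (torus d) \<and> norm_L2 (torus d) (\<lambda>z. u (fst z) * w (snd z)) = norm_L2 (cube_measure d) u * norm_L2 (cube_measure d) w"
    by (intro norm_L2_nn_eq) auto
  then show "(\<lambda>z. u (fst z) * w (snd z)) \<in> L2 (torus d)"
    and "norm_L2 (torus d) (\<lambda>z. u (fst z) * w (snd z)) = norm_L2 (cube_measure d) u * norm_L2 (cube_measure d) w"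
    by blast+
qed

lemma inner_L2_torus_product:
  assumes u: "u \<in> L2 (cube_measure d)" "u' \<in> L2 (cube_measure d)"
    and w: "w \<in> L2 (cube_measure d)" "w' \<in> L2 (cube_measure d)"
  shows "inner_L2 (torus d) (\<lambda>z. u (fst z) * w (snd z)) (\<lambda>z. u' (fst z) * w' (snd z))
     = inner_L2 (cube_measure d) u u' * inner_L2 (cube_measure d) w w'"
proof -
  interpret Q: sigma_finite_measure "cube_measure d" by (rule sigma_finite_cube_measure)
  interpret P: pair_sigma_finite "cube_measure d" "cube_measure d" ..
  have int: "integrable (cube_measure d \<Otimes>\<^sub>M cube_measure d) (\<lambda>z. u (fst z) * w (snd z) * cnj (u' (fst z) * w' (snd z)))"
    using inner_L2_integrable[OF norm_L2_torus_product(1)[OF u(1) w(1)] norm_L2_torus_product(1)[OF u(2) w(2)]]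
    by (simp add: torus_def)
  have "inner_L2 (torus d) (\<lambda>z. u (fst z) * w (snd z)) (\<lambda>z. u' (fst z) * w' (snd z))
     = (LINT x|cube_measure d. LINT y|cube_measure d. (u x * cnj (u' x)) * (w y * cnj (w' y)))"
    unfolding inner_L2_def torus_def
    using P.integral_fst'[OF int] by (simp add: mult_ac)
  also have "\<dots> = inner_L2 (cube_measure d) u u' * inner_L2 (cube_measure d) w w'"
    unfolding inner_L2_def by simp
  finally show ?thesis .
qed

lemma L2_cnj: "f \<in> L2 M \<Longrightarrow> (\<lambda>x. cnj (f x)) \<in> L2 M"
  by (rule L2_dominated[where g=f and c=1]) (auto dest: L2_measurable)

lemma norm_L2_cnj: "norm_L2 M (\<lambda>x. cnj (f x)) = norm_L2 M f"
  by (simp add: norm_L2_def)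

lemma inner_L2_cnj: "inner_L2 M (\<lambda>x. cnj (f x)) (\<lambda>x. cnj (g x)) = cnj (inner_L2 M f g)"
  unfolding inner_L2_def by (rule trans[OF _ Bochner_Integration.integral_cnj]) simp

lemma orthonormal_chr2: "orthonormal_L2 (torus d) (Zd d \<times> Zd d) (chr2 d)"
  unfolding orthonormal_L2_def
proof (intro conjI ballI chr2_L2)
  fix p q assume p: "p \<in> Zd d \<times> Zd d" and q: "q \<in> Zd d \<times> Zd d"
  have "inner_L2 (torus d) (chr2 d p) (chr2 d q)
     = inner_L2 (cube_measure d) (chr d (snd p)) (chr d (snd q)) * cnj (inner_L2 (cube_measure d) (chr d (fst p)) (chr d (fst q)))"
    using inner_L2_torus_product[OF chr_L2[of d "snd p"] chr_L2[of d "snd q"] L2_cnj[OF chr_L2[of d "fst p"]] L2_cnj[OF chr_L2[of d "fst q"]]]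
    unfolding inner_L2_cnj by (simp add: chr2_def[abs_def])
  also have "\<dots> = (if p = q then 1 else 0)"
    using p q orthonormal_chr[of d] by (auto simp: orthonormal_L2_def prod_eq_iff)
  finally show "inner_L2 (torus d) (chr2 d p) (chr2 d q) = (if p = q then 1 else 0)" .
qed

lemma norm_L2_chr:
  assumes "m \<in> Zd d" shows "norm_L2 (cube_measure d) (chr d m) = 1"
proof -
  have "complex_of_real ((norm_L2 (cube_measure d) (chr d m))\<^sup>2) = 1"
    unfolding inner_L2_self[symmetric] using orthonormal_chr[of d] assms by (simp add: orthonormal_L2_def)
  then have "(norm_L2 (cube_measure d) (chr d m))\<^sup>2 = 1" by (simp only: of_real_eq_1_iff)
  then show ?thesis using norm_L2_nonneg[of "cube_measure d" "chr d m"] by (auto simp: power2_eq_1_iff)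
qed

abbreviation "approx_torus d \<equiv> L2_approx (torus d) (Zd d \<times> Zd d) (chr2 d)"

text \<open>The two factors are approximated one after the other, since
\<open>norm_L2_torus_product\<close> makes the error of a product proportional to the error of one
factor.\<close>

lemma approx_torus_product:
  assumes u: "u \<in> L2 (cube_measure d)" and w: "w \<in> L2 (cube_measure d)"
  shows "approx_torus d (\<lambda>z. u (fst z) * cnj (w (snd z)))"
proof -
  have one: "approx_torus d (\<lambda>z. u (fst z) * cnj (chr d m (snd z)))" if m: "m \<in> Zd d" for m
  proof (rule L2_approx_limit[OF chr2_L2 norm_L2_torus_product(1)[OF u L2_cnj[OF chr_L2]]])
    fix e :: real assume e: "0 < e"
    obtain F c where F: "finite F" "F \<subseteq> Zd d" "norm_L2 (cube_measure d) (\<lambda>x. (\<Sum>n\<in>F. c n * chr d n x) - u x) < e"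
      by (rule L2_approxE[OF approx_cube_all[OF u] e])
    let ?g = "\<lambda>z. \<Sum>n\<in>F. c n * chr2 d (m, n) z"
    have g: "approx_torus d ?g"
      by (intro L2_approx_sum L2_approx_cmult L2_approx_basis chr2_L2) (use F m in auto)
    have sL: "(\<lambda>x. (\<Sum>n\<in>F. c n * chr d n x) - u x) \<in> L2 (cube_measure d)"
      by (intro L2_diff L2_sum L2_cmult chr_L2 u)
    have "norm_L2 (torus d) (\<lambda>z. ?g z - u (fst z) * cnj (chr d m (snd z)))
      = norm_L2 (torus d) (\<lambda>z. ((\<Sum>n\<in>F. c n * chr d n (fst z)) - u (fst z)) * cnj (chr d m (snd z)))"
      by (simp add: chr2_def left_diff_distrib sum_distrib_right mult.assoc)
    also have "\<dots> = norm_L2 (cube_measure d) (\<lambda>x. (\<Sum>n\<in>F. c n * chr d n x) - u x) * norm_L2 (cube_measure d) (\<lambda>y. cnj (chr d m y))"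
      by (rule norm_L2_torus_product(2)[OF sL L2_cnj[OF chr_L2]])
    also have "norm_L2 (cube_measure d) (\<lambda>y. cnj (chr d m y)) = 1"
      by (simp only: norm_L2_cnj norm_L2_chr[OF m])
    finally have "norm_L2 (torus d) (\<lambda>z. ?g z - u (fst z) * cnj (chr d m (snd z))) < e" using F(3) by simp
    with g show "\<exists>g. approx_torus d g \<and> norm_L2 (torus d) (\<lambda>z. g z - u (fst z) * cnj (chr d m (snd z))) < e" by blast
  qed
  show ?thesis
  proof (rule L2_approx_limit[OF chr2_L2 norm_L2_torus_product(1)[OF u L2_cnj[OF w]]])
    fix e :: real assume e: "0 < e"
    let ?N = "norm_L2 (cube_measure d) u"
    have e': "0 < e / (?N + 1)" using e by (intro divide_pos_pos) (auto simp: add_nonneg_pos)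
    obtain F c where F: "finite F" "F \<subseteq> Zd d" "norm_L2 (cube_measure d) (\<lambda>x. (\<Sum>n\<in>F. c n * chr d n x) - w x) < e / (?N + 1)"
      by (rule L2_approxE[OF approx_cube_all[OF w] e'])
    let ?g = "\<lambda>z. \<Sum>n\<in>F. cnj (c n) * (u (fst z) * cnj (chr d n (snd z)))"
    have g: "approx_torus d ?g"
      by (intro L2_approx_sum L2_approx_cmult one chr2_L2) (use F in auto)
    have sL: "(\<lambda>x. (\<Sum>n\<in>F. c n * chr d n x) - w x) \<in> L2 (cube_measure d)"
      by (intro L2_diff L2_sum L2_cmult chr_L2 w)
    have "norm_L2 (torus d) (\<lambda>z. ?g z - u (fst z) * cnj (w (snd z)))
      = norm_L2 (torus d) (\<lambda>z. u (fst z) * cnj ((\<Sum>n\<in>F. c n * chr d n (snd z)) - w (snd z)))"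
      by (simp add: right_diff_distrib sum_distrib_left mult_ac)
    also have "\<dots> = ?N * norm_L2 (cube_measure d) (\<lambda>x. cnj ((\<Sum>n\<in>F. c n * chr d n x) - w x))"
      by (rule norm_L2_torus_product(2)[OF u L2_cnj[OF sL]])
    also have "\<dots> = ?N * norm_L2 (cube_measure d) (\<lambda>x. (\<Sum>n\<in>F. c n * chr d n x) - w x)"
      by (simp only: norm_L2_cnj)
    also have "\<dots> \<le> (?N + 1) * norm_L2 (cube_measure d) (\<lambda>x. (\<Sum>n\<in>F. c n * chr d n x) - w x)"
      by (intro mult_right_mono) auto
    also have "\<dots> < e" using F(3) by (simp add: pos_less_divide_eq add_nonneg_pos mult.commute)
    finally have "norm_L2 (torus d) (\<lambda>z. ?g z - u (fst z) * cnj (w (snd z))) < e" .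
    with g show "\<exists>g. approx_torus d g \<and> norm_L2 (torus d) (\<lambda>z. g z - u (fst z) * cnj (w (snd z))) < e" by blast
  qed
qed

lemma approx_torus_all:
  assumes f: "f \<in> L2 (torus d)" shows "approx_torus d f"
proof -
  interpret finite_measure "torus d" by (rule finite_torus)
  have rect: "approx_torus d (indicator (a \<times> b))" if "a \<in> sets (Rd d)" "b \<in> sets (Rd d)" for a b
  proof -
    have "(\<lambda>z. indicator a (fst z) * cnj (indicator b (snd z))) = (indicator (a \<times> b) :: _ \<Rightarrow> complex)"
      by (auto simp: indicator_def fun_eq_iff)
    then show ?thesis
      using approx_torus_product[of "indicator a" d "indicator b"] that
        finite_measure.indicator_L2[OF finite_cube_measure] by simp
  qed
  show ?thesis
  proof (rule L2_approx_pi_system[OF chr2_L2 _ Int_stable_pair_measure_generator _ _ _ f])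
    show "sets (torus d) = sigma_sets (space (torus d)) {a \<times> b |a b. a \<in> sets (Rd d) \<and> b \<in> sets (Rd d)}"
      by (simp only: sets_torus sets_pair_measure space_torus)
    show "{a \<times> b |a b. a \<in> sets (Rd d) \<and> b \<in> sets (Rd d)} \<subseteq> Pow (space (torus d))"
      unfolding space_torus using sets.sets_into_space[of _ "Rd d"] by blast
    show "approx_torus d (indicator (space (torus d)))"
      unfolding space_torus by (rule rect) auto
  qed (use rect in auto)
qed

section \<open>The Zak transform\<close>

lemma nn_integral_Rd_tiling':
  assumes f[measurable]: "f \<in> borel_measurable (Rd d)"
  shows "(\<integral>\<^sup>+x. f x \<partial>Rd d) = (\<integral>\<^sup>+x. (\<integral>\<^sup>+m. f (shift d (rvec m) x) \<partial>count_space (Zd d)) \<partial>cube_measure d)"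
  unfolding nn_integral_Rd_tiling[OF f]
proof (rule nn_integral_cong)
  fix x
  have eq: "f (shift d (rvec (\<lambda>i. - m i)) x) = f (shift d (rvec (\<lambda>i\<in>{..<d}. - m i)) x)" for m
    by (rule arg_cong[where f=f], rule shift_cong) (simp add: rvec_def)
  have "bij_betw (\<lambda>m. \<lambda>i\<in>{..<d}. - m i) (Zd d) (Zd d)"
  proof (rule bij_betw_byWitness[where f'="\<lambda>m. \<lambda>i\<in>{..<d}. - m i"])
    show "\<forall>m\<in>Zd d. (\<lambda>i\<in>{..<d}. - (\<lambda>i\<in>{..<d}. - m i) i) = m"
      by (auto simp: Zd_def PiE_def extensional_def fun_eq_iff)
    then show "\<forall>m\<in>Zd d. (\<lambda>i\<in>{..<d}. - (\<lambda>i\<in>{..<d}. - m i) i) = m" .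
  qed (use uminus_Zd in auto)
  from nn_integral_bij_count_space[OF this, of "\<lambda>m. f (shift d (rvec m) x)"]
  show "(\<integral>\<^sup>+m. f (shift d (rvec (\<lambda>i. - m i)) x) \<partial>count_space (Zd d)) = (\<integral>\<^sup>+m. f (shift d (rvec m) x) \<partial>count_space (Zd d))"
    by (simp only: eq)
qed

definition bounded_support :: "nat \<Rightarrow> nat \<Rightarrow> ((nat \<Rightarrow> real) \<Rightarrow> complex) \<Rightarrow> bool" where
  "bounded_support d N f \<longleftrightarrow> (\<forall>x\<in>space (Rd d). f x \<noteq> 0 \<longrightarrow> (\<forall>i<d. \<bar>x i\<bar> \<le> real N))"

text \<open>For functions of bounded support the sum is finite at every point, so that algebraic
identities hold everywhere and not only almost everywhere.  Other functions are reached as limits in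
\<open>zak_limit_exists\<close>.\<close>

definition zak :: "nat \<Rightarrow> ((nat \<Rightarrow> real) \<Rightarrow> complex) \<Rightarrow> (nat \<Rightarrow> real) \<times> (nat \<Rightarrow> real) \<Rightarrow> complex" where
  "zak d f z = (\<Sum>m | m \<in> Zd d \<and> f (shift d (rvec m) (fst z)) \<noteq> 0.
      f (shift d (rvec m) (fst z)) * ex (dot d (rvec m) (snd z)))"

definition Zbox :: "nat \<Rightarrow> nat \<Rightarrow> (nat \<Rightarrow> int) set" where
  "Zbox d K = (\<Pi>\<^sub>E i\<in>{..<d}. {- int K..int K})"

lemma Zbox: "finite (Zbox d K)" "Zbox d K \<subseteq> Zd d"
  by (auto simp: Zbox_def Zd_def intro: finite_PiE)

lemma bounded_support_lattice:
  assumes f: "bounded_support d N f" and x: "\<And>i. i < d \<Longrightarrow> \<bar>x i\<bar> \<le> real M" and K: "N + M \<le> K"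
    and m: "m \<in> Zd d" "f (shift d (rvec m) x) \<noteq> 0"
  shows "m \<in> Zbox d K"
proof -
  have "\<bar>m i\<bar> \<le> int K" if i: "i < d" for i
  proof -
    have "\<bar>shift d (rvec m) x i\<bar> \<le> real N" using f m i by (auto simp: bounded_support_def)
    then have "\<bar>x i - of_int (m i)\<bar> \<le> real N" using i by (simp add: shift_def rvec_def)
    then have "\<bar>real_of_int (m i)\<bar> \<le> real K" using x[OF i] K by linarith
    then show ?thesis by linarith
  qed
  then show ?thesis using m(1) by (force simp: Zbox_def Zd_def PiE_iff)
qed

lemma coordinates_bounded:
  fixes x :: "nat \<Rightarrow> real"
  shows "\<exists>M::nat. \<forall>i<d. \<bar>x i\<bar> \<le> real M"
proof -
  obtain M :: nat where M: "(\<Sum>i<d. \<bar>x i\<bar>) \<le> real M" using real_arch_simple by blast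
  have "\<bar>x i\<bar> \<le> (\<Sum>i<d. \<bar>x i\<bar>)" if "i < d" for i
    by (rule member_le_sum) (use that in auto)
  then show ?thesis using M by (intro exI[of _ M]) (auto intro: order_trans)
qed

lemma bounded_support_finite:
  assumes "bounded_support d N f" shows "finite {m. m \<in> Zd d \<and> f (shift d (rvec m) x) \<noteq> 0}"
proof -
  obtain M :: nat where M: "\<forall>i<d. \<bar>x i\<bar> \<le> real M" using coordinates_bounded by blast
  have "{m. m \<in> Zd d \<and> f (shift d (rvec m) x) \<noteq> 0} \<subseteq> Zbox d (N + M)"
    using bounded_support_lattice[OF assms, of x M "N + M"] M by auto
  then show ?thesis using Zbox(1) by (rule finite_subset)
qed

lemma zak_eq_sum:
  assumes "finite F" "F \<subseteq> Zd d" "\<And>m. m \<in> Zd d \<Longrightarrow> f (shift d (rvec m) x) \<noteq> 0 \<Longrightarrow> m \<in> F"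
  shows "zak d f (x, y) = (\<Sum>m\<in>F. f (shift d (rvec m) x) * ex (dot d (rvec m) y))"
  unfolding zak_def by (simp, rule sum.mono_neutral_left) (use assms in auto)

text \<open>The character appears as a conjugate because \<open>shift\<close> subtracts its
argument.\<close>

definition quasiperiodic :: "nat \<Rightarrow> ((nat \<Rightarrow> real) \<times> (nat \<Rightarrow> real) \<Rightarrow> complex) \<Rightarrow> bool" where
  "quasiperiodic d \<zeta> \<longleftrightarrow> (\<forall>n\<in>Zd d. \<forall>x\<in>space (Rd d). \<forall>y\<in>space (Rd d).
     \<zeta> (shift d (rvec n) x, y) = cnj (ex (dot d (rvec n) y)) * \<zeta> (x, y) \<and> \<zeta> (x, shift d (rvec n) y) = \<zeta> (x, y))"

lemma zak_quasiperiodic: "quasiperiodic d (zak d f)"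
  unfolding quasiperiodic_def
proof (intro ballI conjI)
  fix n x y assume n: "n \<in> Zd d"
  have sh: "shift d (rvec m) (shift d (rvec n) x) = shift d (rvec (\<lambda>i\<in>{..<d}. m i + n i)) x" for m
    unfolding shift_shift by (rule shift_cong) (simp add: rvec_def)
  have "zak d f (shift d (rvec n) x, y)
     = (\<Sum>m | m \<in> Zd d \<and> f (shift d (rvec m) x) \<noteq> 0. f (shift d (rvec m) x) * (cnj (ex (dot d (rvec n) y)) * ex (dot d (rvec m) y)))"
    unfolding zak_def fst_conv snd_conv
  proof (rule sum.reindex_bij_witness[where i="\<lambda>m. \<lambda>i\<in>{..<d}. m i - n i" and j="\<lambda>m. \<lambda>i\<in>{..<d}. m i + n i"])
    fix m assume m: "m \<in> {m. m \<in> Zd d \<and> f (shift d (rvec m) (shift d (rvec n) x)) \<noteq> 0}"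
    show "(\<lambda>i\<in>{..<d}. (\<lambda>i\<in>{..<d}. m i + n i) i - n i) = m"
      using m by (auto simp: Zd_def PiE_def extensional_def fun_eq_iff)
    show "(\<lambda>i\<in>{..<d}. m i + n i) \<in> {m. m \<in> Zd d \<and> f (shift d (rvec m) x) \<noteq> 0}"
      using m by (simp add: Zd_def sh)
    have "dot d (rvec (\<lambda>i\<in>{..<d}. m i + n i)) y = dot d (rvec m) y + dot d (rvec n) y"
      by (simp add: dot_def rvec_def distrib_right sum.distrib)
    then show "f (shift d (rvec (\<lambda>i\<in>{..<d}. m i + n i)) x) * (cnj (ex (dot d (rvec n) y)) * ex (dot d (rvec (\<lambda>i\<in>{..<d}. m i + n i)) y))
       = f (shift d (rvec m) (shift d (rvec n) x)) * ex (dot d (rvec m) y)"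
      by (simp add: sh ex_add)
  next
    fix m assume m: "m \<in> {m. m \<in> Zd d \<and> f (shift d (rvec m) x) \<noteq> 0}"
    show eq: "(\<lambda>i\<in>{..<d}. (\<lambda>i\<in>{..<d}. m i - n i) i + n i) = m"
      using m by (auto simp: Zd_def PiE_def extensional_def fun_eq_iff)
    show "(\<lambda>i\<in>{..<d}. m i - n i) \<in> {m. m \<in> Zd d \<and> f (shift d (rvec m) (shift d (rvec n) x)) \<noteq> 0}"
      using m unfolding mem_Collect_eq sh eq by (simp add: Zd_def)
  qed
  also have "\<dots> = cnj (ex (dot d (rvec n) y)) * zak d f (x, y)"
    by (simp add: zak_def sum_distrib_left mult_ac)
  finally show "zak d f (shift d (rvec n) x, y) = cnj (ex (dot d (rvec n) y)) * zak d f (x, y)" .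
  show "zak d f (x, shift d (rvec n) y) = zak d f (x, y)"
    by (simp add: zak_def dot_shift ex_diff)
qed

definition tf_shift :: "nat \<Rightarrow> (nat \<Rightarrow> real) \<Rightarrow> (nat \<Rightarrow> real) \<Rightarrow> ((nat \<Rightarrow> real) \<Rightarrow> complex) \<Rightarrow> (nat \<Rightarrow> real) \<Rightarrow> complex" where
  "tf_shift d u v f x = ex (dot d v x) * f (shift d u x)"

text \<open>The time-frequency shift as it acts on Zak transforms: a translation in both variables,
with a phase from the modulation.\<close>

definition zak_shift :: "nat \<Rightarrow> (nat \<Rightarrow> real) \<Rightarrow> (nat \<Rightarrow> real) \<Rightarrow> ((nat \<Rightarrow> real) \<times> (nat \<Rightarrow> real) \<Rightarrow> complex)
    \<Rightarrow> (nat \<Rightarrow> real) \<times> (nat \<Rightarrow> real) \<Rightarrow> complex" where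
  "zak_shift d u v \<zeta> z = ex (dot d v (fst z)) * \<zeta> (shift d u (fst z), shift d v (snd z))"

lemma zak_tf_shift: "zak d (tf_shift d u v f) z = zak_shift d u v (zak d f) z"
proof -
  obtain x y where z: "z = (x, y)" by fastforce
  have sh: "shift d u (shift d (rvec m) x) = shift d (rvec m) (shift d u x)" for m
    unfolding shift_shift by (simp add: add.commute)
  have "ex (dot d v (shift d (rvec m) x)) * ex (dot d (rvec m) y) = ex (dot d v x) * ex (dot d (rvec m) (shift d v y))" for m
    unfolding ex_add[symmetric] dot_shift
    by (rule arg_cong[where f=ex]) (simp add: dot_commute[of d v "rvec m"])
  then have "tf_shift d u v f (shift d (rvec m) x) * ex (dot d (rvec m) y)
      = ex (dot d v x) * (f (shift d (rvec m) (shift d u x)) * ex (dot d (rvec m) (shift d v y)))" for m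
    unfolding tf_shift_def sh by (metis mult.assoc mult.commute)
  then show ?thesis unfolding z zak_shift_def zak_def
    by (simp add: sum_distrib_left) (simp add: tf_shift_def sh)
qed

lemma zak_sum:
  assumes "finite J" "\<And>j. j \<in> J \<Longrightarrow> bounded_support d N (f j)"
  shows "zak d (\<lambda>x. \<Sum>j\<in>J. c j * f j x) z = (\<Sum>j\<in>J. c j * zak d (f j) z)"
proof -
  obtain x y where z: "z = (x, y)" by fastforce
  define F where "F = (\<Union>j\<in>J. {m. m \<in> Zd d \<and> f j (shift d (rvec m) x) \<noteq> 0})"
  have F: "finite F" "F \<subseteq> Zd d" 
    using assms(1) bounded_support_finite[OF assms(2)] by (auto simp: F_def)
  have "zak d (\<lambda>x. \<Sum>j\<in>J. c j * f j x) (x, y) = (\<Sum>m\<in>F. (\<Sum>j\<in>J. c j * f j (shift d (rvec m) x)) * ex (dot d (rvec m) y))"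
  proof (rule zak_eq_sum[OF F])
    fix m assume m: "m \<in> Zd d" "(\<Sum>j\<in>J. c j * f j (shift d (rvec m) x)) \<noteq> 0"
    then obtain j where "j \<in> J" "c j * f j (shift d (rvec m) x) \<noteq> 0" by (meson sum.neutral)
    then show "m \<in> F" using m(1) by (auto simp: F_def)
  qed
  also have "\<dots> = (\<Sum>j\<in>J. c j * (\<Sum>m\<in>F. f j (shift d (rvec m) x) * ex (dot d (rvec m) y)))"
    unfolding sum_distrib_right sum_distrib_left by (subst sum.swap) (simp add: mult.assoc)
  also have "\<dots> = (\<Sum>j\<in>J. c j * zak d (f j) (x, y))"
  proof (rule sum.cong[OF refl])
    fix j assume j: "j \<in> J"
    have "zak d (f j) (x, y) = (\<Sum>m\<in>F. f j (shift d (rvec m) x) * ex (dot d (rvec m) y))"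
      by (rule zak_eq_sum[OF F]) (use j in \<open>auto simp: F_def\<close>)
    then show "c j * (\<Sum>m\<in>F. f j (shift d (rvec m) x) * ex (dot d (rvec m) y)) = c j * zak d (f j) (x, y)" by simp
  qed
  finally show ?thesis using z by simp
qed

text \<open>The summation range of the Zak transform depends on the point, but at each point the
sums over the boxes \<open>Zbox d K\<close> are eventually constant.\<close>

lemma zak_measurable:
  assumes f[measurable]: "f \<in> borel_measurable (Rd d)" and b: "bounded_support d N f"
  shows "zak d f \<in> borel_measurable (Rd d \<Otimes>\<^sub>M Rd d)"
proof (rule borel_measurable_LIMSEQ_metric)
  fix K :: nat
  show "(\<lambda>z. \<Sum>m\<in>Zbox d K. f (shift d (rvec m) (fst z)) * ex (dot d (rvec m) (snd z))) \<in> borel_measurable (Rd d \<Otimes>\<^sub>M Rd d)"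
    by measurable
next
  fix z :: "(nat \<Rightarrow> real) \<times> (nat \<Rightarrow> real)"
  obtain x y where z: "z = (x, y)" by fastforce
  obtain M :: nat where M: "\<forall>i<d. \<bar>x i\<bar> \<le> real M" using coordinates_bounded by blast
  have "(\<Sum>m\<in>Zbox d K. f (shift d (rvec m) x) * ex (dot d (rvec m) y)) = zak d f (x, y)" if "K \<ge> N + M" for K
    by (rule zak_eq_sum[symmetric, OF Zbox]) (use bounded_support_lattice[OF b] M that in auto)
  then show "(\<lambda>K. \<Sum>m\<in>Zbox d K. f (shift d (rvec m) (fst z)) * ex (dot d (rvec m) (snd z))) \<longlonglongrightarrow> zak d f z"
    unfolding z by (intro tendsto_eventually) (auto simp: eventually_sequentially)
qed

lemma zak_cube_sum:
  assumes "bounded_support d N f" "x \<in> cube d"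
  shows "zak d f (x, y) = (\<Sum>m\<in>Zbox d (N + 1). f (shift d (rvec m) x) * chr d m y)"
  unfolding chr_def
proof (rule zak_eq_sum[OF Zbox])
  have "\<bar>x i\<bar> \<le> real 1" if "i < d" for i using assms(2) that unfolding cube_def PiE_iff by (force intro: less_imp_le)
  then show "\<And>m. m \<in> Zd d \<Longrightarrow> f (shift d (rvec m) x) \<noteq> 0 \<Longrightarrow> m \<in> Zbox d (N + 1)"
    using bounded_support_lattice[OF assms(1), of x 1 "N + 1"] by auto
qed

text \<open>For fixed \<open>x\<close> the Zak transform is a trigonometric polynomial in
\<open>y\<close> whose coefficients are the values of \<open>f\<close> at the lattice translates of
\<open>x\<close>.  Parseval's identity in \<open>y\<close> and the tiling of the space in
\<open>x\<close> give the claim.\<close>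

lemma norm_zak:
  assumes f: "f \<in> L2 (Rd d)" and b: "bounded_support d N f"
  shows "zak d f \<in> L2 (torus d) \<and> norm_L2 (torus d) (zak d f) = norm_L2 (Rd d) f"
proof (rule norm_L2_nn_eq)
  have fm[measurable]: "f \<in> borel_measurable (Rd d)" using f by (rule L2_measurable)
  have zm[measurable]: "zak d f \<in> borel_measurable (Rd d \<Otimes>\<^sub>M Rd d)" by (rule zak_measurable[OF fm b])
  show "zak d f \<in> borel_measurable (torus d)" by simp
  have "(\<integral>\<^sup>+z. ennreal ((cmod (zak d f z))\<^sup>2) \<partial>torus d)
      = (\<integral>\<^sup>+x. (\<integral>\<^sup>+y. ennreal ((cmod (zak d f (x, y)))\<^sup>2) \<partial>cube_measure d) \<partial>cube_measure d)"
    by (rule nn_integral_torus) measurable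
  also have "\<dots> = (\<integral>\<^sup>+x. (\<integral>\<^sup>+m. ennreal ((cmod (f (shift d (rvec m) x)))\<^sup>2) \<partial>count_space (Zd d)) \<partial>cube_measure d)"
  proof (rule nn_integral_cong_AE, use AE_cube_measure in eventually_elim)
    fix x assume x: "x \<in> cube d"
    let ?F = "Zbox d (N + 1)"
    have "(\<integral>\<^sup>+y. ennreal ((cmod (zak d f (x, y)))\<^sup>2) \<partial>cube_measure d)
       = ennreal ((norm_L2 (cube_measure d) (\<lambda>y. \<Sum>m\<in>?F. f (shift d (rvec m) x) * chr d m y))\<^sup>2)"
      unfolding zak_cube_sum[OF b x] by (rule norm_L2_nn) (intro L2_sum L2_cmult chr_L2)
    also have "\<dots> = ennreal (\<Sum>m\<in>?F. (cmod (f (shift d (rvec m) x)))\<^sup>2)"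
      by (simp add: norm_orthonormal_sum[OF orthonormal_chr Zbox])
    also have "\<dots> = (\<Sum>m\<in>?F. ennreal ((cmod (f (shift d (rvec m) x)))\<^sup>2))" by (simp add: sum_ennreal)
    also have "\<dots> = (\<integral>\<^sup>+m. ennreal ((cmod (f (shift d (rvec m) x)))\<^sup>2) \<partial>count_space (Zd d))"
    proof (rule nn_integral_count_space'[symmetric, OF Zbox(1) _ Zbox(2)])
      have "\<bar>x i\<bar> \<le> real 1" if "i < d" for i using x that unfolding cube_def PiE_iff by (force intro: less_imp_le)
      then show "ennreal ((cmod (f (shift d (rvec m) x)))\<^sup>2) = 0" if "m \<in> Zd d" "m \<notin> ?F" for m
        using bounded_support_lattice[OF b, of x 1 "N + 1" m] that by auto
    qed
    finally show "(\<integral>\<^sup>+y. ennreal ((cmod (zak d f (x, y)))\<^sup>2) \<partial>cube_measure d)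
       = (\<integral>\<^sup>+m. ennreal ((cmod (f (shift d (rvec m) x)))\<^sup>2) \<partial>count_space (Zd d))" .
  qed
  also have "\<dots> = (\<integral>\<^sup>+x. ennreal ((cmod (f x))\<^sup>2) \<partial>Rd d)"
    by (rule nn_integral_Rd_tiling'[symmetric]) measurable
  also have "\<dots> = ennreal ((norm_L2 (Rd d) f)\<^sup>2)" by (rule norm_L2_nn[OF f])
  finally show "(\<integral>\<^sup>+z. ennreal ((cmod (zak d f z))\<^sup>2) \<partial>torus d) = ennreal ((norm_L2 (Rd d) f)\<^sup>2)" .
qed simp

lemma tf_shift_L2:
  assumes f: "f \<in> L2 (Rd d)"
  shows "tf_shift d u v f \<in> L2 (Rd d) \<and> norm_L2 (Rd d) (tf_shift d u v f) = norm_L2 (Rd d) f"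
proof (rule norm_L2_nn_eq)
  have fm[measurable]: "f \<in> borel_measurable (Rd d)" using f by (rule L2_measurable)
  show "tf_shift d u v f \<in> borel_measurable (Rd d)" unfolding tf_shift_def[abs_def] by measurable
  have "(\<integral>\<^sup>+x. ennreal ((cmod (tf_shift d u v f x))\<^sup>2) \<partial>Rd d) = (\<integral>\<^sup>+x. ennreal ((cmod (f (shift d u x)))\<^sup>2) \<partial>Rd d)"
    by (simp add: tf_shift_def norm_mult)
  also have "\<dots> = (\<integral>\<^sup>+x. ennreal ((cmod (f x))\<^sup>2) \<partial>Rd d)" by (rule nn_integral_Rd_shift) measurable
  also have "\<dots> = ennreal ((norm_L2 (Rd d) f)\<^sup>2)" by (rule norm_L2_nn[OF f])
  finally show "(\<integral>\<^sup>+x. ennreal ((cmod (tf_shift d u v f x))\<^sup>2) \<partial>Rd d) = ennreal ((norm_L2 (Rd d) f)\<^sup>2)" .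
qed simp

text \<open>The modulus of a quasiperiodic function is periodic, so that its integral over the torus
is invariant under translations.\<close>

lemma zak_shift_L2:
  assumes h: "h \<in> L2 (torus d)" and q: "quasiperiodic d h"
  shows "zak_shift d u v h \<in> L2 (torus d) \<and> norm_L2 (torus d) (zak_shift d u v h) = norm_L2 (torus d) h"
proof (rule norm_L2_nn_eq)
  have hm[measurable]: "h \<in> borel_measurable (Rd d \<Otimes>\<^sub>M Rd d)" using h by (auto dest: L2_measurable)
  have "zak_shift d u v h \<in> borel_measurable (Rd d \<Otimes>\<^sub>M Rd d)" unfolding zak_shift_def[abs_def] by measurable
  then show "zak_shift d u v h \<in> borel_measurable (torus d)" by simp
  have "(\<integral>\<^sup>+z. ennreal ((cmod (zak_shift d u v h z))\<^sup>2) \<partial>torus d)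
     = (\<integral>\<^sup>+z. (\<lambda>z. ennreal ((cmod (h z))\<^sup>2)) (shift d u (fst z), shift d v (snd z)) \<partial>torus d)"
    by (simp add: zak_shift_def norm_mult)
  also have "\<dots> = (\<integral>\<^sup>+z. ennreal ((cmod (h z))\<^sup>2) \<partial>torus d)"
    by (rule nn_integral_torus_shift) (use q in \<open>auto simp: quasiperiodic_def norm_mult\<close>)
  also have "\<dots> = ennreal ((norm_L2 (torus d) h)\<^sup>2)" by (rule norm_L2_nn[OF h])
  finally show "(\<integral>\<^sup>+z. ennreal ((cmod (zak_shift d u v h z))\<^sup>2) \<partial>torus d) = ennreal ((norm_L2 (torus d) h)\<^sup>2)" .
qed simp

definition cutoff :: "nat \<Rightarrow> nat \<Rightarrow> ((nat \<Rightarrow> real) \<Rightarrow> complex) \<Rightarrow> (nat \<Rightarrow> real) \<Rightarrow> complex" where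
  "cutoff d N f x = (if \<forall>i<d. \<bar>x i\<bar> \<le> real N then f x else 0)"

lemma bounded_support_cutoff: "bounded_support d N (cutoff d N f)"
  by (auto simp: bounded_support_def cutoff_def)

lemma cutoff_measurable:
  assumes [measurable]: "f \<in> borel_measurable (Rd d)"
  shows "cutoff d N f \<in> borel_measurable (Rd d)"
proof -
  have c[measurable]: "(\<lambda>x. x i) \<in> borel_measurable (Rd d)" if "i \<in> {..<d}" for i
    by (rule measurable_Rd_component[OF measurable_ident_sets[OF refl]]) (use that in simp)
  have "Measurable.pred (Rd d) (\<lambda>x. \<forall>i\<in>{..<d}. \<bar>x i\<bar> \<le> real N)"
    by (intro pred_intros_finite) measurable
  then have [measurable]: "Measurable.pred (Rd d) (\<lambda>x. \<forall>i<d. \<bar>x i\<bar> \<le> real N)" by (simp add: Ball_def)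
  show ?thesis unfolding cutoff_def[abs_def] by measurable
qed

lemma cutoff_L2: "f \<in> L2 (Rd d) \<Longrightarrow> cutoff d N f \<in> L2 (Rd d)"
  by (rule L2_dominated[where g=f and c=1]) (auto simp: cutoff_def dest: L2_measurable intro: cutoff_measurable)

lemma cutoff_tendsto: "(\<lambda>N. cutoff d N f x) \<longlonglongrightarrow> f x"
proof (rule tendsto_eventually)
  obtain M :: nat where M: "\<forall>i<d. \<bar>x i\<bar> \<le> real M" using coordinates_bounded by blast
  have "cutoff d N f x = f x" if "N \<ge> M" for N
    using M that by (auto simp: cutoff_def intro: order_trans)
  then show "\<forall>\<^sub>F N in sequentially. cutoff d N f x = f x" by (auto simp: eventually_sequentially)
qed

lemma cutoff_converges:
  assumes f: "f \<in> L2 (Rd d)"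
  shows "(\<lambda>N. norm_L2 (Rd d) (\<lambda>x. cutoff d N f x - f x)) \<longlonglongrightarrow> 0"
proof (rule L2_dominated_convergence[where b="\<lambda>x. (cmod (f x))\<^sup>2"])
  show "AE x in Rd d. (cmod (cutoff d n f x - f x))\<^sup>2 \<le> (cmod (f x))\<^sup>2" for n
    by (rule AE_I2) (auto simp: cutoff_def)
qed (use f cutoff_tendsto in \<open>auto dest: L2_measurable L2_integrable_square intro: cutoff_measurable\<close>)

text \<open>The Zak transform of a square integrable \<open>g\<close> is the limit of those of
cutoffs of \<open>g\<close>.  Cutoffs that converge geometrically fast make it a pointwise limit
almost everywhere as well.  The isometry is stated for all linear combinations of shifts, because it
then determines their inner products.\<close>

lemma zak_limit_exists:
  assumes g: "g \<in> L2 (Rd d)"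
  shows "\<exists>\<zeta>\<in>L2 (torus d). quasiperiodic d \<zeta> \<and>
    (\<forall>J (c :: 'j \<Rightarrow> complex) u v. finite J \<longrightarrow>
      norm_L2 (Rd d) (\<lambda>x. \<Sum>j\<in>J. c j * tf_shift d (u j) (v j) g x)
      = norm_L2 (torus d) (\<lambda>z. \<Sum>j\<in>J. c j * zak_shift d (u j) (v j) \<zeta> z))"
proof -
  have "\<forall>k::nat. \<exists>N. norm_L2 (Rd d) (\<lambda>x. cutoff d N g x - g x) \<le> (1/2)^k / 2"
  proof
    fix k :: nat
    have "0 < (1/2)^k / (2::real)" by simp
    from LIMSEQ_D[OF cutoff_converges[OF g] this] show "\<exists>N. norm_L2 (Rd d) (\<lambda>x. cutoff d N g x - g x) \<le> (1/2)^k / 2"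
      by (auto intro: less_imp_le)
  qed
  then obtain r where r: "\<And>k. norm_L2 (Rd d) (\<lambda>x. cutoff d (r k) g x - g x) \<le> (1/2)^k / 2"
    unfolding choice_iff by blast
  define h where "h k = cutoff d (r k) g" for k
  have hL: "h k \<in> L2 (Rd d)" and hb: "bounded_support d (r k) (h k)" for k
    using cutoff_L2[OF g] bounded_support_cutoff by (auto simp: h_def)
  define Z where "Z k = zak d (h k)" for k
  have ZL: "Z k \<in> L2 (torus d)" for k using norm_zak[OF hL hb] by (simp add: Z_def)
  have hm: "h k \<in> borel_measurable (Rd d)" for k using hL by (rule L2_measurable)
  have [measurable]: "Z k \<in> borel_measurable (Rd d \<Otimes>\<^sub>M Rd d)" for k unfolding Z_def by (rule zak_measurable[OF hm hb])
  have iso: "norm_L2 (Rd d) (\<lambda>x. \<Sum>j\<in>J. c j * tf_shift d (u j) (v j) (h (k j)) x)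
      = norm_L2 (torus d) (\<lambda>z. \<Sum>j\<in>J. c j * zak_shift d (u j) (v j) (Z (k j)) z)" if J: "finite J"
    for J and c :: "'k \<Rightarrow> complex" and u v k
  proof -
    have "\<exists>N. \<forall>j\<in>J. bounded_support d N (tf_shift d (u j) (v j) (h (k j)))"
    proof -
      have "\<forall>j. \<exists>M::nat. \<forall>i<d. \<bar>u j i\<bar> \<le> real M" using coordinates_bounded by blast
      then obtain M where M: "\<And>j. \<forall>i<d. \<bar>u j i\<bar> \<le> real (M j)" by metis
      let ?N = "\<Sum>j\<in>J. r (k j) + M j"
      have "bounded_support d ?N (tf_shift d (u j) (v j) (h (k j)))" if j: "j \<in> J" for j
        unfolding bounded_support_def
      proof (intro ballI impI allI)
        fix x i assume x: "tf_shift d (u j) (v j) (h (k j)) x \<noteq> 0" and i: "i < d"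
        then have "h (k j) (shift d (u j) x) \<noteq> 0" by (simp add: tf_shift_def)
        then have "\<bar>shift d (u j) x i\<bar> \<le> real (r (k j))" using hb[of "k j"] i by (auto simp: bounded_support_def)
        then have "\<bar>x i\<bar> \<le> real (r (k j) + M j)" using M[rule_format, of i j] i by (simp add: shift_def)
        also have "r (k j) + M j \<le> ?N" by (rule member_le_sum) (use j J in auto)
        finally show "\<bar>x i\<bar> \<le> real ?N" by simp
      qed
      then show ?thesis by blast
    qed
    then obtain N where N: "\<And>j. j \<in> J \<Longrightarrow> bounded_support d N (tf_shift d (u j) (v j) (h (k j)))" by blast
    let ?f = "\<lambda>x. \<Sum>j\<in>J. c j * tf_shift d (u j) (v j) (h (k j)) x"
    have "?f \<in> L2 (Rd d)" using tf_shift_L2[OF hL] by (intro L2_sum L2_cmult) auto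
    moreover have "bounded_support d N ?f"
      unfolding bounded_support_def
    proof (intro ballI impI)
      fix x assume x: "x \<in> space (Rd d)" "?f x \<noteq> 0"
      then obtain j where "j \<in> J" "c j * tf_shift d (u j) (v j) (h (k j)) x \<noteq> 0" by (meson sum.neutral)
      then show "\<forall>i<d. \<bar>x i\<bar> \<le> real N" using N[of j] x(1) by (auto simp: bounded_support_def)
    qed
    ultimately have "norm_L2 (torus d) (zak d ?f) = norm_L2 (Rd d) ?f" using norm_zak by blast
    moreover have "zak d ?f = (\<lambda>z. \<Sum>j\<in>J. c j * zak_shift d (u j) (v j) (Z (k j)) z)"
      by (rule ext, subst zak_sum[where f="\<lambda>j. tf_shift d (u j) (v j) (h (k j))", OF J N])
         (simp_all add: zak_tf_shift Z_def)
    ultimately show ?thesis by simp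
  qed
  have fast: "norm_L2 (torus d) (\<lambda>z. Z (Suc k) z - Z k z) \<le> (1/2)^k" for k
  proof -
    have sp: "z \<in> space (torus d) \<Longrightarrow> zak_shift d (\<lambda>_. 0) (\<lambda>_. 0) w z = w z" for w z
      by (auto simp: zak_shift_def space_torus shift_0 dot_def)
    have sp': "x \<in> space (Rd d) \<Longrightarrow> tf_shift d (\<lambda>_. 0) (\<lambda>_. 0) w x = w x" for w x
      by (auto simp: tf_shift_def shift_0 dot_def)
    have "norm_L2 (torus d) (\<lambda>z. Z (Suc k) z - Z k z) = norm_L2 (Rd d) (\<lambda>x. h (Suc k) x - h k x)"
    proof -
      let ?c = "\<lambda>b. if b then 1 else - 1 :: complex" and ?k = "\<lambda>b. if b then Suc k else k"
      have "norm_L2 (torus d) (\<lambda>z. \<Sum>b\<in>UNIV. ?c b * zak_shift d (\<lambda>_. 0) (\<lambda>_. 0) (Z (?k b)) z) = norm_L2 (torus d) (\<lambda>z. Z (Suc k) z - Z k z)"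
        unfolding norm_L2_def
        by (intro arg_cong[where f=sqrt] Bochner_Integration.integral_cong) (auto simp: UNIV_bool sp norm_minus_commute)
      moreover have "norm_L2 (Rd d) (\<lambda>x. \<Sum>b\<in>UNIV. ?c b * tf_shift d (\<lambda>_. 0) (\<lambda>_. 0) (h (?k b)) x) = norm_L2 (Rd d) (\<lambda>x. h (Suc k) x - h k x)"
        unfolding norm_L2_def
        by (intro arg_cong[where f=sqrt] Bochner_Integration.integral_cong) (auto simp: UNIV_bool sp' norm_minus_commute)
      ultimately show ?thesis using iso[of UNIV ?c "\<lambda>_ _. 0" "\<lambda>_ _. 0" ?k] by simp
    qed
    also have "\<dots> \<le> (1/2)^Suc k / 2 + (1/2)^k / 2"
      using norm_L2_diff_triangle[OF hL[of "Suc k"] g hL[of k]] r[of "Suc k"] r[of k]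
      by (simp add: h_def norm_L2_minus_commute[of _ g])
    also have "\<dots> \<le> (1/2)^k" by simp
    finally show ?thesis .
  qed
  \<comment> \<open>the set of convergence is invariant under lattice translations, so the value \<open>0\<close> elsewhere keeps \<open>\<zeta>\<close> quasiperiodic at every point\<close>
  define \<zeta> where "\<zeta> z = (if convergent (\<lambda>k. Z k z) then lim (\<lambda>k. Z k z) else 0)" for z
  have [measurable]: "Measurable.pred (Rd d \<Otimes>\<^sub>M Rd d) (\<lambda>z. convergent (\<lambda>k. Z k z))"
    unfolding Cauchy_convergent_iff[symmetric] pred_def by (rule sets_Collect_Cauchy) measurable
  have zm: "\<zeta> \<in> borel_measurable (torus d)"
    unfolding \<zeta>_def[abs_def] by simp measurable
  have conv: "AE z in torus d. (\<lambda>k. Z k z) \<longlonglongrightarrow> \<zeta> z"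
    using L2_fast_cauchy_AE[OF ZL fast] by eventually_elim (simp add: \<zeta>_def convergent_LIMSEQ_iff)
  note zlim = L2_cauchy_limit_AE[OF ZL fast_cauchy_imp_cauchy[OF ZL fast] zm conv]
  have Zq: "quasiperiodic d (Z k)" for k unfolding Z_def by (rule zak_quasiperiodic)
  have zq: "quasiperiodic d \<zeta>"
    unfolding quasiperiodic_def
  proof (intro ballI conjI)
    fix n x y assume n: "n \<in> Zd d" "x \<in> space (Rd d)" "y \<in> space (Rd d)"
    let ?c = "cnj (ex (dot d (rvec n) y))"
    have c: "?c \<noteq> 0" by simp
    have e1: "Z k (shift d (rvec n) x, y) = ?c * Z k (x, y)" and e2: "Z k (x, shift d (rvec n) y) = Z k (x, y)" for k
      using Zq[of k] n by (auto simp: quasiperiodic_def)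
    show "\<zeta> (x, shift d (rvec n) y) = \<zeta> (x, y)" by (simp add: \<zeta>_def e2)
    show "\<zeta> (shift d (rvec n) x, y) = ?c * \<zeta> (x, y)"
    proof (cases "convergent (\<lambda>k. Z k (x, y))")
      case True
      then have "(\<lambda>k. Z k (x, y)) \<longlonglongrightarrow> \<zeta> (x, y)" by (simp add: \<zeta>_def convergent_LIMSEQ_iff)
      then have "(\<lambda>k. ?c * Z k (x, y)) \<longlonglongrightarrow> ?c * \<zeta> (x, y)" by (intro tendsto_intros)
      then show ?thesis using limI convergentI unfolding \<zeta>_def[of "(shift d (rvec n) x, y)"] e1 by metis
    next
      case False
      then have "\<not> convergent (\<lambda>k. ?c * Z k (x, y))"
        using convergent_mult_const_iff[OF c, of "\<lambda>k. Z k (x, y)"] by simp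
      then show ?thesis using False by (simp add: \<zeta>_def e1)
    qed
  qed
  have "norm_L2 (Rd d) (\<lambda>x. \<Sum>j\<in>J. c j * tf_shift d (u j) (v j) g x)
      = norm_L2 (torus d) (\<lambda>z. \<Sum>j\<in>J. c j * zak_shift d (u j) (v j) \<zeta> z)" if J: "finite J" for J and c :: "'j \<Rightarrow> complex" and u v
  proof -
    let ?C = "\<Sum>j\<in>J. cmod (c j)"
    let ?f = "\<lambda>w x. \<Sum>j\<in>J. c j * tf_shift d (u j) (v j) w x"
    let ?z = "\<lambda>w x. \<Sum>j\<in>J. c j * zak_shift d (u j) (v j) w x"
    have fL: "?f w \<in> L2 (Rd d)" if "w \<in> L2 (Rd d)" for w
      using tf_shift_L2[OF that] by (intro L2_sum L2_cmult) auto
    have zL: "?z w \<in> L2 (torus d)" if "w \<in> L2 (torus d)" "quasiperiodic d w" for w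
      using zak_shift_L2[OF that] by (intro L2_sum L2_cmult) auto
    have f1: "\<bar>norm_L2 (Rd d) (?f (h k)) - norm_L2 (Rd d) (?f g)\<bar> \<le> ?C * norm_L2 (Rd d) (\<lambda>x. h k x - g x)" for k
    proof -
      have D: "(\<lambda>x. h k x - g x) \<in> L2 (Rd d)" by (intro L2_diff hL g)
      have "norm_L2 (Rd d) (\<lambda>x. ?f (h k) x - ?f g x) = norm_L2 (Rd d) (?f (\<lambda>x. h k x - g x))"
        by (simp add: tf_shift_def right_diff_distrib sum_subtractf)
      also have "\<dots> \<le> (\<Sum>j\<in>J. norm_L2 (Rd d) (\<lambda>x. c j * tf_shift d (u j) (v j) (\<lambda>x. h k x - g x) x))"
        by (rule norm_L2_sum_le) (use tf_shift_L2[OF D] in \<open>auto intro: L2_cmult\<close>)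
      also have "\<dots> = ?C * norm_L2 (Rd d) (\<lambda>x. h k x - g x)"
        using tf_shift_L2[OF D] by (simp add: norm_L2_cmult sum_distrib_right)
      finally show ?thesis using norm_L2_triangle_diff[OF fL[OF hL[of k]] fL[OF g]] by linarith
    qed
    have z1: "\<bar>norm_L2 (torus d) (?z (Z k)) - norm_L2 (torus d) (?z \<zeta>)\<bar> \<le> ?C * norm_L2 (torus d) (\<lambda>x. Z k x - \<zeta> x)" for k
    proof -
      have D: "(\<lambda>x. Z k x - \<zeta> x) \<in> L2 (torus d)" by (intro L2_diff ZL zlim)
      have Dq: "quasiperiodic d (\<lambda>x. Z k x - \<zeta> x)"
        using Zq[of k] zq by (auto simp: quasiperiodic_def right_diff_distrib)
      have "norm_L2 (torus d) (\<lambda>x. ?z (Z k) x - ?z \<zeta> x) = norm_L2 (torus d) (?z (\<lambda>x. Z k x - \<zeta> x))"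
        by (simp add: zak_shift_def right_diff_distrib sum_subtractf)
      also have "\<dots> \<le> (\<Sum>j\<in>J. norm_L2 (torus d) (\<lambda>x. c j * zak_shift d (u j) (v j) (\<lambda>x. Z k x - \<zeta> x) x))"
        by (rule norm_L2_sum_le) (use zak_shift_L2[OF D Dq] in \<open>auto intro: L2_cmult\<close>)
      also have "\<dots> = ?C * norm_L2 (torus d) (\<lambda>x. Z k x - \<zeta> x)"
        using zak_shift_L2[OF D Dq] by (simp add: norm_L2_cmult sum_distrib_right)
      finally show ?thesis using norm_L2_triangle_diff[OF zL[OF ZL[of k] Zq] zL[OF zlim(1) zq]] by linarith
    qed
    have h0: "(\<lambda>k. norm_L2 (Rd d) (\<lambda>x. h k x - g x)) \<longlonglongrightarrow> 0"
    proof (rule tendsto_sandwich[OF _ _ tendsto_const])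
      show "(\<lambda>k. (1/2)^k / 2 :: real) \<longlonglongrightarrow> 0" using LIMSEQ_power_zero[of "1/2::real"] by (auto intro!: tendsto_eq_intros)
    qed (use r in \<open>auto simp: h_def\<close>)
    have l1: "(\<lambda>k. norm_L2 (Rd d) (?f (h k))) \<longlonglongrightarrow> norm_L2 (Rd d) (?f g)"
      by (rule LIM_zero_cancel, rule tendsto_0_le[OF h0, where K="?C"])
         (use f1 in \<open>auto simp: mult.commute\<close>)
    have l2: "(\<lambda>k. norm_L2 (torus d) (?z (Z k))) \<longlonglongrightarrow> norm_L2 (torus d) (?z \<zeta>)"
      by (rule LIM_zero_cancel, rule tendsto_0_le[OF zlim(2), where K="?C"])
         (use z1 in \<open>auto simp: mult.commute\<close>)
    have "norm_L2 (Rd d) (?f (h k)) = norm_L2 (torus d) (?z (Z k))" for k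
      using iso[OF J, of c u v "\<lambda>_. k"] by simp
    with l2 have "(\<lambda>k. norm_L2 (Rd d) (?f (h k))) \<longlonglongrightarrow> norm_L2 (torus d) (?z \<zeta>)" by simp
    from LIMSEQ_unique[OF l1 this] show ?thesis .
  qed
  then show ?thesis using zlim(1) zq by blast
qed

section \<open>The Plancherel theorem\<close>

lemma fourier_integral_ex: "fourier_integral d f \<xi> = (LINT x|Rd d. f x * cnj (ex (dot d x \<xi>)))"
  unfolding fourier_integral_def dot_def ex_minus[symmetric] ex_def by (simp add: cis_cnj)

lemma dot_measurable_pair[measurable]: "(\<lambda>p. dot d (fst p) (snd p)) \<in> borel_measurable (Rd d \<Otimes>\<^sub>M Rd d)"
  unfolding dot_def
  by (intro borel_measurable_sum borel_measurable_times measurable_Rd_component[OF measurable_fst] measurable_Rd_component[OF measurable_snd]) auto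

lemma fourier_integral_measurable:
  assumes [measurable]: "f \<in> borel_measurable (Rd d)"
  shows "fourier_integral d f \<in> borel_measurable (Rd d)"
proof -
  interpret sigma_finite_measure "Rd d" by (rule sigma_finite_Rd)
  have d[measurable]: "(\<lambda>p. dot d (snd p) (fst p)) \<in> borel_measurable (Rd d \<Otimes>\<^sub>M Rd d)"
    using dot_measurable_pair[of d] by (simp add: dot_commute[of d "snd _"])
  have "(\<lambda>\<xi>. LINT x|Rd d. f x * cnj (ex (dot d x \<xi>))) \<in> borel_measurable (Rd d)"
  proof (rule borel_measurable_lebesgue_integral)
    have "(\<lambda>p. f (snd p) * cnj (ex (dot d (snd p) (fst p)))) \<in> borel_measurable (Rd d \<Otimes>\<^sub>M Rd d)" by measurable
    then show "(\<lambda>(\<xi>, x). f x * cnj (ex (dot d x \<xi>))) \<in> borel_measurable (Rd d \<Otimes>\<^sub>M Rd d)"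
      by (simp add: case_prod_beta')
  qed
  then show ?thesis by (simp add: fourier_integral_ex[abs_def])
qed

lemma fourier_integrand_integrable:
  assumes "integrable (Rd d) f" shows "integrable (Rd d) (\<lambda>x. f x * cnj (ex (dot d x \<xi>)))"
proof (rule Bochner_Integration.integrable_bound[OF assms])
  have [measurable]: "f \<in> borel_measurable (Rd d)" using assms by auto
  show "(\<lambda>x. f x * cnj (ex (dot d x \<xi>))) \<in> borel_measurable (Rd d)" by measurable
qed (auto simp: norm_mult)

lemma fourier_integral_add:
  assumes "integrable (Rd d) f" "integrable (Rd d) g"
  shows "fourier_integral d (\<lambda>x. f x + c * g x) \<xi> = fourier_integral d f \<xi> + c * fourier_integral d g \<xi>"
  using fourier_integrand_integrable[OF assms(1), of \<xi>] fourier_integrand_integrable[OF assms(2), of \<xi>]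
  by (simp add: fourier_integral_ex distrib_right mult.assoc)

lemma fourier_integral_diff:
  assumes "integrable (Rd d) f" "integrable (Rd d) g"
  shows "fourier_integral d (\<lambda>x. f x - g x) \<xi> = fourier_integral d f \<xi> - fourier_integral d g \<xi>"
  using fourier_integral_add[OF assms, of "-1" \<xi>] by simp

lemma fourier_integral_shift:
  assumes [measurable]: "f \<in> borel_measurable (Rd d)"
  shows "fourier_integral d (\<lambda>x. f (shift d s x)) \<xi> = cnj (ex (dot d s \<xi>)) * fourier_integral d f \<xi>"
proof -
  let ?G = "\<lambda>y. cnj (ex (dot d s \<xi>)) * (f y * cnj (ex (dot d y \<xi>)))"
  have "fourier_integral d (\<lambda>x. f (shift d s x)) \<xi> = (LINT x|Rd d. ?G (shift d s x))"
    unfolding fourier_integral_ex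
    by (rule Bochner_Integration.integral_cong) (simp_all add: dot_shift_left ex_diff mult_ac)
  also have "\<dots> = (LINT x|Rd d. ?G x)" by (rule integral_Rd_shift) measurable
  finally show ?thesis by (simp add: fourier_integral_ex)
qed

lemma integrable_Rd_shift:
  fixes f :: "_ \<Rightarrow> complex"
  assumes "integrable (Rd d) f" shows "integrable (Rd d) (\<lambda>x. f (shift d s x))"
  using integrable_distr[OF shift_measurable, of d s f] assms by (simp add: Rd_shift_invariant)

lemma bounded_support_integrable:
  assumes f: "f \<in> L2 (Rd d)" and b: "bounded_support d N f"
  shows "integrable (Rd d) f"
proof -
  let ?B = "\<Pi>\<^sub>E i\<in>{..<d}. {- real N..real N}"
  have B[measurable]: "?B \<in> sets (Rd d)" unfolding Rd_def by (rule sets_PiM_I_finite) auto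
  have "emeasure (Rd d) ?B = (\<Prod>i<d. emeasure lborel {- real N..real N})"
    unfolding Rd_def by (rule lborel_product.emeasure_PiM) auto
  also have "\<dots> < \<infinity>" by (simp add: ennreal_power)
  finally have fin: "emeasure (Rd d) ?B < \<infinity>" .
  have "(indicator ?B :: _ \<Rightarrow> complex) \<in> L2 (Rd d)"
  proof -
    have "(\<lambda>x. (cmod (indicator ?B x))\<^sup>2) = (indicator ?B :: _ \<Rightarrow> real)" by (auto simp: indicator_def)
    then show ?thesis using fin by (simp add: L2_def integrable_indicator_iff)
  qed
  from L2_mult_integrable[OF f this] show ?thesis
  proof (rule Bochner_Integration.integrable_bound)
    show "f \<in> borel_measurable (Rd d)" using f by (rule L2_measurable)
    show "AE x in Rd d. norm (f x) \<le> norm (cmod (f x) * cmod (indicator ?B x))"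
    proof (rule AE_I2)
      fix x assume x: "x \<in> space (Rd d)"
      show "norm (f x) \<le> norm (cmod (f x) * cmod (indicator ?B x))"
      proof (cases "f x = 0")
        case False
        then have "\<forall>i<d. \<bar>x i\<bar> \<le> real N" using b x unfolding bounded_support_def by blast
        then have "- real N \<le> x i \<and> x i \<le> real N" if "i < d" for i using that by (metis abs_le_D1 abs_le_D2 minus_le_iff)
        then have "x \<in> ?B" using x by (auto simp: space_Rd PiE_iff)
        then show ?thesis by simp
      qed simp
    qed
  qed
qed

text \<open>The phase \<open>cnj (ex (dot d x \<xi>))\<close> turns \<open>zak d f (x,
\<xi>)\<close> into a function periodic in \<open>x\<close>, the periodization of \<open>f\<close>
times a character.  Its Fourier coefficients are integrals over the cube that unfold along the
tiling to integrals over the whole space, as in the Poisson summation formula.\<close>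

lemma zak_fourier_coefficient:
  assumes f: "f \<in> L2 (Rd d)" and b: "bounded_support d N f" and n: "n \<in> Zd d"
  shows "inner_L2 (cube_measure d) (\<lambda>x. zak d f (x, \<xi>) * cnj (ex (dot d x \<xi>))) (chr d n)
    = fourier_integral d f (shift d (rvec (\<lambda>i. - n i)) \<xi>)"
proof -
  have fm[measurable]: "f \<in> borel_measurable (Rd d)" using f by (rule L2_measurable)
  have fi: "integrable (Rd d) f" by (rule bounded_support_integrable[OF f b])
  let ?F = "Zbox d (N + 1)"
  let ?\<eta> = "shift d (rvec (\<lambda>i. - n i)) \<xi>"
  let ?w = "\<lambda>y. f y * cnj (ex (dot d y ?\<eta>))"
  have wi: "integrable (Rd d) ?w" by (rule fourier_integrand_integrable[OF fi])
  have wm[measurable]: "?w \<in> borel_measurable (Rd d)" by measurable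
  have eta: "dot d y ?\<eta> = dot d y \<xi> + dot d (rvec n) y" for y
    unfolding dot_shift dot_commute[of d "rvec n"] by (simp add: dot_def rvec_def sum_negf)
  have point: "zak d f (x, \<xi>) * cnj (ex (dot d x \<xi>)) * cnj (chr d n x) = (\<Sum>m\<in>?F. ?w (shift d (rvec m) x))" if x: "x \<in> cube d" for x
  proof -
    have "f (shift d (rvec m) x) * chr d m \<xi> * cnj (ex (dot d x \<xi>)) * cnj (chr d n x) = ?w (shift d (rvec m) x)" for m
    proof -
      have "cnj (ex (dot d (shift d (rvec m) x) ?\<eta>)) = chr d m \<xi> * cnj (ex (dot d x \<xi>)) * cnj (chr d n x)"
        unfolding eta[of "shift d (rvec m) x"] unfolding dot_shift_left dot_shift chr_def ex_add ex_diff
        by (simp add: mult_ac dot_commute[of d x])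
      then show ?thesis by (simp add: mult_ac)
    qed
    then show ?thesis unfolding zak_cube_sum[OF b x] sum_distrib_right by (intro sum.cong refl)
  qed
  have "inner_L2 (cube_measure d) (\<lambda>x. zak d f (x, \<xi>) * cnj (ex (dot d x \<xi>))) (chr d n)
      = (LINT x|cube_measure d. (\<Sum>m\<in>?F. ?w (shift d (rvec m) x)))"
    unfolding inner_L2_def
  proof (rule integral_cong_AE)
    have zm[measurable]: "zak d f \<in> borel_measurable (Rd d \<Otimes>\<^sub>M Rd d)" by (rule zak_measurable[OF fm b])
    have sx: "shift d (\<lambda>_. 0) \<xi> \<in> space (Rd d)" by simp
    have "zak d f (x, \<xi>) = zak d f (x, shift d (\<lambda>_. 0) \<xi>)" for x
      by (simp add: zak_def dot_shift) (simp add: dot_def)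
    then show "(\<lambda>x. zak d f (x, \<xi>) * cnj (ex (dot d x \<xi>)) * cnj (chr d n x)) \<in> borel_measurable (cube_measure d)"
      using measurable_Pair1[OF zm sx] by simp measurable
    show "(\<lambda>x. \<Sum>m\<in>?F. ?w (shift d (rvec m) x)) \<in> borel_measurable (cube_measure d)" by simp measurable
    show "AE x in cube_measure d. zak d f (x, \<xi>) * cnj (ex (dot d x \<xi>)) * cnj (chr d n x) = (\<Sum>m\<in>?F. ?w (shift d (rvec m) x))"
      using AE_cube_measure by eventually_elim (rule point)
  qed
  also have "\<dots> = (LINT x|Rd d. indicator (cube d) x * (\<Sum>m\<in>?F. ?w (shift d (rvec m) x)))"
    by (rule integral_cube_measure) measurable
  also have "\<dots> = (\<Sum>m\<in>?F. LINT x|Rd d. indicator (cube d) x * ?w (shift d (rvec m) x))"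
    unfolding sum_distrib_left
  proof (rule Bochner_Integration.integral_sum)
    fix m
    show "integrable (Rd d) (\<lambda>x. indicator (cube d) x * ?w (shift d (rvec m) x))"
      by (rule Bochner_Integration.integrable_bound[OF integrable_Rd_shift[OF wi]])
         (auto simp: indicator_def norm_mult)
  qed
  also have "\<dots> = (\<Sum>m\<in>?F. LINT x|Rd d. indicator (cube d) (shift d (\<lambda>i. - rvec m i) x) * ?w x)"
  proof (rule sum.cong[OF refl])
    fix m
    have "(LINT x|Rd d. indicator (cube d) (shift d (\<lambda>i. - rvec m i) x) * ?w x)
       = (LINT x|Rd d. (\<lambda>x. indicator (cube d) (shift d (\<lambda>i. - rvec m i) x) * ?w x) (shift d (rvec m) x))"
      by (rule integral_Rd_shift[symmetric]) measurable
    also have "\<dots> = (LINT x|Rd d. indicator (cube d) x * ?w (shift d (rvec m) x))"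
      by (rule Bochner_Integration.integral_cong) (auto simp: shift_inverse)
    finally show "(LINT x|Rd d. indicator (cube d) x * ?w (shift d (rvec m) x)) = (LINT x|Rd d. indicator (cube d) (shift d (\<lambda>i. - rvec m i) x) * ?w x)" by simp
  qed
  also have "\<dots> = (LINT x|Rd d. (\<Sum>m\<in>?F. indicator (cube d) (shift d (\<lambda>i. - rvec m i) x) * ?w x))"
  proof (rule Bochner_Integration.integral_sum[symmetric])
    fix m
    show "integrable (Rd d) (\<lambda>x. indicator (cube d) (shift d (\<lambda>i. - rvec m i) x) * ?w x)"
      by (rule Bochner_Integration.integrable_bound[OF wi]) (auto simp: indicator_def norm_mult)
  qed
  also have "\<dots> = (LINT x|Rd d. ?w x)"
  proof (rule Bochner_Integration.integral_cong[OF refl])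
    fix x assume x: "x \<in> space (Rd d)"
    show "(\<Sum>m\<in>?F. indicator (cube d) (shift d (\<lambda>i. - rvec m i) x) * ?w x) = ?w x"
    proof (cases "f x = 0")
      case False
      define k where "k = (\<lambda>i\<in>{..<d}. - floor_vec d x i)"
      have iff: "shift d (\<lambda>i. - rvec m i) x \<in> cube d \<longleftrightarrow> m = k" if m: "m \<in> Zd d" for m
      proof -
        have "shift d (\<lambda>i. - rvec m i) x = shift d (rvec (\<lambda>i\<in>{..<d}. - m i)) x"
          by (rule shift_cong) (simp add: rvec_def)
        then have "shift d (\<lambda>i. - rvec m i) x \<in> cube d \<longleftrightarrow> (\<lambda>i\<in>{..<d}. - m i) = floor_vec d x"
          using shift_cube_iff[OF uminus_Zd[OF m] x] by simp
        also have "\<dots> \<longleftrightarrow> m = k"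
          using m by (force simp: k_def Zd_def PiE_def extensional_def fun_eq_iff floor_vec_def)
        finally show ?thesis .
      qed
      have "k \<in> ?F"
      proof -
        have "- int (N + 1) \<le> k i \<and> k i \<le> int (N + 1)" if i: "i < d" for i
        proof -
          have "\<bar>x i\<bar> \<le> real N" using b False x i by (auto simp: bounded_support_def)
          then have "- int (N + 1) \<le> \<lfloor>x i\<rfloor>" "\<lfloor>x i\<rfloor> \<le> int (N + 1)"
            by (auto simp: le_floor_iff floor_le_iff abs_le_iff)
          then show ?thesis using i by (simp add: k_def floor_vec_def)
        qed
        then show ?thesis by (auto simp: Zbox_def k_def)
      qed
      have "(\<Sum>m\<in>?F. indicator (cube d) (shift d (\<lambda>i. - rvec m i) x) * ?w x) = (\<Sum>m\<in>?F. if m = k then ?w x else 0)"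
        by (rule sum.cong[OF refl]) (use iff Zbox(2) in \<open>auto simp: indicator_def\<close>)
      then show ?thesis using \<open>k \<in> ?F\<close> Zbox(1) by simp
    qed simp
  qed
  finally show ?thesis by (simp add: fourier_integral_ex)
qed

text \<open>For fixed \<open>\<xi>\<close> the values of the Fourier transform on the coset of
\<open>\<xi>\<close> are the Fourier coefficients of the Zak transform in its first variable.
Parseval's identity, integrated over \<open>\<xi>\<close> in the cube, equates the norm of the
Fourier transform with that of the Zak transform.\<close>

lemma plancherel_bounded_support:
  assumes f: "f \<in> L2 (Rd d)" and b: "bounded_support d N f"
  shows "fourier_integral d f \<in> L2 (Rd d) \<and> norm_L2 (Rd d) (fourier_integral d f) = norm_L2 (Rd d) f"
proof (rule norm_L2_nn_eq)
  have fm[measurable]: "f \<in> borel_measurable (Rd d)" using f by (rule L2_measurable)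
  have Fm[measurable]: "fourier_integral d f \<in> borel_measurable (Rd d)" by (rule fourier_integral_measurable[OF fm])
  show "fourier_integral d f \<in> borel_measurable (Rd d)" by (rule Fm)
  have zm[measurable]: "zak d f \<in> borel_measurable (Rd d \<Otimes>\<^sub>M Rd d)" by (rule zak_measurable[OF fm b])
  have "(\<integral>\<^sup>+\<xi>. ennreal ((cmod (fourier_integral d f \<xi>))\<^sup>2) \<partial>Rd d)
     = (\<integral>\<^sup>+\<xi>. (\<integral>\<^sup>+n. ennreal ((cmod (fourier_integral d f (shift d (rvec (\<lambda>i. - n i)) \<xi>)))\<^sup>2) \<partial>count_space (Zd d)) \<partial>cube_measure d)"
    by (rule nn_integral_Rd_tiling) measurable
  also have "\<dots> = (\<integral>\<^sup>+\<xi>. (\<integral>\<^sup>+x. ennreal ((cmod (zak d f (x, \<xi>)))\<^sup>2) \<partial>cube_measure d) \<partial>cube_measure d)"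
  proof (rule nn_integral_cong)
    fix \<xi> assume "\<xi> \<in> space (cube_measure d)"
    then have xi: "\<xi> \<in> space (Rd d)" by simp
    let ?P = "\<lambda>x. zak d f (x, \<xi>) * cnj (ex (dot d x \<xi>))"
    have zx[measurable]: "(\<lambda>x. zak d f (x, \<xi>)) \<in> borel_measurable (Rd d)" by (rule measurable_Pair1[OF zm xi])
    have PL: "?P \<in> L2 (cube_measure d)"
    proof -
      let ?q = "\<lambda>m x. f (shift d (rvec m) x)"
      have q: "?q m \<in> L2 (cube_measure d)" for m
      proof -
        have "?q m \<in> L2 (Rd d)" using tf_shift_L2[OF f, of "rvec m" "\<lambda>_. 0"] by (simp add: tf_shift_def[abs_def] dot_def)
        then have fin: "(\<integral>\<^sup>+x. ennreal ((cmod (?q m x))\<^sup>2) \<partial>Rd d) < \<infinity>" by (subst (asm) L2_iff_nn) auto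
        have "(\<integral>\<^sup>+x. ennreal ((cmod (?q m x))\<^sup>2) \<partial>cube_measure d) = (\<integral>\<^sup>+x. indicator (cube d) x * ennreal ((cmod (?q m x))\<^sup>2) \<partial>Rd d)"
          by (rule nn_integral_cube_measure) measurable
        also have "\<dots> \<le> (\<integral>\<^sup>+x. ennreal ((cmod (?q m x))\<^sup>2) \<partial>Rd d)" by (rule nn_integral_mono) (auto simp: indicator_def)
        finally show ?thesis using fin by (subst L2_iff_nn) (auto intro: order.strict_trans1)
      qed
      have sL: "(\<lambda>x. \<Sum>m\<in>Zbox d (N + 1). chr d m \<xi> * ?q m x) \<in> L2 (cube_measure d)"
        by (intro L2_sum L2_cmult q)
      have "(\<integral>\<^sup>+x. ennreal ((cmod (?P x))\<^sup>2) \<partial>cube_measure d) = (\<integral>\<^sup>+x. ennreal ((cmod (\<Sum>m\<in>Zbox d (N + 1). chr d m \<xi> * ?q m x))\<^sup>2) \<partial>cube_measure d)"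
        by (rule nn_integral_cong_AE, use AE_cube_measure in eventually_elim)
           (simp add: norm_mult zak_cube_sum[OF b] mult.commute)
      also have "\<dots> < \<infinity>" using sL by (subst (asm) L2_iff_nn[OF L2_measurable[OF sL]])
      finally show ?thesis by (subst L2_iff_nn) (simp_all, measurable)
    qed
    have "(\<integral>\<^sup>+n. ennreal ((cmod (fourier_integral d f (shift d (rvec (\<lambda>i. - n i)) \<xi>)))\<^sup>2) \<partial>count_space (Zd d))
      = (\<integral>\<^sup>+n. ennreal ((cmod (inner_L2 (cube_measure d) ?P (chr d n)))\<^sup>2) \<partial>count_space (Zd d))"
      by (rule nn_integral_cong) (simp add: zak_fourier_coefficient[OF f b])
    also have "\<dots> = ennreal ((norm_L2 (cube_measure d) ?P)\<^sup>2)"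
      by (rule parseval_orthonormal[OF orthonormal_chr approx_cube_all[OF PL] countable_Zd])
    also have "\<dots> = (\<integral>\<^sup>+x. ennreal ((cmod (?P x))\<^sup>2) \<partial>cube_measure d)" by (rule norm_L2_nn[OF PL, symmetric])
    finally show "(\<integral>\<^sup>+n. ennreal ((cmod (fourier_integral d f (shift d (rvec (\<lambda>i. - n i)) \<xi>)))\<^sup>2) \<partial>count_space (Zd d))
      = (\<integral>\<^sup>+x. ennreal ((cmod (zak d f (x, \<xi>)))\<^sup>2) \<partial>cube_measure d)" by (simp add: norm_mult)
  qed
  also have "\<dots> = (\<integral>\<^sup>+z. ennreal ((cmod (zak d f z))\<^sup>2) \<partial>torus d)"
    by (rule nn_integral_torus(2)[symmetric]) measurable
  also have "\<dots> = ennreal ((norm_L2 (Rd d) f)\<^sup>2)"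
    using norm_zak[OF f b] norm_L2_nn by metis
  finally show "(\<integral>\<^sup>+\<xi>. ennreal ((cmod (fourier_integral d f \<xi>))\<^sup>2) \<partial>Rd d) = ennreal ((norm_L2 (Rd d) f)\<^sup>2)" .
qed simp

text \<open>Cutoffs converge to \<open>f\<close> in both norms: their transforms converge pointwise
because \<open>f\<close> is integrable, and they form a Cauchy sequence because \<open>f\<close> is
square integrable.\<close>

theorem plancherel:
  assumes fi: "integrable (Rd d) f" and f: "f \<in> L2 (Rd d)"
  shows "fourier_integral d f \<in> L2 (Rd d)" "norm_L2 (Rd d) (fourier_integral d f) = norm_L2 (Rd d) f"
proof -
  let ?c = "\<lambda>N. cutoff d N f"
  have fm[measurable]: "f \<in> borel_measurable (Rd d)" using f by (rule L2_measurable)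
  have cL: "?c N \<in> L2 (Rd d)" for N by (rule cutoff_L2[OF f])
  have ci: "integrable (Rd d) (?c N)" for N by (rule bounded_support_integrable[OF cL bounded_support_cutoff])
  have FL: "fourier_integral d (?c N) \<in> L2 (Rd d)" for N using plancherel_bounded_support[OF cL bounded_support_cutoff] by simp
  have lim: "(\<lambda>N. fourier_integral d (?c N) \<xi>) \<longlonglongrightarrow> fourier_integral d f \<xi>" for \<xi>
    unfolding fourier_integral_ex
  proof (rule integral_dominated_convergence[where w="\<lambda>x. cmod (f x)"])
    show "AE x in Rd d. (\<lambda>N. cutoff d N f x * cnj (ex (dot d x \<xi>))) \<longlonglongrightarrow> f x * cnj (ex (dot d x \<xi>))"
      by (intro AE_I2 tendsto_mult cutoff_tendsto tendsto_const)
    show "AE x in Rd d. norm (cutoff d N f x * cnj (ex (dot d x \<xi>))) \<le> cmod (f x)" for N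
      by (rule AE_I2) (auto simp: cutoff_def norm_mult)
    show "(\<lambda>x. cutoff d N f x * cnj (ex (dot d x \<xi>))) \<in> borel_measurable (Rd d)" for N
      using borel_measurable_integrable[OF fourier_integrand_integrable[OF ci]] .
    show "(\<lambda>x. f x * cnj (ex (dot d x \<xi>))) \<in> borel_measurable (Rd d)" by measurable
  qed (use fi in auto)
  have diff: "norm_L2 (Rd d) (\<lambda>\<xi>. fourier_integral d (?c m) \<xi> - fourier_integral d (?c n) \<xi>) = norm_L2 (Rd d) (\<lambda>x. ?c m x - ?c n x)" for m n
  proof -
    have "bounded_support d (max m n) (\<lambda>x. ?c m x - ?c n x)"
      unfolding bounded_support_def by (force simp: cutoff_def split: if_splits)
    from plancherel_bounded_support[OF L2_diff[OF cL cL] this]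
    show ?thesis unfolding fourier_integral_diff[OF ci ci, abs_def] by simp
  qed
  have cauchy: "\<exists>N. \<forall>m\<ge>N. \<forall>n\<ge>N. norm_L2 (Rd d) (\<lambda>\<xi>. fourier_integral d (?c m) \<xi> - fourier_integral d (?c n) \<xi>) \<le> e" if e: "0 < e" for e
  proof -
    obtain N where N: "\<And>n. n \<ge> N \<Longrightarrow> norm_L2 (Rd d) (\<lambda>x. ?c n x - f x) < e/2"
      using LIMSEQ_D[OF cutoff_converges[OF f], of "e/2"] e by auto
    have "norm_L2 (Rd d) (\<lambda>x. ?c m x - ?c n x) \<le> e" if "m \<ge> N" "n \<ge> N" for m n
      using norm_L2_diff_triangle[OF cL[of m] f cL[of n]] N[OF that(1)] N[OF that(2)]
        norm_L2_minus_commute[of "Rd d" f "?c n"] by linarith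
    then show ?thesis unfolding diff by blast
  qed
  note L = L2_cauchy_limit_AE[OF FL cauchy fourier_integral_measurable[OF fm] AE_I2[OF lim]]
  show FfL: "fourier_integral d f \<in> L2 (Rd d)" by (rule L(1))
  have l1: "(\<lambda>N. norm_L2 (Rd d) (fourier_integral d (?c N))) \<longlonglongrightarrow> norm_L2 (Rd d) (fourier_integral d f)"
    by (rule LIM_zero_cancel, rule tendsto_0_le[OF L(2), where K=1])
       (use norm_L2_triangle_diff[OF FL FfL] in auto)
  have l2: "(\<lambda>N. norm_L2 (Rd d) (?c N)) \<longlonglongrightarrow> norm_L2 (Rd d) f"
    by (rule LIM_zero_cancel, rule tendsto_0_le[OF cutoff_converges[OF f], where K=1])
       (use norm_L2_triangle_diff[OF cL f] in auto)
  have "norm_L2 (Rd d) (fourier_integral d (?c N)) = norm_L2 (Rd d) (?c N)" for N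
    using plancherel_bounded_support[OF cL bounded_support_cutoff] by simp
  then show "norm_L2 (Rd d) (fourier_integral d f) = norm_L2 (Rd d) f"
    using LIMSEQ_unique[OF l1] l2 by simp
qed

text \<open>The transforms of cutoffs form a Cauchy sequence by Plancherel's theorem; its limit
witnesses the choice in \<open>fourier_L2\<close>.\<close>

lemma fourier_L2_spec:
  assumes g: "g \<in> L2 (Rd d)"
  shows "fourier_L2 d g \<in> L2 (Rd d) \<and>
    (\<exists>f :: nat \<Rightarrow> (nat \<Rightarrow> real) \<Rightarrow> complex.
        (\<forall>k. integrable (Rd d) (f k) \<and> f k \<in> L2 (Rd d) \<and> fourier_integral d (f k) \<in> L2 (Rd d)) \<and>
        (\<lambda>k. norm_L2 (Rd d) (\<lambda>x. f k x - g x)) \<longlonglongrightarrow> 0 \<and>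
        (\<lambda>k. norm_L2 (Rd d) (\<lambda>\<xi>. fourier_integral d (f k) \<xi> - fourier_L2 d g \<xi>)) \<longlonglongrightarrow> 0)"
    (is "?Q (fourier_L2 d g)")
proof -
  let ?c = "\<lambda>N. cutoff d N g"
  have cL: "?c N \<in> L2 (Rd d)" for N by (rule cutoff_L2[OF g])
  have ci: "integrable (Rd d) (?c N)" for N by (rule bounded_support_integrable[OF cL bounded_support_cutoff])
  have FL: "fourier_integral d (?c N) \<in> L2 (Rd d)" for N by (rule plancherel(1)[OF ci cL])
  have diff: "norm_L2 (Rd d) (\<lambda>\<xi>. fourier_integral d (?c m) \<xi> - fourier_integral d (?c n) \<xi>) = norm_L2 (Rd d) (\<lambda>x. ?c m x - ?c n x)" for m n
    using plancherel(2)[OF Bochner_Integration.integrable_diff[OF ci ci] L2_diff[OF cL cL], of m n]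
    unfolding fourier_integral_diff[OF ci ci, abs_def] .
  have "\<exists>h\<in>L2 (Rd d). (\<lambda>n. norm_L2 (Rd d) (\<lambda>x. fourier_integral d (?c n) x - h x)) \<longlonglongrightarrow> 0"
  proof (rule L2_complete[OF FL])
    fix e :: real assume e: "0 < e"
    obtain N where N: "\<And>n. n \<ge> N \<Longrightarrow> norm_L2 (Rd d) (\<lambda>x. ?c n x - g x) < e/2"
      using LIMSEQ_D[OF cutoff_converges[OF g], of "e/2"] e by auto
    have "norm_L2 (Rd d) (\<lambda>x. ?c m x - ?c n x) \<le> e" if "m \<ge> N" "n \<ge> N" for m n
      using norm_L2_diff_triangle[OF cL[of m] g cL[of n]] N[OF that(1)] N[OF that(2)]
        norm_L2_minus_commute[of "Rd d" g "?c n"] by linarith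
    then show "\<exists>N. \<forall>m\<ge>N. \<forall>n\<ge>N. norm_L2 (Rd d) (\<lambda>\<xi>. fourier_integral d (?c m) \<xi> - fourier_integral d (?c n) \<xi>) \<le> e"
      unfolding diff by blast
  qed
  then obtain h where h: "h \<in> L2 (Rd d)" "(\<lambda>n. norm_L2 (Rd d) (\<lambda>x. fourier_integral d (?c n) x - h x)) \<longlonglongrightarrow> 0" by blast
  have "?Q h" using h ci cL FL cutoff_converges[OF g] by (intro conjI exI[of _ ?c]) auto
  then show "?Q (fourier_L2 d g)" unfolding fourier_L2_def by (rule someI[of ?Q])
qed

lemma fourier_L2_eq_integral:
  assumes gi: "integrable (Rd d) g" and g: "g \<in> L2 (Rd d)"
  shows "AE \<xi> in Rd d. fourier_L2 d g \<xi> = fourier_integral d g \<xi>"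
proof -
  obtain f where f': "\<forall>k. integrable (Rd d) (f k) \<and> f k \<in> L2 (Rd d) \<and> fourier_integral d (f k) \<in> L2 (Rd d)"
    "(\<lambda>k. norm_L2 (Rd d) (\<lambda>x. f k x - g x)) \<longlonglongrightarrow> 0"
    "(\<lambda>k. norm_L2 (Rd d) (\<lambda>\<xi>. fourier_integral d (f k) \<xi> - fourier_L2 d g \<xi>)) \<longlonglongrightarrow> 0"
    using conjunct2[OF fourier_L2_spec[OF g]] by blast
  have f: "fourier_L2 d g \<in> L2 (Rd d)" "\<And>k. integrable (Rd d) (f k)" "\<And>k. f k \<in> L2 (Rd d)"
    "(\<lambda>k. norm_L2 (Rd d) (\<lambda>x. f k x - g x)) \<longlonglongrightarrow> 0"
    "(\<lambda>k. norm_L2 (Rd d) (\<lambda>\<xi>. fourier_integral d (f k) \<xi> - fourier_L2 d g \<xi>)) \<longlonglongrightarrow> 0"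
    using f' fourier_L2_spec[OF g] by blast+
  let ?h = "fourier_L2 d g" and ?G = "fourier_integral d g"
  have GL: "?G \<in> L2 (Rd d)" by (rule plancherel(1)[OF gi g])
  have eq: "norm_L2 (Rd d) (\<lambda>\<xi>. fourier_integral d (f k) \<xi> - ?G \<xi>) = norm_L2 (Rd d) (\<lambda>x. f k x - g x)" for k
    using plancherel(2)[OF Bochner_Integration.integrable_diff[OF f(2) gi] L2_diff[OF f(3) g], of k]
    unfolding fourier_integral_diff[OF f(2) gi, abs_def] .
  have "norm_L2 (Rd d) (\<lambda>\<xi>. ?h \<xi> - ?G \<xi>) \<le> norm_L2 (Rd d) (\<lambda>\<xi>. fourier_integral d (f k) \<xi> - ?h \<xi>) + norm_L2 (Rd d) (\<lambda>x. f k x - g x)" for k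
    using norm_L2_diff_triangle[OF f(1) plancherel(1)[OF f(2,3)[of k]] GL] norm_L2_minus_commute[of "Rd d" ?h] eq[of k] by simp
  moreover have "(\<lambda>k. norm_L2 (Rd d) (\<lambda>\<xi>. fourier_integral d (f k) \<xi> - ?h \<xi>) + norm_L2 (Rd d) (\<lambda>x. f k x - g x)) \<longlonglongrightarrow> 0 + 0"
    by (intro tendsto_add f)
  ultimately have "norm_L2 (Rd d) (\<lambda>\<xi>. ?h \<xi> - ?G \<xi>) \<le> 0 + 0"
    by (intro LIMSEQ_le_const) auto
  then have "norm_L2 (Rd d) (\<lambda>\<xi>. ?h \<xi> - ?G \<xi>) = 0" using norm_L2_nonneg[of "Rd d" "\<lambda>\<xi>. ?h \<xi> - ?G \<xi>"] by linarith
  then show ?thesis using norm_L2_eq_0_iff[OF L2_diff[OF f(1) GL]] by simp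
qed

text \<open>By polarization it suffices to compare the norms of \<open>g(x - s) + c g(x - t)\<close>
and of its Fourier transform.  They agree for integrable approximations of \<open>g\<close> by
Plancherel's theorem, and both are continuous in \<open>g\<close>.\<close>

lemma fourier_L2_gram:
  assumes g: "g \<in> L2 (Rd d)"
  shows "inner_L2 (Rd d) (\<lambda>x. g (shift d s x)) (\<lambda>x. g (shift d t x))
    = inner_L2 (Rd d) (\<lambda>\<xi>. cnj (ex (dot d s \<xi>)) * fourier_L2 d g \<xi>) (\<lambda>\<xi>. cnj (ex (dot d t \<xi>)) * fourier_L2 d g \<xi>)"
proof -
  obtain f where f': "\<forall>k. integrable (Rd d) (f k) \<and> f k \<in> L2 (Rd d) \<and> fourier_integral d (f k) \<in> L2 (Rd d)"
    "(\<lambda>k. norm_L2 (Rd d) (\<lambda>x. f k x - g x)) \<longlonglongrightarrow> 0"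
    "(\<lambda>k. norm_L2 (Rd d) (\<lambda>\<xi>. fourier_integral d (f k) \<xi> - fourier_L2 d g \<xi>)) \<longlonglongrightarrow> 0"
    using conjunct2[OF fourier_L2_spec[OF g]] by blast
  have f: "fourier_L2 d g \<in> L2 (Rd d)" "\<And>k. integrable (Rd d) (f k)" "\<And>k. f k \<in> L2 (Rd d)"
    "(\<lambda>k. norm_L2 (Rd d) (\<lambda>x. f k x - g x)) \<longlonglongrightarrow> 0"
    "(\<lambda>k. norm_L2 (Rd d) (\<lambda>\<xi>. fourier_integral d (f k) \<xi> - fourier_L2 d g \<xi>)) \<longlonglongrightarrow> 0"
    using f' fourier_L2_spec[OF g] by blast+
  let ?h = "fourier_L2 d g" and ?F = "\<lambda>k. fourier_integral d (f k)"
  have FL: "?F k \<in> L2 (Rd d)" for k by (rule plancherel(1)[OF f(2,3)])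
  have sh: "(\<lambda>x. w (shift d u x)) \<in> L2 (Rd d) \<and> norm_L2 (Rd d) (\<lambda>x. w (shift d u x)) = norm_L2 (Rd d) w" if "w \<in> L2 (Rd d)" for w u
    using tf_shift_L2[OF that, of u "\<lambda>_. 0"] by (simp add: tf_shift_def[abs_def] dot_def)
  have mo: "(\<lambda>\<xi>. cnj (ex (dot d u \<xi>)) * w \<xi>) \<in> L2 (Rd d)" if "w \<in> L2 (Rd d)" for w u
  proof (rule L2_dominated[OF _ that, where c=1])
    have [measurable]: "w \<in> borel_measurable (Rd d)" using that by (rule L2_measurable)
    show "(\<lambda>\<xi>. cnj (ex (dot d u \<xi>)) * w \<xi>) \<in> borel_measurable (Rd d)" by measurable
  qed (simp add: norm_mult)
  have moN: "norm_L2 (Rd d) (\<lambda>\<xi>. cnj (ex (dot d u \<xi>)) * w \<xi>) = norm_L2 (Rd d) w" for w u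
    by (simp add: norm_L2_def norm_mult)
  show ?thesis
  proof (rule inner_L2_eq_polarization)
    fix c :: complex
    let ?A = "\<lambda>w x. w (shift d s x) + c * w (shift d t x)"
    let ?B = "\<lambda>w \<xi>. cnj (ex (dot d s \<xi>)) * w \<xi> + c * (cnj (ex (dot d t \<xi>)) * w \<xi>)"
    have AL: "?A w \<in> L2 (Rd d)" and AN: "norm_L2 (Rd d) (?A w) \<le> (1 + cmod c) * norm_L2 (Rd d) w" if w: "w \<in> L2 (Rd d)" for w
      using norm_L2_triangle[OF conjunct1[OF sh[OF w, of s]] L2_cmult[OF conjunct1[OF sh[OF w, of t]], of c]] sh[OF w, of s] sh[OF w, of t]
      by (auto simp: norm_L2_cmult distrib_right intro: L2_add L2_cmult)
    have BL: "?B w \<in> L2 (Rd d)" if w: "w \<in> L2 (Rd d)" for w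
      by (rule L2_add[OF mo[OF w] L2_cmult[OF mo[OF w]]])
    have BN: "norm_L2 (Rd d) (?B w) \<le> (1 + cmod c) * norm_L2 (Rd d) w" if w: "w \<in> L2 (Rd d)" for w
      using norm_L2_triangle[OF mo[OF w, of s] L2_cmult[OF mo[OF w, of t], of c]] mo[OF w]
      by (auto simp: norm_L2_cmult distrib_right moN intro: L2_add L2_cmult)
    have eq: "norm_L2 (Rd d) (?A (f k)) = norm_L2 (Rd d) (?B (?F k))" for k
    proof -
      have fm: "f k \<in> borel_measurable (Rd d)" using f(3) by (rule L2_measurable)
      have i1: "integrable (Rd d) (\<lambda>x. f k (shift d u x))" for u by (rule integrable_Rd_shift[OF f(2)])
      have "fourier_integral d (?A (f k)) = ?B (?F k)"
        by (rule ext) (simp add: fourier_integral_add[OF i1 i1] fourier_integral_shift[OF fm])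
      moreover have "integrable (Rd d) (?A (f k))" using i1 by auto
      ultimately show ?thesis using plancherel(2)[OF _ AL[OF f(3)], of k] by simp
    qed
    have l1: "(\<lambda>k. norm_L2 (Rd d) (?A (f k))) \<longlonglongrightarrow> norm_L2 (Rd d) (?A g)"
    proof (rule LIM_zero_cancel, rule tendsto_0_le[OF f(4), where K="1 + cmod c"], rule always_eventually, rule allI)
      fix k
      have "norm_L2 (Rd d) (\<lambda>x. ?A (f k) x - ?A g x) = norm_L2 (Rd d) (?A (\<lambda>x. f k x - g x))"
        by (simp add: algebra_simps)
      then show "norm (norm_L2 (Rd d) (?A (f k)) - norm_L2 (Rd d) (?A g)) \<le> norm (norm_L2 (Rd d) (\<lambda>x. f k x - g x)) * (1 + cmod c)"
        using AN[OF L2_diff[OF f(3) g], of k] norm_L2_triangle_diff[OF AL[OF f(3)] AL[OF g], of k]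
        by (simp add: mult.commute)
    qed
    have l2: "(\<lambda>k. norm_L2 (Rd d) (?B (?F k))) \<longlonglongrightarrow> norm_L2 (Rd d) (?B ?h)"
    proof (rule LIM_zero_cancel, rule tendsto_0_le[OF f(5), where K="1 + cmod c"], rule always_eventually, rule allI)
      fix k
      have "norm_L2 (Rd d) (\<lambda>x. ?B (?F k) x - ?B ?h x) = norm_L2 (Rd d) (?B (\<lambda>x. ?F k x - ?h x))"
        by (simp add: algebra_simps)
      then show "norm (norm_L2 (Rd d) (?B (?F k)) - norm_L2 (Rd d) (?B ?h)) \<le> norm (norm_L2 (Rd d) (\<lambda>x. ?F k x - ?h x)) * (1 + cmod c)"
        using BN[OF L2_diff[OF FL f(1)], of k] norm_L2_triangle_diff[OF BL[OF FL] BL[OF f(1)], of k]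
        by (simp add: mult.commute)
    qed
    show "norm_L2 (Rd d) (\<lambda>x. g (shift d s x) + c * g (shift d t x))
       = norm_L2 (Rd d) (\<lambda>\<xi>. cnj (ex (dot d s \<xi>)) * ?h \<xi> + c * (cnj (ex (dot d t \<xi>)) * ?h \<xi>))"
      using LIMSEQ_unique[OF l1] l2 unfolding eq by blast
  qed (use sh[OF g] mo[OF f(1)] in auto)
qed

section \<open>Riesz bases and the modulus of the Zak transform\<close>

lemma gabor_eq_tf_shift: "gabor d g p = tf_shift d (rvec (fst p)) (rvec (snd p)) g"
  by (cases p) (simp add: gabor_def tf_shift_def fun_eq_iff ex_def dot_def rvec_def shift_def)

text \<open>At lattice points quasiperiodicity undoes the translation, and only a character
remains.\<close>

lemma zak_shift_lattice:
  assumes q: "quasiperiodic d \<zeta>" and p: "p \<in> Zd d \<times> Zd d" and z: "z \<in> space (torus d)"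
  shows "zak_shift d (rvec (fst p)) (rvec (snd p)) \<zeta> z = chr2 d p z * \<zeta> z"
proof -
  obtain x y where xy: "z = (x, y)" "x \<in> space (Rd d)" "y \<in> space (Rd d)"
    using z by (auto simp: space_torus)
  obtain m n where mn: "p = (m, n)" "m \<in> Zd d" "n \<in> Zd d" using p by auto
  have "\<zeta> (shift d (rvec m) x, shift d (rvec n) y) = cnj (ex (dot d (rvec m) (shift d (rvec n) y))) * \<zeta> (x, y)"
  proof -
    have "\<zeta> (shift d (rvec m) x, shift d (rvec n) y) = cnj (ex (dot d (rvec m) (shift d (rvec n) y))) * \<zeta> (x, shift d (rvec n) y)"
      using q mn(2) xy(2) shift_in_space[of d "rvec n" y] unfolding quasiperiodic_def by blast
    also have "\<zeta> (x, shift d (rvec n) y) = \<zeta> (x, y)"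
      using q mn(3) xy(2,3) unfolding quasiperiodic_def by blast
    finally show ?thesis .
  qed
  also have "cnj (ex (dot d (rvec m) (shift d (rvec n) y))) = cnj (ex (dot d (rvec m) y))"
    by (simp add: dot_shift ex_diff)
  finally show ?thesis by (simp add: zak_shift_def chr2_def chr_def xy mn)
qed

lemma riesz_constants_finite:
  assumes R: "riesz_constants M I v A B" and v: "\<And>i. i \<in> I \<Longrightarrow> v i \<in> L2 M" and F: "finite F" "F \<subseteq> I"
  shows "A * (\<Sum>i\<in>F. (cmod (c i))\<^sup>2) \<le> (norm_L2 M (\<lambda>x. \<Sum>i\<in>F. c i * v i x))\<^sup>2"
    and "(norm_L2 M (\<lambda>x. \<Sum>i\<in>F. c i * v i x))\<^sup>2 \<le> B * (\<Sum>i\<in>F. (cmod (c i))\<^sup>2)"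
proof -
  define a where "a i = (if i \<in> F then c i else 0)" for i
  have "((\<lambda>i. (cmod (a i))\<^sup>2) has_sum (\<Sum>i\<in>F. (cmod (a i))\<^sup>2)) F" using F(1) by simp
  then have hs: "((\<lambda>i. (cmod (a i))\<^sup>2) has_sum (\<Sum>i\<in>F. (cmod (a i))\<^sup>2)) I"
    by (subst has_sum_cong_neutral[where T=F and g="\<lambda>i. (cmod (a i))\<^sup>2"]) (use F in \<open>auto simp: a_def\<close>)
  have s: "(\<Sum>i\<in>F. (cmod (a i))\<^sup>2) = (\<Sum>i\<in>F. (cmod (c i))\<^sup>2)" by (rule sum.cong) (auto simp: a_def)
  have inf: "(\<Sum>\<^sub>\<infinity>i\<in>I. (cmod (a i))\<^sup>2) = (\<Sum>i\<in>F. (cmod (c i))\<^sup>2)" using infsumI[OF hs] s by simp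
  obtain f where f: "has_L2_sum M I v a f" "A * (\<Sum>i\<in>F. (cmod (c i))\<^sup>2) \<le> (norm_L2 M f)\<^sup>2"
     "(norm_L2 M f)\<^sup>2 \<le> B * (\<Sum>i\<in>F. (cmod (c i))\<^sup>2)"
    using R has_sum_imp_summable[OF hs] unfolding riesz_constants_def inf[symmetric] by blast
  have "norm_L2 M f = norm_L2 M (\<lambda>x. \<Sum>i\<in>F. a i * v i x)"
    by (rule has_L2_sum_finite_norm[OF v F f(1)]) (auto simp: a_def)
  also have "(\<lambda>x. \<Sum>i\<in>F. a i * v i x) = (\<lambda>x. \<Sum>i\<in>F. c i * v i x)"
    by (rule ext, rule sum.cong) (auto simp: a_def)
  finally show "A * (\<Sum>i\<in>F. (cmod (c i))\<^sup>2) \<le> (norm_L2 M (\<lambda>x. \<Sum>i\<in>F. c i * v i x))\<^sup>2"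
    "(norm_L2 M (\<lambda>x. \<Sum>i\<in>F. c i * v i x))\<^sup>2 \<le> B * (\<Sum>i\<in>F. (cmod (c i))\<^sup>2)" using f by simp_all
qed

lemma L2_fast_limit_AE:
  assumes f: "\<And>n. f n \<in> L2 M" and g: "g \<in> L2 M" and fast: "\<And>n. norm_L2 M (\<lambda>x. f n x - g x) \<le> (1/2)^n / 2"
  shows "AE x in M. (\<lambda>n. f n x) \<longlonglongrightarrow> g x"
proof -
  have fast': "norm_L2 M (\<lambda>x. f (Suc n) x - f n x) \<le> (1/2)^n" for n
  proof -
    have "norm_L2 M (\<lambda>x. f (Suc n) x - f n x) \<le> (1/2)^Suc n / 2 + (1/2)^n / 2"
      using norm_L2_diff_triangle[OF f[of "Suc n"] g f[of n]] fast[of "Suc n"] fast[of n]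
      by (simp add: norm_L2_minus_commute[of _ g])
    also have "\<dots> \<le> (1/2)^n" by simp
    finally show ?thesis .
  qed
  have [measurable]: "f n \<in> borel_measurable M" for n using f by (rule L2_measurable)
  define h where "h x = lim (\<lambda>n. f n x)" for x
  have hm: "h \<in> borel_measurable M" unfolding h_def[abs_def] by measurable
  have conv: "AE x in M. (\<lambda>n. f n x) \<longlonglongrightarrow> h x"
    using L2_fast_cauchy_AE[OF f fast'] by eventually_elim (simp add: h_def convergent_LIMSEQ_iff)
  note L = L2_cauchy_limit_AE[OF f fast_cauchy_imp_cauchy[OF f fast'] hm conv]
  have "norm_L2 M (\<lambda>x. h x - g x) \<le> norm_L2 M (\<lambda>x. f n x - h x) + (1/2)^n / 2" for n
    using norm_L2_diff_triangle[OF L(1) f[of n] g] fast[of n] norm_L2_minus_commute[of M h "f n"] by linarith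
  moreover have "(\<lambda>n. norm_L2 M (\<lambda>x. f n x - h x) + (1/2)^n / 2) \<longlonglongrightarrow> 0 + 0 / 2"
    by (intro tendsto_add L(2) tendsto_divide LIMSEQ_power_zero tendsto_const) auto
  ultimately have "norm_L2 M (\<lambda>x. h x - g x) \<le> 0 + 0 / 2" by (intro LIMSEQ_le_const) auto
  then have "norm_L2 M (\<lambda>x. h x - g x) = 0" using norm_L2_nonneg[of M "\<lambda>x. h x - g x"] by linarith
  then have "AE x in M. h x - g x = 0" using norm_L2_eq_0_iff[OF L2_diff[OF L(1) g]] by simp
  with conv show ?thesis by eventually_elim simp
qed

text \<open>Density carries the two inequalities from trigonometric polynomials to indicators, and
tested on the sets where \<open>B < \<bar>\<zeta>\<bar>\<^sup>2\<close> and
\<open>\<bar>\<zeta>\<bar>\<^sup>2 < A\<close> they show that both are null.  For the upper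
inequality Fatou's lemma suffices.  It makes multiplication by \<open>\<zeta>\<close> bounded, which
the passage to the limit in the lower one requires.\<close>

lemma multiplier_bounds_AE:
  assumes z: "\<zeta> \<in> L2 (torus d)" and A: "0 < A" "0 < B"
    and bd: "\<And>F c. finite F \<Longrightarrow> F \<subseteq> Zd d \<times> Zd d \<Longrightarrow>
      A * (norm_L2 (torus d) (\<lambda>z. \<Sum>p\<in>F. c p * chr2 d p z))\<^sup>2 \<le> (norm_L2 (torus d) (\<lambda>z. (\<Sum>p\<in>F. c p * chr2 d p z) * \<zeta> z))\<^sup>2 \<and>
      (norm_L2 (torus d) (\<lambda>z. (\<Sum>p\<in>F. c p * chr2 d p z) * \<zeta> z))\<^sup>2 \<le> B * (norm_L2 (torus d) (\<lambda>z. \<Sum>p\<in>F. c p * chr2 d p z))\<^sup>2"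
  shows "AE z in torus d. A \<le> (cmod (\<zeta> z))\<^sup>2 \<and> (cmod (\<zeta> z))\<^sup>2 \<le> B"
proof -
  let ?T = "torus d" and ?N = "norm_L2 (torus d)"
  interpret finite_measure ?T by (rule finite_torus)
  have zm[measurable]: "\<zeta> \<in> borel_measurable ?T" using z by (rule L2_measurable)
  have approx: "\<exists>p :: nat \<Rightarrow> _ \<Rightarrow> complex. (\<forall>n. p n \<in> L2 ?T \<and> (\<lambda>z. p n z * \<zeta> z) \<in> L2 ?T \<and> ?N (\<lambda>z. p n z - indicator S z) \<le> (1/2)^n / 2
      \<and> sqrt A * ?N (p n) \<le> ?N (\<lambda>z. p n z * \<zeta> z) \<and> ?N (\<lambda>z. p n z * \<zeta> z) \<le> sqrt B * ?N (p n))" if S: "S \<in> sets ?T" for S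
  proof -
    have "\<exists>p. p \<in> L2 ?T \<and> (\<lambda>z. p z * \<zeta> z) \<in> L2 ?T \<and> ?N (\<lambda>z. p z - indicator S z) \<le> (1/2)^n / 2
      \<and> sqrt A * ?N p \<le> ?N (\<lambda>z. p z * \<zeta> z) \<and> ?N (\<lambda>z. p z * \<zeta> z) \<le> sqrt B * ?N p" for n
    proof -
      have e: "0 < (1/2)^n / (2::real)" by simp
      obtain F c where F: "finite F" "F \<subseteq> Zd d \<times> Zd d" "?N (\<lambda>z. (\<Sum>p\<in>F. c p * chr2 d p z) - indicator S z) < (1/2)^n / 2"
        by (rule L2_approxE[OF approx_torus_all[OF indicator_L2[OF S]] e])
      let ?p = "\<lambda>z. \<Sum>p\<in>F. c p * chr2 d p z"
      have pL: "?p \<in> L2 ?T" by (intro L2_sum L2_cmult chr2_L2)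
      have "(\<lambda>z. \<Sum>p\<in>F. c p * (chr2 d p z * \<zeta> z)) \<in> L2 ?T"
      proof (intro L2_sum L2_cmult)
        show "(\<lambda>z. chr2 d p z * \<zeta> z) \<in> L2 ?T" for p
          by (rule L2_dominated[OF _ z, where c=1]) (auto simp: norm_mult)
      qed
      then have pzL: "(\<lambda>z. ?p z * \<zeta> z) \<in> L2 ?T" by (simp add: sum_distrib_right mult.assoc)
      have "sqrt A * ?N ?p \<le> ?N (\<lambda>z. ?p z * \<zeta> z)"
        by (rule power2_le_imp_le) (use bd[OF F(1,2), of c] A in \<open>auto simp: power_mult_distrib\<close>)
      moreover have "?N (\<lambda>z. ?p z * \<zeta> z) \<le> sqrt B * ?N ?p"
        by (rule power2_le_imp_le) (use bd[OF F(1,2), of c] A in \<open>auto simp: power_mult_distrib\<close>)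
      ultimately show ?thesis using pL pzL F(3) by (intro exI[of _ ?p]) auto
    qed
    then show ?thesis by (intro choice allI) auto
  qed
  have normS: "?N (\<lambda>z. indicator S z * \<zeta> z) \<le> sqrt B * ?N (indicator S)" if S: "S \<in> sets ?T" for S
  proof -
    obtain p where p: "\<And>n. p n \<in> L2 ?T" "\<And>n. (\<lambda>z. p n z * \<zeta> z) \<in> L2 ?T" "\<And>n. ?N (\<lambda>z. p n z - indicator S z) \<le> (1/2)^n / 2"
      "\<And>n. ?N (\<lambda>z. p n z * \<zeta> z) \<le> sqrt B * ?N (p n)" using approx[OF S] by blast
    have SL: "(indicator S :: _ \<Rightarrow> complex) \<in> L2 ?T" by (rule indicator_L2[OF S])
    have lim: "AE z in ?T. (\<lambda>n. p n z) \<longlonglongrightarrow> indicator S z" by (rule L2_fast_limit_AE[OF p(1) SL p(3)])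
    have "?N (\<lambda>z. indicator S z * \<zeta> z) \<le> sqrt B * (?N (indicator S) + (1/2)^k)" for k
    proof (rule L2_fatou(2)[where f="\<lambda>n z. p (n + k) z * \<zeta> z"])
      show "?N (\<lambda>z. p (n + k) z * \<zeta> z) \<le> sqrt B * (?N (indicator S) + (1/2)^k)" for n
      proof -
        have "?N (p (n + k)) \<le> ?N (indicator S) + (1/2)^(n+k) / 2"
          using norm_L2_triangle_diff[OF p(1)[of "n+k"] SL] p(3)[of "n + k"] by linarith
        also have "(1/2)^(n+k) / 2 \<le> (1/2::real)^k"
        proof -
          have "(1/2)^(n+k) \<le> (1/2::real)^k" by (rule power_decreasing) auto
          moreover have "0 \<le> (1/2::real)^(n+k)" by simp
          ultimately show ?thesis by linarith
        qed
        finally show ?thesis using p(4)[of "n+k"] A by (meson add_left_mono mult_left_mono order_trans real_sqrt_ge_zero less_imp_le)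
      qed
      show "AE z in ?T. (\<lambda>n. p (n + k) z * \<zeta> z) \<longlonglongrightarrow> indicator S z * \<zeta> z"
        using lim by eventually_elim (intro tendsto_mult tendsto_const LIMSEQ_ignore_initial_segment)
      show "(\<lambda>z. indicator S z * \<zeta> z) \<in> borel_measurable ?T" using S by measurable
    qed (use p(2) A in auto)
    moreover have "(\<lambda>k. sqrt B * (?N (indicator S) + (1/2)^k)) \<longlonglongrightarrow> sqrt B * (?N (indicator S) + 0)"
      by (intro tendsto_intros LIMSEQ_power_zero) auto
    ultimately show ?thesis using LIMSEQ_le_const[of "\<lambda>k. sqrt B * (?N (indicator S) + (1/2)^k)" "sqrt B * (?N (indicator S) + 0)"] by auto
  qed
  have sq: "(?N (\<lambda>z. indicator S z * \<zeta> z))\<^sup>2 = (LINT z|?T. indicator S z * (cmod (\<zeta> z))\<^sup>2)"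
    "(?N (indicator S))\<^sup>2 = (LINT z|?T. indicator S z)" for S
    unfolding norm_L2_power2 by (auto intro!: Bochner_Integration.integral_cong simp: indicator_def)
  have int: "integrable ?T (\<lambda>z. indicator S z * (cmod (\<zeta> z))\<^sup>2)" "integrable ?T (indicator S :: _ \<Rightarrow> real)" if "S \<in> sets ?T" for S
  proof -
    show "integrable ?T (\<lambda>z. indicator S z * (cmod (\<zeta> z))\<^sup>2)"
      using integrable_mult_indicator[OF that L2_integrable_square[OF z]] by simp
    show "integrable ?T (indicator S :: _ \<Rightarrow> real)"
      by (rule integrable_const_bound[where B=1]) (use that in \<open>auto simp: indicator_def\<close>)
  qed
  have null: "AE z in ?T. z \<notin> S"
    if S: "S \<in> sets ?T" and pos: "\<And>z. z \<in> S \<Longrightarrow> 0 < h z" and hi: "integrable ?T (\<lambda>z. indicator S z * h z)"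
      and le: "(LINT z|?T. indicator S z * h z) \<le> 0" for S and h :: "_ \<Rightarrow> real"
  proof -
    have nn: "AE z in ?T. 0 \<le> indicator S z * h z" using pos by (intro AE_I2) (auto simp: indicator_def less_imp_le)
    then have "(LINT z|?T. indicator S z * h z) = 0" using le integral_nonneg_AE[OF nn] by linarith
    then have "AE z in ?T. indicator S z * h z = 0" using integral_nonneg_eq_0_iff_AE[OF hi nn] by simp
    then show ?thesis by eventually_elim (use pos in \<open>force simp: indicator_def\<close>)
  qed
  define U where "U = {z \<in> space ?T. B < (cmod (\<zeta> z))\<^sup>2}"
  have U[measurable]: "U \<in> sets ?T" unfolding U_def by measurable
  have ub: "AE z in ?T. z \<notin> U"
  proof (rule null[OF U, where h="\<lambda>z. (cmod (\<zeta> z))\<^sup>2 - B"])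
    have i: "integrable ?T (\<lambda>z. indicator U z * (cmod (\<zeta> z))\<^sup>2 - B * indicator U z)" using int[OF U] by auto
    then show "integrable ?T (\<lambda>z. indicator U z * ((cmod (\<zeta> z))\<^sup>2 - B))" by (simp add: right_diff_distrib mult.commute)
    have "(?N (\<lambda>z. indicator U z * \<zeta> z))\<^sup>2 \<le> (sqrt B * ?N (indicator U))\<^sup>2" by (intro power_mono normS U) simp
    then have "(LINT z|?T. indicator U z * (cmod (\<zeta> z))\<^sup>2) \<le> B * (LINT z|?T. indicator U z)"
      unfolding power_mult_distrib sq using A by simp
    then have "(LINT z|?T. indicator U z * (cmod (\<zeta> z))\<^sup>2 - B * indicator U z) \<le> 0" using int[OF U] by simp
    then show "(LINT z|?T. indicator U z * ((cmod (\<zeta> z))\<^sup>2 - B)) \<le> 0" by (simp add: right_diff_distrib mult.commute)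
  qed (auto simp: U_def)
  have zb: "AE z in ?T. cmod (\<zeta> z) \<le> sqrt B"
    using ub AE_space by eventually_elim (auto simp: U_def real_le_rsqrt)
  have normS': "sqrt A * ?N (indicator S) \<le> ?N (\<lambda>z. indicator S z * \<zeta> z)" if S: "S \<in> sets ?T" for S
  proof -
    obtain p where p: "\<And>n. p n \<in> L2 ?T" "\<And>n. (\<lambda>z. p n z * \<zeta> z) \<in> L2 ?T" "\<And>n. ?N (\<lambda>z. p n z - indicator S z) \<le> (1/2)^n / 2"
      "\<And>n. sqrt A * ?N (p n) \<le> ?N (\<lambda>z. p n z * \<zeta> z)" using approx[OF S] by blast
    have SL: "(indicator S :: _ \<Rightarrow> complex) \<in> L2 ?T" by (rule indicator_L2[OF S])
    have SzL: "(\<lambda>z. indicator S z * \<zeta> z) \<in> L2 ?T"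
      by (rule L2_dominated[OF _ z, where c=1]) (use S in \<open>auto simp: indicator_def\<close>)
    have d: "?N (\<lambda>z. p n z * \<zeta> z - indicator S z * \<zeta> z) \<le> sqrt B * ((1/2)^n / 2)" for n
    proof -
      have DL: "(\<lambda>z. p n z - indicator S z) \<in> L2 ?T" by (rule L2_diff[OF p(1) SL])
      have "?N (\<lambda>z. p n z * \<zeta> z - indicator S z * \<zeta> z) \<le> sqrt B * ?N (\<lambda>z. p n z - indicator S z)"
      proof (rule norm_L2_nn_le(2))
        show "(\<lambda>z. p n z * \<zeta> z - indicator S z * \<zeta> z) \<in> borel_measurable ?T" using L2_diff[OF p(2) SzL] by (rule L2_measurable)
        have "(\<integral>\<^sup>+z. ennreal ((cmod (p n z * \<zeta> z - indicator S z * \<zeta> z))\<^sup>2) \<partial>?T) \<le> (\<integral>\<^sup>+z. ennreal ((cmod (sqrt B * (p n z - indicator S z)))\<^sup>2) \<partial>?T)"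
        proof (rule nn_integral_mono_AE, use zb in eventually_elim, intro ennreal_leI power_mono)
          fix z assume "cmod (\<zeta> z) \<le> sqrt B"
          then have "cmod (\<zeta> z) * cmod (p n z - indicator S z) \<le> sqrt B * cmod (p n z - indicator S z)" by (rule mult_right_mono) simp
          then show "cmod (p n z * \<zeta> z - indicator S z * \<zeta> z) \<le> cmod (sqrt B * (p n z - indicator S z))"
            using A unfolding left_diff_distrib[symmetric] norm_mult by (simp add: mult.commute)
        qed simp
        also have "\<dots> = ennreal ((sqrt B * ?N (\<lambda>z. p n z - indicator S z))\<^sup>2)"
          using norm_L2_nn[OF L2_cmult[OF DL], of "complex_of_real (sqrt B)"] A unfolding norm_L2_cmult by simp
        finally show "(\<integral>\<^sup>+z. ennreal ((cmod (p n z * \<zeta> z - indicator S z * \<zeta> z))\<^sup>2) \<partial>?T) \<le> ennreal ((sqrt B * ?N (\<lambda>z. p n z - indicator S z))\<^sup>2)" .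
      qed (use A in simp)
      also have "\<dots> \<le> sqrt B * ((1/2)^n / 2)" using A by (intro mult_left_mono p(3)) simp
      finally show ?thesis .
    qed
    have "sqrt A * ?N (indicator S) \<le> ?N (\<lambda>z. indicator S z * \<zeta> z) + (sqrt A + sqrt B) * ((1/2)^n / 2)" for n
    proof -
      have "sqrt A * ?N (indicator S) \<le> sqrt A * (?N (p n) + (1/2)^n / 2)"
        using norm_L2_triangle_diff[OF p(1)[of n] SL] p(3)[of n] A by (intro mult_left_mono) auto
      also have "\<dots> \<le> ?N (\<lambda>z. p n z * \<zeta> z) + sqrt A * ((1/2)^n / 2)" using p(4)[of n] by (simp only: distrib_left)
      also have "?N (\<lambda>z. p n z * \<zeta> z) \<le> ?N (\<lambda>z. indicator S z * \<zeta> z) + sqrt B * ((1/2)^n / 2)"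
        using norm_L2_triangle_diff[OF p(2)[of n] SzL] d[of n] by linarith
      finally show ?thesis by (simp only: distrib_right) simp
    qed
    moreover have "(\<lambda>n. ?N (\<lambda>z. indicator S z * \<zeta> z) + (sqrt A + sqrt B) * ((1/2)^n / 2)) \<longlonglongrightarrow> ?N (\<lambda>z. indicator S z * \<zeta> z) + (sqrt A + sqrt B) * (0 / 2)"
      by (intro tendsto_intros LIMSEQ_power_zero) auto
    ultimately show ?thesis
      using LIMSEQ_le_const[of "\<lambda>n. ?N (\<lambda>z. indicator S z * \<zeta> z) + (sqrt A + sqrt B) * ((1/2)^n / 2)"
        "?N (\<lambda>z. indicator S z * \<zeta> z) + (sqrt A + sqrt B) * (0 / 2)"] by auto
  qed
  define V where "V = {z \<in> space ?T. (cmod (\<zeta> z))\<^sup>2 < A}"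
  have V[measurable]: "V \<in> sets ?T" unfolding V_def by measurable
  have lb: "AE z in ?T. z \<notin> V"
  proof (rule null[OF V, where h="\<lambda>z. A - (cmod (\<zeta> z))\<^sup>2"])
    have i: "integrable ?T (\<lambda>z. A * indicator V z - indicator V z * (cmod (\<zeta> z))\<^sup>2)" using int[OF V] by auto
    then show "integrable ?T (\<lambda>z. indicator V z * (A - (cmod (\<zeta> z))\<^sup>2))" by (simp add: right_diff_distrib mult.commute)
    have "(sqrt A * ?N (indicator V))\<^sup>2 \<le> (?N (\<lambda>z. indicator V z * \<zeta> z))\<^sup>2" using A by (intro power_mono normS' V) simp
    then have "A * (LINT z|?T. indicator V z) \<le> (LINT z|?T. indicator V z * (cmod (\<zeta> z))\<^sup>2)"
      unfolding power_mult_distrib sq using A by simp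
    then have "(LINT z|?T. A * indicator V z - indicator V z * (cmod (\<zeta> z))\<^sup>2) \<le> 0" using int[OF V] by simp
    then show "(LINT z|?T. indicator V z * (A - (cmod (\<zeta> z))\<^sup>2)) \<le> 0" by (simp add: right_diff_distrib mult.commute)
  qed (auto simp: V_def)
  show ?thesis using ub lb AE_space by eventually_elim (auto simp: U_def V_def)
qed

text \<open>The grid argument evaluates the Zak transform at individual points, whereas the Riesz
constants bound it only almost everywhere.  It is therefore redefined on the exceptional set, in a
quasiperiodic way and with modulus \<open>sqrt A\<close>.\<close>

lemma gabor_riesz_zak:
  assumes g: "g \<in> L2 (Rd d)" and R: "riesz_constants (Rd d) (Zd d \<times> Zd d) (gabor d g) A B"
  obtains \<zeta> where "\<zeta> \<in> borel_measurable (Rd d \<Otimes>\<^sub>M Rd d)" "quasiperiodic d \<zeta>"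
    "\<And>z. A \<le> (cmod (\<zeta> z))\<^sup>2" "\<And>z. (cmod (\<zeta> z))\<^sup>2 \<le> B"
    "\<And>u v u' v'. inner_L2 (Rd d) (tf_shift d u v g) (tf_shift d u' v' g)
       = inner_L2 (torus d) (zak_shift d u v \<zeta>) (zak_shift d u' v' \<zeta>)"
proof -
  obtain \<zeta> where zL: "\<zeta> \<in> L2 (torus d)" and zq: "quasiperiodic d \<zeta>"
    and iso: "\<And>J (c :: (nat \<Rightarrow> int) \<times> (nat \<Rightarrow> int) \<Rightarrow> complex) u v. finite J \<Longrightarrow>
      norm_L2 (Rd d) (\<lambda>x. \<Sum>j\<in>J. c j * tf_shift d (u j) (v j) g x)
      = norm_L2 (torus d) (\<lambda>z. \<Sum>j\<in>J. c j * zak_shift d (u j) (v j) \<zeta> z)"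
    using zak_limit_exists[OF g] by blast
  have A: "0 < A" "0 < B" using R by (auto simp: riesz_constants_def)
  have zm[measurable]: "\<zeta> \<in> borel_measurable (Rd d \<Otimes>\<^sub>M Rd d)" using zL by (auto dest: L2_measurable)
  have gL: "gabor d g p \<in> L2 (Rd d)" for p unfolding gabor_eq_tf_shift using tf_shift_L2[OF g] by blast
  have bounds: "AE z in torus d. A \<le> (cmod (\<zeta> z))\<^sup>2 \<and> (cmod (\<zeta> z))\<^sup>2 \<le> B"
  proof (rule multiplier_bounds_AE[OF zL A])
    fix F and c :: "_ \<Rightarrow> complex" assume F: "finite F" "F \<subseteq> Zd d \<times> Zd d"
    have "norm_L2 (Rd d) (\<lambda>x. \<Sum>p\<in>F. c p * gabor d g p x)
      = norm_L2 (torus d) (\<lambda>z. \<Sum>p\<in>F. c p * zak_shift d (rvec (fst p)) (rvec (snd p)) \<zeta> z)"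
      unfolding gabor_eq_tf_shift using iso[OF F(1), of c "\<lambda>p. rvec (fst p)" "\<lambda>p. rvec (snd p)"] .
    also have "\<dots> = norm_L2 (torus d) (\<lambda>z. (\<Sum>p\<in>F. c p * chr2 d p z) * \<zeta> z)"
      unfolding norm_L2_def
    proof (intro arg_cong[where f=sqrt] Bochner_Integration.integral_cong[OF refl])
      fix z assume z: "z \<in> space (torus d)"
      have "(\<Sum>p\<in>F. c p * zak_shift d (rvec (fst p)) (rvec (snd p)) \<zeta> z) = (\<Sum>p\<in>F. c p * chr2 d p z) * \<zeta> z"
        unfolding sum_distrib_right
        by (rule sum.cong[OF refl]) (use zak_shift_lattice[OF zq _ z] F in \<open>auto simp: mult.assoc\<close>)
      then show "(cmod (\<Sum>p\<in>F. c p * zak_shift d (rvec (fst p)) (rvec (snd p)) \<zeta> z))\<^sup>2 = (cmod ((\<Sum>p\<in>F. c p * chr2 d p z) * \<zeta> z))\<^sup>2"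
        by simp
    qed
    finally have n: "norm_L2 (Rd d) (\<lambda>x. \<Sum>p\<in>F. c p * gabor d g p x) = norm_L2 (torus d) (\<lambda>z. (\<Sum>p\<in>F. c p * chr2 d p z) * \<zeta> z)" .
    show "A * (norm_L2 (torus d) (\<lambda>z. \<Sum>p\<in>F. c p * chr2 d p z))\<^sup>2 \<le> (norm_L2 (torus d) (\<lambda>z. (\<Sum>p\<in>F. c p * chr2 d p z) * \<zeta> z))\<^sup>2 \<and>
      (norm_L2 (torus d) (\<lambda>z. (\<Sum>p\<in>F. c p * chr2 d p z) * \<zeta> z))\<^sup>2 \<le> B * (norm_L2 (torus d) (\<lambda>z. \<Sum>p\<in>F. c p * chr2 d p z))\<^sup>2"
      using riesz_constants_finite[OF R gL F, of c] n norm_orthonormal_sum[OF orthonormal_chr2 F, of c] by simp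
  qed
  define good where "good z \<longleftrightarrow> A \<le> (cmod (\<zeta> z))\<^sup>2 \<and> (cmod (\<zeta> z))\<^sup>2 \<le> B" for z
  have "\<exists>z. good z"
  proof (rule ccontr)
    assume "\<nexists>z. good z"
    then have "\<not> good z" for z by blast
    then have "AE z in torus d. False"
      by (intro eventually_mono[OF bounds]) (auto simp: good_def)
    then have "emeasure (torus d) (space (torus d)) = 0"
      using AE_iff_measurable[OF sets.top[of "torus d"], of "\<lambda>_. False"] by simp
    then show False using prob_torus[of d] by simp
  qed
  then have AB: "A \<le> B" by (auto simp: good_def)
  \<comment> \<open>a quasiperiodic function of constant modulus; its discontinuities in \<open>fst z\<close> are harmless\<close>
  define w where "w z = sqrt A * ex (dot d (rvec (floor_vec d (fst z))) (snd z))" for z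
  define \<theta> where "\<theta> z = (if good z then \<zeta> z else w z)" for z
  have wn: "(cmod (w z))\<^sup>2 = A" for z using A by (simp add: w_def norm_mult)
  have c1: "(\<lambda>z. fst z i) \<in> borel_measurable (Rd d \<Otimes>\<^sub>M Rd d)" "(\<lambda>z. snd z i) \<in> borel_measurable (Rd d \<Otimes>\<^sub>M Rd d)" if "i < d" for i
    using measurable_Rd_component[OF measurable_fst that] measurable_Rd_component[OF measurable_snd that] by auto
  have [measurable]: "(\<lambda>z. dot d (rvec (floor_vec d (fst z))) (snd z)) \<in> borel_measurable (Rd d \<Otimes>\<^sub>M Rd d)"
  proof -
    have "(\<lambda>z. \<Sum>i<d. real_of_int \<lfloor>fst z i\<rfloor> * snd z i) \<in> borel_measurable (Rd d \<Otimes>\<^sub>M Rd d)"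
    proof (intro borel_measurable_sum borel_measurable_times)
      fix i assume "i \<in> {..<d}"
      then show "(\<lambda>z. real_of_int \<lfloor>fst z i\<rfloor>) \<in> borel_measurable (Rd d \<Otimes>\<^sub>M Rd d)"
        "(\<lambda>z. snd z i) \<in> borel_measurable (Rd d \<Otimes>\<^sub>M Rd d)"
        using measurable_compose[OF c1(1)[of i], of "\<lambda>t. real_of_int \<lfloor>t\<rfloor>" borel] c1(2)[of i] by auto
    qed
    then show ?thesis by (simp add: dot_def rvec_def floor_vec_def)
  qed
  have tm: "\<theta> \<in> borel_measurable (Rd d \<Otimes>\<^sub>M Rd d)"
    unfolding \<theta>_def[abs_def] good_def w_def by measurable
  have tq: "quasiperiodic d \<theta>"
    unfolding quasiperiodic_def
  proof (intro ballI conjI)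
    fix n x y assume n: "n \<in> Zd d" "x \<in> space (Rd d)" "y \<in> space (Rd d)"
    have z1: "\<zeta> (shift d (rvec n) x, y) = cnj (ex (dot d (rvec n) y)) * \<zeta> (x, y)" and z2: "\<zeta> (x, shift d (rvec n) y) = \<zeta> (x, y)"
      using zq n by (auto simp: quasiperiodic_def)
    have fl: "dot d (rvec (floor_vec d (shift d (rvec n) x))) y = dot d (rvec (floor_vec d x)) y - dot d (rvec n) y"
      by (simp add: dot_def rvec_def floor_vec_def shift_def left_diff_distrib sum_subtractf)
    show "\<theta> (shift d (rvec n) x, y) = cnj (ex (dot d (rvec n) y)) * \<theta> (x, y)"
      by (simp add: \<theta>_def good_def z1 norm_mult w_def fl ex_diff)
    show "\<theta> (x, shift d (rvec n) y) = \<theta> (x, y)"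
      by (simp add: \<theta>_def good_def z2 w_def dot_shift ex_diff)
  qed
  have tb: "A \<le> (cmod (\<theta> z))\<^sup>2" "(cmod (\<theta> z))\<^sup>2 \<le> B" for z
    using AB by (auto simp: \<theta>_def good_def wn)
  have tL: "\<theta> \<in> L2 (torus d)"
  proof (rule bounded_L2[OF finite_torus, where c="sqrt B"])
    show "cmod (\<theta> z) \<le> sqrt B" for z using tb(2)[of z] by (simp add: real_le_rsqrt)
  qed (use tm in simp)
  have DL: "(\<lambda>z. \<zeta> z - \<theta> z) \<in> L2 (torus d)" by (rule L2_diff[OF zL tL])
  have Dq: "quasiperiodic d (\<lambda>z. \<zeta> z - \<theta> z)" using zq tq by (auto simp: quasiperiodic_def right_diff_distrib)
  have "AE z in torus d. \<zeta> z - \<theta> z = 0"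
    using bounds by eventually_elim (simp add: \<theta>_def good_def)
  then have D0: "norm_L2 (torus d) (\<lambda>z. \<zeta> z - \<theta> z) = 0" using norm_L2_eq_0_iff[OF DL] by simp
  have ae: "AE z in torus d. zak_shift d u v \<zeta> z = zak_shift d u v \<theta> z" for u v
  proof -
    have "AE z in torus d. zak_shift d u v (\<lambda>z. \<zeta> z - \<theta> z) z = 0"
      using zak_shift_L2[OF DL Dq, of u v] D0 norm_L2_eq_0_iff[of "zak_shift d u v (\<lambda>z. \<zeta> z - \<theta> z)" "torus d"] by simp
    then show ?thesis by eventually_elim (simp add: zak_shift_def)
  qed
  have gram: "inner_L2 (Rd d) (tf_shift d u v g) (tf_shift d u' v' g) = inner_L2 (torus d) (zak_shift d u v \<zeta>) (zak_shift d u' v' \<zeta>)" for u v u' v'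
  proof (rule inner_L2_eq_polarization)
    fix c :: complex
    \<comment> \<open>any two distinct labels for the two summands\<close>
    define a b :: "(nat \<Rightarrow> int) \<times> (nat \<Rightarrow> int)" where "a = ((\<lambda>_. 0), (\<lambda>_. 0))" and "b = ((\<lambda>_. 1), (\<lambda>_. 0))"
    have ab: "a \<noteq> b" by (auto simp: a_def b_def fun_eq_iff)
    show "norm_L2 (Rd d) (\<lambda>x. tf_shift d u v g x + c * tf_shift d u' v' g x)
        = norm_L2 (torus d) (\<lambda>z. zak_shift d u v \<zeta> z + c * zak_shift d u' v' \<zeta> z)"
      using iso[of "{a, b}" "\<lambda>j. if j = a then 1 else c" "\<lambda>j. if j = a then u else u'" "\<lambda>j. if j = a then v else v'"] ab
      by simp
  qed (use tf_shift_L2[OF g] zak_shift_L2[OF zL zq] in auto)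
  have "inner_L2 (torus d) (zak_shift d u v \<zeta>) (zak_shift d u' v' \<zeta>) = inner_L2 (torus d) (zak_shift d u v \<theta>) (zak_shift d u' v' \<theta>)" for u v u' v'
    unfolding inner_L2_def
  proof (rule integral_cong_AE)
    show "AE z in torus d. zak_shift d u v \<zeta> z * cnj (zak_shift d u' v' \<zeta> z) = zak_shift d u v \<theta> z * cnj (zak_shift d u' v' \<theta> z)"
      using ae[of u v] ae[of u' v'] by eventually_elim simp
    have L: "zak_shift d u v w \<in> L2 (torus d)" if "w \<in> L2 (torus d)" "quasiperiodic d w" for w u v
      using zak_shift_L2[OF that] by simp
    show "(\<lambda>z. zak_shift d u v \<zeta> z * cnj (zak_shift d u' v' \<zeta> z)) \<in> borel_measurable (torus d)"
      by (rule borel_measurable_integrable[OF inner_L2_integrable[OF L[OF zL zq] L[OF zL zq]]])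
    show "(\<lambda>z. zak_shift d u v \<theta> z * cnj (zak_shift d u' v' \<theta> z)) \<in> borel_measurable (torus d)"
      by (rule borel_measurable_integrable[OF inner_L2_integrable[OF L[OF tL tq] L[OF tL tq]]])
  qed
  with gram have "inner_L2 (Rd d) (tf_shift d u v g) (tf_shift d u' v' g)
      = inner_L2 (torus d) (zak_shift d u v \<theta>) (zak_shift d u' v' \<theta>)" for u v u' v'
    by (simp only:)
  then show ?thesis by (rule that[OF tm tq tb])
qed

section \<open>A de la Vallee Poussin kernel\<close>

lemma integrable_inverse_square: "integrable lborel (\<lambda>x::real. 1 / (1 + x\<^sup>2))"
proof (rule integrableI_bounded)
  let ?f = "\<lambda>x::real. 1 / (1 + x\<^sup>2)"
  have pos: "0 < 1 + x\<^sup>2" for x :: real by (simp add: add_pos_nonneg)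
  have half: "(\<integral>\<^sup>+x. ennreal (?f x) * indicator {0..} x \<partial>lborel) = ennreal (pi / 2 - arctan 0)"
  proof (rule nn_integral_FTC_atLeast)
    show "DERIV arctan x :> ?f x" for x using DERIV_arctan[of x] by (simp add: divide_inverse)
    show "(arctan \<longlongrightarrow> pi / 2) at_top" by (rule tendsto_arctan_at_top)
  qed (use pos in \<open>auto intro: less_imp_le\<close>)
  have "(\<integral>\<^sup>+x. ennreal (norm (?f x)) \<partial>lborel) \<le> (\<integral>\<^sup>+x. ennreal (?f x) * indicator {0..} x + ennreal (?f x) * indicator {..0} x \<partial>lborel)"
  proof (rule nn_integral_mono)
    fix x :: real
    have "norm (?f x) = ?f x" using pos[of x] by simp
    then show "ennreal (norm (?f x)) \<le> ennreal (?f x) * indicator {0..} x + ennreal (?f x) * indicator {..0} x"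
      by (auto simp: indicator_def)
  qed
  also have "\<dots> = (\<integral>\<^sup>+x. ennreal (?f x) * indicator {0..} x \<partial>lborel) + (\<integral>\<^sup>+x. ennreal (?f x) * indicator {..0} x \<partial>lborel)"
    by (rule nn_integral_add) auto
  also have "(\<integral>\<^sup>+x. ennreal (?f x) * indicator {..0} x \<partial>lborel) = (\<integral>\<^sup>+x. ennreal (?f x) * indicator {0..} x \<partial>lborel)"
    by (subst nn_integral_real_affine[where c="-1" and t=0]) (auto simp: indicator_def intro!: nn_integral_cong)
  finally show "(\<integral>\<^sup>+x. ennreal (norm (?f x)) \<partial>lborel) < \<infinity>" unfolding half by (auto intro: order.strict_trans1 simp flip: ennreal_plus)
qed measurable

text \<open>A multiple of the Fejer kernel.  Its Fourier transform is a tent function, which here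
results from \<open>cosdiff_integral\<close>: scaling shows how the integral depends on
\<open>a\<close>, and the value of the integral for \<open>a = 1\<close> may stay unknown.\<close>

definition cosdiff :: "real \<Rightarrow> real \<Rightarrow> real" where "cosdiff a x = (1 - cos (a * x)) / x\<^sup>2"

definition cosdiff_mass :: real where "cosdiff_mass = (LINT x|lborel. cosdiff 1 x)"

lemma cosdiff_measurable[measurable]: "cosdiff a \<in> borel_measurable borel"
  unfolding cosdiff_def[abs_def] by measurable

lemma cosdiff_nonneg: "0 \<le> cosdiff a x" by (simp add: cosdiff_def)

lemma one_minus_cos_le: "1 - cos x \<le> x\<^sup>2 / 2" for x :: real
proof -
  have "1 - cos x = 2 * (sin (x/2))\<^sup>2" using cos_double_sin[of "x/2"] by simp
  also have "(sin (x/2))\<^sup>2 \<le> (x/2)\<^sup>2" using abs_sin_x_le_abs_x[of "x/2"] by (simp only: abs_le_square_iff)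
  finally show ?thesis by (simp add: power_divide)
qed

lemma cosdiff_bound: "cosdiff 1 x \<le> 3 / (1 + x\<^sup>2)"
proof (cases "x = 0")
  case False
  have "(1 - cos x) * (1 + x\<^sup>2) \<le> x\<^sup>2 / 2 + 2 * x\<^sup>2"
    using one_minus_cos_le[of x] mult_right_mono[of "1 - cos x" 2 "x\<^sup>2"] cos_ge_minus_one[of x]
    by (simp only: distrib_left mult_1_right) simp
  also have "\<dots> \<le> 3 * x\<^sup>2" by simp
  finally show ?thesis using False by (simp add: cosdiff_def divide_le_eq pos_le_divide_eq add_pos_nonneg)
qed (simp add: cosdiff_def)

lemma cosdiff_integrable_1: "integrable lborel (cosdiff 1)"
proof (rule Bochner_Integration.integrable_bound[where f="\<lambda>x. 3 * (1 / (1 + x\<^sup>2))"])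
  show "integrable lborel (\<lambda>x::real. 3 * (1 / (1 + x\<^sup>2)))" using integrable_inverse_square by (rule integrable_mult_right)
  show "AE x in lborel. norm (cosdiff 1 x) \<le> norm (3 * (1 / (1 + x\<^sup>2)))"
    using cosdiff_bound cosdiff_nonneg by (intro AE_I2) auto
qed simp

lemma cosdiff_scale: "a \<noteq> 0 \<Longrightarrow> cosdiff a x = a\<^sup>2 * cosdiff 1 (a * x)"
  by (simp add: cosdiff_def power_mult_distrib)

lemma cosdiff_integrable: "integrable lborel (cosdiff a)"
proof (cases "a = 0")
  case False
  have "integrable lborel (\<lambda>x. a\<^sup>2 * cosdiff 1 (0 + a * x))"
    by (intro integrable_mult_right lborel_integrable_real_affine cosdiff_integrable_1 False)
  then show ?thesis using cosdiff_scale[OF False] by (simp add: cosdiff_scale[OF False, abs_def])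
qed (simp add: cosdiff_def[abs_def])

lemma cosdiff_integral: "(LINT x|lborel. cosdiff a x) = \<bar>a\<bar> * cosdiff_mass"
proof (cases "a = 0")
  case False
  have "cosdiff_mass = \<bar>a\<bar> * (LINT x|lborel. cosdiff 1 (a * x))"
    unfolding cosdiff_mass_def using lborel_integral_real_affine[OF False, of "cosdiff 1" 0] by simp
  then have "\<bar>a\<bar> * cosdiff_mass = \<bar>a\<bar> * (\<bar>a\<bar> * (LINT x|lborel. cosdiff 1 (a * x)))" by (rule arg_cong)
  also have "\<dots> = a\<^sup>2 * (LINT x|lborel. cosdiff 1 (a * x))"
    by (simp only: mult.assoc[symmetric] abs_mult_self_eq power2_eq_square)
  also have "\<dots> = (LINT x|lborel. cosdiff a x)" by (simp add: cosdiff_scale[OF False])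
  finally show ?thesis by simp
qed (simp add: cosdiff_def)

lemma cosdiff_mass_pos: "0 < cosdiff_mass"
proof -
  have "cosdiff_mass \<noteq> 0"
  proof
    assume "cosdiff_mass = 0"
    then have "AE x in lborel. cosdiff 1 x = 0"
      unfolding cosdiff_mass_def
      by (subst (asm) integral_nonneg_eq_0_iff_AE[OF cosdiff_integrable_1]) (auto simp: cosdiff_nonneg)
    then have "AE x in lborel. x \<notin> {0<..<1::real}"
    proof eventually_elim
      case (elim x)
      show ?case
      proof
        assume x: "x \<in> {0<..<1}"
        then have "cos x < cos 0" using pi_gt3 by (intro cos_monotone_0_pi) auto
        then show False using elim x by (simp add: cosdiff_def)
      qed
    qed
    then have "emeasure lborel {0<..<1::real} = 0"
      by (subst (asm) AE_iff_measurable[where N="{0<..<1}"]) auto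
    then show False by simp
  qed
  moreover have "0 \<le> cosdiff_mass" unfolding cosdiff_mass_def by (rule integral_nonneg_AE) (simp add: cosdiff_nonneg)
  ultimately show ?thesis by simp
qed

text \<open>A difference of two Fejer kernels, whose Fourier transform \<open>vp_symbol\<close> is a
difference of two tents: a trapezoid that is \<open>1\<close> on \<open>[-1, 1]\<close> and vanishes
outside \<open>[-2, 2]\<close>.\<close>

definition vp_kernel :: "real \<Rightarrow> real" where
  "vp_kernel x = (cosdiff 2 x - cosdiff 1 x) / cosdiff_mass"

definition vp_symbol :: "real \<Rightarrow> real" where
  "vp_symbol t = (\<bar>2 + t\<bar> + \<bar>2 - t\<bar> - \<bar>1 + t\<bar> - \<bar>1 - t\<bar>) / 2"

lemma vp_kernel_measurable[measurable]: "vp_kernel \<in> borel_measurable borel"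
  unfolding vp_kernel_def[abs_def] by measurable

lemma vp_kernel_integrable: "integrable lborel vp_kernel"
  unfolding vp_kernel_def[abs_def] using cosdiff_integrable by auto

lemma vp_symbol_bounds: "0 \<le> vp_symbol t" "vp_symbol t \<le> 1" "\<bar>t\<bar> \<le> 1 \<Longrightarrow> vp_symbol t = 1"
proof -
  show "0 \<le> vp_symbol t" by (simp add: vp_symbol_def abs_if)
  show "vp_symbol t \<le> 1" by (simp add: vp_symbol_def abs_if)
  show "\<bar>t\<bar> \<le> 1 \<Longrightarrow> vp_symbol t = 1" by (auto simp: vp_symbol_def abs_le_iff)
qed

text \<open>Product formulas for the cosine express the integrand through \<open>cosdiff\<close>
with the four parameters \<open>2 + t\<close>, \<open>2 - t\<close>, \<open>1 + t\<close>, \<open>1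
- t\<close>, whose integrals are proportional to their moduli.\<close>

lemma vp_kernel_cos: "(LINT x|lborel. vp_kernel x * cos (t * x)) = vp_symbol t"
proof -
  have eq: "vp_kernel x * cos (t * x) =
    (cosdiff (2 + t) x + cosdiff (2 - t) x - cosdiff (1 + t) x - cosdiff (1 - t) x) / (2 * cosdiff_mass)" for x
  proof -
    have "(cos x - cos (2 * x)) * cos (t * x) = (cos ((1 + t) * x) + cos ((1 - t) * x) - cos ((2 + t) * x) - cos ((2 - t) * x)) / 2"
      by (simp add: distrib_right left_diff_distrib cos_add cos_diff)
    moreover have "vp_kernel x = (cos x - cos (2 * x)) / x\<^sup>2 / cosdiff_mass"
      by (simp add: vp_kernel_def cosdiff_def diff_divide_distrib)
    ultimately have "vp_kernel x * cos (t * x) = (cos ((1 + t) * x) + cos ((1 - t) * x) - cos ((2 + t) * x) - cos ((2 - t) * x)) / 2 / x\<^sup>2 / cosdiff_mass"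
      by (metis (no_types, lifting) times_divide_eq_left)
    then show ?thesis by (simp add: cosdiff_def add_divide_distrib diff_divide_distrib)
  qed
  show ?thesis unfolding eq
    using cosdiff_mass_pos by (simp add: cosdiff_integrable cosdiff_integral vp_symbol_def field_simps)
qed

lemma vp_kernel_even: "vp_kernel (- x) = vp_kernel x"
  by (simp add: vp_kernel_def cosdiff_def)

lemma vp_kernel_sin: "(LINT x|lborel. vp_kernel x * sin (t * x)) = 0"
proof -
  have "(LINT x|lborel. vp_kernel x * sin (t * x)) = (LINT x|lborel. vp_kernel (0 + (-1) * x) * sin (t * (0 + (-1) * x)))"
    by (subst lborel_integral_real_affine[where c="-1" and t=0]) auto
  also have "\<dots> = - (LINT x|lborel. vp_kernel x * sin (t * x))" by (simp add: vp_kernel_even)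
  finally show ?thesis by simp
qed

lemma vp_kernel_trig_integrable:
  "integrable lborel (\<lambda>x. vp_kernel x * cos (t * x))" "integrable lborel (\<lambda>x. vp_kernel x * sin (t * x))"
  by (rule Bochner_Integration.integrable_bound[OF vp_kernel_integrable];
      (intro AE_I2 | measurable); simp add: abs_mult mult_left_le)+

lemma vp_kernel_cis: "(LINT x|lborel. complex_of_real (vp_kernel x) * cis (t * x)) = of_real (vp_symbol t)"
proof -
  have "(LINT x|lborel. complex_of_real (vp_kernel x) * cis (t * x))
     = (LINT x|lborel. complex_of_real (vp_kernel x * cos (t * x)) + \<i> * complex_of_real (vp_kernel x * sin (t * x)))"
    by (rule Bochner_Integration.integral_cong) (auto simp: complex_eq_iff)
  also have "\<dots> = complex_of_real (LINT x|lborel. vp_kernel x * cos (t * x)) + \<i> * complex_of_real (LINT x|lborel. vp_kernel x * sin (t * x))"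
    using integrable_of_real[OF vp_kernel_trig_integrable(1)[of t], where 'a=complex] integrable_of_real[OF vp_kernel_trig_integrable(2)[of t], where 'a=complex]
    by (simp add: integral_complex_of_real del: of_real_mult)
  finally show ?thesis by (simp add: vp_kernel_cos vp_kernel_sin)
qed

lemma vp_kernel_bound: "\<bar>vp_kernel x\<bar> \<le> (15 / cosdiff_mass) * (1 / (1 + x\<^sup>2))"
proof -
  have p: "0 < 1 + x\<^sup>2" by (simp add: add_pos_nonneg)
  have "cosdiff 2 x = 4 * cosdiff 1 (2 * x)" using cosdiff_scale[of 2 x] by simp
  also have "\<dots> \<le> 4 * (3 / (1 + (2 * x)\<^sup>2))" by (intro mult_left_mono cosdiff_bound) simp
  also have "\<dots> \<le> 12 / (1 + x\<^sup>2)" using p by (auto simp: power_mult_distrib intro!: divide_left_mono mult_pos_pos add_pos_nonneg)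
  finally have "\<bar>cosdiff 2 x - cosdiff 1 x\<bar> \<le> 12 / (1 + x\<^sup>2) + 3 / (1 + x\<^sup>2)"
    using cosdiff_bound[of x] cosdiff_nonneg[of 1 x] cosdiff_nonneg[of 2 x] by linarith
  also have "\<dots> = 15 / (1 + x\<^sup>2)" by (simp add: add_divide_distrib[symmetric])
  finally have "\<bar>cosdiff 2 x - cosdiff 1 x\<bar> / cosdiff_mass \<le> 15 / (1 + x\<^sup>2) / cosdiff_mass"
    using cosdiff_mass_pos by (intro divide_right_mono) auto
  then show ?thesis using cosdiff_mass_pos by (simp add: vp_kernel_def mult.commute)
qed

text \<open>Translation is continuous in the integral norm, by dominated convergence with the
majorant from \<open>vp_kernel_bound\<close>.\<close>

lemma vp_kernel_translation:
  assumes e: "0 < e"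
  shows "\<exists>\<eta>>0. \<eta> \<le> 1 \<and> (\<forall>h. \<bar>h\<bar> \<le> \<eta> \<longrightarrow> (LINT x|lborel. \<bar>vp_kernel (x + h) - vp_kernel x\<bar>) \<le> e)"
proof -
  let ?w = "\<lambda>h. LINT x|lborel. \<bar>vp_kernel (x + h) - vp_kernel x\<bar>"
  let ?C = "15 / cosdiff_mass"
  have C: "0 < ?C" using cosdiff_mass_pos by simp
  have "(?w \<longlongrightarrow> 0) (at 0 within {-1..1})"
    unfolding tendsto_at_iff_sequentially
  proof (intro allI impI)
    fix X :: "nat \<Rightarrow> real" assume X: "\<forall>i. X i \<in> {-1..1} - {0}" "X \<longlonglongrightarrow> 0"
    have "(\<lambda>n. LINT x|lborel. \<bar>vp_kernel (x + X n) - vp_kernel x\<bar>) \<longlonglongrightarrow> (LINT x|(lborel :: real measure). 0)"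
    proof (rule integral_dominated_convergence[where w="\<lambda>x. 4 * ?C * (1 / (1 + x\<^sup>2))"])
      \<comment> \<open>\<open>3\<close> for the translate, as \<open>\<bar>X n\<bar> \<le> 1\<close>, and \<open>1\<close> for the kernel itself\<close>
      show "integrable lborel (\<lambda>x::real. 4 * ?C * (1 / (1 + x\<^sup>2)))"
        using integrable_inverse_square by (rule integrable_mult_right)
      show "AE x in lborel. norm \<bar>vp_kernel (x + X n) - vp_kernel x\<bar> \<le> 4 * ?C * (1 / (1 + x\<^sup>2))" for n
      proof (rule AE_I2)
        fix x
        let ?h = "X n"
        have h: "?h\<^sup>2 \<le> 1" using X(1) by (auto simp: abs_square_le_1 abs_le_iff)
        have "x\<^sup>2 = ((x + ?h) + (- ?h))\<^sup>2" by simp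
        also have "\<dots> \<le> 2 * (x + ?h)\<^sup>2 + 2 * (- ?h)\<^sup>2"
          using sum_squares_bound[of "x + ?h" "- ?h"] by (simp only: power2_sum) simp
        finally have sq: "x\<^sup>2 \<le> 2 * (x + ?h)\<^sup>2 + 2 * ?h\<^sup>2" unfolding power2_minus .
        have "1 + p \<le> 3 * (1 + a)" if "p \<le> 2 * a + 2 * b" "b \<le> 1" "0 \<le> a" for p a b :: real
          using that by simp
        from this[OF sq h zero_le_power2] have "1 + x\<^sup>2 \<le> 3 * (1 + (x + ?h)\<^sup>2)" .
        then have "1 / (1 + (x + ?h)\<^sup>2) \<le> 3 * (1 / (1 + x\<^sup>2))"
          by (simp add: divide_le_eq pos_divide_le_eq pos_le_divide_eq add_pos_nonneg)
        then have "?C * (1 / (1 + (x + ?h)\<^sup>2)) \<le> ?C * (3 * (1 / (1 + x\<^sup>2)))" using C by (intro mult_left_mono) auto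
        then show "norm \<bar>vp_kernel (x + X n) - vp_kernel x\<bar> \<le> 4 * ?C * (1 / (1 + x\<^sup>2))"
          using vp_kernel_bound[of "x + ?h"] vp_kernel_bound[of x] by simp
      qed
      have "AE x in lborel. x \<noteq> (0::real)" by (rule AE_lborel_singleton)
      then show "AE x in lborel. (\<lambda>n. \<bar>vp_kernel (x + X n) - vp_kernel x\<bar>) \<longlonglongrightarrow> 0"
      proof eventually_elim
        case (elim x)
        have "isCont vp_kernel x"
          unfolding vp_kernel_def[abs_def] cosdiff_def using elim cosdiff_mass_pos by (intro continuous_intros) auto
        moreover have "(\<lambda>n. x + X n) \<longlonglongrightarrow> x + 0" by (intro tendsto_intros X)
        ultimately have "(\<lambda>n. vp_kernel (x + X n)) \<longlonglongrightarrow> vp_kernel x" by (auto intro: isCont_tendsto_compose)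
        then have "(\<lambda>n. \<bar>vp_kernel (x + X n) - vp_kernel x\<bar>) \<longlonglongrightarrow> \<bar>vp_kernel x - vp_kernel x\<bar>" by (intro tendsto_intros)
        then show ?case by simp
      qed
    qed auto
    then show "(?w \<circ> X) \<longlonglongrightarrow> 0" by (simp add: comp_def)
  qed
  then have "\<forall>\<^sub>F h in at 0 within {-1..1}. dist (?w h) 0 < e" using e by (rule tendstoD)
  then obtain r where r: "0 < r" "\<And>h. h \<in> {-1..1} \<Longrightarrow> h \<noteq> 0 \<Longrightarrow> dist h 0 < r \<Longrightarrow> dist (?w h) 0 < e"
    unfolding eventually_at by blast
  have "?w h \<le> e" if h: "\<bar>h\<bar> \<le> min 1 (r/2)" for h
  proof (cases "h = 0")
    case False
    have "dist (?w h) 0 < e" by (rule r(2)) (use h r(1) False in \<open>auto simp: abs_le_iff\<close>)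
    then show ?thesis by simp
  qed (use e in simp)
  then show ?thesis using r(1) by (intro exI[of _ "min 1 (r/2)"]) auto
qed

text \<open>Concentrated at scale \<open>1 / W\<close>; its Fourier transform is \<open>1\<close> on
frequencies of modulus at most \<open>W\<close>, in the normalization of
\<open>scaled_kernel_symbol\<close>.\<close>

definition scaled_kernel :: "real \<Rightarrow> real \<Rightarrow> real" where "scaled_kernel W s = W * vp_kernel (W * s)"

lemma scaled_kernel_integrable: "0 < W \<Longrightarrow> integrable lborel (scaled_kernel W)"
  unfolding scaled_kernel_def[abs_def]
  using integrable_mult_right[OF lborel_integrable_real_affine[OF vp_kernel_integrable, of W 0], of W] by simp

lemma scaled_kernel_symbol:
  assumes W: "0 < W"
  shows "(LINT s|lborel. of_real (scaled_kernel W s) * cis (t * s)) = of_real (vp_symbol (t / W))"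
proof -
  have "(LINT x|lborel. complex_of_real (vp_kernel x) * cis (t / W * x))
      = \<bar>W\<bar> *\<^sub>R (LINT x|lborel. complex_of_real (vp_kernel (0 + W * x)) * cis (t / W * (0 + W * x)))"
    by (rule lborel_integral_real_affine) (use W in simp)
  also have "\<dots> = (LINT s|lborel. of_real (scaled_kernel W s) * cis (t * s))"
    using W by (simp add: scaled_kernel_def scaleR_conv_of_real mult.assoc)
  finally show ?thesis unfolding vp_kernel_cis by (rule sym)
qed

lemma scaled_kernel_L1: "0 < W \<Longrightarrow> (LINT s|lborel. \<bar>scaled_kernel W s\<bar>) = (LINT x|lborel. \<bar>vp_kernel x\<bar>)"
  using lborel_integral_real_affine[of W "\<lambda>x. \<bar>vp_kernel x\<bar>" 0] by (simp add: scaled_kernel_def abs_mult)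

lemma scaled_kernel_translation: "0 < W \<Longrightarrow>
    (LINT s|lborel. \<bar>scaled_kernel W (s + h) - scaled_kernel W s\<bar>) = (LINT x|lborel. \<bar>vp_kernel (x + W * h) - vp_kernel x\<bar>)"
proof -
  assume W: "0 < W"
  have "(LINT x|lborel. \<bar>vp_kernel (x + W * h) - vp_kernel x\<bar>) = W * (LINT s|lborel. \<bar>vp_kernel (W * s + W * h) - vp_kernel (W * s)\<bar>)"
    using lborel_integral_real_affine[of W "\<lambda>x. \<bar>vp_kernel (x + W * h) - vp_kernel x\<bar>" 0] W by simp
  also have "\<dots> = (LINT s|lborel. W * \<bar>vp_kernel (W * s + W * h) - vp_kernel (W * s)\<bar>)" by simp
  also have "\<dots> = (LINT s|lborel. \<bar>scaled_kernel W (s + h) - scaled_kernel W s\<bar>)"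
    using W by (intro Bochner_Integration.integral_cong) (auto simp: scaled_kernel_def distrib_left right_diff_distrib[symmetric] abs_mult)
  finally show ?thesis by simp
qed

text \<open>The translation is moved from \<open>u\<close>, which need not be continuous, to the
integrable kernel.\<close>

lemma integral_translate_difference:
  fixes u :: "real \<Rightarrow> complex"
  assumes k: "integrable lborel k" and u[measurable]: "u \<in> borel_measurable borel" and b: "\<And>s. cmod (u s) \<le> b"
  shows "cmod ((LINT s|lborel. of_real (k s) * u (s - h)) - (LINT s|lborel. of_real (k s) * u s))
    \<le> b * (LINT s|lborel. \<bar>k (s + h) - k s\<bar>)"
proof -
  have [measurable]: "k \<in> borel_measurable borel" using k by auto
  have b0: "0 \<le> b" using b[of 0] norm_ge_zero[of "u 0"] by linarith
  have k': "integrable lborel (\<lambda>s. k (s + h))" using lborel_integrable_real_affine[OF k, of 1 h] by (simp add: add.commute)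
  have int: "integrable lborel (\<lambda>s. of_real (r s) * u s)" if r: "integrable lborel r" for r :: "real \<Rightarrow> real"
  proof (rule Bochner_Integration.integrable_bound[where f="\<lambda>s. b * \<bar>r s\<bar>"])
    show "integrable lborel (\<lambda>s. b * \<bar>r s\<bar>)" using r by auto
    show "AE s in lborel. norm (of_real (r s) * u s) \<le> norm (b * \<bar>r s\<bar>)"
    proof (rule AE_I2)
      fix s
      show "norm (of_real (r s) * u s) \<le> norm (b * \<bar>r s\<bar>)"
        using mult_right_mono[OF b[of s] abs_ge_zero[of "r s"]] b0 by (simp add: norm_mult abs_mult mult.commute)
    qed
    show "(\<lambda>s. of_real (r s) * u s) \<in> borel_measurable lborel" using borel_measurable_integrable[OF r] by measurable
  qed
  have "(LINT s|lborel. of_real (k s) * u (s - h)) = (LINT s|lborel. of_real (k (s + h)) * u s)"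
    using lborel_integral_real_affine[of 1 "\<lambda>s. of_real (k s) * u (s - h)" h] by (simp add: add.commute)
  then have "(LINT s|lborel. of_real (k s) * u (s - h)) - (LINT s|lborel. of_real (k s) * u s)
     = (LINT s|lborel. of_real (k (s + h)) * u s - of_real (k s) * u s)"
    using int[OF k] int[OF k'] by simp
  also have "\<dots> = (LINT s|lborel. of_real (k (s + h) - k s) * u s)" by (simp add: left_diff_distrib)
  also have "cmod \<dots> \<le> (LINT s|lborel. cmod (of_real (k (s + h) - k s) * u s))" by (rule integral_norm_bound)
  also have "\<dots> \<le> (LINT s|lborel. b * \<bar>k (s + h) - k s\<bar>)"
  proof (rule integral_mono)
    have d: "integrable lborel (\<lambda>s. k (s + h) - k s)" using k k' by auto
    show "integrable lborel (\<lambda>s. cmod (of_real (k (s + h) - k s) * u s))" using int[OF d] by (rule integrable_norm)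
    show "integrable lborel (\<lambda>s. b * \<bar>k (s + h) - k s\<bar>)" using d by auto
    show "cmod (of_real (k (s + h) - k s) * u s) \<le> b * \<bar>k (s + h) - k s\<bar>" for s
      unfolding norm_mult norm_of_real using mult_left_mono[OF b[of s], of "\<bar>k (s + h) - k s\<bar>"] by (simp add: mult.commute)
  qed
  finally show ?thesis by simp
qed

section \<open>Winding numbers on a grid\<close>

lemma exp_eq_1_small: "exp z = 1 \<Longrightarrow> \<bar>Im z\<bar> < 2 * pi \<Longrightarrow> Im z = 0"
proof -
  assume e: "exp z = 1" and b: "\<bar>Im z\<bar> < 2 * pi"
  obtain n :: int where n: "Im z = of_int (2 * n) * pi" using e exp_eq_1 by blast
  have "\<bar>real_of_int n\<bar> * (2 * pi) < 1 * (2 * pi)" using b unfolding n by (simp add: abs_mult)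
  then have "\<bar>real_of_int n\<bar> < 1" using pi_gt_zero by (simp only: mult_less_cancel_right_pos)
  then have "n = 0" by linarith
  then show ?thesis using n by simp
qed

text \<open>Along every edge the quotient of neighbouring values has an argument below \<open>\<pi>
/ 2\<close> in modulus.  The four arguments around a cell add up to a multiple of \<open>2
\<pi>\<close> that is smaller than \<open>2 \<pi>\<close>, hence to \<open>0\<close>, and so the
total argument \<open>V p\<close> along the column \<open>p\<close> does not depend on
\<open>p\<close>.  The last condition makes the total along the last column exceed that along the
first by \<open>2 \<pi>\<close>.\<close>

lemma grid_winding:
  fixes z :: "nat \<Rightarrow> nat \<Rightarrow> complex"
  assumes K: "2 \<le> K'"
    and hor: "\<And>p q. p < K \<Longrightarrow> q \<le> K' \<Longrightarrow> cmod (z (Suc p) q - z p q) < cmod (z p q)"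
    and ver: "\<And>p q. p \<le> K \<Longrightarrow> q < K' \<Longrightarrow> cmod (z p (Suc q) - z p q) < cmod (z p q)"
    and per: "\<And>p. p \<le> K \<Longrightarrow> z p K' = z p 0"
    and quasi: "\<And>q. q \<le> K' \<Longrightarrow> z K q = ex (t + real q / real K') * z 0 q"
  shows False
proof -
  have log: "exp (Ln (b / a)) = b / a \<and> \<bar>Im (Ln (b / a))\<bar> < pi / 2" if ab: "cmod (b - a) < cmod a" for a b :: complex
  proof -
    have a: "a \<noteq> 0" using ab by auto
    have "cmod (b / a - 1) < 1" using ab a by (simp add: norm_divide diff_divide_distrib[symmetric] divide_simps flip: divide_diff_eq_iff)
    then have "\<bar>Re (b / a - 1)\<bar> < 1" using abs_Re_le_cmod[of "b / a - 1"] by linarith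
    then have re: "0 < Re (b / a)" by simp
    then have "b / a \<noteq> 0" by auto
    then show ?thesis using Re_Ln_pos_lt_imp[OF re] by simp
  qed
  define \<alpha> where "\<alpha> p q = Ln (z (Suc p) q / z p q)" for p q
  define \<beta> where "\<beta> p q = Ln (z p (Suc q) / z p q)" for p q
  have a: "exp (\<alpha> p q) = z (Suc p) q / z p q" "\<bar>Im (\<alpha> p q)\<bar> < pi / 2" if "p < K" "q \<le> K'" for p q
    using log[OF hor[OF that]] by (auto simp: \<alpha>_def)
  have b: "exp (\<beta> p q) = z p (Suc q) / z p q" "\<bar>Im (\<beta> p q)\<bar> < pi / 2" if "p \<le> K" "q < K'" for p q
    using log[OF ver[OF that]] by (auto simp: \<beta>_def)
  have nz: "z p q \<noteq> 0" if "p \<le> K" "q < K'" for p q using ver[OF that] by auto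
  have nz': "z p q \<noteq> 0" if "p \<le> K" "q \<le> K'" for p q
  proof (cases "q < K'")
    case False
    then have "z p q = z p 0" using per that by simp
    then show ?thesis using nz[of p 0] that K by simp
  qed (use nz that in simp)
  have plaq: "Im (\<alpha> p q) + Im (\<beta> (Suc p) q) = Im (\<alpha> p (Suc q)) + Im (\<beta> p q)" if p: "p < K" and q: "q < K'" for p q
  proof -
    let ?w = "\<alpha> p q + \<beta> (Suc p) q - \<alpha> p (Suc q) - \<beta> p q"
    have "exp ?w = (z (Suc p) q / z p q) * (z (Suc p) (Suc q) / z (Suc p) q) / (z (Suc p) (Suc q) / z p (Suc q)) / (z p (Suc q) / z p q)"
      using p q by (simp only: exp_diff exp_add a b Suc_leI less_imp_le)
    also have "\<dots> = 1" using nz'[of p q] nz'[of "Suc p" q] nz'[of "Suc p" "Suc q"] nz'[of p "Suc q"] p q by simp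
    finally have "Im ?w = 0"
    proof (rule exp_eq_1_small)
      have "\<bar>Im (\<alpha> p q)\<bar> < pi / 2" "\<bar>Im (\<beta> (Suc p) q)\<bar> < pi / 2" "\<bar>Im (\<alpha> p (Suc q))\<bar> < pi / 2" "\<bar>Im (\<beta> p q)\<bar> < pi / 2"
        using a(2)[of p q] b(2)[of "Suc p" q] a(2)[of p "Suc q"] b(2)[of p q] p q by auto
      moreover have "Im ?w = Im (\<alpha> p q) + Im (\<beta> (Suc p) q) - Im (\<alpha> p (Suc q)) - Im (\<beta> p q)" by simp
      ultimately show "\<bar>Im ?w\<bar> < 2 * pi" by linarith
    qed
    then show ?thesis by simp
  qed
  \<comment> \<open>the total argument along a column\<close>
  define V where "V p = (\<Sum>q<K'. Im (\<beta> p q))" for p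
  have step: "V (Suc p) = V p" if p: "p < K" for p
  proof -
    have "V (Suc p) - V p = (\<Sum>q<K'. Im (\<alpha> p (Suc q)) - Im (\<alpha> p q))"
      unfolding V_def sum_subtractf[symmetric] by (rule sum.cong) (use plaq[OF p] in force)+
    also have "\<dots> = Im (\<alpha> p K') - Im (\<alpha> p 0)" by (rule sum_lessThan_telescope)
    also have "\<dots> = 0" using per[of p] per[of "Suc p"] p by (simp add: \<alpha>_def)
    finally show ?thesis by simp
  qed
  have VK: "V p = V 0" if "p \<le> K" for p using that by (induction p) (auto simp: step)
  have jump: "Im (\<beta> K q) = Im (\<beta> 0 q) + 2 * pi / real K'" if q: "q < K'" for q
  proof -
    let ?w = "\<beta> K q - \<beta> 0 q - \<i> * of_real (2 * pi / real K')"
    have cis: "exp (\<i> * of_real (2 * pi / real K')) = ex (1 / real K')" by (simp add: ex_def cis_conv_exp)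
    have "ex (t + real (Suc q) / real K') = ex (t + real q / real K') * ex (1 / real K')"
      unfolding ex_add[symmetric] by (simp add: add_divide_distrib add_ac)
    then have "z K (Suc q) / z K q = ex (1 / real K') * (z 0 (Suc q) / z 0 q)"
      using quasi[of q] quasi[of "Suc q"] q by simp
    then have "exp ?w = 1"
      unfolding exp_diff cis using b(1)[of K q] b(1)[of 0 q] nz'[of 0 q] nz'[of 0 "Suc q"] q by simp
    moreover have "\<bar>Im ?w\<bar> < 2 * pi"
    proof -
      \<comment> \<open>\<open>2 \<le> K'\<close> keeps the three terms of \<open>Im ?w\<close> below \<open>2 \<pi>\<close> together\<close>
      have "2 * pi / real K' \<le> 2 * pi / 2" using K by (intro divide_left_mono) auto
      moreover have "0 \<le> 2 * pi / real K'" by simp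
      moreover have "Im ?w = Im (\<beta> K q) - Im (\<beta> 0 q) - 2 * pi / real K'" by simp
      ultimately show ?thesis using b(2)[of K q] b(2)[of 0 q] q by linarith
    qed
    ultimately have "Im ?w = 0" by (rule exp_eq_1_small)
    then show ?thesis by simp
  qed
  have "V K = V 0 + (\<Sum>q<K'. 2 * pi / real K')"
    unfolding V_def sum.distrib[symmetric] by (rule sum.cong) (use jump in auto)
  also have "(\<Sum>q<K'. 2 * pi / real K') = 2 * pi" using K by simp
  finally show False using VK[of K] pi_gt_zero by simp
qed

section \<open>The lower bound for the energy\<close>

definition axis :: "nat \<Rightarrow> real \<Rightarrow> nat \<Rightarrow> real" where "axis i s = (\<lambda>j. if j = i then s else 0)"

lemma dot_axis: "i < d \<Longrightarrow> dot d (axis i s) x = s * x i"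
proof -
  assume "i < d"
  have "dot d (axis i s) x = (\<Sum>j<d. if j = i then s * x i else 0)"
    unfolding dot_def by (rule sum.cong) (auto simp: axis_def)
  then show ?thesis using \<open>i < d\<close> by simp
qed

lemma axis_add: "(\<lambda>j. axis i s j + axis i t j) = axis i (s + t)" by (auto simp: axis_def)

lemma axis_0: "axis i 0 = (\<lambda>_. 0)" by (auto simp: axis_def)

lemma dot_zero[simp]: "dot d (\<lambda>_. 0) x = 0" by (simp add: dot_def)

lemma zak_shift_quasiperiodic:
  assumes q: "quasiperiodic d \<zeta>" shows "quasiperiodic d (zak_shift d u v \<zeta>)"
  unfolding quasiperiodic_def
proof (intro ballI conjI)
  fix n x y assume n: "n \<in> Zd d" and xy: "x \<in> space (Rd d)" "y \<in> space (Rd d)"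
  have c: "shift d w (shift d (rvec n) x) = shift d (rvec n) (shift d w x)" for w x
    unfolding shift_shift by (simp add: add.commute)
  have q1: "\<zeta> (shift d (rvec n) (shift d u x), shift d v y) = cnj (ex (dot d (rvec n) (shift d v y))) * \<zeta> (shift d u x, shift d v y)"
    using q n unfolding quasiperiodic_def by (meson shift_in_space)
  have q2: "\<zeta> (shift d u x, shift d (rvec n) (shift d v y)) = \<zeta> (shift d u x, shift d v y)"
    using q n unfolding quasiperiodic_def by (meson shift_in_space)
  show "zak_shift d u v \<zeta> (x, shift d (rvec n) y) = zak_shift d u v \<zeta> (x, y)"
    by (simp add: zak_shift_def c q2)
  have "ex (dot d v (shift d (rvec n) x)) * cnj (ex (dot d (rvec n) (shift d v y))) = cnj (ex (dot d (rvec n) y)) * ex (dot d v x)"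
    unfolding ex_minus[symmetric] ex_add[symmetric] dot_shift
    by (rule arg_cong[where f=ex]) (simp add: dot_commute[of d v "rvec n"])
  then show "zak_shift d u v \<zeta> (shift d (rvec n) x, y) = cnj (ex (dot d (rvec n) y)) * zak_shift d u v \<zeta> (x, y)"
    by (simp add: zak_shift_def c q1 mult.assoc[symmetric])
qed

lemma superposition_quasiperiodic:
  assumes "\<And>s. quasiperiodic d (w s)" shows "quasiperiodic d (superposition k w)"
  unfolding quasiperiodic_def
proof (intro ballI conjI)
  fix n x y assume n: "n \<in> Zd d" "x \<in> space (Rd d)" "y \<in> space (Rd d)"
  have e: "w s (shift d (rvec n) x, y) = cnj (ex (dot d (rvec n) y)) * w s (x, y)" "w s (x, shift d (rvec n) y) = w s (x, y)" for s
    using assms[of s] n unfolding quasiperiodic_def by blast+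
  show "superposition k w (x, shift d (rvec n) y) = superposition k w (x, y)"
    by (simp add: superposition_def e)
  show "superposition k w (shift d (rvec n) x, y) = cnj (ex (dot d (rvec n) y)) * superposition k w (x, y)"
    unfolding superposition_def e mult.left_commute[of "of_real _" "cnj _"] by simp
qed

lemma sigma_finite_torus: "sigma_finite_measure (torus d)"
  using finite_torus[of d] by (rule finite_measure.axioms)

lemma open_box_sets: "open_box d L \<in> sets (Rd d)"
  unfolding open_box_def Rd_def by (rule sets_PiM_I_finite) auto

text \<open>The remainder on the torus has the norm of the remainder of the modulations \<open>ex
(\<sigma> * (s * x i)) * h x\<close>.  There the superposition multiplies \<open>h\<close> by
\<open>vp_symbol (\<sigma> * x i / L i)\<close>, which is \<open>1\<close> on the box, and the
factor left over has modulus at most \<open>1\<close> elsewhere.\<close>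

lemma smoothing_energy:
  assumes i: "i < d" and h: "h \<in> L2 (Rd d)" and L: "0 < L i" and sg: "\<bar>\<sigma>\<bar> = (1::real)"
    and w[measurable]: "(\<lambda>(s, z). w s z) \<in> borel_measurable (lborel \<Otimes>\<^sub>M torus d)"
    and bd: "\<And>s z. cmod (w s z) \<le> b"
    and gram: "\<And>s t. inner_L2 (torus d) (w s) (w t)
      = inner_L2 (Rd d) (\<lambda>x. ex (\<sigma> * (s * x i)) * h x) (\<lambda>x. ex (\<sigma> * (t * x i)) * h x)"
  shows "(\<lambda>z. w 0 z - superposition (scaled_kernel (2 * pi * L i)) w z) \<in> L2 (torus d)"
    "(norm_L2 (torus d) (\<lambda>z. w 0 z - superposition (scaled_kernel (2 * pi * L i)) w z))\<^sup>2 \<le> energy_outside d L h"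
proof -
  let ?W = "2 * pi * L i"
  have W: "0 < ?W" using L by simp
  let ?k = "scaled_kernel ?W"
  define v where "v s x = ex (\<sigma> * (s * x i)) * h x" for s :: real and x
  have hm[measurable]: "h \<in> borel_measurable (Rd d)" using h by (rule L2_measurable)
  have k: "integrable lborel ?k" by (rule scaled_kernel_integrable[OF W])
  interpret T: finite_measure "torus d" by (rule finite_torus)
  note g1 = superposition_remainder_gram[OF sigma_finite_torus k w, of "\<lambda>_. b", OF _ _ bd]
  have comp[measurable]: "(\<lambda>p. snd p i) \<in> borel_measurable (lborel \<Otimes>\<^sub>M Rd d)" by (rule measurable_Rd_component[OF measurable_snd i])
  have vm: "(\<lambda>(s, x). v s x) \<in> borel_measurable (lborel \<Otimes>\<^sub>M Rd d)"
  proof -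
    have "(\<lambda>p. ex (\<sigma> * (fst p * snd p i)) * h (snd p)) \<in> borel_measurable (lborel \<Otimes>\<^sub>M Rd d)" by measurable
    then show ?thesis by (simp add: v_def case_prod_beta')
  qed
  have hb: "(\<lambda>x. cmod (h x)) \<in> borel_measurable (Rd d)" by measurable
  note g2 = superposition_remainder_gram[OF sigma_finite_Rd k vm hb L2_integrable_square[OF h]]
  have vb: "cmod (v s x) \<le> cmod (h x)" for s x by (simp add: v_def norm_mult)
  have gv: "inner_L2 (torus d) (w s) (w t) = inner_L2 (Rd d) (v s) (v t)" for s t
    unfolding gram v_def[abs_def] ..
  show DL: "(\<lambda>z. w 0 z - superposition ?k w z) \<in> L2 (torus d)" by (rule g1(1)) auto
  have "complex_of_real ((norm_L2 (torus d) (\<lambda>z. w 0 z - superposition ?k w z))\<^sup>2)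
      = complex_of_real ((norm_L2 (Rd d) (\<lambda>z. v 0 z - superposition ?k v z))\<^sup>2)"
    using g1(2) g2(2)[OF vb] unfolding gv by simp
  then have eq: "(norm_L2 (torus d) (\<lambda>z. w 0 z - superposition ?k w z))\<^sup>2 = (norm_L2 (Rd d) (\<lambda>z. v 0 z - superposition ?k v z))\<^sup>2"
    by (simp only: of_real_eq_iff)
  let ?m = "\<lambda>x. vp_symbol (\<sigma> * x i / L i)"
  have sup: "superposition ?k v x = h x * of_real (?m x)" for x
  proof -
    have "superposition ?k v x = (LINT s|lborel. (of_real (?k s) * cis ((2 * pi * (\<sigma> * x i)) * s)) * h x)"
      unfolding superposition_def v_def ex_def by (simp add: mult_ac)
    also have "\<dots> = of_real (vp_symbol ((2 * pi * (\<sigma> * x i)) / ?W)) * h x"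
      by (subst integral_mult_left_zero) (simp only: scaled_kernel_symbol[OF W])
    also have "(2 * pi * (\<sigma> * x i)) / ?W = \<sigma> * x i / L i" using L by simp
    finally show ?thesis by (simp add: mult.commute)
  qed
  have DvL: "(\<lambda>z. v 0 z - superposition ?k v z) \<in> L2 (Rd d)" by (rule g2(1)[OF vb])
  have "(norm_L2 (Rd d) (\<lambda>z. v 0 z - superposition ?k v z))\<^sup>2
     \<le> (LINT x|Rd d. indicator (space (Rd d) - open_box d L) x *\<^sub>R (cmod (h x))\<^sup>2)"
    unfolding norm_L2_power2
  proof (rule integral_mono)
    show "integrable (Rd d) (\<lambda>x. (cmod (v 0 x - superposition ?k v x))\<^sup>2)" using DvL by (rule L2_integrable_square)
    show "integrable (Rd d) (\<lambda>x. indicator (space (Rd d) - open_box d L) x *\<^sub>R (cmod (h x))\<^sup>2)"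
      by (rule integrable_mult_indicator[OF _ L2_integrable_square[OF h]]) (use open_box_sets in auto)
    fix x assume x: "x \<in> space (Rd d)"
    have D: "v 0 x - superposition ?k v x = h x * of_real (1 - ?m x)" unfolding sup by (simp add: v_def algebra_simps)
    show "(cmod (v 0 x - superposition ?k v x))\<^sup>2 \<le> indicator (space (Rd d) - open_box d L) x *\<^sub>R (cmod (h x))\<^sup>2"
    proof (cases "x \<in> open_box d L")
      case True
      then have "x i \<in> {- L i <..< L i}" using i unfolding open_box_def PiE_iff by blast
      then have "\<bar>x i\<bar> < L i" by (auto simp: abs_less_iff)
      then have "\<bar>\<sigma> * x i / L i\<bar> \<le> 1" using L sg by (simp add: abs_mult)
      then have "?m x = 1" by (rule vp_symbol_bounds(3))
      then show ?thesis using True unfolding D by simp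
    next
      case False
      have m: "\<bar>1 - ?m x\<bar> \<le> 1" using vp_symbol_bounds(1,2)[of "\<sigma> * x i / L i"] by linarith
      have "cmod (v 0 x - superposition ?k v x) = cmod (h x) * \<bar>1 - ?m x\<bar>" unfolding D by (simp only: norm_mult norm_of_real)
      also have "\<dots> \<le> cmod (h x) * 1" using m by (rule mult_left_mono) simp
      finally have "(cmod (v 0 x - superposition ?k v x))\<^sup>2 \<le> (cmod (h x))\<^sup>2" by (intro power_mono) auto
      then show ?thesis using False x by simp
    qed
  qed
  then show "(norm_L2 (torus d) (\<lambda>z. w 0 z - superposition ?k w z))\<^sup>2 \<le> energy_outside d L h"
    unfolding eq energy_outside_def set_lebesgue_integral_def .
qed

lemma AE_torus_cube: "AE z in torus d. fst z \<in> cube d"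
proof -
  have [measurable]: "{z \<in> space (Rd d \<Otimes>\<^sub>M Rd d). fst z \<notin> cube d} \<in> sets (Rd d \<Otimes>\<^sub>M Rd d)" by measurable
  have "(\<integral>\<^sup>+z. indicator (- cube d) (fst z) \<partial>torus d) = (\<integral>\<^sup>+y. (\<integral>\<^sup>+x. indicator (- cube d) x \<partial>cube_measure d) \<partial>cube_measure d)"
  proof -
    have "(\<lambda>z. indicator (- cube d) (fst z) :: ennreal) = (\<lambda>z. 1 - indicator (cube d) (fst z))" by (auto simp: indicator_def)
    then have "(\<lambda>z. indicator (- cube d) (fst z) :: ennreal) \<in> borel_measurable (Rd d \<Otimes>\<^sub>M Rd d)" by simp
    from nn_integral_torus(2)[OF this] show ?thesis by simp
  qed
  also have "(\<integral>\<^sup>+x. indicator (- cube d) x \<partial>cube_measure d) = (\<integral>\<^sup>+x. (0::ennreal) \<partial>cube_measure d)"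
    by (rule nn_integral_cong_AE, use AE_cube_measure in eventually_elim) simp
  finally have z: "(\<integral>\<^sup>+z. indicator (- cube d) (fst z) \<partial>torus d) = (0::ennreal)" by simp
  have "(\<lambda>z. indicator (- cube d) (fst z) :: ennreal) = (\<lambda>z. 1 - indicator (cube d) (fst z))" by (auto simp: indicator_def)
  then have "(\<lambda>z. indicator (- cube d) (fst z) :: ennreal) \<in> borel_measurable (torus d)" by simp
  from nn_integral_0_iff_AE[OF this] z show ?thesis by (auto simp: indicator_def split: if_splits elim!: eventually_mono)
qed

lemma norm_ex_minus_1: "cmod (ex a - 1) \<le> 2 * pi * \<bar>a\<bar>"
proof -
  have "cmod (ex a - 1) = 2 * \<bar>sin (2 * pi * a / 2)\<bar>"
    unfolding ex_def cis_conv_exp by (rule dist_exp_i_1)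
  also have "\<dots> \<le> 2 * \<bar>2 * pi * a / 2\<bar>" by (intro mult_left_mono abs_sin_x_le_abs_x) simp
  finally show ?thesis by (simp add: abs_mult)
qed

lemma axis_shift_space: "x \<in> space (Rd d) \<Longrightarrow> shift d (axis i 0) x = x"
  by (simp add: axis_0 shift_0)

lemma measurable_axis_shift:
  assumes f: "f \<in> N \<rightarrow>\<^sub>M borel" and g: "g \<in> N \<rightarrow>\<^sub>M Rd d"
  shows "(\<lambda>p. shift d (axis i (f p)) (g p)) \<in> N \<rightarrow>\<^sub>M Rd d"
  unfolding shift_def
proof (rule measurable_Rd_restrict)
  fix j assume "j < d"
  from measurable_Rd_component[OF g this]
  show "(\<lambda>p. g p j - axis i (f p) j) \<in> borel_measurable N"
    unfolding axis_def using f by (cases "j = i") auto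
qed

text \<open>The family \<open>w1\<close> translates \<open>\<zeta>\<close> in the first variable and
corresponds to translations of \<open>g\<close>; \<open>w2\<close> translates it in the second
variable and corresponds to modulations.  The parts \<open>S1\<close> and \<open>S2\<close> smoothed
by the kernels change along an edge of the grid by at most \<open>sqrt A / 8\<close> and \<open>sqrt
A / 4\<close>.  If the remainders \<open>D1\<close> and \<open>D2\<close> were below \<open>sqrt A /
4\<close> at both endpoints of every edge, then \<open>\<zeta>\<close> would change by less than
\<open>sqrt A\<close>, that is, by less than its modulus.\<close>

proposition balian_low_quantitative:
  fixes A B \<eta> :: real
  assumes A: "0 < A" "0 < B" and eta: "0 < \<eta>" "\<eta> \<le> 1"
    and trans: "\<And>h. \<bar>h\<bar> \<le> \<eta> \<Longrightarrow> sqrt B * (LINT x|lborel. \<bar>vp_kernel (x + h) - vp_kernel x\<bar>) \<le> sqrt A / 8"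
    and phase: "sqrt B * (4 * pi * \<eta> * (LINT x|lborel. \<bar>vp_kernel x\<bar>)) \<le> sqrt A / 8"
    and g: "g \<in> L2 (Rd d)" and riesz: "riesz_constants (Rd d) (Zd d \<times> Zd d) (gabor d g) A B"
    and i: "i < d" and R: "1 \<le> R i" and L: "1 \<le> L i"
  shows "(A * \<eta>\<^sup>2 / (144 * pi\<^sup>2)) / (R i * L i) \<le> energy_outside d R g + energy_outside d L (fourier_L2 d g)"
proof -
  obtain \<zeta> where zm[measurable]: "\<zeta> \<in> borel_measurable (Rd d \<Otimes>\<^sub>M Rd d)" and zq: "quasiperiodic d \<zeta>"
    and zA: "\<And>z. A \<le> (cmod (\<zeta> z))\<^sup>2" and zB: "\<And>z. (cmod (\<zeta> z))\<^sup>2 \<le> B"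
    and gram: "\<And>u v u' v'. inner_L2 (Rd d) (tf_shift d u v g) (tf_shift d u' v' g)
       = inner_L2 (torus d) (zak_shift d u v \<zeta>) (zak_shift d u' v' \<zeta>)"
    using gabor_riesz_zak[OF g riesz] by blast
  let ?a = "sqrt A" and ?b = "sqrt B" and ?o = "\<lambda>_::nat. 0::real"
  have a0: "0 < ?a" and b0: "0 < ?b" using A by auto
  have za: "?a \<le> cmod (\<zeta> z)" and zb: "cmod (\<zeta> z) \<le> ?b" for z
    using zA[of z] zB[of z] by (auto intro: real_le_lsqrt real_le_rsqrt)
  define w1 where "w1 s = zak_shift d (axis i s) ?o \<zeta>" for s
  define w2 where "w2 t = zak_shift d ?o (axis i t) \<zeta>" for t
  define W1 where "W1 = 2 * pi * L i"
  define W2 where "W2 = 2 * pi * R i"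
  have W: "2 * pi \<le> W1" "2 * pi \<le> W2" using L R by (auto simp: W1_def W2_def)
  have Wp: "0 < W1" "0 < W2" using W pi_gt_zero by linarith+
  define S1 where "S1 = superposition (scaled_kernel W1) w1"
  define S2 where "S2 = superposition (scaled_kernel W2) w2"
  define D1 where "D1 z = w1 0 z - S1 z" for z
  define D2 where "D2 z = w2 0 z - S2 z" for z
  have shm[measurable]: "(\<lambda>p. shift d (axis i (fst p)) (fst (snd p))) \<in> (lborel \<Otimes>\<^sub>M (Rd d \<Otimes>\<^sub>M Rd d)) \<rightarrow>\<^sub>M Rd d"
    "(\<lambda>p. shift d (axis i (fst p)) (snd (snd p))) \<in> (lborel \<Otimes>\<^sub>M (Rd d \<Otimes>\<^sub>M Rd d)) \<rightarrow>\<^sub>M Rd d"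
    by (rule measurable_axis_shift; measurable)+
  have sets_eq: "sets (lborel \<Otimes>\<^sub>M torus d) = sets (lborel \<Otimes>\<^sub>M (Rd d \<Otimes>\<^sub>M Rd d))"
    by (rule sets_pair_measure_cong) auto
  have w1m: "(\<lambda>(s, z). w1 s z) \<in> borel_measurable (lborel \<Otimes>\<^sub>M torus d)"
  proof -
    have "(\<lambda>p. \<zeta> (shift d (axis i (fst p)) (fst (snd p)), shift d ?o (snd (snd p)))) \<in> borel_measurable (lborel \<Otimes>\<^sub>M (Rd d \<Otimes>\<^sub>M Rd d))"
      by measurable
    then show ?thesis unfolding measurable_cong_sets[OF sets_eq refl]
      by (simp add: w1_def zak_shift_def case_prod_beta')
  qed
  have w2m: "(\<lambda>(s, z). w2 s z) \<in> borel_measurable (lborel \<Otimes>\<^sub>M torus d)"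
  proof -
    have [measurable]: "(\<lambda>p. fst (snd p) i) \<in> borel_measurable (lborel \<Otimes>\<^sub>M (Rd d \<Otimes>\<^sub>M Rd d))"
      by (rule measurable_Rd_component[OF _ i]) measurable
    have "(\<lambda>p. ex (fst p * fst (snd p) i) * \<zeta> (shift d ?o (fst (snd p)), shift d (axis i (fst p)) (snd (snd p)))) \<in> borel_measurable (lborel \<Otimes>\<^sub>M (Rd d \<Otimes>\<^sub>M Rd d))"
      by measurable
    then show ?thesis unfolding measurable_cong_sets[OF sets_eq refl]
      by (simp add: w2_def zak_shift_def case_prod_beta' dot_axis[OF i])
  qed
  have wb: "cmod (w1 s z) \<le> ?b" "cmod (w2 s z) \<le> ?b" for s z
    by (auto simp: w1_def w2_def zak_shift_def norm_mult zb)
  have f: "fourier_L2 d g \<in> L2 (Rd d)" using fourier_L2_spec[OF g] by blast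
  have gram1: "inner_L2 (torus d) (w1 s) (w1 t)
      = inner_L2 (Rd d) (\<lambda>x. ex ((-1) * (s * x i)) * fourier_L2 d g x) (\<lambda>x. ex ((-1) * (t * x i)) * fourier_L2 d g x)" for s t
  proof -
    have "tf_shift d (axis i s) ?o g = (\<lambda>x. g (shift d (axis i s) x))" for s
      by (simp add: tf_shift_def[abs_def])
    then show ?thesis
      using gram[of "axis i s" ?o "axis i t" ?o] fourier_L2_gram[OF g, of "axis i s" "axis i t"]
      by (simp add: w1_def dot_axis[OF i] ex_minus)
  qed
  have gram2: "inner_L2 (torus d) (w2 s) (w2 t)
      = inner_L2 (Rd d) (\<lambda>x. ex (1 * (s * x i)) * g x) (\<lambda>x. ex (1 * (t * x i)) * g x)" for s t
  proof -
    have "inner_L2 (torus d) (w2 s) (w2 t) = inner_L2 (Rd d) (tf_shift d ?o (axis i s) g) (tf_shift d ?o (axis i t) g)"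
      using gram[of ?o "axis i s" ?o "axis i t"] by (simp add: w2_def)
    also have "\<dots> = inner_L2 (Rd d) (\<lambda>x. ex (1 * (s * x i)) * g x) (\<lambda>x. ex (1 * (t * x i)) * g x)"
      unfolding inner_L2_def
      by (rule Bochner_Integration.integral_cong) (simp_all add: tf_shift_def dot_axis[OF i] shift_0)
    finally show ?thesis .
  qed
  have E1: "D1 \<in> L2 (torus d)" "(norm_L2 (torus d) D1)\<^sup>2 \<le> energy_outside d L (fourier_L2 d g)"
    using smoothing_energy[OF i f _ _ w1m wb(1) gram1, of L] L by (simp_all add: D1_def[abs_def] S1_def W1_def)
  have E2: "D2 \<in> L2 (torus d)" "(norm_L2 (torus d) D2)\<^sup>2 \<le> energy_outside d R g"
    using smoothing_energy[OF i g _ _ w2m wb(2) gram2, of R] R by (simp_all add: D2_def[abs_def] S2_def W2_def)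
  have D1q: "quasiperiodic d D1" and D2q: "quasiperiodic d D2"
  proof -
    have q: "quasiperiodic d (w1 s)" "quasiperiodic d (w2 s)" for s
      unfolding w1_def w2_def by (rule zak_shift_quasiperiodic[OF zq])+
    have "quasiperiodic d S1" "quasiperiodic d S2"
      unfolding S1_def S2_def by (rule superposition_quasiperiodic, rule q)+
    then show "quasiperiodic d D1" "quasiperiodic d D2"
      using q(1)[of 0] q(2)[of 0] unfolding quasiperiodic_def D1_def D2_def by (simp_all add: right_diff_distrib)
  qed
  \<comment> \<open>translation by \<open>+ s\<close> in coordinate \<open>i\<close>; the sign is opposite to that of \<open>shift\<close>\<close>
  define X where "X s x = shift d (axis i (- s)) x" for s x
  have Xs[simp]: "X s x \<in> space (Rd d)" for s x by (simp add: X_def)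
  have XX: "X s (X t x) = X (s + t) x" for s t x by (simp add: X_def shift_shift axis_add)
  have X0: "x \<in> space (Rd d) \<Longrightarrow> X 0 x = x" for x by (simp add: X_def axis_shift_space)
  have Xi: "X s x i = x i + s" for s x using i by (simp add: X_def shift_def axis_def)
  define n where "n = (\<lambda>j\<in>{..<d}. if j = i then - 1 else 0 :: int)"
  have n: "n \<in> Zd d" by (simp add: n_def Zd_def)
  have X1: "X 1 x = shift d (rvec n) x" for x
    unfolding X_def by (rule shift_cong) (simp add: n_def rvec_def axis_def)
  have dotn: "dot d (rvec n) y = - y i" for y
  proof -
    have "dot d (rvec n) y = dot d (axis i (-1)) y"
      unfolding dot_def by (rule sum.cong) (auto simp: n_def rvec_def axis_def)
    then show ?thesis by (simp add: dot_axis[OF i])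
  qed
  have qper: "h (X 1 x, y) = ex (y i) * h (x, y)" "h (x, X 1 y) = h (x, y)"
    if "quasiperiodic d h" "x \<in> space (Rd d)" "y \<in> space (Rd d)" for h x y
    using that n unfolding quasiperiodic_def X1 by (simp_all add: dotn ex_minus)
  have wz: "w1 0 (x, y) = \<zeta> (x, y)" "w2 0 (x, y) = \<zeta> (x, y)" if "x \<in> space (Rd d)" "y \<in> space (Rd d)" for x y
    using that by (simp_all add: w1_def w2_def zak_shift_def axis_0 shift_0)
  have um1: "(\<lambda>s. \<zeta> (shift d (axis i s) x, y)) \<in> borel_measurable borel"
    and um2: "(\<lambda>s. \<zeta> (x, shift d (axis i s) y)) \<in> borel_measurable borel"
    if "x \<in> space (Rd d)" "y \<in> space (Rd d)" for x y
  proof -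
    have [measurable]: "(\<lambda>s. shift d (axis i s) x) \<in> borel \<rightarrow>\<^sub>M Rd d" "(\<lambda>s. shift d (axis i s) y) \<in> borel \<rightarrow>\<^sub>M Rd d"
      "(\<lambda>_. x) \<in> borel \<rightarrow>\<^sub>M Rd d" "(\<lambda>_. y) \<in> borel \<rightarrow>\<^sub>M Rd d"
      using that by (auto intro!: measurable_axis_shift)
    show "(\<lambda>s. \<zeta> (shift d (axis i s) x, y)) \<in> borel_measurable borel" "(\<lambda>s. \<zeta> (x, shift d (axis i s) y)) \<in> borel_measurable borel"
      by measurable
  qed
  have shX: "shift d (axis i s) (X t x) = shift d (axis i (s - t)) x" for s t x
    by (simp add: X_def shift_shift axis_add)
  have kW: "integrable lborel (scaled_kernel W1)" "integrable lborel (scaled_kernel W2)"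
    using Wp scaled_kernel_integrable by auto
  have jump1: "cmod (S1 (X \<delta> x, y) - S1 (x, y)) \<le> ?a / 8"
    if xy: "x \<in> space (Rd d)" "y \<in> space (Rd d)" and dl: "\<bar>W1 * \<delta>\<bar> \<le> \<eta>" for x y \<delta>
  proof -
    let ?u = "\<lambda>s. \<zeta> (shift d (axis i s) x, y)"
    have "S1 (X \<delta> x, y) = (LINT s|lborel. of_real (scaled_kernel W1 s) * ?u (s - \<delta>))"
      "S1 (x, y) = (LINT s|lborel. of_real (scaled_kernel W1 s) * ?u s)"
      using xy by (simp_all add: S1_def superposition_def w1_def zak_shift_def shX shift_0)
    then have "cmod (S1 (X \<delta> x, y) - S1 (x, y)) \<le> ?b * (LINT s|lborel. \<bar>scaled_kernel W1 (s + \<delta>) - scaled_kernel W1 s\<bar>)"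
      using integral_translate_difference[OF kW(1) um1[OF xy] zb, of \<delta>] by simp
    also have "\<dots> \<le> ?a / 8" unfolding scaled_kernel_translation[OF Wp(1)] by (rule trans[OF dl])
    finally show ?thesis .
  qed
  have jump2: "cmod (S2 (x, X \<delta> y) - S2 (x, y)) \<le> ?a / 4"
    if xy: "x \<in> space (Rd d)" "y \<in> space (Rd d)" and dl: "\<bar>W2 * \<delta>\<bar> \<le> \<eta>" "\<bar>\<delta>\<bar> \<le> \<eta>" and xi: "\<bar>x i\<bar> \<le> 2" for x y \<delta>
  proof -
    let ?u = "\<lambda>s. ex (s * x i) * \<zeta> (x, shift d (axis i s) y)"
    let ?T = "LINT s|lborel. of_real (scaled_kernel W2 s) * ?u (s - \<delta>)"
    have um: "?u \<in> borel_measurable borel" using um2[OF xy] by measurable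
    have ub: "cmod (?u s) \<le> ?b" for s by (simp add: norm_mult zb)
    have s2: "S2 (x, y) = (LINT s|lborel. of_real (scaled_kernel W2 s) * ?u s)"
      using xy by (simp add: S2_def superposition_def w2_def zak_shift_def shift_0 dot_axis[OF i] mult.assoc)
    \<comment> \<open>unlike \<open>S1\<close>, moving \<open>y\<close> by \<open>\<delta>\<close> also produces the phase \<open>ex (\<delta> * x i)\<close>, which is close to \<open>1\<close> for bounded \<open>x i\<close>\<close>
    have "S2 (x, X \<delta> y) = (LINT s|lborel. ex (\<delta> * x i) * (of_real (scaled_kernel W2 s) * ?u (s - \<delta>)))"
      unfolding S2_def superposition_def
    proof (rule Bochner_Integration.integral_cong[OF refl])
      fix s :: real
      have "ex (s * x i) = ex (\<delta> * x i) * ex ((s - \<delta>) * x i)" unfolding ex_add[symmetric] by (simp add: algebra_simps)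
      then show "of_real (scaled_kernel W2 s) * w2 s (x, X \<delta> y) = ex (\<delta> * x i) * (of_real (scaled_kernel W2 s) * ?u (s - \<delta>))"
        using xy by (simp add: w2_def zak_shift_def shX shift_0 dot_axis[OF i] mult_ac)
    qed
    then have s2': "S2 (x, X \<delta> y) = ex (\<delta> * x i) * ?T" by simp
    have T: "cmod (?T - S2 (x, y)) \<le> ?a / 8"
    proof -
      have "cmod (?T - S2 (x, y)) \<le> ?b * (LINT s|lborel. \<bar>scaled_kernel W2 (s + \<delta>) - scaled_kernel W2 s\<bar>)"
        unfolding s2 by (rule integral_translate_difference[OF kW(2) um ub])
      also have "\<dots> \<le> ?a / 8" unfolding scaled_kernel_translation[OF Wp(2)] by (rule trans[OF dl(1)])
      finally show ?thesis .
    qed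
    have S2b: "cmod (S2 (x, y)) \<le> ?b * (LINT x|lborel. \<bar>vp_kernel x\<bar>)"
    proof -
      have "cmod (S2 (x, y)) \<le> (LINT s|lborel. cmod (of_real (scaled_kernel W2 s) * ?u s))" unfolding s2 by (rule integral_norm_bound)
      also have "\<dots> \<le> (LINT s|lborel. ?b * \<bar>scaled_kernel W2 s\<bar>)"
      proof (rule integral_mono')
        show "integrable lborel (\<lambda>s. ?b * \<bar>scaled_kernel W2 s\<bar>)" using kW(2) by auto
        show "cmod (of_real (scaled_kernel W2 s) * ?u s) \<le> ?b * \<bar>scaled_kernel W2 s\<bar>" for s
          using mult_right_mono[OF ub[of s] abs_ge_zero[of "scaled_kernel W2 s"]] by (simp add: norm_mult mult.commute)
      qed (use b0 in simp)
      finally show ?thesis by (simp add: scaled_kernel_L1[OF Wp(2)])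
    qed
    have ph: "cmod (ex (\<delta> * x i) - 1) \<le> 4 * pi * \<eta>"
    proof -
      have "\<bar>\<delta> * x i\<bar> \<le> \<eta> * 2" unfolding abs_mult by (intro mult_mono dl xi) (use eta in auto)
      then have "2 * pi * \<bar>\<delta> * x i\<bar> \<le> 2 * pi * (\<eta> * 2)" by (intro mult_left_mono) auto
      from order_trans[OF norm_ex_minus_1 this] show ?thesis by (simp add: mult_ac)
    qed
    have "S2 (x, X \<delta> y) - S2 (x, y) = ex (\<delta> * x i) * (?T - S2 (x, y)) + (ex (\<delta> * x i) - 1) * S2 (x, y)"
      unfolding s2' by (simp add: algebra_simps)
    then have "cmod (S2 (x, X \<delta> y) - S2 (x, y)) \<le> cmod (ex (\<delta> * x i) * (?T - S2 (x, y))) + cmod ((ex (\<delta> * x i) - 1) * S2 (x, y))"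
      by (simp only: norm_triangle_ineq)
    also have "\<dots> \<le> ?a / 8 + 4 * pi * \<eta> * (?b * (LINT x|lborel. \<bar>vp_kernel x\<bar>))"
      unfolding norm_mult norm_ex mult_1 by (intro add_mono T mult_mono ph S2b) (use eta in auto)
    also have "4 * pi * \<eta> * (?b * (LINT x|lborel. \<bar>vp_kernel x\<bar>)) \<le> ?a / 8" using phase by (simp only: mult_ac)
    finally show ?thesis by simp
  qed
  define K where "K = nat \<lceil>W1 / \<eta>\<rceil>"
  define K' where "K' = nat \<lceil>W2 / \<eta>\<rceil>"
  \<comment> \<open>\<open>2 < W / \<eta>\<close>, so rounding up costs at most a factor \<open>3 / 2\<close>\<close>
  have Kb: "W / \<eta> \<le> real (nat \<lceil>W / \<eta>\<rceil>) \<and> real (nat \<lceil>W / \<eta>\<rceil>) \<le> 3 / 2 * (W / \<eta>) \<and> 2 \<le> nat \<lceil>W / \<eta>\<rceil>" if "2 * pi \<le> W" for W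
  proof -
    have "0 \<le> W" using that pi_gt_zero by linarith
    then have "W * 1 \<le> W * (1 / \<eta>)" using eta by (intro mult_left_mono) auto
    then have "2 < W / \<eta>" using that pi_gt3 by simp
    then show ?thesis by linarith
  qed
  have K: "W1 / \<eta> \<le> real K" "real K \<le> 3 / 2 * (W1 / \<eta>)" "2 \<le> K"
    and K': "W2 / \<eta> \<le> real K'" "real K' \<le> 3 / 2 * (W2 / \<eta>)" "2 \<le> K'"
    using Kb[OF W(1)] Kb[OF W(2)] by (auto simp: K_def K'_def)
  have dK: "\<bar>W1 * (1 / real K)\<bar> \<le> \<eta>" using K(1,3) Wp eta by (simp add: field_simps)
  have dK': "\<bar>W2 * (1 / real K')\<bar> \<le> \<eta>" using K'(1,3) Wp eta by (simp add: field_simps)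
  have dK'': "\<bar>1 / real K'\<bar> \<le> \<eta>"
  proof -
    have "1 * (1 / real K') \<le> W2 * (1 / real K')" using W(2) pi_gt3 by (intro mult_right_mono) auto
    moreover have "0 \<le> 1 / real K'" by simp
    ultimately show ?thesis using dK' by linarith
  qed
  define P where "P p q z = (X (real p / real K) (fst z), X (real q / real K') (snd z))" for p q :: nat and z
  have bad: "\<exists>p<K. \<exists>q<K'. ?a / 4 \<le> cmod (D1 (P p q z)) \<or> ?a / 4 \<le> cmod (D2 (P p q z))"
    if z: "z \<in> space (torus d)" and c: "fst z \<in> cube d" for z
  proof (rule ccontr)
    assume no: "\<not> ?thesis"
    obtain x y where xy: "z = (x, y)" "x \<in> space (Rd d)" "y \<in> space (Rd d)" using z by (auto simp: space_torus)
    have x01: "0 \<le> x i" "x i < 1" using c i xy by (auto simp: cube_def PiE_iff)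
    have XK: "X (real K / real K) x = X 1 x" "X (real K' / real K') x = X 1 x" for x using K K' by auto
    have small: "cmod (D1 (P p q z)) < ?a / 4 \<and> cmod (D2 (P p q z)) < ?a / 4" if "p \<le> K" "q \<le> K'" for p q
    proof -
      \<comment> \<open>the moduli of the remainders are periodic, so the last row and column repeat the first\<close>
      define p' where "p' = (if p = K then 0 else p)"
      define q' where "q' = (if q = K' then 0 else q)"
      have lt: "p' < K" "q' < K'" using that K K' by (auto simp: p'_def q'_def)
      have per1: "cmod (h (X (real p / real K) x, v)) = cmod (h (X (real p' / real K) x, v))"
        if "quasiperiodic d h" "v \<in> space (Rd d)" for h v
        using qper(1)[OF that(1) xy(2) that(2)] X0[OF xy(2)] by (auto simp: p'_def XK norm_mult simp del: div_self divide_self_if)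
      have per2: "h (v, X (real q / real K') y) = h (v, X (real q' / real K') y)"
        if "quasiperiodic d h" "v \<in> space (Rd d)" for h v
        using qper(2)[OF that(1) that(2) xy(3)] X0[OF xy(3)] by (auto simp: q'_def XK simp del: div_self divide_self_if)
      have "cmod (h (P p q z)) = cmod (h (P p' q' z))" if "quasiperiodic d h" for h
        unfolding P_def xy fst_conv snd_conv using per1[OF that] per2[OF that] by simp
      then show ?thesis using no lt D1q D2q by (simp add: not_le)
    qed
    let ?Z = "\<lambda>p q. \<zeta> (P p q z)"
    have dec: "?Z p q = D1 (P p q z) + S1 (P p q z)" "?Z p q = D2 (P p q z) + S2 (P p q z)" for p q
      unfolding P_def by (simp_all add: D1_def D2_def wz)
    show False
    proof (rule grid_winding[where z="?Z" and K=K and K'=K' and t="y i"])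
      show "2 \<le> K'" by (rule K'(3))
    next
      fix p q assume pq: "p < K" "q \<le> K'"
      have st: "P (Suc p) q z = (X (1 / real K) (fst (P p q z)), snd (P p q z))"
        by (simp add: P_def XX add_divide_distrib add.commute)
      have "cmod (S1 (P (Suc p) q z) - S1 (P p q z)) \<le> ?a / 8"
        using jump1[OF _ _ dK, of "fst (P p q z)" "snd (P p q z)"] unfolding st by (simp add: P_def)
      moreover have "?Z (Suc p) q - ?Z p q = D1 (P (Suc p) q z) - D1 (P p q z) + (S1 (P (Suc p) q z) - S1 (P p q z))"
        by (simp add: dec(1))
      then have "cmod (?Z (Suc p) q - ?Z p q) \<le> cmod (D1 (P (Suc p) q z)) + cmod (D1 (P p q z)) + cmod (S1 (P (Suc p) q z) - S1 (P p q z))"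
        by (smt (verit) norm_triangle_ineq norm_triangle_ineq4)
      ultimately show "cmod (?Z (Suc p) q - ?Z p q) < cmod (?Z p q)"
        using small[of "Suc p" q] small[of p q] pq za[of "P p q z"] a0 by linarith
    next
      fix p q assume pq: "p \<le> K" "q < K'"
      have st: "P p (Suc q) z = (fst (P p q z), X (1 / real K') (snd (P p q z)))"
        by (simp add: P_def XX add_divide_distrib add.commute)
      have "real p / real K \<le> 1" using pq K(3) by simp
      moreover have "fst (P p q z) i = x i + real p / real K" by (simp add: P_def xy Xi)
      moreover have "0 \<le> real p / real K" by simp
      ultimately have xi: "\<bar>fst (P p q z) i\<bar> \<le> 2" using x01 by linarith
      have "cmod (S2 (P p (Suc q) z) - S2 (P p q z)) \<le> ?a / 4"
        using jump2[of "fst (P p q z)" "snd (P p q z)" "1 / real K'", OF _ _ dK' dK'' xi] unfolding st by (simp add: P_def)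
      moreover have "?Z p (Suc q) - ?Z p q = D2 (P p (Suc q) z) - D2 (P p q z) + (S2 (P p (Suc q) z) - S2 (P p q z))"
        by (simp add: dec(2))
      then have "cmod (?Z p (Suc q) - ?Z p q) \<le> cmod (D2 (P p (Suc q) z)) + cmod (D2 (P p q z)) + cmod (S2 (P p (Suc q) z) - S2 (P p q z))"
        by (smt (verit) norm_triangle_ineq norm_triangle_ineq4)
      ultimately show "cmod (?Z p (Suc q) - ?Z p q) < cmod (?Z p q)"
        using small[of p "Suc q"] small[of p q] pq za[of "P p q z"] a0 by linarith
    next
      fix p assume "p \<le> K"
      show "?Z p K' = ?Z p 0"
        unfolding P_def xy fst_conv snd_conv XK using qper(2)[OF zq _ xy(3)] X0[OF xy(3)] by simp
    next
      fix q assume "q \<le> K'"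
      show "?Z K q = ex (y i + real q / real K') * ?Z 0 q"
        unfolding P_def xy fst_conv snd_conv XK using qper(1)[OF zq xy(2)] X0[OF xy(2)] by (simp add: Xi)
    qed
  qed
  have nn: "(\<integral>\<^sup>+z. ennreal ((cmod (D (P p q z)))\<^sup>2) \<partial>torus d) = ennreal ((norm_L2 (torus d) D)\<^sup>2)"
    if D: "D \<in> L2 (torus d)" "quasiperiodic d D" for D p q
  proof -
    have [measurable]: "D \<in> borel_measurable (Rd d \<Otimes>\<^sub>M Rd d)" using D by (auto dest: L2_measurable)
    have "(\<integral>\<^sup>+z. (\<lambda>z. ennreal ((cmod (D z))\<^sup>2)) (shift d (axis i (- (real p / real K))) (fst z), shift d (axis i (- (real q / real K'))) (snd z)) \<partial>torus d)
       = (\<integral>\<^sup>+z. ennreal ((cmod (D z))\<^sup>2) \<partial>torus d)"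
      by (rule nn_integral_torus_shift) (use D(2) in \<open>auto simp: quasiperiodic_def norm_mult\<close>)
    then show ?thesis by (simp add: P_def X_def norm_L2_nn[OF D(1)])
  qed
  have PM: "(\<lambda>z. ennreal ((cmod (D (P p q z)))\<^sup>2)) \<in> borel_measurable (torus d)" if "D \<in> L2 (torus d)" for D p q
  proof -
    have [measurable]: "D \<in> borel_measurable (Rd d \<Otimes>\<^sub>M Rd d)" using that by (auto dest: L2_measurable)
    show ?thesis unfolding P_def X_def by simp measurable
  qed
  define E where "E = (norm_L2 (torus d) D1)\<^sup>2 + (norm_L2 (torus d) D2)\<^sup>2"
  have E0: "0 \<le> E" by (simp add: E_def)
  have "ennreal (A / 16) = (\<integral>\<^sup>+z. ennreal (A / 16) \<partial>torus d)" using prob_torus[of d] by simp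
  also have "\<dots> \<le> (\<integral>\<^sup>+z. (\<Sum>p<K. \<Sum>q<K'. ennreal ((cmod (D1 (P p q z)))\<^sup>2) + ennreal ((cmod (D2 (P p q z)))\<^sup>2)) \<partial>torus d)"
  proof (rule nn_integral_mono_AE, use AE_torus_cube AE_space in eventually_elim)
    fix z assume z: "fst z \<in> cube d" "z \<in> space (torus d)"
    let ?t = "\<lambda>p q. ennreal ((cmod (D1 (P p q z)))\<^sup>2) + ennreal ((cmod (D2 (P p q z)))\<^sup>2)"
    obtain p q where pq: "p < K" "q < K'" "?a / 4 \<le> cmod (D1 (P p q z)) \<or> ?a / 4 \<le> cmod (D2 (P p q z))"
      using bad[OF z(2,1)] by blast
    have sq: "A / 16 \<le> r\<^sup>2" if "?a / 4 \<le> r" for r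
      using power_mono[OF that, of 2] A a0 by (simp add: power_divide)
    have "A / 16 \<le> (cmod (D1 (P p q z)))\<^sup>2 + (cmod (D2 (P p q z)))\<^sup>2"
      using pq(3) sq[of "cmod (D1 (P p q z))"] sq[of "cmod (D2 (P p q z))"]
        zero_le_power2[of "cmod (D1 (P p q z))"] zero_le_power2[of "cmod (D2 (P p q z))"] by linarith
    then have "ennreal (A / 16) \<le> ?t p q" by (simp flip: ennreal_plus)
    also have "\<dots> \<le> (\<Sum>q<K'. ?t p q)" by (rule member_le_sum) (use pq in auto)
    also have "\<dots> \<le> (\<Sum>p<K. \<Sum>q<K'. ?t p q)" by (rule member_le_sum[of p _ "\<lambda>p. \<Sum>q<K'. ?t p q"]) (use pq in auto)
    finally show "ennreal (A / 16) \<le> (\<Sum>p<K. \<Sum>q<K'. ?t p q)" .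
  qed
  also have "\<dots> = (\<Sum>p<K. \<Sum>q<K'. ennreal E)"
    using PM[OF E1(1)] PM[OF E2(1)] nn[OF E1(1) D1q] nn[OF E2(1) D2q]
    by (simp add: nn_integral_sum nn_integral_add E_def)
  also have "\<dots> = ennreal (real K * (real K' * E))"
    using E0 by (simp add: ennreal_mult ennreal_of_nat_eq_real_of_nat)
  finally have "A / 16 \<le> real K * (real K' * E)" using E0 by (subst (asm) ennreal_le_iff) auto
  also have "\<dots> \<le> (3 / 2 * (W1 / \<eta>)) * ((3 / 2 * (W2 / \<eta>)) * E)"
    by (intro mult_mono K(2) K'(2) order_refl E0) (use Wp eta E0 in auto)
  also have "\<dots> = (9 * pi\<^sup>2 * (R i * L i) / \<eta>\<^sup>2) * E"
    by (simp add: W1_def W2_def power2_eq_square)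
  also have "\<dots> = E * (9 * pi\<^sup>2 * (R i * L i) / \<eta>\<^sup>2)" by (rule mult.commute)
  finally have "A / 16 \<le> E * (9 * pi\<^sup>2 * (R i * L i) / \<eta>\<^sup>2)" .
  moreover have "0 < 9 * pi\<^sup>2 * (R i * L i) / \<eta>\<^sup>2" using R L eta by simp
  ultimately have "(A / 16) / (9 * pi\<^sup>2 * (R i * L i) / \<eta>\<^sup>2) \<le> E" by (rule mult_imp_div_pos_le[rotated])
  moreover have "(A / 16) / (9 * pi\<^sup>2 * (R i * L i) / \<eta>\<^sup>2) = (A * \<eta>\<^sup>2 / (144 * pi\<^sup>2)) / (R i * L i)" by simp
  ultimately show ?thesis using E1(2) E2(2) by (simp add: E_def)
qed

text \<open>The width \<open>\<eta>\<close> of the grid, and with it the constant, is chosen from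
\<open>A\<close>, \<open>B\<close> and the kernel alone.\<close>

lemma uncertainty_constant_exists:
  assumes "0 < A" "0 < (B::real)"
  shows "\<exists>c>0. \<forall>d g R L i. g \<in> L2 (Rd d) \<longrightarrow> riesz_constants (Rd d) (Zd d \<times> Zd d) (gabor d g) A B \<longrightarrow> i < d \<longrightarrow> 1 \<le> R i \<longrightarrow> 1 \<le> L i \<longrightarrow>
     c / (R i * L i) \<le> energy_outside d R g + energy_outside d L (fourier_L2 d g)"
proof -
  let ?k = "LINT x|lborel. \<bar>vp_kernel x\<bar>"
  have k0: "0 \<le> ?k" by simp
  \<comment> \<open>chosen so that \<open>sqrt B * e = sqrt A / 8\<close>\<close>
  define e where "e = sqrt A / (8 * sqrt B)"
  have e: "0 < e" using assms by (simp add: e_def)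
  obtain \<eta>1 where e1: "0 < \<eta>1" "\<eta>1 \<le> 1" "\<And>h. \<bar>h\<bar> \<le> \<eta>1 \<Longrightarrow> (LINT x|lborel. \<bar>vp_kernel (x + h) - vp_kernel x\<bar>) \<le> e"
    using vp_kernel_translation[OF e] by blast
  \<comment> \<open>the second term bounds the phase; \<open>?k + 1\<close> avoids a division by zero\<close>
  define \<eta> where "\<eta> = min \<eta>1 (e / (4 * pi * (?k + 1)))"
  have den: "0 < 4 * pi * (?k + 1)" using k0 by (intro mult_pos_pos add_nonneg_pos) auto
  have eta: "0 < \<eta>" "\<eta> \<le> 1" using e1 e den by (auto simp: \<eta>_def)
  have be: "sqrt B * e = sqrt A / 8" using assms by (simp add: e_def)
  have t: "sqrt B * (LINT x|lborel. \<bar>vp_kernel (x + h) - vp_kernel x\<bar>) \<le> sqrt A / 8" if "\<bar>h\<bar> \<le> \<eta>" for h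
    unfolding be[symmetric] using that assms by (intro mult_left_mono e1) (auto simp: \<eta>_def)
  have "4 * pi * \<eta> * ?k \<le> 4 * pi * \<eta> * (?k + 1)" using eta by (intro mult_left_mono) auto
  also have "\<dots> = \<eta> * (4 * pi * (?k + 1))" by simp
  also have "\<dots> \<le> e" using den by (simp add: \<eta>_def pos_le_divide_eq[symmetric])
  finally have p: "sqrt B * (4 * pi * \<eta> * ?k) \<le> sqrt A / 8"
    unfolding be[symmetric] using assms by (intro mult_left_mono) auto
  show ?thesis
    using balian_low_quantitative[OF assms eta t p] assms eta
    by (intro exI[of _ "A * \<eta>\<^sup>2 / (144 * pi\<^sup>2)"]) auto
qed

section \<open>Sharpness: the indicator of the unit cube\<close>

definition cube_window :: "nat \<Rightarrow> (nat \<Rightarrow> real) \<Rightarrow> complex" where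
  "cube_window d = indicator (cube d)"

lemma cube_window_integrable: "integrable (Rd d) (cube_window d)"
proof -
  have "integrable (Rd d) (indicator (cube d) :: _ \<Rightarrow> real)"
    by (rule integrable_real_indicator) (auto simp: emeasure_cube)
  from integrable_of_real[OF this, where 'a=complex]
  show ?thesis by (rule Bochner_Integration.integrable_bound) (auto simp: cube_window_def indicator_def)
qed

lemma cube_window_L2: "cube_window d \<in> L2 (Rd d)"
proof -
  have "(\<lambda>x. (cmod (cube_window d x))\<^sup>2) = (\<lambda>x. cmod (cube_window d x))" by (auto simp: cube_window_def indicator_def)
  then show ?thesis using cube_window_integrable[of d] by (simp add: L2_def)
qed

lemma gabor_cube_window: "gabor d (cube_window d) p x = chr d (snd p) x * indicator (cube d) (shift d (rvec (fst p)) x)"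
  by (simp add: gabor_eq_tf_shift tf_shift_def chr_def cube_window_def)

lemma integral_cube_cell:
  fixes u :: "(nat \<Rightarrow> real) \<Rightarrow> complex"
  assumes [measurable]: "u \<in> borel_measurable (Rd d)" and per: "\<And>x. x \<in> space (Rd d) \<Longrightarrow> u (shift d (\<lambda>i. - rvec m i) x) = u x"
  shows "(LINT x|Rd d. indicator (cube d) (shift d (rvec m) x) * u x) = (LINT x|cube_measure d. u x)"
proof -
  have "(LINT x|Rd d. indicator (cube d) (shift d (rvec m) x) * u x)
     = (LINT x|Rd d. (\<lambda>x. indicator (cube d) (shift d (rvec m) x) * u x) (shift d (\<lambda>i. - rvec m i) x))"
    by (rule integral_Rd_shift[symmetric]) measurable
  also have "\<dots> = (LINT x|Rd d. indicator (cube d) x * u x)"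
    by (rule Bochner_Integration.integral_cong) (simp_all add: shift_inverse per)
  also have "\<dots> = (LINT x|cube_measure d. u x)" by (rule integral_cube_measure[symmetric]) measurable
  finally show ?thesis .
qed

lemma chr_shift_int: "chr d n (shift d (\<lambda>i. - rvec m i) x) = chr d n x"
proof -
  have e: "shift d (\<lambda>i. - rvec m i) x = shift d (rvec (\<lambda>i. - m i)) x" by (rule shift_cong) (simp add: rvec_def)
  show ?thesis unfolding e chr_def dot_shift ex_diff by simp
qed

lemma orthonormal_gabor_cube: "orthonormal_L2 (Rd d) (Zd d \<times> Zd d) (gabor d (cube_window d))"
  unfolding orthonormal_L2_def
proof (intro conjI ballI)
  show "gabor d (cube_window d) p \<in> L2 (Rd d)" for p
    unfolding gabor_eq_tf_shift using tf_shift_L2[OF cube_window_L2] by blast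
  fix p q assume p: "p \<in> Zd d \<times> Zd d" and q: "q \<in> Zd d \<times> Zd d"
  have ind: "indicator (cube d) (shift d (rvec (fst p)) x) * indicator (cube d) (shift d (rvec (fst q)) x)
     = (if fst p = fst q then indicator (cube d) (shift d (rvec (fst p)) x) else (0::complex))" if "x \<in> space (Rd d)" for x
    using shift_cube_iff[OF _ that, of "fst p"] shift_cube_iff[OF _ that, of "fst q"] p q by (auto simp: indicator_def)
  have "inner_L2 (Rd d) (gabor d (cube_window d) p) (gabor d (cube_window d) q)
     = (LINT x|Rd d. (if fst p = fst q then indicator (cube d) (shift d (rvec (fst p)) x) else 0) * (chr d (snd p) x * cnj (chr d (snd q) x)))"
    unfolding inner_L2_def gabor_cube_window
  proof (rule Bochner_Integration.integral_cong[OF refl])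
    fix x assume x: "x \<in> space (Rd d)"
    have c: "cnj (indicator S y) = (indicator S y :: complex)" for S :: "(nat \<Rightarrow> real) set" and y by (simp add: indicator_def)
    show "chr d (snd p) x * indicator (cube d) (shift d (rvec (fst p)) x) * cnj (chr d (snd q) x * indicator (cube d) (shift d (rvec (fst q)) x))
      = (if fst p = fst q then indicator (cube d) (shift d (rvec (fst p)) x) else 0) * (chr d (snd p) x * cnj (chr d (snd q) x))"
      unfolding ind[OF x, symmetric] by (simp add: c mult_ac)
  qed
  also have "\<dots> = (if p = q then 1 else 0)"
  proof (cases "fst p = fst q")
    case True
    have "(LINT x|Rd d. indicator (cube d) (shift d (rvec (fst p)) x) * (chr d (snd p) x * cnj (chr d (snd q) x)))
      = inner_L2 (cube_measure d) (chr d (snd p)) (chr d (snd q))"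
      unfolding inner_L2_def by (rule integral_cube_cell) (auto simp: chr_shift_int)
    also have "\<dots> = (if snd p = snd q then 1 else 0)" using orthonormal_chr[of d] p q by (auto simp: orthonormal_L2_def)
    finally show ?thesis using True by (simp add: prod_eq_iff)
  qed (auto simp: prod_eq_iff)
  finally show "inner_L2 (Rd d) (gabor d (cube_window d) p) (gabor d (cube_window d) q) = (if p = q then 1 else 0)" .
qed

lemma gabor_cube_L2: "gabor d (cube_window d) p \<in> L2 (Rd d)"
  unfolding gabor_eq_tf_shift using tf_shift_L2[OF cube_window_L2] by blast

text \<open>On the translate of the cube by \<open>m\<close> the functions of the system with first
index \<open>m\<close> are all the characters, and these are complete on the cube.\<close>

lemma gabor_cube_approx_cell:
  assumes f: "f \<in> L2 (Rd d)" and m: "m \<in> Zd d"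
  shows "L2_approx (Rd d) (Zd d \<times> Zd d) (gabor d (cube_window d)) (\<lambda>x. indicator (cube d) (shift d (rvec m) x) * f x)"
proof -
  let ?v = "gabor d (cube_window d)"
  let ?ap = "L2_approx (Rd d) (Zd d \<times> Zd d) ?v"
  have fm[measurable]: "f \<in> borel_measurable (Rd d)" using f by (rule L2_measurable)
  show ?thesis
  proof (rule L2_approx_limit[OF gabor_cube_L2])
    show cL: "(\<lambda>x. indicator (cube d) (shift d (rvec m) x) * f x) \<in> L2 (Rd d)"
      by (rule L2_dominated[OF _ f, where c=1]) (auto simp: indicator_def norm_mult)
    fix e :: real assume e: "0 < e"
    let ?f = "\<lambda>x. f (shift d (\<lambda>i. - rvec m i) x)"
    have fs: "?f \<in> L2 (Rd d)" using tf_shift_L2[OF f, of "\<lambda>i. - rvec m i" "\<lambda>_. 0"] by (simp add: tf_shift_def[abs_def])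
    have fc: "?f \<in> L2 (cube_measure d)"
    proof -
      have "(\<integral>\<^sup>+x. ennreal ((cmod (?f x))\<^sup>2) \<partial>cube_measure d) = (\<integral>\<^sup>+x. indicator (cube d) x * ennreal ((cmod (?f x))\<^sup>2) \<partial>Rd d)"
        by (rule nn_integral_cube_measure) measurable
      also have "\<dots> \<le> (\<integral>\<^sup>+x. ennreal ((cmod (?f x))\<^sup>2) \<partial>Rd d)" by (rule nn_integral_mono) (auto simp: indicator_def)
      also have "\<dots> < \<infinity>" using fs by (subst (asm) L2_iff_nn) auto
      finally show ?thesis by (subst L2_iff_nn) auto
    qed
    obtain F c where F: "finite F" "F \<subseteq> Zd d" "norm_L2 (cube_measure d) (\<lambda>x. (\<Sum>n\<in>F. c n * chr d n x) - ?f x) < e"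
      by (rule L2_approxE[OF approx_cube_all[OF fc] e])
    let ?p = "\<lambda>x. \<Sum>n\<in>F. c n * chr d n x"
    let ?D = "\<lambda>x. ?p x - ?f x"
    have DL: "?D \<in> L2 (cube_measure d)" by (intro L2_diff L2_sum L2_cmult chr_L2 fc)
    have pm[measurable]: "?p \<in> borel_measurable (Rd d)" by measurable
    let ?g = "\<lambda>x. \<Sum>n\<in>F. c n * ?v (m, n) x"
    have g: "?ap ?g" by (intro L2_approx_sum L2_approx_cmult L2_approx_basis gabor_cube_L2) (use F m in auto)
    have geq: "?g x = indicator (cube d) (shift d (rvec m) x) * ?p x" for x
      by (simp add: gabor_cube_window sum_distrib_left mult_ac)
    have "norm_L2 (Rd d) (\<lambda>x. ?g x - indicator (cube d) (shift d (rvec m) x) * f x) \<le> norm_L2 (cube_measure d) ?D"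
    proof (rule norm_L2_nn_le(2))
      show "(\<lambda>x. ?g x - indicator (cube d) (shift d (rvec m) x) * f x) \<in> borel_measurable (Rd d)"
        unfolding geq by measurable
      have "(\<integral>\<^sup>+x. ennreal ((cmod (?g x - indicator (cube d) (shift d (rvec m) x) * f x))\<^sup>2) \<partial>Rd d)
          = (\<integral>\<^sup>+x. indicator (cube d) (shift d (rvec m) x) * ennreal ((cmod (?p x - f x))\<^sup>2) \<partial>Rd d)"
        unfolding geq by (rule nn_integral_cong) (auto simp: indicator_def)
      also have "\<dots> = (\<integral>\<^sup>+x. (\<lambda>x. indicator (cube d) (shift d (rvec m) x) * ennreal ((cmod (?p x - f x))\<^sup>2)) (shift d (\<lambda>i. - rvec m i) x) \<partial>Rd d)"
        by (rule nn_integral_Rd_shift[symmetric]) measurable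
      also have "\<dots> = (\<integral>\<^sup>+x. indicator (cube d) x * ennreal ((cmod (?D x))\<^sup>2) \<partial>Rd d)"
        by (rule nn_integral_cong) (simp add: shift_inverse chr_shift_int)
      also have "\<dots> = (\<integral>\<^sup>+x. ennreal ((cmod (?D x))\<^sup>2) \<partial>cube_measure d)" by (rule nn_integral_cube_measure[symmetric]) measurable
      also have "\<dots> = ennreal ((norm_L2 (cube_measure d) ?D)\<^sup>2)" by (rule norm_L2_nn[OF DL])
      finally show "(\<integral>\<^sup>+x. ennreal ((cmod (?g x - indicator (cube d) (shift d (rvec m) x) * f x))\<^sup>2) \<partial>Rd d) \<le> ennreal ((norm_L2 (cube_measure d) ?D)\<^sup>2)" by simp
    qed simp
    with F(3) g show "\<exists>g. ?ap g \<and> norm_L2 (Rd d) (\<lambda>x. g x - indicator (cube d) (shift d (rvec m) x) * f x) < e"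
      by (intro exI[of _ ?g]) auto
  qed
qed

lemma complete_gabor_cube: "complete_system (Rd d) (Zd d \<times> Zd d) (gabor d (cube_window d))"
  unfolding complete_system_iff
proof
  let ?ap = "L2_approx (Rd d) (Zd d \<times> Zd d) (gabor d (cube_window d))"
  fix f assume f: "f \<in> L2 (Rd d)"
  have cut: "?ap (cutoff d N f)" for N
  proof (rule L2_approx_cong_AE[OF gabor_cube_L2])
    let ?h = "cutoff d N f"
    have hL: "?h \<in> L2 (Rd d)" by (rule cutoff_L2[OF f])
    show "?ap (\<lambda>x. \<Sum>m\<in>Zbox d (N + 1). indicator (cube d) (shift d (rvec m) x) * ?h x)"
      by (rule L2_approx_sum[OF gabor_cube_L2], rule gabor_cube_approx_cell[OF hL]) (use Zbox(2) in blast)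
    show "?h \<in> borel_measurable (Rd d)" using hL by (rule L2_measurable)
    show "AE x in Rd d. (\<Sum>m\<in>Zbox d (N + 1). indicator (cube d) (shift d (rvec m) x) * ?h x) = ?h x"
    proof (rule AE_I2)
      fix x assume x: "x \<in> space (Rd d)"
      show "(\<Sum>m\<in>Zbox d (N + 1). indicator (cube d) (shift d (rvec m) x) * ?h x) = ?h x"
      proof (cases "\<forall>i<d. \<bar>x i\<bar> \<le> real N")
        case True
        have "- int (N + 1) \<le> \<lfloor>x i\<rfloor> \<and> \<lfloor>x i\<rfloor> \<le> int (N + 1)" if i: "i < d" for i
          using True[rule_format, OF i] by (auto simp: le_floor_iff floor_le_iff abs_le_iff)
        then have k: "floor_vec d x \<in> Zbox d (N + 1)" by (auto simp: Zbox_def floor_vec_def)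
        have "(\<Sum>m\<in>Zbox d (N + 1). indicator (cube d) (shift d (rvec m) x) * ?h x) = (\<Sum>m\<in>Zbox d (N + 1). if m = floor_vec d x then ?h x else 0)"
          by (rule sum.cong[OF refl]) (use shift_cube_iff[OF _ x] Zbox(2) in \<open>auto simp: indicator_def\<close>)
        then show ?thesis using k Zbox(1) by simp
      next
        case False
        then have "?h x = 0" unfolding cutoff_def by (rule if_not_P)
        then show ?thesis by simp
      qed
    qed
  qed
  show "?ap f" by (rule L2_approx_limit_seq[OF gabor_cube_L2 f cut cutoff_converges[OF f]])
qed

lemma riesz_gabor_cube: "gabor_riesz_basis d (cube_window d)"
proof -
  have "riesz_constants (Rd d) (Zd d \<times> Zd d) (gabor d (cube_window d)) 1 1"
    unfolding riesz_constants_def using orthonormal_has_L2_sum[OF orthonormal_gabor_cube] by fastforce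
  then show ?thesis unfolding riesz_basis_def using gabor_cube_L2 complete_gabor_cube by blast
qed

lemma gabor_optimal_constants:
  "gabor_riesz_basis d g \<Longrightarrow> riesz_constants (Rd d) (Zd d \<times> Zd d) (gabor d g) (gabor_lower_bound d g) (gabor_upper_bound d g)"
  by (rule riesz_basis_optimal_constants[where ?i0.0="((\<lambda>i\<in>{..<d}. 0), (\<lambda>i\<in>{..<d}. 0))"]) (auto simp: Zd_def)

text \<open>The Fourier transform of the unit interval; that of the cube is a product of such
factors.\<close>

definition unit_fourier :: "real \<Rightarrow> complex" where
  "unit_fourier t = (LINT x|lborel. indicator {0..<1} x * ex (- (t * x)))"

lemma fourier_cube_window: "fourier_integral d (cube_window d) \<xi> = (\<Prod>i<d. unit_fourier (\<xi> i))"
proof -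
  have "fourier_integral d (cube_window d) \<xi> = (LINT x|cube_measure d. cnj (ex (dot d x \<xi>)))"
    unfolding fourier_integral_ex cube_window_def by (rule integral_cube_measure[symmetric]) measurable
  also have "\<dots> = (LINT x|cube_measure d. (\<Prod>i<d. ex (- (\<xi> i * x i))))"
    by (simp add: dot_def ex_minus[symmetric] ex_sum[symmetric] sum_negf mult.commute)
  also have "\<dots> = (\<Prod>i<d. LINT t|lborel. indicator {0..<1} t * ex (- (\<xi> i * t)))"
    by (rule integral_cube_prod[where f="\<lambda>i t. ex (- (\<xi> i * t))"]) auto
  finally show ?thesis by (simp add: unit_fourier_def)
qed

lemma unit_fourier_measurable[measurable]: "unit_fourier \<in> borel_measurable borel"
  unfolding unit_fourier_def[abs_def] by measurable

lemma unit_fourier_le_1: "cmod (unit_fourier t) \<le> 1"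
proof -
  have "cmod (unit_fourier t) \<le> (LINT x|lborel. cmod (indicator {0..<1} x * ex (- (t * x))))"
    unfolding unit_fourier_def by (rule integral_norm_bound)
  also have "\<dots> = (LINT x|lborel. indicator {0..<1::real} x)"
    by (rule Bochner_Integration.integral_cong) (auto simp: norm_mult indicator_def)
  finally show ?thesis by simp
qed

lemma unit_fourier_decay: "t \<noteq> 0 \<Longrightarrow> cmod (unit_fourier t) \<le> 1 / (pi * \<bar>t\<bar>)"
proof -
  assume t: "t \<noteq> 0"
  \<comment> \<open>\<open>F\<close> is an antiderivative of the integrand\<close>
  define c :: complex where "c = - (2 * of_real pi * \<i> * of_real t)"
  have c0: "c \<noteq> 0" using t by (simp add: c_def)
  have ex: "ex (- (t * x)) = exp (c * of_real x)" for x
    by (simp add: ex_def cis_conv_exp c_def mult_ac)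
  define F where "F x = exp (c * of_real x) / c" for x :: real
  have der: "(F has_vector_derivative ex (- (t * x))) (at x within {0..1})" for x
  proof -
    have "((\<lambda>z. exp (c * z) / c) has_field_derivative exp (c * of_real x)) (at (of_real x))"
      using c0 by (auto intro!: derivative_eq_intros)
    from has_vector_derivative_real_field[OF this] show ?thesis by (simp add: F_def[abs_def] ex)
  qed
  have cont: "continuous_on {0..1} (\<lambda>x. ex (- (t * x)))" unfolding ex by (intro continuous_intros)
  have "unit_fourier t = (LINT x|lborel. indicator {0..1} x *\<^sub>R ex (- (t * x)))"
    unfolding unit_fourier_def
  proof (rule integral_cong_AE)
    have "AE x in lborel. x \<noteq> (1::real)" by (rule AE_lborel_singleton)
    then show "AE x in lborel. indicator {0..<1} x * ex (- (t * x)) = indicator {0..1} x *\<^sub>R ex (- (t * x))"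
      by eventually_elim (auto simp: indicator_def)
  qed auto
  also have "\<dots> = F 1 - F 0" by (rule integral_FTC_Icc[OF _ der cont]) simp
  finally have "cmod (unit_fourier t) \<le> cmod (F 1) + cmod (F 0)" by (simp only: norm_triangle_ineq4)
  also have "\<dots> = 2 / cmod c" by (simp add: F_def norm_divide ex[symmetric, of 1, simplified])
  also have "\<dots> = 1 / (pi * \<bar>t\<bar>)" by (simp add: c_def norm_mult)
  finally show ?thesis .
qed

lemma unit_fourier_square_bound: "t \<noteq> 0 \<Longrightarrow> (cmod (unit_fourier t))\<^sup>2 \<le> 1 / t\<^sup>2"
proof -
  assume t: "t \<noteq> 0"
  have "1 / (pi * \<bar>t\<bar>) \<le> 1 / \<bar>t\<bar>"
    using t pi_gt3 by (intro divide_left_mono mult_pos_pos) auto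
  then have "cmod (unit_fourier t) \<le> 1 / \<bar>t\<bar>" using unit_fourier_decay[OF t] by linarith
  from power_mono[OF this, of 2] show ?thesis by (simp add: power_divide)
qed

text \<open>The majorant \<open>2 / (1 + t\<^sup>2)\<close> combines boundedness near the origin
with quadratic decay.\<close>

lemma unit_fourier_mass: "(\<integral>\<^sup>+t. ennreal ((cmod (unit_fourier t))\<^sup>2) \<partial>lborel) < \<infinity>"
proof -
  have b: "(cmod (unit_fourier t))\<^sup>2 \<le> 2 * (1 / (1 + t\<^sup>2))" for t
  proof (cases "\<bar>t\<bar> \<le> 1")
    case True
    then have "t\<^sup>2 \<le> 1" by (simp add: abs_square_le_1)
    then have "1 \<le> 2 * (1 / (1 + t\<^sup>2))" by (simp add: le_divide_eq add_pos_nonneg)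
    moreover have "(cmod (unit_fourier t))\<^sup>2 \<le> 1" using power_mono[OF unit_fourier_le_1, of t 2] by simp
    ultimately show ?thesis by linarith
  next
    case False
    then have "1 < t\<^sup>2" by (simp add: abs_square_le_1 not_le[symmetric])
    have "1 / p \<le> 2 * (1 / (1 + p))" if "1 < p" for p :: real using that by (simp add: divide_simps)
    from this[OF \<open>1 < t\<^sup>2\<close>] have "1 / t\<^sup>2 \<le> 2 * (1 / (1 + t\<^sup>2))" .
    moreover have "t \<noteq> 0" using False by auto
    ultimately show ?thesis using unit_fourier_square_bound[of t] by linarith
  qed
  have "(\<integral>\<^sup>+t. ennreal ((cmod (unit_fourier t))\<^sup>2) \<partial>lborel) \<le> (\<integral>\<^sup>+t. ennreal (2 * (1 / (1 + t\<^sup>2))) \<partial>lborel)"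
    by (intro nn_integral_mono ennreal_leI b)
  also have "\<dots> < \<infinity>"
    using integrable_mult_right[OF integrable_inverse_square, of 2] unfolding integrable_iff_bounded
    by (simp add: add_nonneg_nonneg)
  finally show ?thesis .
qed

lemma unit_fourier_tail:
  assumes l: "0 < l"
  shows "(\<integral>\<^sup>+t. indicator {t. l \<le> \<bar>t\<bar>} t * ennreal ((cmod (unit_fourier t))\<^sup>2) \<partial>lborel) \<le> ennreal (2 / l)"
proof -
  have half: "(\<integral>\<^sup>+t. ennreal (1 / t\<^sup>2) * indicator {l..} t \<partial>lborel) = ennreal (0 - (- (1 / l)))"
  proof (rule nn_integral_FTC_atLeast)
    show "DERIV (\<lambda>t. - (1 / t)) t :> 1 / t\<^sup>2" if "l \<le> t" for t
      using that l by (auto intro!: derivative_eq_intros simp: power2_eq_square)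
    have "((\<lambda>t::real. 1 / t) \<longlongrightarrow> 0) at_top" using tendsto_inverse_0_at_top[OF filterlim_ident] by (simp add: inverse_eq_divide)
    from tendsto_minus[OF this] show "((\<lambda>t::real. - (1 / t)) \<longlongrightarrow> 0) at_top" by simp
  qed auto
  have "(\<integral>\<^sup>+t. indicator {t. l \<le> \<bar>t\<bar>} t * ennreal ((cmod (unit_fourier t))\<^sup>2) \<partial>lborel)
     \<le> (\<integral>\<^sup>+t. ennreal (1 / t\<^sup>2) * indicator {l..} t + ennreal (1 / t\<^sup>2) * indicator {..-l} t \<partial>lborel)"
  proof (rule nn_integral_mono)
    fix t :: real
    show "indicator {t. l \<le> \<bar>t\<bar>} t * ennreal ((cmod (unit_fourier t))\<^sup>2) \<le> ennreal (1 / t\<^sup>2) * indicator {l..} t + ennreal (1 / t\<^sup>2) * indicator {..-l} t"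
    proof (cases "l \<le> \<bar>t\<bar>")
      case True
      then have "t \<noteq> 0" using l by auto
      from ennreal_leI[OF unit_fourier_square_bound[OF this]] show ?thesis
        using True l by (cases "0 \<le> t") (auto simp: indicator_def)
    qed simp
  qed
  also have "\<dots> = (\<integral>\<^sup>+t. ennreal (1 / t\<^sup>2) * indicator {l..} t \<partial>lborel) + (\<integral>\<^sup>+t. ennreal (1 / t\<^sup>2) * indicator {..-l} t \<partial>lborel)"
    by (rule nn_integral_add) auto
  also have "(\<integral>\<^sup>+t. ennreal (1 / t\<^sup>2) * indicator {..-l} t \<partial>lborel) = (\<integral>\<^sup>+t. ennreal (1 / t\<^sup>2) * indicator {l..} t \<partial>lborel)"
    by (subst nn_integral_real_affine[where c="-1" and t=0]) (auto simp: indicator_def intro!: nn_integral_cong)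
  also have "(\<integral>\<^sup>+t. ennreal (1 / t\<^sup>2) * indicator {l..} t \<partial>lborel) + (\<integral>\<^sup>+t. ennreal (1 / t\<^sup>2) * indicator {l..} t \<partial>lborel) = ennreal (2 / l)"
    unfolding half using l by (simp flip: ennreal_plus)
  finally show ?thesis .
qed

text \<open>A point outside the box has a coordinate \<open>j\<close> of modulus at least
\<open>l\<close>.  The integral over this set factors, one factor being a tail of size \<open>2 /
l\<close> and the other \<open>d - 1\<close> factors being the total mass.\<close>

lemma cube_window_fourier_tail:
  "\<exists>M. \<forall>l\<ge>1. energy_outside d (\<lambda>_. l) (fourier_L2 d (cube_window d)) \<le> M / l"
proof -
  let ?h = "fourier_L2 d (cube_window d)" and ?H = "fourier_integral d (cube_window d)"
  let ?u = "\<lambda>t. ennreal ((cmod (unit_fourier t))\<^sup>2)"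
  have hL: "?h \<in> L2 (Rd d)" using fourier_L2_spec[OF cube_window_L2] by blast
  have HL: "?H \<in> L2 (Rd d)" by (rule plancherel(1)[OF cube_window_integrable cube_window_L2])
  have ae: "AE \<xi> in Rd d. ?h \<xi> = ?H \<xi>" by (rule fourier_L2_eq_integral[OF cube_window_integrable cube_window_L2])
  define \<kappa> where "\<kappa> = enn2real (\<integral>\<^sup>+t. ?u t \<partial>lborel)"
  have kappa: "(\<integral>\<^sup>+t. ?u t \<partial>lborel) = ennreal \<kappa>" "0 \<le> \<kappa>"
    using unit_fourier_mass by (auto simp: \<kappa>_def less_top)
  define M where "M = real d * (2 * \<kappa> ^ (d - 1))"
  have "energy_outside d (\<lambda>_. l) ?h \<le> M / l" if l: "1 \<le> l" for l
  proof -
    let ?S = "space (Rd d) - open_box d (\<lambda>_. l)"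
    have S[measurable]: "?S \<in> sets (Rd d)" using open_box_sets by auto
    have [measurable]: "?h \<in> borel_measurable (Rd d)" "?H \<in> borel_measurable (Rd d)" using hL HL by (auto dest: L2_measurable)
    have comp: "(\<lambda>\<xi>. \<xi> i) \<in> borel_measurable (Rd d)" if "i < d" for i
      by (rule measurable_Rd_component[OF measurable_ident_sets[OF refl] that])
    let ?f = "\<lambda>j i t. (if i = j then indicator {t. l \<le> \<bar>t\<bar>} t else 1) * ?u t"
    have fm: "?f j i \<in> borel_measurable borel" for i j by measurable
    have int: "integrable (Rd d) (\<lambda>x. indicator ?S x *\<^sub>R (cmod (?h x))\<^sup>2)"
      by (rule integrable_mult_indicator[OF S L2_integrable_square[OF hL]])
    have "ennreal (energy_outside d (\<lambda>_. l) ?h) = (\<integral>\<^sup>+x. ennreal (indicator ?S x *\<^sub>R (cmod (?h x))\<^sup>2) \<partial>Rd d)"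
      unfolding energy_outside_def set_lebesgue_integral_def
      by (rule nn_integral_eq_integral[OF int, symmetric]) (auto simp: indicator_def)
    also have "\<dots> = (\<integral>\<^sup>+x. indicator ?S x * ennreal ((cmod (?H x))\<^sup>2) \<partial>Rd d)"
      by (rule nn_integral_cong_AE, use ae in eventually_elim) (auto simp: indicator_def)
    also have "\<dots> \<le> (\<integral>\<^sup>+x. (\<Sum>j<d. \<Prod>i<d. ?f j i (x i)) \<partial>Rd d)"
    proof (rule nn_integral_mono)
      fix x assume x: "x \<in> space (Rd d)"
      show "indicator ?S x * ennreal ((cmod (?H x))\<^sup>2) \<le> (\<Sum>j<d. \<Prod>i<d. ?f j i (x i))"
      proof (cases "x \<in> ?S")
        case True
        then obtain j where j: "j < d" "x j \<notin> {- l <..< l}" using x unfolding open_box_def space_Rd PiE_iff by blast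
        have "l \<le> \<bar>x j\<bar>" using j(2) by (auto simp: abs_if)
        then have "(\<Prod>i<d. ?f j i (x i)) = (\<Prod>i<d. ?u (x i))" by (intro prod.cong) auto
        also have "\<dots> = ennreal ((cmod (?H x))\<^sup>2)"
          unfolding fourier_cube_window by (simp add: prod_ennreal prod_norm[symmetric] prod_power_distrib)
        finally have "ennreal ((cmod (?H x))\<^sup>2) = (\<Prod>i<d. ?f j i (x i))" by simp
        also have "\<dots> \<le> (\<Sum>j<d. \<Prod>i<d. ?f j i (x i))" by (rule member_le_sum[of j _ "\<lambda>j. \<Prod>i<d. ?f j i (x i)"]) (use j in auto)
        finally show ?thesis using True by simp
      qed simp
    qed
    also have "\<dots> = (\<Sum>j<d. \<integral>\<^sup>+x. (\<Prod>i<d. ?f j i (x i)) \<partial>Rd d)"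
    proof (rule nn_integral_sum)
      fix j
      show "(\<lambda>x. \<Prod>i<d. ?f j i (x i)) \<in> borel_measurable (Rd d)"
        by (rule borel_measurable_prod_ennreal, rule measurable_compose[OF comp fm]) simp
    qed
    also have "\<dots> = (\<Sum>j<d. \<Prod>i<d. \<integral>\<^sup>+t. ?f j i t \<partial>lborel)"
      unfolding Rd_def
      by (rule sum.cong[OF refl], rule lborel_product.product_nn_integral_prod) (use fm in auto)
    also have "\<dots> \<le> (\<Sum>j<d. ennreal (2 / l) * ennreal (\<kappa> ^ (d - 1)))"
    proof (rule sum_mono)
      fix j assume j: "j \<in> {..<d}"
      have "(\<Prod>i<d. \<integral>\<^sup>+t. ?f j i t \<partial>lborel) = (\<integral>\<^sup>+t. ?f j j t \<partial>lborel) * (\<Prod>i\<in>{..<d} - {j}. \<integral>\<^sup>+t. ?f j i t \<partial>lborel)"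
        by (rule prod.remove) (use j in auto)
      also have "(\<Prod>i\<in>{..<d} - {j}. \<integral>\<^sup>+t. ?f j i t \<partial>lborel) = (\<Prod>i\<in>{..<d} - {j}. ennreal \<kappa>)"
        by (rule prod.cong) (auto simp: kappa)
      also have "\<dots> = ennreal (\<kappa> ^ (d - 1))" using j kappa(2) by (simp add: ennreal_power)
      also have "(\<integral>\<^sup>+t. ?f j j t \<partial>lborel) * ennreal (\<kappa> ^ (d - 1)) \<le> ennreal (2 / l) * ennreal (\<kappa> ^ (d - 1))"
        using unit_fourier_tail[of l] l by (intro mult_right_mono) auto
      finally show "(\<Prod>i<d. \<integral>\<^sup>+t. ?f j i t \<partial>lborel) \<le> ennreal (2 / l) * ennreal (\<kappa> ^ (d - 1))" .
    qed
    also have "\<dots> = ennreal (M / l)"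
      using l kappa(2) by (simp add: M_def ennreal_mult[symmetric] ennreal_of_nat_eq_real_of_nat)
    finally have "ennreal (energy_outside d (\<lambda>_. l) ?h) \<le> ennreal (M / l)" .
    moreover have "0 \<le> M / l" using l kappa(2) by (simp add: M_def)
    ultimately show ?thesis by (simp add: ennreal_le_iff)
  qed
  then show ?thesis by blast
qed

lemma cube_window_energy: "energy_outside d (\<lambda>_. 1) (cube_window d) = 0"
proof -
  have "indicator (space (Rd d) - open_box d (\<lambda>_. 1)) x *\<^sub>R (cmod (cube_window d x))\<^sup>2 = 0" for x
  proof (cases "x \<in> cube d")
    case True
    then have "x \<in> open_box d (\<lambda>_. 1)" unfolding cube_def open_box_def PiE_iff by force
    then show ?thesis by simp
  qed (simp add: cube_window_def)
  then show ?thesis unfolding energy_outside_def set_lebesgue_integral_def by (simp only: Bochner_Integration.integral_zero)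
qed

section \<open>The uncertainty inequality\<close>

theorem theorem1:
  "(\<exists>C :: real \<Rightarrow> real \<Rightarrow> real. (\<forall>A B. 0 < A \<and> 0 < B \<longrightarrow> 0 < C A B) \<and>
      (\<forall>d\<ge>1. \<forall>g\<in>L2 (Rd d). gabor_riesz_basis d g \<longrightarrow>
        (\<forall>R L :: nat \<Rightarrow> real. (\<forall>i<d. 1 \<le> R i \<and> 1 \<le> L i) \<longrightarrow>
          (\<forall>i<d. energy_outside d R g + energy_outside d L (fourier_L2 d g)
                   \<ge> C (gabor_lower_bound d g) (gabor_upper_bound d g) / (R i * L i)))))
   \<and>
   (\<forall>d\<ge>1. \<not> (\<exists>C :: real \<Rightarrow> real \<Rightarrow> real. (\<forall>A B. 0 < A \<and> 0 < B \<longrightarrow> 0 < C A B) \<and>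
      (\<forall>g\<in>L2 (Rd d). gabor_riesz_basis d g \<longrightarrow>
        (\<forall>R L :: nat \<Rightarrow> real. (\<forall>i<d. 1 \<le> R i \<and> 1 \<le> L i) \<longrightarrow>
          (\<forall>i<d. energy_outside d R g + energy_outside d L (fourier_L2 d g)
                   \<ge> C (gabor_lower_bound d g) (gabor_upper_bound d g)
                       * ln (R i * L i) / (R i * L i))))))"
proof (intro conjI allI impI notI)
  define P where "P A B c \<longleftrightarrow> (\<forall>d g R L i. g \<in> L2 (Rd d) \<longrightarrow> riesz_constants (Rd d) (Zd d \<times> Zd d) (gabor d g) A B \<longrightarrow> i < d \<longrightarrow> 1 \<le> R i \<longrightarrow> 1 \<le> L i \<longrightarrow>
     c / (R i * L i) \<le> energy_outside d R g + energy_outside d L (fourier_L2 d g))" for A B c :: real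
  have ex: "\<forall>A B. \<exists>c. 0 < A \<and> 0 < B \<longrightarrow> 0 < c \<and> P A B c"
  proof (intro allI)
    fix A B :: real
    show "\<exists>c. 0 < A \<and> 0 < B \<longrightarrow> 0 < c \<and> P A B c"
    proof (cases "0 < A \<and> 0 < B")
      case True
      then have AB: "0 < A" "0 < B" by auto
      from uncertainty_constant_exists[OF AB] have "\<exists>c>0. P A B c" unfolding P_def .
      then show ?thesis by blast
    qed blast
  qed
  define C where "C A B = (SOME c. 0 < A \<and> 0 < B \<longrightarrow> 0 < c \<and> P A B c)" for A B
  have C: "0 < C A B \<and> P A B (C A B)" if "0 < A" "0 < B" for A B
    using someI_ex[OF ex[rule_format, of A B]] that unfolding C_def by blast
  show "\<exists>C :: real \<Rightarrow> real \<Rightarrow> real. (\<forall>A B. 0 < A \<and> 0 < B \<longrightarrow> 0 < C A B) \<and>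
      (\<forall>d\<ge>1. \<forall>g\<in>L2 (Rd d). gabor_riesz_basis d g \<longrightarrow>
        (\<forall>R L :: nat \<Rightarrow> real. (\<forall>i<d. 1 \<le> R i \<and> 1 \<le> L i) \<longrightarrow>
          (\<forall>i<d. energy_outside d R g + energy_outside d L (fourier_L2 d g)
                   \<ge> C (gabor_lower_bound d g) (gabor_upper_bound d g) / (R i * L i))))"
  proof (intro exI[of _ C] conjI allI impI ballI)
    show "0 < C A B" if "0 < A \<and> 0 < B" for A B using C that by blast
    fix d :: nat and g and R L :: "nat \<Rightarrow> real" and i
    assume g: "g \<in> L2 (Rd d)" and rb: "gabor_riesz_basis d g" and RL: "\<forall>i<d. 1 \<le> R i \<and> 1 \<le> L i" and i: "i < d"
    \<comment> \<open>the optimal bounds are themselves Riesz constants, and the constant for this pair applies\<close>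
    note rc = gabor_optimal_constants[OF rb]
    have "0 < gabor_lower_bound d g" "0 < gabor_upper_bound d g" using rc by (auto simp: riesz_constants_def)
    then have "P (gabor_lower_bound d g) (gabor_upper_bound d g) (C (gabor_lower_bound d g) (gabor_upper_bound d g))" using C by blast
    then show "C (gabor_lower_bound d g) (gabor_upper_bound d g) / (R i * L i) \<le> energy_outside d R g + energy_outside d L (fourier_L2 d g)"
      unfolding P_def using g rc i RL by blast
  qed
next
  fix d :: nat assume d: "1 \<le> d"
  let ?g = "cube_window d"
  assume "\<exists>C :: real \<Rightarrow> real \<Rightarrow> real. (\<forall>A B. 0 < A \<and> 0 < B \<longrightarrow> 0 < C A B) \<and>
      (\<forall>g\<in>L2 (Rd d). gabor_riesz_basis d g \<longrightarrow>
        (\<forall>R L :: nat \<Rightarrow> real. (\<forall>i<d. 1 \<le> R i \<and> 1 \<le> L i) \<longrightarrow>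
          (\<forall>i<d. energy_outside d R g + energy_outside d L (fourier_L2 d g)
                   \<ge> C (gabor_lower_bound d g) (gabor_upper_bound d g)
                       * ln (R i * L i) / (R i * L i))))"
  then obtain C :: "real \<Rightarrow> real \<Rightarrow> real" where C: "\<forall>A B. 0 < A \<and> 0 < B \<longrightarrow> 0 < C A B"
    and bound: "\<forall>g\<in>L2 (Rd d). gabor_riesz_basis d g \<longrightarrow>
        (\<forall>R L :: nat \<Rightarrow> real. (\<forall>i<d. 1 \<le> R i \<and> 1 \<le> L i) \<longrightarrow>
          (\<forall>i<d. energy_outside d R g + energy_outside d L (fourier_L2 d g)
                   \<ge> C (gabor_lower_bound d g) (gabor_upper_bound d g)
                       * ln (R i * L i) / (R i * L i)))" by blast
  define c where "c = C (gabor_lower_bound d ?g) (gabor_upper_bound d ?g)"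
  have "0 < gabor_lower_bound d ?g" "0 < gabor_upper_bound d ?g"
    using gabor_optimal_constants[OF riesz_gabor_cube] by (auto simp: riesz_constants_def)
  then have c: "0 < c" using C by (simp add: c_def)
  obtain M where M: "\<And>l. 1 \<le> l \<Longrightarrow> energy_outside d (\<lambda>_. l) (fourier_L2 d ?g) \<le> M / l"
    using cube_window_fourier_tail by blast
  \<comment> \<open>so large that \<open>c * ln l = \<bar>M\<bar> + c\<close> exceeds \<open>M\<close>\<close>
  define l where "l = exp (\<bar>M\<bar> / c + 1)"
  have l: "1 \<le> l" using c by (simp add: l_def)
  have "c * ln (1 * l) / (1 * l) \<le> energy_outside d (\<lambda>_. 1) ?g + energy_outside d (\<lambda>_. l) (fourier_L2 d ?g)"
    using bound[THEN bspec, OF cube_window_L2, THEN mp, OF riesz_gabor_cube, THEN spec[of _ "\<lambda>_. 1"], THEN spec[of _ "\<lambda>_. l"], THEN mp, THEN spec[of _ 0], THEN mp] d l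
    unfolding c_def by simp
  then have "c * ln l / l \<le> M / l"
    using M[OF l] unfolding cube_window_energy by simp
  then have "c * ln l \<le> M" using l by (simp add: divide_le_cancel)
  moreover have "c * ln l = \<bar>M\<bar> + c" using c by (simp add: l_def distrib_left)
  ultimately show False using c by linarith
qed

end
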